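(* Let $\mathcal{S}$ be a finite set with $|\mathcal{S}| = S$, and fix a probability distribution $Q=(q_1,\ldots,q_S)$ on $\mathcal{S}$. Let $\mathcal{D}=\mathcal{P}(Q,\tfrac12)$ be the set of probability measures $P$ on $(X,Y)\in\mathcal{S}\times\{0,1\}$ with $P(Y=0)=P(Y=1)=\tfrac12$ and $P_{X|Y=1}=Q$; such a $P$ is determined by $R=P_{X|Y=0}=(r_1,\ldots,r_S)$. Classifiers are maps $t:\mathcal{S}\to\{0,1\}$ with loss $\mathbbm{1}(Y\neq t(X))$. One observes $n$ i.i.d. samples $X_1,\ldots,X_n$ from $R$, with empirical distribution $R_n=(\hat r_1,\ldots,\hat r_S)$, $\hat r_x=\frac1n\sum_{j=1}^n\mathbbm{1}(X_j=x)$. Let $U(P)=\frac12-\frac14\sum_{i=1}^S|r_i-q_i|$ be the Bayes error, and define $$R_{\mathsf{EST}}(n)=\inf_{\hat U}\sup_{P\in\mathcal{D}}\mathbb{E}_P|\hat U-U(P)|,$$ the infimum over all estimators $\hat U=\hat U(X_1,\ldots,X_n)$ (which may depend on $Q$); $$R_{\mathsf{ACH}}(n)=\inf_{\hat t}\sup_{P\in\mathcal{D}}\Big(\mathbb{E}\big[\mathbbm{1}(Y\neq \hat t(X))\big]-U(P)\Big),$$ the infimum over all classifiers $\hat t$ that depend on $X_1,\ldots,X_n$ (and $Q$), where $(X,Y)\sim P$ is independent of the samples; and $$R_{\mathsf{PLU}}(n)=\sup_{P\in\mathcal{D}}\mathbb{E}_P\big|U(P_n)-U(P)\big|,$$ where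 $U(P_n)=\frac12-\frac14\sum_{i=1}^S|\hat r_i-q_i|$ is the plug-in estimate. If $$\ln S\lesssim \ln n\lesssim \ln\Big(\sum_{i=1}^S \sqrt{q_i}\wedge q_i\sqrt{n\ln n}\Big),$$ then $$R_{\mathsf{EST}}(n)\asymp\sum_{i=1}^S q_i\wedge\sqrt{\frac{q_i}{n\ln n}},\qquad R_{\mathsf{ACH}}(n)\asymp\sum_{i=1}^S q_i\wedge\sqrt{\frac{q_i}{n}},\qquad R_{\mathsf{PLU}}(n)\asymp\sum_{i=1}^S q_i\wedge\sqrt{\frac{q_i}{n}}.$$ Moreover, the maximum likelihood classifier $t_{\mathsf{MLE}}(x)=1-\mathbbm{1}(\hat r_x>q_x)$ does not achieve the rate of $R_{\mathsf{ACH}}(n)$ (i.e. its worst-case regret over $\mathcal{D}$ is not bounded by a universal constant times $\sum_{i}q_i\wedge\sqrt{q_i/n}$), while the classifier $t_Q(x)=1-\mathbbm{1}\big(\{\hat r_x>q_x\}\cup\{q_x<\tfrac1n\}\big)$ achieves the rate of $R_{\mathsf{ACH}}(n)$.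
   Context: For nonnegative quantities, $a\lesssim b$ means $a\le Cb$ for a universal constant $C$, $a\asymp b$ means $a\lesssim b$ and $b\lesssim a$; $a\wedge b=\min\{a,b\}$. $\mathbbm{1}$ denotes the indicator function. The Bayes error of $P\in\mathcal{D}$ is $\min_t P(Y\neq t(X))=\frac12-\frac14 L_1(R,Q)$ with $L_1(R,Q)=\sum_i|r_i-q_i|$. *)

theory Defs
  imports Complex_Main
begin

definition dist_on :: "nat \<Rightarrow> (nat \<Rightarrow> real) \<Rightarrow> bool" where
  "dist_on S r \<longleftrightarrow> (\<forall>i<S. 0 \<le> r i) \<and> (\<Sum>i<S. r i) = 1"

definition samples :: "nat \<Rightarrow> nat \<Rightarrow> nat list set" where
  "samples S n = {xs. length xs = n \<and> set xs \<subseteq> {..<S}}"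

definition expect :: "nat \<Rightarrow> nat \<Rightarrow> (nat \<Rightarrow> real) \<Rightarrow> (nat list \<Rightarrow> real) \<Rightarrow> real" where
  "expect S n r f = (\<Sum>xs\<in>samples S n. prod_list (map r xs) * f xs)"

definition emp :: "nat list \<Rightarrow> nat \<Rightarrow> real" where
  "emp xs x = real (count_list xs x) / real (length xs)"

definition bayes_err :: "nat \<Rightarrow> (nat \<Rightarrow> real) \<Rightarrow> (nat \<Rightarrow> real) \<Rightarrow> real" where
  "bayes_err S q r = 1/2 - 1/4 * (\<Sum>i<S. \<bar>r i - q i\<bar>)"

text \<open>Risk P(Y \<noteq> t(X)) of a classifier t (t x = True means predict label 1),
  where P(Y=0)=P(Y=1)=1/2, X|Y=0 ~ r, X|Y=1 ~ q.\<close>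
definition risk :: "nat \<Rightarrow> (nat \<Rightarrow> real) \<Rightarrow> (nat \<Rightarrow> real) \<Rightarrow> (nat \<Rightarrow> bool) \<Rightarrow> real" where
  "risk S q r t = 1/2 * (\<Sum>x<S. r x * (if t x then 1 else 0))
                + 1/2 * (\<Sum>x<S. q x * (if t x then 0 else 1))"

definition regret :: "nat \<Rightarrow> (nat \<Rightarrow> real) \<Rightarrow> nat \<Rightarrow> (nat list \<Rightarrow> nat \<Rightarrow> bool) \<Rightarrow> (nat \<Rightarrow> real) \<Rightarrow> real" where
  "regret S q n th r = expect S n r (\<lambda>xs. risk S q r (th xs)) - bayes_err S q r"

definition worst_regret :: "nat \<Rightarrow> (nat \<Rightarrow> real) \<Rightarrow> nat \<Rightarrow> (nat list \<Rightarrow> nat \<Rightarrow> bool) \<Rightarrow> real" where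
  "worst_regret S q n th = (SUP r\<in>{r. dist_on S r}. regret S q n th r)"

definition R_EST :: "nat \<Rightarrow> (nat \<Rightarrow> real) \<Rightarrow> nat \<Rightarrow> real" where
  "R_EST S q n = (INF Uh\<in>(UNIV :: (nat list \<Rightarrow> real) set).
      SUP r\<in>{r. dist_on S r}. expect S n r (\<lambda>xs. \<bar>Uh xs - bayes_err S q r\<bar>))"

definition R_ACH :: "nat \<Rightarrow> (nat \<Rightarrow> real) \<Rightarrow> nat \<Rightarrow> real" where
  "R_ACH S q n = (INF th\<in>(UNIV :: (nat list \<Rightarrow> nat \<Rightarrow> bool) set). worst_regret S q n th)"

definition R_PLU :: "nat \<Rightarrow> (nat \<Rightarrow> real) \<Rightarrow> nat \<Rightarrow> real" where
  "R_PLU S q n = (SUP r\<in>{r. dist_on S r}.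
      expect S n r (\<lambda>xs. \<bar>bayes_err S q (emp xs) - bayes_err S q r\<bar>))"

definition t_MLE :: "(nat \<Rightarrow> real) \<Rightarrow> nat list \<Rightarrow> nat \<Rightarrow> bool" where
  "t_MLE q xs x \<longleftrightarrow> \<not> (emp xs x > q x)"

definition t_Q :: "(nat \<Rightarrow> real) \<Rightarrow> nat \<Rightarrow> nat list \<Rightarrow> nat \<Rightarrow> bool" where
  "t_Q q n xs x \<longleftrightarrow> \<not> (emp xs x > q x \<or> q x < 1 / real n)"

definition rate_est :: "nat \<Rightarrow> (nat \<Rightarrow> real) \<Rightarrow> nat \<Rightarrow> real" where
  "rate_est S q n = (\<Sum>i<S. min (q i) (sqrt (q i / (real n * ln (real n)))))"

definition rate_ach :: "nat \<Rightarrow> (nat \<Rightarrow> real) \<Rightarrow> nat \<Rightarrow> real" where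
  "rate_ach S q n = (\<Sum>i<S. min (q i) (sqrt (q i / real n)))"

definition regime :: "real \<Rightarrow> real \<Rightarrow> nat \<Rightarrow> (nat \<Rightarrow> real) \<Rightarrow> nat \<Rightarrow> bool" where
  "regime c1 c2 S q n \<longleftrightarrow> 2 \<le> n \<and> dist_on S q \<and>
     ln (real S) \<le> c1 * ln (real n) \<and>
     ln (real n) \<le> c2 * ln (\<Sum>i<S. min (sqrt (q i)) (q i * sqrt (real n * ln (real n))))"

definition asymp_eq :: "real \<Rightarrow> real \<Rightarrow> real \<Rightarrow> bool" where
  "asymp_eq C a b \<longleftrightarrow> a \<le> C * b \<and> b \<le> C * a"

end

theory Submission
  imports Defs "HOL-Analysis.Analysis" "HOL-Real_Asymp.Real_Asymp"
begin

text \<open>\<open>Upper bounds.\<close> The regret of \<open>t\<^sub>Q\<close> at a symbol is at most the mean deviation of its empirical frequency,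
  of order \<open>q \<and> sqrt (q/n)\<close>. To estimate \<open>\<bar>r - q\<bar>\<close> at the rate \<open>sqrt (q/(n ln n))\<close>, the first half of the
  sample decides the sign of \<open>r - q\<close> whenever \<open>r\<close> is far from \<open>q\<close> on the scale \<open>sqrt (q ln n / n)\<close>; otherwise
  \<open>\<bar>r - q\<bar>\<close> is replaced by a polynomial of degree of order \<open>ln n\<close>, whose powers have unbiased
  estimates built from independent blocks of the second half.

  \<open>Lower bounds.\<close> Classification is treated by Assouad's argument. For estimation, two priors on \<open>R\<close>
  give every light symbol a random mass near \<open>q\<close> whose first moments, up to order \<open>ln n\<close>, agree under both,
  while the mean of \<open>\<bar>r - q\<bar>\<close> differs by order \<open>sqrt (q/(n ln n))\<close>. One further symbol absorbs the
  difference of the masses, so that every draw is a probability distribution, and the two sample laws are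
  compared by exchanging the prior of one symbol at a time.\<close>

section \<open>Finite weights and product expectations\<close>

text \<open>Both halves of the estimation rate come from one object, the Jackson kernel sampled at
  \<open>2 * N\<close> equispaced angles with \<open>N = 4 * M\<close>. Its averages give an
  explicit polynomial near \<open>\<bar>t - a\<bar>\<close> with bounded coefficients, and those
  bounds control the variance of the estimator. The same kernel with alternating signs is an
  explicit signed measure that kills all low powers and still sees the kink. Masses cannot be
  negative, so for light symbols the kink sits close to an end of the interval; both statements
  therefore carry a factor \<open>sqrt (1 - a\<^sup>2)\<close> or \<open>sin \<theta>\<close>, since
  an error of order \<open>1 / M\<close> would be too coarse there. The sample size is fixed, so
  symbol counts are dependent. This explains the joint linear functional per block in the upper
  bound and the compensating symbol in the lower bound. The first regime condition lets a factor
  \<open>S\<close> be paid for by a power of \<open>1 / n\<close>. The second lifts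
  \<open>rate_est\<close> above \<open>1 / sqrt (n * ln n)\<close> by a power of \<open>n\<close>,
  which absorbs all noise terms. Below a threshold for \<open>n\<close> that depends on
  \<open>c1\<close> and \<open>c2\<close>, crude bounds suffice.\<close>

lemma weighted_sum_square_le:
  fixes w f :: "'a \<Rightarrow> real"
  assumes "\<And>x. x \<in> X \<Longrightarrow> 0 \<le> w x"
  shows "(\<Sum>x\<in>X. w x * f x)\<^sup>2 \<le> (\<Sum>x\<in>X. w x) * (\<Sum>x\<in>X. w x * (f x)\<^sup>2)"
proof -
  have "(\<Sum>x\<in>X. sqrt (w x) * (sqrt (w x) * f x))\<^sup>2
      \<le> (\<Sum>x\<in>X. (sqrt (w x))\<^sup>2) * (\<Sum>x\<in>X. (sqrt (w x) * f x)\<^sup>2)"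
    by (rule Cauchy_Schwarz_ineq_sum)
  moreover have "(\<Sum>x\<in>X. sqrt (w x) * (sqrt (w x) * f x)) = (\<Sum>x\<in>X. w x * f x)"
    by (intro sum.cong refl) (simp add: assms mult.assoc[symmetric])
  moreover have "(\<Sum>x\<in>X. (sqrt (w x))\<^sup>2) = (\<Sum>x\<in>X. w x)"
    by (intro sum.cong refl) (simp add: assms)
  moreover have "(\<Sum>x\<in>X. (sqrt (w x) * f x)\<^sup>2) = (\<Sum>x\<in>X. w x * (f x)\<^sup>2)"
    by (intro sum.cong refl) (simp add: assms power_mult_distrib)
  ultimately show ?thesis by simp
qed

definition is_weight :: "'a set \<Rightarrow> ('a \<Rightarrow> real) \<Rightarrow> bool" where
  "is_weight X w \<longleftrightarrow> finite X \<and> (\<forall>x\<in>X. 0 \<le> w x) \<and> sum w X = 1"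

lemma is_weightD:
  assumes "is_weight X w"
  shows "finite X" "\<And>x. x \<in> X \<Longrightarrow> 0 \<le> w x" "sum w X = 1"
  using assms by (auto simp: is_weight_def)

lemma weighted_mean_square_le:
  assumes "is_weight X w"
  shows "(\<Sum>x\<in>X. w x * f x)\<^sup>2 \<le> (\<Sum>x\<in>X. w x * (f x)\<^sup>2)"
  using weighted_sum_square_le[of X w f] assms by (simp add: is_weight_def)

lemma weighted_mean_abs_le_sqrt:
  assumes "is_weight X w"
  shows "(\<Sum>x\<in>X. w x * \<bar>f x\<bar>) \<le> sqrt (\<Sum>x\<in>X. w x * (f x)\<^sup>2)"
  using weighted_mean_square_le[OF assms, of "\<lambda>x. \<bar>f x\<bar>"]
  by (intro real_le_rsqrt) simp

lemma weighted_mean_const: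
  assumes "is_weight X w"
  shows "(\<Sum>x\<in>X. w x * c) = c"
  using is_weightD(3)[OF assms] by (simp add: sum_distrib_right[symmetric])

lemma weighted_mean_mono:
  assumes "is_weight X w" "\<And>x. x \<in> X \<Longrightarrow> f x \<le> g x"
  shows "(\<Sum>x\<in>X. w x * f x) \<le> (\<Sum>x\<in>X. w x * g x)"
  using assms by (auto intro!: sum_mono mult_left_mono simp: is_weight_def)

text \<open>The mean is the best constant predictor: the two sides differ by
  \<open>(?m - d)\<^sup>2\<close>.\<close>

lemma weighted_variance_le:
  assumes "is_weight X w"
  shows "(\<Sum>x\<in>X. w x * (f x)\<^sup>2) - (\<Sum>x\<in>X. w x * f x)\<^sup>2 \<le> (\<Sum>x\<in>X. w x * (f x - d)\<^sup>2)"
proof -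
  let ?m = "\<Sum>x\<in>X. w x * f x"
  have "(\<Sum>x\<in>X. w x * (f x - d)\<^sup>2) = (\<Sum>x\<in>X. w x * (f x)\<^sup>2 - 2 * d * (w x * f x) + d\<^sup>2 * w x)"
    by (intro sum.cong refl) (simp add: power2_eq_square algebra_simps)
  also have "\<dots> = (\<Sum>x\<in>X. w x * (f x)\<^sup>2) - 2 * d * ?m + d\<^sup>2"
    using is_weightD(3)[OF assms] by (simp add: sum.distrib sum_subtractf sum_distrib_left[symmetric])
  also have "\<dots> = (\<Sum>x\<in>X. w x * (f x)\<^sup>2) - ?m\<^sup>2 + (?m - d)\<^sup>2"
    by (simp add: power2_eq_square algebra_simps)
  finally show ?thesis using zero_le_power2[of "?m - d"] by linarith
qed

text \<open>Independent coordinates with possibly different laws on one finite set. It is used for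
  the fair signs of Assouad's argument, for independent sample blocks, and for the priors on the
  masses.\<close>

definition prod_exp :: "'a set \<Rightarrow> (nat \<Rightarrow> 'a \<Rightarrow> real) \<Rightarrow> nat \<Rightarrow> ((nat \<Rightarrow> 'a) \<Rightarrow> real) \<Rightarrow> real" where
  "prod_exp X p n f = (\<Sum>\<xi>\<in>PiE {..<n} (\<lambda>_. X). (\<Prod>i<n. p i (\<xi> i)) * f \<xi>)"

lemma prod_exp_0: "prod_exp X p 0 f = f (\<lambda>_. undefined)"
  by (simp add: prod_exp_def)

lemma prod_exp_Suc:
  "prod_exp X p (Suc n) f = (\<Sum>x\<in>X. p n x * prod_exp X p n (\<lambda>\<xi>. f (\<xi>(n := x))))"
proof -
  have inj: "inj_on (\<lambda>(y, g). g(n := y)) (X \<times> PiE {..<n} (\<lambda>_. X))"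
  proof (rule inj_onI, clarsimp)
    fix a b a' b'
    assume b: "b \<in> PiE {..<n} (\<lambda>_. X)" "b' \<in> PiE {..<n} (\<lambda>_. X)"
      and eq: "b(n := a) = b'(n := a')"
    have "a = a'" using fun_cong[OF eq, of n] by simp
    moreover have "b = b'"
    proof
      fix i show "b i = b' i"
        using fun_cong[OF eq, of i] b by (cases "i = n") (auto simp: PiE_def extensional_def)
    qed
    ultimately show "a = a' \<and> b = b'" by simp
  qed
  have ins: "{..<Suc n} = insert n {..<n}" by auto
  have "prod_exp X p (Suc n) f
      = (\<Sum>\<xi>\<in>(\<lambda>(y, g). g(n := y)) ` (X \<times> PiE {..<n} (\<lambda>_. X)). (\<Prod>i<Suc n. p i (\<xi> i)) * f \<xi>)"
    unfolding prod_exp_def by (subst (1) ins, subst PiE_insert_eq) simp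
  also have "\<dots> = (\<Sum>(x, \<xi>)\<in>X \<times> PiE {..<n} (\<lambda>_. X). (\<Prod>i<Suc n. p i ((\<xi>(n := x)) i)) * f (\<xi>(n := x)))"
    by (subst sum.reindex[OF inj]) (simp add: case_prod_unfold)
  also have "\<dots> = (\<Sum>x\<in>X. \<Sum>\<xi>\<in>PiE {..<n} (\<lambda>_. X). (\<Prod>i<Suc n. p i ((\<xi>(n := x)) i)) * f (\<xi>(n := x)))"
    by (rule sum.cartesian_product[symmetric])
  also have "\<dots> = (\<Sum>x\<in>X. p n x * prod_exp X p n (\<lambda>\<xi>. f (\<xi>(n := x))))"
    unfolding prod_exp_def sum_distrib_left
    by (intro sum.cong refl) (simp add: mult_ac)
  finally show ?thesis .
qed

lemma is_weight_prod:
  fixes p :: "nat \<Rightarrow> 'a \<Rightarrow> real"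
  assumes "\<And>i. i < n \<Longrightarrow> is_weight X (p i)" "finite X"
  shows "is_weight (PiE {..<n} (\<lambda>_. X)) (\<lambda>\<xi>. \<Prod>i<n. p i (\<xi> i))"
  unfolding is_weight_def
proof (intro conjI ballI)
  show "finite (PiE {..<n} (\<lambda>_. X))" using assms(2) by (intro finite_PiE) auto
  show "0 \<le> (\<Prod>i<n. p i (\<xi> i))" if "\<xi> \<in> PiE {..<n} (\<lambda>_. X)" for \<xi>
    using that assms(1) by (intro prod_nonneg) (auto simp: is_weight_def PiE_def Pi_def)
  have "(\<Sum>\<xi>\<in>PiE {..<n} (\<lambda>_. X). \<Prod>i<n. p i (\<xi> i)) = (\<Prod>i<n. \<Sum>x\<in>X. p i x)"
    using assms(2) by (intro prod_sum_PiE[symmetric]) auto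
  also have "\<dots> = 1" using assms(1) by (intro prod.neutral) (auto simp: is_weight_def)
  finally show "(\<Sum>\<xi>\<in>PiE {..<n} (\<lambda>_. X). \<Prod>i<n. p i (\<xi> i)) = 1" .
qed

lemma prod_exp_add: "prod_exp X p n (\<lambda>\<xi>. f \<xi> + g \<xi>) = prod_exp X p n f + prod_exp X p n g"
  by (simp add: prod_exp_def distrib_left sum.distrib)

lemma prod_exp_diff: "prod_exp X p n (\<lambda>\<xi>. f \<xi> - g \<xi>) = prod_exp X p n f - prod_exp X p n g"
  by (simp add: prod_exp_def right_diff_distrib sum_subtractf)

lemma prod_exp_cmult: "prod_exp X p n (\<lambda>\<xi>. c * f \<xi>) = c * prod_exp X p n f"
  by (simp add: prod_exp_def sum_distrib_left mult_ac)

lemma prod_exp_sum: "prod_exp X p n (\<lambda>\<xi>. \<Sum>i\<in>I. f i \<xi>) = (\<Sum>i\<in>I. prod_exp X p n (f i))"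
  unfolding prod_exp_def sum_distrib_left by (rule sum.swap)

lemma prod_exp_cong:
  assumes "\<And>\<xi>. \<xi> \<in> PiE {..<n} (\<lambda>_. X) \<Longrightarrow> f \<xi> = g \<xi>" "\<And>i. i < n \<Longrightarrow> p i = p' i"
  shows "prod_exp X p n f = prod_exp X p' n g"
  unfolding prod_exp_def using assms by (intro sum.cong) auto

lemma prod_exp_const:
  assumes "\<And>i. i < n \<Longrightarrow> is_weight X (p i)" "finite X"
  shows "prod_exp X p n (\<lambda>_. c) = c"
  unfolding prod_exp_def by (rule weighted_mean_const[OF is_weight_prod[OF assms]])

lemma prod_exp_mono:
  assumes "\<And>i. i < n \<Longrightarrow> is_weight X (p i)" "finite X"
    and "\<And>\<xi>. \<xi> \<in> PiE {..<n} (\<lambda>_. X) \<Longrightarrow> f \<xi> \<le> g \<xi>"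
  shows "prod_exp X p n f \<le> prod_exp X p n g"
  unfolding prod_exp_def by (rule weighted_mean_mono[OF is_weight_prod[OF assms(1,2)] assms(3)])

lemma prod_exp_abs_le_sqrt:
  assumes "\<And>i. i < n \<Longrightarrow> is_weight X (p i)" "finite X"
  shows "prod_exp X p n (\<lambda>\<xi>. \<bar>f \<xi>\<bar>) \<le> sqrt (prod_exp X p n (\<lambda>\<xi>. (f \<xi>)\<^sup>2))"
  unfolding prod_exp_def by (rule weighted_mean_abs_le_sqrt[OF is_weight_prod[OF assms]])

lemma prod_exp_square_le:
  assumes "\<And>i. i < n \<Longrightarrow> is_weight X (p i)" "finite X"
  shows "(prod_exp X p n f)\<^sup>2 \<le> prod_exp X p n (\<lambda>\<xi>. (f \<xi>)\<^sup>2)"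
  unfolding prod_exp_def by (rule weighted_mean_square_le[OF is_weight_prod[OF assms]])

lemma prod_exp_abs_le:
  assumes "\<And>i. i < n \<Longrightarrow> is_weight X (p i)" "finite X"
  shows "\<bar>prod_exp X p n f\<bar> \<le> prod_exp X p n (\<lambda>\<xi>. \<bar>f \<xi>\<bar>)"
proof -
  have "prod_exp X p n f \<le> prod_exp X p n (\<lambda>\<xi>. \<bar>f \<xi>\<bar>)"
    by (rule prod_exp_mono[OF assms]) simp_all
  moreover have "(-1) * prod_exp X p n f \<le> prod_exp X p n (\<lambda>\<xi>. \<bar>f \<xi>\<bar>)"
    unfolding prod_exp_cmult[symmetric] by (rule prod_exp_mono[OF assms]) simp_all
  ultimately show ?thesis by linarith
qed

lemma prod_exp_prod:
  assumes "finite X"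
  shows "prod_exp X p n (\<lambda>\<xi>. \<Prod>i<n. h i (\<xi> i)) = (\<Prod>i<n. \<Sum>x\<in>X. p i x * h i x)"
proof -
  have "prod_exp X p n (\<lambda>\<xi>. \<Prod>i<n. h i (\<xi> i))
      = (\<Sum>\<xi>\<in>PiE {..<n} (\<lambda>_. X). \<Prod>i<n. p i (\<xi> i) * h i (\<xi> i))"
    by (simp add: prod_exp_def prod.distrib)
  also have "\<dots> = (\<Prod>i<n. \<Sum>x\<in>X. p i x * h i x)"
    using assms by (intro prod_sum_PiE[symmetric]) auto
  finally show ?thesis .
qed

lemma prod_exp_prod_subset:
  assumes "finite X" "\<And>i. i < n \<Longrightarrow> is_weight X (p i)" "B \<subseteq> {..<n}"
  shows "prod_exp X p n (\<lambda>\<xi>. \<Prod>i\<in>B. h i (\<xi> i)) = (\<Prod>i\<in>B. \<Sum>x\<in>X. p i x * h i x)"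
proof -
  have 1: "(\<Prod>i\<in>B. g i) = (\<Prod>i<n. if i \<in> B then g i else 1)" for g :: "nat \<Rightarrow> real"
    by (rule prod.mono_neutral_cong_left) (use assms(3) in auto)
  have "prod_exp X p n (\<lambda>\<xi>. \<Prod>i\<in>B. h i (\<xi> i))
     = prod_exp X p n (\<lambda>\<xi>. \<Prod>i<n. (if i \<in> B then h i else (\<lambda>_. 1)) (\<xi> i))"
    unfolding 1 by (intro arg_cong[where f="prod_exp X p n"] ext prod.cong refl) auto
  also have "\<dots> = (\<Prod>i<n. \<Sum>x\<in>X. p i x * (if i \<in> B then h i else (\<lambda>_. 1)) x)"
    by (rule prod_exp_prod[OF assms(1)])
  also have "\<dots> = (\<Prod>i<n. if i \<in> B then \<Sum>x\<in>X. p i x * h i x else 1)"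
    by (intro prod.cong refl) (use assms(2) in \<open>auto simp: is_weight_def\<close>)
  finally show ?thesis unfolding 1[symmetric] .
qed

text \<open>The k-th coordinate is overwritten by \<open>x\<close>, so the average over its old
  value runs over a dummy and disappears because \<open>p k\<close> has mass one. Keeping all
  \<open>n\<close> coordinates avoids reindexing.\<close>

lemma prod_exp_pull:
  assumes "\<And>i. i < n \<Longrightarrow> is_weight X (p i)" "k < n"
  shows "prod_exp X p n f = (\<Sum>x\<in>X. p k x * prod_exp X p n (\<lambda>\<xi>. f (\<xi>(k := x))))"
  using assms
proof (induction n arbitrary: f)
  case 0 then show ?case by simp
next
  case (Suc n)
  show ?case
  proof (cases "k = n")
    case True
    have "prod_exp X p (Suc n) (\<lambda>\<xi>. f (\<xi>(k := x))) = prod_exp X p n (\<lambda>\<xi>. f (\<xi>(n := x)))" for x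
      unfolding prod_exp_Suc using Suc.prems(1)[of n] True
      by (simp add: weighted_mean_const[of X "p n"])
    then show ?thesis unfolding prod_exp_Suc[of X p n f] True by (simp add: fun_upd_def)
  next
    case False
    then have k: "k < n" using Suc.prems by simp
    have "prod_exp X p (Suc n) f = (\<Sum>y\<in>X. p n y * (\<Sum>x\<in>X. p k x * prod_exp X p n (\<lambda>\<xi>. f (\<xi>(k := x, n := y)))))"
      unfolding prod_exp_Suc by (intro sum.cong refl arg_cong2[where f="(*)"] Suc.IH) (use Suc.prems k in auto)
    also have "\<dots> = (\<Sum>x\<in>X. p k x * (\<Sum>y\<in>X. p n y * prod_exp X p n (\<lambda>\<xi>. f (\<xi>(k := x, n := y)))))"
      unfolding sum_distrib_left by (subst sum.swap) (simp add: mult_ac)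
    also have "\<dots> = (\<Sum>x\<in>X. p k x * prod_exp X p (Suc n) (\<lambda>\<xi>. f (\<xi>(k := x))))"
      unfolding prod_exp_Suc using False by (simp add: fun_upd_twist)
    finally show ?thesis .
  qed
qed

text \<open>The law of a coordinate that \<open>g\<close> ignores is irrelevant. In
  \<open>hybrid_bound\<close> two neighbouring hybrids differ only in the law of such a
  coordinate.\<close>

lemma prod_exp_upd_cong:
  assumes "\<And>i. i < n \<Longrightarrow> is_weight X (p i)" "\<And>i. i < n \<Longrightarrow> is_weight X (p' i)"
    and "k < n" "\<And>i. i < n \<Longrightarrow> i \<noteq> k \<Longrightarrow> p i = p' i"
    and "\<And>\<xi> x. g (\<xi>(k := x)) = g \<xi>"
  shows "prod_exp X p n g = prod_exp X p' n g"
  using assms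
proof (induction n arbitrary: g)
  case 0 then show ?case by simp
next
  case (Suc n)
  show ?case
  proof (cases "k = n")
    case True
    have *: "prod_exp X p n g = prod_exp X p' n g"
      by (rule prod_exp_cong) (use Suc.prems True in auto)
    show ?thesis
      unfolding prod_exp_Suc using Suc.prems(1)[of n] Suc.prems(2)[of n] Suc.prems(5) True *
      by (simp add: weighted_mean_const fun_upd_def)
  next
    case False
    have "p n = p' n" using Suc.prems False by simp
    moreover have "prod_exp X p n (\<lambda>\<xi>. g (\<xi>(n := x))) = prod_exp X p' n (\<lambda>\<xi>. g (\<xi>(n := x)))" for x
    proof (rule Suc.IH)
      fix \<xi> xa
      have e: "(\<xi>(k := xa))(n := x) = (\<lambda>a. if a = k then xa else if a = n then x else \<xi> a)"
        using False by (auto simp: fun_eq_iff)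
      show "g ((\<xi>(k := xa))(n := x)) = g (\<xi>(n := x))"
        unfolding e using Suc.prems(5)[of "\<xi>(n := x)" xa] by (simp add: fun_upd_def)
    qed (use Suc.prems False in auto)
    ultimately show ?thesis unfolding prod_exp_Suc by simp
  qed
qed

text \<open>The Efron--Stein inequality; \<open>d\<close> may be any predictor that ignores the \<open>k\<close>-th coordinate.\<close>

lemma efron_stein:
  assumes "\<And>i. i < n \<Longrightarrow> is_weight X (p i)" "finite X"
  shows "prod_exp X p n (\<lambda>\<xi>. (f \<xi>)\<^sup>2) - (prod_exp X p n f)\<^sup>2
     \<le> (\<Sum>k<n. prod_exp X p n (\<lambda>\<xi>. \<Sum>x\<in>X. p k x * (f (\<xi>(k := x)) - d k \<xi>)\<^sup>2))"
  using assms
proof (induction n arbitrary: f d)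
  case 0 then show ?case by (simp add: prod_exp_0)
next
  case (Suc n)
  let ?E = "prod_exp X p n"
  let ?fx = "\<lambda>x \<xi>. f (\<xi>(n := x))"
  have w: "\<And>i. i < n \<Longrightarrow> is_weight X (p i)" and wn: "is_weight X (p n)" using Suc.prems by auto
  let ?m = "\<lambda>\<xi>. \<Sum>x\<in>X. p n x * ?fx x \<xi>"
  \<comment> \<open>With the last coordinate frozen at \<open>x\<close>, the induction hypothesis
    bounds the conditional variance. What remains is the variance of the conditional means.\<close>
  have A: "(\<Sum>x\<in>X. p n x * ?E (\<lambda>\<xi>. (?fx x \<xi>)\<^sup>2)) - (\<Sum>x\<in>X. p n x * (?E (?fx x))\<^sup>2)
     \<le> (\<Sum>x\<in>X. p n x * (\<Sum>k<n. ?E (\<lambda>\<xi>. \<Sum>y\<in>X. p k y * (?fx x (\<xi>(k := y)) - d k (\<xi>(n := x)))\<^sup>2)))"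
    unfolding sum_subtractf[symmetric] right_diff_distrib[symmetric]
    by (rule weighted_mean_mono[OF wn]) (rule Suc.IH[OF w Suc.prems(2)])
  have C: "(\<Sum>x\<in>X. p n x * (\<Sum>k<n. ?E (\<lambda>\<xi>. \<Sum>y\<in>X. p k y * (?fx x (\<xi>(k := y)) - d k (\<xi>(n := x)))\<^sup>2)))
      = (\<Sum>k<n. prod_exp X p (Suc n) (\<lambda>\<xi>. \<Sum>x\<in>X. p k x * (f (\<xi>(k := x)) - d k \<xi>)\<^sup>2))"
    unfolding prod_exp_Suc sum_distrib_left
    by (subst sum.swap, intro sum.cong refl) (simp add: fun_upd_twist)
  show ?case
  proof -
    have gen2: "prod_exp X p (Suc n) (\<lambda>\<xi>. (f \<xi>)\<^sup>2) - (prod_exp X p (Suc n) f)\<^sup>2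
     \<le> (\<Sum>k<n. prod_exp X p (Suc n) (\<lambda>\<xi>. \<Sum>x\<in>X. p k x * (f (\<xi>(k := x)) - d k \<xi>)\<^sup>2))
       + ?E (\<lambda>\<xi>. \<Sum>x\<in>X. p n x * (?fx x \<xi> - dn \<xi>)\<^sup>2)" for dn
    proof -
      \<comment> \<open>The number \<open>?E dn\<close> is the same for every \<open>x\<close>, so
        it may serve as the constant predictor; Jensen's inequality then moves the square inside
        \<open>?E\<close>.\<close>
      have "(\<Sum>x\<in>X. p n x * (?E (?fx x))\<^sup>2) - (\<Sum>x\<in>X. p n x * ?E (?fx x))\<^sup>2
        \<le> (\<Sum>x\<in>X. p n x * (?E (?fx x) - ?E dn)\<^sup>2)"
        by (rule weighted_variance_le[OF wn])
      also have "\<dots> \<le> (\<Sum>x\<in>X. p n x * ?E (\<lambda>\<xi>. (?fx x \<xi> - dn \<xi>)\<^sup>2))"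
        unfolding prod_exp_diff[symmetric]
        by (rule weighted_mean_mono[OF wn]) (rule prod_exp_square_le[OF w Suc.prems(2)])
      also have "\<dots> = ?E (\<lambda>\<xi>. \<Sum>x\<in>X. p n x * (?fx x \<xi> - dn \<xi>)\<^sup>2)"
        by (simp add: prod_exp_sum prod_exp_cmult)
      finally show ?thesis using A C unfolding prod_exp_Suc by linarith
    qed
    have "?E (\<lambda>\<xi>. \<Sum>x\<in>X. p n x * (?fx x \<xi> - ?m \<xi>)\<^sup>2)
        \<le> prod_exp X p (Suc n) (\<lambda>\<xi>. \<Sum>x\<in>X. p n x * (f (\<xi>(n := x)) - d n \<xi>)\<^sup>2)"
    proof -
      \<comment> \<open>The predictor \<open>d n\<close> is read at \<open>\<xi>(n := y)\<close>.
        For every \<open>y\<close> the conditional mean \<open>?m\<close> predicts at least as well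
        as that value, so averaging over \<open>y\<close> preserves the bound.\<close>
      have opt: "(\<Sum>x\<in>X. p n x * (?fx x \<xi> - ?m \<xi>)\<^sup>2) \<le> (\<Sum>x\<in>X. p n x * (?fx x \<xi> - c)\<^sup>2)" for \<xi> c
      proof -
        have "(\<Sum>x\<in>X. p n x * (?fx x \<xi> - ?m \<xi>)\<^sup>2)
          = (\<Sum>x\<in>X. p n x * (?fx x \<xi>)\<^sup>2 - 2 * ?m \<xi> * (p n x * ?fx x \<xi>) + (?m \<xi>)\<^sup>2 * p n x)"
          by (intro sum.cong refl) (simp add: power2_eq_square algebra_simps)
        also have "\<dots> = (\<Sum>x\<in>X. p n x * (?fx x \<xi>)\<^sup>2) - 2 * ?m \<xi> * ?m \<xi> + (?m \<xi>)\<^sup>2"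
          using is_weightD(3)[OF wn] by (simp add: sum.distrib sum_subtractf sum_distrib_left[symmetric])
        also have "\<dots> = (\<Sum>x\<in>X. p n x * (?fx x \<xi>)\<^sup>2) - (?m \<xi>)\<^sup>2"
          by (simp add: power2_eq_square)
        also have "\<dots> \<le> (\<Sum>x\<in>X. p n x * (?fx x \<xi> - c)\<^sup>2)" by (rule weighted_variance_le[OF wn])
        finally show ?thesis .
      qed
      have "?E (\<lambda>\<xi>. \<Sum>x\<in>X. p n x * (?fx x \<xi> - ?m \<xi>)\<^sup>2)
         = (\<Sum>y\<in>X. p n y * ?E (\<lambda>\<xi>. \<Sum>x\<in>X. p n x * (?fx x \<xi> - ?m \<xi>)\<^sup>2))"
        by (simp add: weighted_mean_const[OF wn])
      also have "\<dots> \<le> (\<Sum>y\<in>X. p n y * ?E (\<lambda>\<xi>. \<Sum>x\<in>X. p n x * (?fx x \<xi> - d n (\<xi>(n := y)))\<^sup>2))"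
        by (rule weighted_mean_mono[OF wn]) (rule prod_exp_mono[OF w Suc.prems(2) opt])
      also have "\<dots> = prod_exp X p (Suc n) (\<lambda>\<xi>. \<Sum>x\<in>X. p n x * (f (\<xi>(n := x)) - d n \<xi>)\<^sup>2)"
        unfolding prod_exp_Suc by simp
      finally show ?thesis .
    qed
    then show ?thesis using gen2[of ?m] by (simp add: fun_upd_def)
  qed
qed

section \<open>Expectations under i.i.d. sampling\<close>

lemma finite_samples: "finite (samples S n)"
  unfolding samples_def using finite_lists_length_eq[of "{..<S}" n] by (simp add: conj_commute)

lemma samples_0: "samples S 0 = {[]}"
  by (auto simp: samples_def)

lemma samples_Suc: "samples S (Suc n) = (\<lambda>(x, xs). x # xs) ` ({..<S} \<times> samples S n)"
  by (auto simp: samples_def length_Suc_conv image_iff)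

lemma expect_0: "expect S 0 r f = f []"
  by (simp add: expect_def samples_0)

lemma expect_Suc: "expect S (Suc n) r f = (\<Sum>x<S. r x * expect S n r (\<lambda>xs. f (x # xs)))"
proof -
  have inj: "inj_on (\<lambda>(x, xs). x # xs) ({..<S} \<times> samples S n)" by (auto simp: inj_on_def)
  have "expect S (Suc n) r f = (\<Sum>(x, xs)\<in>{..<S} \<times> samples S n. r x * prod_list (map r xs) * f (x # xs))"
    unfolding expect_def samples_Suc by (subst sum.reindex[OF inj]) (simp add: case_prod_unfold)
  also have "\<dots> = (\<Sum>x<S. r x * expect S n r (\<lambda>xs. f (x # xs)))"
    unfolding expect_def sum_distrib_left by (subst sum.cartesian_product) (simp add: mult_ac)
  finally show ?thesis .
qed

lemma expect_add: "expect S (a + b) r f = expect S a r (\<lambda>xs. expect S b r (\<lambda>ys. f (xs @ ys)))"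
  by (induction a arbitrary: f) (simp_all add: expect_0 expect_Suc)

text \<open>Sampling factorises over positions. The weight \<open>r\<close> is arbitrary: with
  \<open>r\<close> constantly 1 the lemma turns a plain sum over \<open>samples\<close> into a
  power, which gives the Hellinger affinity of product laws in
  \<open>likelihood_overlap_ge\<close>.\<close>

lemma expect_prod_list: "expect S n r (\<lambda>xs. prod_list (map h xs)) = (\<Sum>x<S. r x * h x) ^ n"
proof (induction n)
  case (Suc n)
  have "expect S (Suc n) r (\<lambda>xs. prod_list (map h xs))
      = (\<Sum>x<S. r x * (h x * expect S n r (\<lambda>xs. prod_list (map h xs))))"
    unfolding expect_Suc by (simp add: expect_def sum_distrib_left mult_ac)
  then show ?case using Suc by (simp add: sum_distrib_right mult_ac)
qed (simp add: expect_0)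

lemma is_weight_samples:
  assumes "dist_on S r"
  shows "is_weight (samples S n) (\<lambda>xs. prod_list (map r xs))"
  unfolding is_weight_def
proof (intro conjI ballI)
  show "0 \<le> prod_list (map r xs)" if "xs \<in> samples S n" for xs
    using that assms by (intro prod_list_nonneg) (auto simp: samples_def dist_on_def)
  have "expect S n r (\<lambda>xs. prod_list (map (\<lambda>_. 1) xs)) = 1"
    unfolding expect_prod_list using assms by (simp add: dist_on_def)
  moreover have "prod_list (map (\<lambda>_. 1::real) xs) = 1" for xs :: "nat list"
    by (induction xs) auto
  ultimately show "(\<Sum>xs\<in>samples S n. prod_list (map r xs)) = 1"
    by (simp add: expect_def)
qed (rule finite_samples)

lemma expect_plus: "expect S n r (\<lambda>xs. f xs + g xs) = expect S n r f + expect S n r g"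
  by (simp add: expect_def distrib_left sum.distrib)

lemma expect_minus: "expect S n r (\<lambda>xs. f xs - g xs) = expect S n r f - expect S n r g"
  by (simp add: expect_def right_diff_distrib sum_subtractf)

lemma expect_cmult: "expect S n r (\<lambda>xs. c * f xs) = c * expect S n r f"
  by (simp add: expect_def sum_distrib_left mult_ac)

lemma expect_sum: "expect S n r (\<lambda>xs. \<Sum>i\<in>I. f i xs) = (\<Sum>i\<in>I. expect S n r (f i))"
  unfolding expect_def sum_distrib_left by (rule sum.swap)

lemma expect_cong:
  assumes "\<And>xs. xs \<in> samples S n \<Longrightarrow> f xs = g xs"
  shows "expect S n r f = expect S n r g"
  unfolding expect_def using assms by (intro sum.cong) auto

lemma expect_const: "dist_on S r \<Longrightarrow> expect S n r (\<lambda>_. c) = c"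
  unfolding expect_def by (rule weighted_mean_const[OF is_weight_samples])

lemma expect_mono:
  assumes "dist_on S r" "\<And>xs. xs \<in> samples S n \<Longrightarrow> f xs \<le> g xs"
  shows "expect S n r f \<le> expect S n r g"
  unfolding expect_def by (rule weighted_mean_mono[OF is_weight_samples[OF assms(1)] assms(2)])

lemma expect_nonneg:
  assumes "dist_on S r" "\<And>xs. xs \<in> samples S n \<Longrightarrow> 0 \<le> f xs"
  shows "0 \<le> expect S n r f"
  using expect_mono[OF assms(1), of n "\<lambda>_. 0" f] assms by (simp add: expect_const)

lemma expect_le_const:
  assumes "dist_on S r" "\<And>xs. xs \<in> samples S n \<Longrightarrow> f xs \<le> c"
  shows "expect S n r f \<le> c"
  using expect_mono[OF assms(1), of n f "\<lambda>_. c"] assms by (simp add: expect_const)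

lemma expect_abs_le_sqrt:
  assumes "dist_on S r"
  shows "expect S n r (\<lambda>xs. \<bar>f xs\<bar>) \<le> sqrt (expect S n r (\<lambda>xs. (f xs)\<^sup>2))"
  unfolding expect_def by (rule weighted_mean_abs_le_sqrt[OF is_weight_samples[OF assms]])

lemma sum_list_moments:
  fixes \<phi> :: "nat \<Rightarrow> real"
  assumes "dist_on S r" and m1: "(\<Sum>x<S. r x * \<phi> x) = 0"
  shows "expect S n r (\<lambda>xs. sum_list (map \<phi> xs)) = 0"
    and "expect S n r (\<lambda>xs. (sum_list (map \<phi> xs))\<^sup>2) = real n * (\<Sum>x<S. r x * (\<phi> x)\<^sup>2)"
    and "expect S n r (\<lambda>xs. (sum_list (map \<phi> xs)) ^ 4)
       = real n * (\<Sum>x<S. r x * \<phi> x ^ 4) + 3 * real n * (real n - 1) * (\<Sum>x<S. r x * (\<phi> x)\<^sup>2)\<^sup>2"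
proof -
  have one: "(\<Sum>x<S. r x) = 1" using assms(1) by (simp add: dist_on_def)
  define s where "s = (\<lambda>xs. sum_list (map \<phi> xs))"
  have s: "s (x # xs) = \<phi> x + s xs" for x xs by (simp add: s_def)
  have rw: "(\<Sum>x<S. r x * (c * \<phi> x ^ k)) = c * (\<Sum>x<S. r x * \<phi> x ^ k)" for c k
    by (simp add: sum_distrib_left mult_ac)
  have rwc: "(\<Sum>x<S. r x * c) = c" for c using one by (simp add: sum_distrib_right[symmetric])
  have A: "expect S n r s = 0" for n
  proof (induction n)
    case (Suc n)
    then show ?case
      by (simp add: expect_Suc s expect_plus expect_const[OF assms(1)] m1)
  qed (simp add: expect_0 s_def)
  have B: "expect S n r (\<lambda>xs. (s xs)\<^sup>2) = real n * (\<Sum>x<S. r x * (\<phi> x)\<^sup>2)" for n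
  proof (induction n)
    case (Suc n)
    have "(\<lambda>xs. (\<phi> x + s xs)\<^sup>2) = (\<lambda>xs. (\<phi> x)\<^sup>2 + 2 * \<phi> x * s xs + (s xs)\<^sup>2)" for x
      by (simp add: power2_eq_square algebra_simps)
    then have "expect S (Suc n) r (\<lambda>xs. (s xs)\<^sup>2) = (\<Sum>x<S. r x * ((\<phi> x)\<^sup>2 + n * (\<Sum>x<S. r x * (\<phi> x)\<^sup>2)))"
      by (simp add: expect_Suc s expect_plus expect_cmult A Suc expect_const[OF assms(1)])
    then show ?case by (simp add: distrib_left sum.distrib rwc) (simp add: algebra_simps)
  qed (simp add: expect_0 s_def)
  let ?m2 = "(\<Sum>x<S. r x * (\<phi> x)\<^sup>2)"
  have D: "expect S n r (\<lambda>xs. (s xs) ^ 4) = real n * (\<Sum>x<S. r x * \<phi> x ^ 4) + 3 * real n * (real n - 1) * ?m2\<^sup>2" for n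
  proof (induction n)
    case (Suc n)
    have e: "(\<lambda>xs. (\<phi> x + s xs) ^ 4)
       = (\<lambda>xs. \<phi> x ^ 4 + 4 * \<phi> x ^ 3 * s xs + 6 * (\<phi> x)\<^sup>2 * (s xs)\<^sup>2 + 4 * \<phi> x * (s xs) ^ 3 + (s xs) ^ 4)" for x
      by (rule ext) (simp add: power2_eq_square power3_eq_cube power4_eq_xxxx algebra_simps)
    \<comment> \<open>The third moment of the partial sum is left unevaluated: it is multiplied by
      the first moment of \<open>\<phi>\<close>, which is zero.\<close>
    have "expect S (Suc n) r (\<lambda>xs. (s xs) ^ 4)
       = (\<Sum>x<S. r x * \<phi> x ^ 4 + 6 * (n * ?m2) * (r x * (\<phi> x)\<^sup>2)
          + 4 * expect S n r (\<lambda>xs. (s xs) ^ 3) * (r x * \<phi> x) + r x * expect S n r (\<lambda>xs. (s xs) ^ 4))"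
      unfolding expect_Suc s e expect_plus expect_cmult A B expect_const[OF assms(1)]
      by (intro sum.cong refl) (simp add: algebra_simps)
    also have "\<dots> = (\<Sum>x<S. r x * \<phi> x ^ 4) + 6 * (n * ?m2) * ?m2 + expect S n r (\<lambda>xs. (s xs) ^ 4)"
      by (simp add: sum.distrib sum_distrib_left[symmetric] rwc m1)
    finally show ?case unfolding Suc by (simp add: algebra_simps power2_eq_square)
  qed (simp add: expect_0 s_def)
  show "expect S n r (\<lambda>xs. sum_list (map \<phi> xs)) = 0" using A[of n] by (simp add: s_def)
  show "expect S n r (\<lambda>xs. (sum_list (map \<phi> xs))\<^sup>2) = real n * (\<Sum>x<S. r x * (\<phi> x)\<^sup>2)"
    using B[of n] by (simp add: s_def)
  show "expect S n r (\<lambda>xs. (sum_list (map \<phi> xs)) ^ 4)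
       = real n * (\<Sum>x<S. r x * \<phi> x ^ 4) + 3 * real n * (real n - 1) * (\<Sum>x<S. r x * (\<phi> x)\<^sup>2)\<^sup>2"
    using D[of n] by (simp add: s_def)
qed

lemma count_list_sum:
  fixes xs :: "nat list"
  assumes "set xs \<subseteq> {..<S}"
  shows "(\<Sum>i<S. \<beta> i * real (count_list xs i)) = sum_list (map \<beta> xs)"
  using assms
proof (induction xs)
  case (Cons x xs)
  have "(\<Sum>i<S. \<beta> i * real (count_list (x # xs) i))
     = (\<Sum>i<S. \<beta> i * real (count_list xs i) + (if i = x then \<beta> i else 0))"
    by (intro sum.cong) (auto simp: algebra_simps)
  also have "\<dots> = (\<Sum>i<S. \<beta> i * real (count_list xs i)) + \<beta> x"
    using Cons.prems by (simp add: sum.distrib)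
  finally show ?case using Cons by simp
qed simp

lemma emp_sum:
  assumes "xs \<in> samples S n"
  shows "(\<Sum>i<S. \<beta> i * emp xs i) = sum_list (map \<beta> xs) / n"
  using count_list_sum[of xs S \<beta>] assms by (simp add: samples_def emp_def sum_divide_distrib[symmetric])

lemma emp_dist_on:
  assumes "xs \<in> samples S n" "n > 0"
  shows "dist_on S (emp xs)"
proof -
  have "(\<Sum>i<S. emp xs i) = sum_list (map (\<lambda>_. 1) xs) / n"
    using emp_sum[OF assms(1), of "\<lambda>_. 1"] by simp
  also have "sum_list (map (\<lambda>_. 1::real) xs) = n"
    using assms(1) by (simp add: samples_def sum_list_triv)
  finally show ?thesis using assms(2) by (simp add: dist_on_def emp_def)
qed

text \<open>Subtracting the mean \<open>\<mu>\<close> from \<open>\<beta>\<close> makes the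
  statistic an average of i.i.d. centred terms. All multinomial covariances are contained in the
  negative square, so any linear functional of the frequencies can be handled at once.\<close>

lemma expect_emp_deviation:
  assumes r: "dist_on S r" and n: "n > 0"
  shows "expect S n r (\<lambda>xs. (\<Sum>i<S. \<beta> i * (emp xs i - r i))\<^sup>2)
     = ((\<Sum>i<S. r i * (\<beta> i)\<^sup>2) - (\<Sum>i<S. r i * \<beta> i)\<^sup>2) / n"
proof -
  define \<mu> where "\<mu> = (\<Sum>i<S. r i * \<beta> i)"
  have one: "(\<Sum>x<S. r x) = 1" using r by (simp add: dist_on_def)
  have m1: "(\<Sum>x<S. r x * (\<beta> x - \<mu>)) = 0"
    by (simp add: right_diff_distrib sum_subtractf sum_distrib_right[symmetric] one \<mu>_def)
  have "(\<Sum>i<S. \<beta> i * (emp xs i - r i)) = sum_list (map (\<lambda>x. \<beta> x - \<mu>) xs) / n" if "xs \<in> samples S n" for xs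
  proof -
    have "(\<Sum>i<S. \<beta> i * (emp xs i - r i)) = sum_list (map \<beta> xs) / n - \<mu>"
      using emp_sum[OF that, of \<beta>] by (simp add: right_diff_distrib sum_subtractf \<mu>_def mult.commute)
    also have "\<dots> = sum_list (map (\<lambda>x. \<beta> x - \<mu>) xs) / n"
      using n that by (simp add: sum_list_subtractf sum_list_triv samples_def field_simps)
    finally show ?thesis .
  qed
  then have "expect S n r (\<lambda>xs. (\<Sum>i<S. \<beta> i * (emp xs i - r i))\<^sup>2)
     = expect S n r (\<lambda>xs. (1 / n\<^sup>2) * (sum_list (map (\<lambda>x. \<beta> x - \<mu>) xs))\<^sup>2)"
    by (intro expect_cong) (simp add: power_divide)
  also have "\<dots> = (\<Sum>x<S. r x * (\<beta> x - \<mu>)\<^sup>2) / n"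
    unfolding expect_cmult sum_list_moments(2)[OF r m1] using n by (simp add: power2_eq_square)
  also have "(\<Sum>x<S. r x * (\<beta> x - \<mu>)\<^sup>2) = (\<Sum>x<S. r x * (\<beta> x)\<^sup>2 - 2 * \<mu> * (r x * \<beta> x) + \<mu>\<^sup>2 * r x)"
    by (intro sum.cong refl) (simp add: power2_eq_square algebra_simps)
  also have "\<dots> = (\<Sum>i<S. r i * (\<beta> i)\<^sup>2) - \<mu>\<^sup>2"
    by (simp add: sum.distrib sum_subtractf sum_distrib_left[symmetric] one \<mu>_def[symmetric])
       (simp add: power2_eq_square)
  finally show ?thesis by (simp add: \<mu>_def)
qed

lemma expect_emp_deviation_le:
  assumes "dist_on S r" "n > 0"
  shows "expect S n r (\<lambda>xs. (\<Sum>i<S. \<beta> i * (emp xs i - r i))\<^sup>2) \<le> (\<Sum>i<S. r i * (\<beta> i)\<^sup>2) / n"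
  unfolding expect_emp_deviation[OF assms] by (intro divide_right_mono) auto

lemma expect_emp_variance:
  assumes r: "dist_on S r" and n: "n > 0" and x: "x < S"
  shows "expect S n r (\<lambda>xs. (emp xs x - r x)\<^sup>2) = r x * (1 - r x) / n"
proof -
  have *: "(\<Sum>i<S. g i * (if i = x then 1 else 0)) = g x" for g :: "nat \<Rightarrow> real"
    using x by (simp add: if_distrib cong: if_cong)
  have "expect S n r (\<lambda>xs. (\<Sum>i<S. (if i = x then 1 else 0) * (emp xs i - r i))\<^sup>2) = r x * (1 - r x) / n"
    unfolding expect_emp_deviation[OF r n] using x
    by (simp add: if_distrib[where f="\<lambda>z. z ^ 2"] * power2_eq_square[of "r x"] right_diff_distrib cong: if_cong)
  moreover have "(\<Sum>i<S. (if i = x then 1 else 0) * (emp xs i - r i)) = emp xs x - r x" for xs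
    using *[of "\<lambda>i. emp xs i - r i"] by (simp add: mult.commute)
  ultimately show ?thesis by simp
qed

lemma dist_on_le_1:
  assumes "dist_on S r" "x < S" shows "0 \<le> r x" "r x \<le> 1"
  using assms member_le_sum[of x "{..<S}" r] by (auto simp: dist_on_def)

lemma expect_emp_abs_le:
  assumes "dist_on S r" "n > 0" "x < S"
  shows "expect S n r (\<lambda>xs. \<bar>emp xs x - r x\<bar>) \<le> sqrt (r x / n)"
proof -
  have "expect S n r (\<lambda>xs. \<bar>emp xs x - r x\<bar>) \<le> sqrt (r x * (1 - r x) / n)"
    using expect_abs_le_sqrt[OF assms(1), of n "\<lambda>xs. emp xs x - r x"] expect_emp_variance[OF assms] by simp
  also have "\<dots> \<le> sqrt (r x / n)"
    using dist_on_le_1[OF assms(1,3)]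
    by (intro real_sqrt_le_mono divide_right_mono) (auto simp: mult_left_le)
  finally show ?thesis .
qed

lemma expect_exp_count:
  assumes "dist_on S r" "x < S"
  shows "expect S n r (\<lambda>xs. exp (t * real (count_list xs x))) = (1 + r x * (exp t - 1)) ^ n"
proof -
  have 1: "exp (t * real (count_list xs x)) = prod_list (map (\<lambda>y. if y = x then exp t else 1) xs)" for xs
    by (induction xs) (auto simp: distrib_left exp_add)
  have "(\<Sum>y<S. r y * (if y = x then exp t else 1)) = (\<Sum>y<S. r y + (if y = x then r y * (exp t - 1) else 0))"
    by (intro sum.cong) (auto simp: algebra_simps)
  also have "\<dots> = 1 + r x * (exp t - 1)"
    using assms by (simp add: sum.distrib dist_on_def)
  finally show ?thesis unfolding 1 expect_prod_list by simp
qed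

lemma emp_range: "0 \<le> emp xs x" "emp xs x \<le> 1"
proof -
  show "0 \<le> emp xs x" by (simp add: emp_def)
  show "emp xs x \<le> 1" using count_le_length[of xs x] by (cases "xs = []") (auto simp: emp_def divide_simps)
qed

section \<open>Classification and plug-in upper bounds\<close>

lemma dist_on_emp_bayes_range:
  assumes "dist_on S q" "dist_on S r"
  shows "0 \<le> bayes_err S q r" "bayes_err S q r \<le> 1 / 2"
proof -
  have "(\<Sum>i<S. \<bar>r i - q i\<bar>) \<le> (\<Sum>i<S. r i + q i)"
    using assms by (intro sum_mono) (auto simp: dist_on_def abs_if)
  also have "\<dots> = 2" using assms by (simp add: sum.distrib dist_on_def)
  finally show "0 \<le> bayes_err S q r" by (simp add: bayes_err_def)
  have "0 \<le> (\<Sum>i<S. \<bar>r i - q i\<bar>)" by (intro sum_nonneg) auto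
  then show "bayes_err S q r \<le> 1 / 2" by (simp add: bayes_err_def)
qed

lemma risk_minus_bayes:
  assumes "dist_on S q" "dist_on S r"
  shows "risk S q r t - bayes_err S q r
     = 1 / 2 * (\<Sum>x<S. if t x then max 0 (r x - q x) else max 0 (q x - r x))"
proof -
  have "(\<Sum>x<S. \<bar>r x - q x\<bar>) = (\<Sum>x<S. r x + q x - 2 * min (r x) (q x))"
    by (intro sum.cong refl) auto
  also have "\<dots> = 2 - 2 * (\<Sum>x<S. min (r x) (q x))"
    using assms by (simp add: sum.distrib sum_subtractf sum_distrib_left[symmetric] dist_on_def)
  finally have b: "bayes_err S q r = 1 / 2 * (\<Sum>x<S. min (r x) (q x))"
    unfolding bayes_err_def by (simp add: field_simps)
  have "(\<Sum>x<S. if t x then max 0 (r x - q x) else max 0 (q x - r x))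
      = (\<Sum>x<S. r x * (if t x then 1 else 0) + q x * (if t x then 0 else 1) - min (r x) (q x))"
    by (intro sum.cong refl) auto
  then show ?thesis unfolding b risk_def by (simp add: sum.distrib sum_subtractf algebra_simps)
qed

lemma regret_eq:
  assumes "dist_on S q" "dist_on S r"
  shows "regret S q n th r = 1 / 2 * (\<Sum>x<S. expect S n r
           (\<lambda>xs. if th xs x then max 0 (r x - q x) else max 0 (q x - r x)))"
proof -
  have "regret S q n th r = expect S n r (\<lambda>xs. risk S q r (th xs) - bayes_err S q r)"
    by (simp add: regret_def expect_minus expect_const assms)
  then show ?thesis by (simp only: risk_minus_bayes[OF assms] expect_cmult expect_sum)
qed

lemma regret_range:
  assumes "dist_on S q" "dist_on S r"
  shows "0 \<le> regret S q n th r" "regret S q n th r \<le> 1"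
proof -
  show "0 \<le> regret S q n th r" unfolding regret_eq[OF assms]
    by (intro mult_nonneg_nonneg sum_nonneg expect_nonneg assms) auto
  have "(\<Sum>x<S. expect S n r (\<lambda>xs. if th xs x then max 0 (r x - q x) else max 0 (q x - r x)))
     \<le> (\<Sum>x<S. r x + q x)"
    using assms by (intro sum_mono expect_le_const) (auto simp: dist_on_def)
  also have "\<dots> = 2" using assms by (simp add: sum.distrib dist_on_def)
  finally show "regret S q n th r \<le> 1" unfolding regret_eq[OF assms] by simp
qed

lemma regret_le_worst:
  assumes "dist_on S q" "dist_on S r"
  shows "regret S q n th r \<le> worst_regret S q n th"
  unfolding worst_regret_def
  by (rule cSUP_upper) (use assms regret_range(2)[OF assms(1)] in \<open>auto intro!: bdd_aboveI2[where M=1]\<close>)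

lemma worst_regret_nonneg: "dist_on S q \<Longrightarrow> 0 \<le> worst_regret S q n th"
  using regret_le_worst[of S q q n th] regret_range(1)[of S q q n th] by linarith

text \<open>Allows the rate to absorb the standard deviation \<open>1 / sqrt n\<close> of one linear
  statistic. Each summand dominates \<open>q i / sqrt n\<close> because
  \<open>q i \<le> 1\<close>.\<close>

lemma rate_ach_ge:
  assumes "dist_on S q" "n > 0"
  shows "1 / sqrt n \<le> rate_ach S q n"
proof -
  have "1 / sqrt n = (\<Sum>i<S. q i / sqrt n)"
    using assms by (simp add: sum_divide_distrib[symmetric] dist_on_def)
  also have "\<dots> \<le> (\<Sum>i<S. min (q i) (sqrt (q i / n)))"
  proof (rule sum_mono)
    fix i assume "i \<in> {..<S}"
    then have q: "0 \<le> q i" "q i \<le> 1" using dist_on_le_1[OF assms(1)] by auto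
    then have "(q i)\<^sup>2 \<le> q i" by (simp add: power2_eq_square mult_left_le)
    then have "q i \<le> sqrt (q i)" by (rule real_le_rsqrt)
    then have "q i / sqrt n \<le> sqrt (q i / n)"
      by (simp add: real_sqrt_divide divide_right_mono)
    moreover have "q i / sqrt n \<le> q i / 1"
      using q assms(2) by (intro divide_left_mono) auto
    ultimately show "q i / sqrt n \<le> min (q i) (sqrt (q i / n))" by simp
  qed
  finally show ?thesis by (simp add: rate_ach_def)
qed

lemma min_rate_small:
  assumes "0 \<le> q" "q < 1 / real n"
  shows "min q (sqrt (q / n)) = q"
proof -
  have "q\<^sup>2 \<le> q / n" using assms mult_left_mono[of q "1 / n" q] by (simp add: power2_eq_square)
  then show ?thesis using real_le_rsqrt by fastforce
qed

lemma min_rate_large: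
  assumes "1 / real n \<le> q" "n > 0"
  shows "min q (sqrt (q / n)) = sqrt (q / n)" "1 / n \<le> sqrt (q / n)"
proof -
  have q: "0 \<le> q" using assms by (meson divide_nonneg_nonneg of_nat_0_le_iff order_trans zero_le_one)
  have "q / n \<le> q\<^sup>2" using assms q mult_left_mono[of "1 / n" q q] by (simp add: power2_eq_square)
  then have "sqrt (q / n) \<le> q" using q by (simp add: real_le_lsqrt)
  then show "min q (sqrt (q / n)) = sqrt (q / n)" by simp
  have "(1 / n)\<^sup>2 \<le> q / n" using assms divide_right_mono[of "1 / n" q n] by (simp add: power2_eq_square)
  then show "1 / n \<le> sqrt (q / n)" by (rule real_le_rsqrt)
qed

text \<open>Far from the boundary the variance, at most \<open>r x / n\<close>, is divided by a
  margin comparable with \<open>r x\<close>. This leaves order \<open>1 / n\<close>, which is below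
  \<open>sqrt (q / n)\<close> as soon as \<open>1 / n \<le> q\<close>.\<close>

lemma expect_square_ratio_le:
  assumes r: "dist_on S r" and n: "n > 0" and x: "x < S" and q: "1 / real n \<le> q" and big: "4 * q < r x"
  shows "expect S n r (\<lambda>xs. (emp xs x - r x)\<^sup>2 / (r x - q)) \<le> 2 * sqrt (q / n)"
proof -
  have q0: "0 < q" using q n by (meson divide_pos_pos of_nat_0_less_iff order_less_le_trans zero_less_one)
  have "expect S n r (\<lambda>xs. (emp xs x - r x)\<^sup>2 / (r x - q))
      = 1 / (r x - q) * (r x * (1 - r x) / n)"
    unfolding expect_emp_variance[OF r n x, symmetric] expect_cmult[symmetric] by simp
  also have "\<dots> \<le> 1 / (r x - q) * (r x / n)"
    using dist_on_le_1[OF r x] big q0 n by (intro mult_left_mono divide_right_mono) (auto simp: mult_left_le)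
  also have "\<dots> = r x / (r x - q) * (1 / n)" by simp
  also have "\<dots> \<le> 2 * (1 / n)"
    using big q0 by (intro mult_right_mono) (auto simp: field_simps)
  also have "\<dots> \<le> 2 * sqrt (q / n)" using min_rate_large(2)[OF q n] by simp
  finally show ?thesis .
qed

text \<open>For \<open>q x < 1 / n\<close> label 0 is always predicted and loses at most
  \<open>q x\<close>. Otherwise an error puts \<open>emp xs x\<close> and \<open>r x\<close> on
  different sides of \<open>q x\<close>, so the loss is at most
  \<open>\<bar>emp xs x - r x\<bar>\<close>. Its mean is of order \<open>sqrt (r x / n)\<close>,
  good enough while \<open>r x \<le> 4 * q x\<close>; beyond that a Chebyshev bound takes
  over.\<close>

lemma t_Q_pointwise:
  assumes q: "dist_on S q" and r: "dist_on S r" and n: "n > 0" and x: "x < S"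
  shows "expect S n r (\<lambda>xs. if t_Q q n xs x then max 0 (r x - q x) else max 0 (q x - r x))
     \<le> 2 * min (q x) (sqrt (q x / n))"
proof (cases "q x < 1 / n")
  case True
  have q0: "0 \<le> q x" "0 \<le> r x" using dist_on_le_1[OF q x] dist_on_le_1[OF r x] by auto
  have "expect S n r (\<lambda>xs. if t_Q q n xs x then max 0 (r x - q x) else max 0 (q x - r x)) \<le> q x"
    using True q0 by (intro expect_le_const[OF r]) (auto simp: t_Q_def)
  then show ?thesis using min_rate_small[OF q0(1) True] q0 by simp
next
  case False
  then have qn: "1 / n \<le> q x" by simp
  have r0: "0 \<le> r x" using dist_on_le_1[OF r x] by auto
  note m = min_rate_large[OF qn n]
  show ?thesis
  proof (cases "r x \<le> 4 * q x")
    case True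
    have "expect S n r (\<lambda>xs. if t_Q q n xs x then max 0 (r x - q x) else max 0 (q x - r x))
       \<le> expect S n r (\<lambda>xs. \<bar>emp xs x - r x\<bar>)"
      using False by (intro expect_mono[OF r]) (auto simp: t_Q_def)
    also have "\<dots> \<le> sqrt (r x / n)" by (rule expect_emp_abs_le[OF r n x])
    also have "\<dots> \<le> sqrt (4 * (q x / n))"
      using divide_right_mono[of "r x" "4 * q x" n] True by (intro real_sqrt_le_mono) simp
    also have "\<dots> = 2 * sqrt (q x / n)" by (simp only: real_sqrt_mult real_sqrt_four)
    finally show ?thesis using m by simp
  next
    case big: False
    have q0: "0 \<le> q x" using dist_on_le_1[OF q x] by auto
    have "expect S n r (\<lambda>xs. if t_Q q n xs x then max 0 (r x - q x) else max 0 (q x - r x))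
       \<le> expect S n r (\<lambda>xs. (emp xs x - r x)\<^sup>2 / (r x - q x))"
    proof (intro expect_mono[OF r])
      fix xs
      \<comment> \<open>On an error the deviation \<open>r x - emp xs x\<close> is at least the
        margin \<open>r x - q x\<close>, so the margin is at most the squared deviation over the
        margin.\<close>
      have "r x - q x \<le> (emp xs x - r x)\<^sup>2 / (r x - q x)" if "emp xs x \<le> q x"
      proof -
        have "(r x - q x) * (r x - q x) \<le> (r x - emp xs x) * (r x - emp xs x)"
          using that big q0 by (intro mult_mono) auto
        then show ?thesis using big q0 by (simp add: field_simps power2_eq_square)
      qed
      moreover have "0 \<le> (emp xs x - r x)\<^sup>2 / (r x - q x)" using big q0 by simp
      ultimately show "(if t_Q q n xs x then max 0 (r x - q x) else max 0 (q x - r x))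
        \<le> (emp xs x - r x)\<^sup>2 / (r x - q x)"
        using big q0 False by (auto simp: t_Q_def)
    qed
    also have "\<dots> \<le> 2 * sqrt (q x / n)"
      using big by (intro expect_square_ratio_le[OF r n x qn]) simp
    finally show ?thesis using m by simp
  qed
qed

lemma worst_regret_t_Q:
  assumes "dist_on S q" "n > 0"
  shows "worst_regret S q n (t_Q q n) \<le> rate_ach S q n"
  unfolding worst_regret_def
proof (rule cSUP_least)
  show "{r. dist_on S r} \<noteq> {}" using assms by auto
  fix r assume "r \<in> {r. dist_on S r}"
  then have r: "dist_on S r" by simp
  have "regret S q n (t_Q q n) r \<le> 1 / 2 * (\<Sum>x<S. 2 * min (q x) (sqrt (q x / n)))"
    unfolding regret_eq[OF assms(1) r]
    by (intro mult_left_mono sum_mono t_Q_pointwise[OF assms(1) r assms(2)]) auto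
  then show "regret S q n (t_Q q n) r \<le> rate_ach S q n"
    by (simp add: sum_distrib_left[symmetric] rate_ach_def)
qed

lemma R_ACH_le:
  assumes "dist_on S q" "n > 0"
  shows "R_ACH S q n \<le> rate_ach S q n"
proof -
  have "R_ACH S q n \<le> worst_regret S q n (t_Q q n)"
    unfolding R_ACH_def
    by (rule cINF_lower) (use worst_regret_nonneg[OF assms(1)] in \<open>auto intro!: bdd_belowI2[where m=0]\<close>)
  then show ?thesis using worst_regret_t_Q[OF assms] by linarith
qed

text \<open>Where \<open>r x\<close> may be much larger than \<open>q x\<close>, the fluctuation of
  \<open>emp xs x\<close> is itself too large for the bound, but there the absolute value is nearly
  linear. The linear part is therefore removed here and treated globally in
  \<open>plugin_error_le\<close>.\<close>

lemma plugin_pointwise: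
  assumes q: "dist_on S q" and r: "dist_on S r" and n: "n > 0" and x: "x < S"
  shows "expect S n r (\<lambda>xs. \<bar>\<bar>emp xs x - q x\<bar> - \<bar>r x - q x\<bar>
           - (if q x < 1 / n \<or> 4 * q x < r x then 1 else 0) * (emp xs x - r x)\<bar>)
     \<le> 2 * min (q x) (sqrt (q x / n))"
proof -
  have q0: "0 \<le> q x" "0 \<le> r x" using dist_on_le_1[OF q x] dist_on_le_1[OF r x] by auto
  show ?thesis
  proof (cases "q x < 1 / n")
    case True
    have "expect S n r (\<lambda>xs. \<bar>\<bar>emp xs x - q x\<bar> - \<bar>r x - q x\<bar>
           - (if q x < 1 / n \<or> 4 * q x < r x then 1 else 0) * (emp xs x - r x)\<bar>) \<le> 2 * q x"
    proof (intro expect_le_const[OF r])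
      fix xs
      show "\<bar>\<bar>emp xs x - q x\<bar> - \<bar>r x - q x\<bar>
           - (if q x < 1 / n \<or> 4 * q x < r x then 1 else 0) * (emp xs x - r x)\<bar> \<le> 2 * q x"
        using True q0 emp_range(1)[of xs x] by (auto simp: abs_if)
    qed
    then show ?thesis using min_rate_small[OF q0(1) True] by simp
  next
    case False
    then have qn: "1 / n \<le> q x" by simp
    note m = min_rate_large[OF qn n]
    show ?thesis
    proof (cases "4 * q x < r x")
      case False': False
      have "expect S n r (\<lambda>xs. \<bar>\<bar>emp xs x - q x\<bar> - \<bar>r x - q x\<bar>
           - (if q x < 1 / n \<or> 4 * q x < r x then 1 else 0) * (emp xs x - r x)\<bar>)
         \<le> expect S n r (\<lambda>xs. \<bar>emp xs x - r x\<bar>)"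
        using False False' by (intro expect_mono[OF r]) (auto simp: abs_if)
      also have "\<dots> \<le> sqrt (r x / n)" by (rule expect_emp_abs_le[OF r n x])
      also have "\<dots> \<le> sqrt (4 * (q x / n))"
        using divide_right_mono[of "r x" "4 * q x" n] False' by (intro real_sqrt_le_mono) simp
      also have "\<dots> = 2 * sqrt (q x / n)" by (simp only: real_sqrt_mult real_sqrt_four)
      finally show ?thesis using m by simp
    next
      case big: True
      have "expect S n r (\<lambda>xs. \<bar>\<bar>emp xs x - q x\<bar> - \<bar>r x - q x\<bar>
           - (if q x < 1 / n \<or> 4 * q x < r x then 1 else 0) * (emp xs x - r x)\<bar>)
         \<le> expect S n r (\<lambda>xs. (emp xs x - r x)\<^sup>2 / (r x - q x))"
      proof (intro expect_mono[OF r])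
        fix xs
        define e where "e = emp xs x"
        have p: "0 < r x - q x" using big q0 by simp
        \<comment> \<open>The arithmetic-geometric inequality for \<open>r x - q x\<close> and
          \<open>q x - e\<close>, whose sum is \<open>r x - e\<close>.\<close>
        have "4 * ((r x - q x) * (q x - e)) \<le> (e - r x)\<^sup>2"
          using zero_le_power2[of "(r x - q x) - (q x - e)"] by (simp add: power2_eq_square algebra_simps)
        then have "(r x - q x) * (2 * (q x - e)) \<le> (e - r x)\<^sup>2"
          using zero_le_power2[of "e - r x"] by linarith
        then have "2 * (q x - e) \<le> (e - r x)\<^sup>2 / (r x - q x)" using p by (simp add: field_simps)
        moreover have "0 \<le> (e - r x)\<^sup>2 / (r x - q x)" using p by simp
        ultimately show "\<bar>\<bar>emp xs x - q x\<bar> - \<bar>r x - q x\<bar>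
           - (if q x < 1 / n \<or> 4 * q x < r x then 1 else 0) * (emp xs x - r x)\<bar>
           \<le> (emp xs x - r x)\<^sup>2 / (r x - q x)"
          using big p unfolding e_def[symmetric] by (auto simp: abs_if)
      qed
      also have "\<dots> \<le> 2 * sqrt (q x / n)" by (rule expect_square_ratio_le[OF r n x qn big])
      finally show ?thesis using m by simp
    qed
  qed
qed

text \<open>The linear parts are added before the absolute value is taken. Together they cost one
  multinomial standard deviation, at most \<open>1 / sqrt n\<close>, instead of a sum over the
  symbols.\<close>

lemma plugin_error_le:
  assumes q: "dist_on S q" and r: "dist_on S r" and n: "n > 0"
  shows "expect S n r (\<lambda>xs. \<bar>bayes_err S q (emp xs) - bayes_err S q r\<bar>) \<le> rate_ach S q n"
proof -
  define \<beta> :: "nat \<Rightarrow> real" where "\<beta> = (\<lambda>x. if q x < 1 / n \<or> 4 * q x < r x then 1 else 0)"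
  define D where "D = (\<lambda>xs x. \<bar>emp xs x - q x\<bar> - \<bar>r x - q x\<bar> - \<beta> x * (emp xs x - r x))"
  have D: "expect S n r (\<lambda>xs. \<bar>D xs x\<bar>) \<le> 2 * min (q x) (sqrt (q x / n))" if "x < S" for x
    using plugin_pointwise[OF q r n that] by (simp add: D_def \<beta>_def)
  have "expect S n r (\<lambda>xs. \<bar>bayes_err S q (emp xs) - bayes_err S q r\<bar>)
      \<le> expect S n r (\<lambda>xs. 1 / 4 * \<bar>\<Sum>x<S. \<beta> x * (emp xs x - r x)\<bar> + 1 / 4 * (\<Sum>x<S. \<bar>D xs x\<bar>))"
  proof (rule expect_mono[OF r])
    fix xs
    have "bayes_err S q (emp xs) - bayes_err S q r
      = - (1 / 4) * ((\<Sum>x<S. \<beta> x * (emp xs x - r x)) + (\<Sum>x<S. D xs x))"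
      unfolding bayes_err_def D_def sum_subtractf by (simp add: field_simps)
    also have "\<bar>\<dots>\<bar> \<le> 1 / 4 * (\<bar>\<Sum>x<S. \<beta> x * (emp xs x - r x)\<bar> + \<bar>\<Sum>x<S. D xs x\<bar>)"
      by (simp add: abs_mult)
    also have "\<bar>\<Sum>x<S. D xs x\<bar> \<le> (\<Sum>x<S. \<bar>D xs x\<bar>)" by (rule sum_abs)
    finally show "\<bar>bayes_err S q (emp xs) - bayes_err S q r\<bar>
       \<le> 1 / 4 * \<bar>\<Sum>x<S. \<beta> x * (emp xs x - r x)\<bar> + 1 / 4 * (\<Sum>x<S. \<bar>D xs x\<bar>)"
      by simp
  qed
  also have "\<dots> = 1 / 4 * expect S n r (\<lambda>xs. \<bar>\<Sum>x<S. \<beta> x * (emp xs x - r x)\<bar>)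
      + 1 / 4 * (\<Sum>x<S. expect S n r (\<lambda>xs. \<bar>D xs x\<bar>))"
    by (simp only: expect_plus expect_cmult expect_sum)
  also have "\<dots> \<le> 1 / 4 * (1 / sqrt n) + 1 / 4 * (\<Sum>x<S. 2 * min (q x) (sqrt (q x / n)))"
  proof (intro add_mono mult_left_mono sum_mono)
    have "expect S n r (\<lambda>xs. \<bar>\<Sum>x<S. \<beta> x * (emp xs x - r x)\<bar>)
        \<le> sqrt (expect S n r (\<lambda>xs. (\<Sum>x<S. \<beta> x * (emp xs x - r x))\<^sup>2))"
      by (rule expect_abs_le_sqrt[OF r])
    also have "\<dots> \<le> sqrt ((\<Sum>i<S. r i * (\<beta> i)\<^sup>2) / n)"
      by (intro real_sqrt_le_mono expect_emp_deviation_le[OF r n])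
    also have "\<dots> \<le> sqrt (1 / n)"
    proof (intro real_sqrt_le_mono divide_right_mono)
      have "(\<Sum>i<S. r i * (\<beta> i)\<^sup>2) \<le> (\<Sum>i<S. r i * 1)"
        using dist_on_le_1[OF r] by (intro sum_mono mult_left_mono) (auto simp: \<beta>_def)
      then show "(\<Sum>i<S. r i * (\<beta> i)\<^sup>2) \<le> 1" using r by (simp add: dist_on_def)
    qed simp
    finally show "expect S n r (\<lambda>xs. \<bar>\<Sum>x<S. \<beta> x * (emp xs x - r x)\<bar>) \<le> 1 / sqrt n"
      by (simp add: real_sqrt_divide)
  qed (use D in auto)
  also have "\<dots> \<le> rate_ach S q n"
    using rate_ach_ge[OF q n] sum_nonneg[of "{..<S}" "\<lambda>i. min (q i) (sqrt (q i / n))"] dist_on_le_1(1)[OF q]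
    by (simp add: sum_distrib_left[symmetric] rate_ach_def)
  finally show ?thesis .
qed

lemma R_PLU_le:
  assumes "dist_on S q" "n > 0"
  shows "R_PLU S q n \<le> rate_ach S q n"
  unfolding R_PLU_def by (rule cSUP_least) (use assms plugin_error_le in auto)

lemma R_PLU_ge_point:
  assumes "dist_on S q" "dist_on S r" "n > 0"
  shows "expect S n r (\<lambda>xs. \<bar>bayes_err S q (emp xs) - bayes_err S q r\<bar>) \<le> R_PLU S q n"
  unfolding R_PLU_def
  by (rule cSUP_upper)
     (use assms plugin_error_le[OF assms(1) _ assms(3)] in \<open>auto intro!: bdd_aboveI2[where M="rate_ach S q n"]\<close>)

section \<open>Failure of the maximum likelihood classifier\<close>

text \<open>Bernoulli's inequality for the whole exponent yields only 0; for half of it, it yields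
  about 1/2, which is then squared. For odd \<open>n = 2 * k + 1\<close> the remaining factor is
  compensated by \<open>(k + 1) / n > 1 / 2\<close>.\<close>

lemma one_minus_inverse_power_ge:
  assumes "n \<ge> 2"
  shows "1 / 4 \<le> (1 - 1 / real n) ^ n"
proof -
  define k where "k = n div 2"
  have b: "1 - real k / n \<le> (1 - 1 / real n) ^ k"
    using Bernoulli_inequality[of "- 1 / real n" k] assms by (simp add: field_simps)
  show ?thesis
  proof (cases "even n")
    case True
    then have k: "real n = 2 * real k" "n = k + k" by (auto simp: k_def)
    then have "1 / 2 \<le> (1 - 1 / real n) ^ k" using b assms by (simp add: field_simps)
    then have "1 / 2 * (1 / 2) \<le> (1 - 1 / real n) ^ k * (1 - 1 / real n) ^ k"
      by (intro mult_mono) auto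
    then show ?thesis by (subst (2) k(2)) (simp add: power_add)
  next
    case False
    then have n: "n = k + k + 1" by (auto simp: k_def elim!: oddE)
    then have nr: "real n = 2 * real k + 1" by simp
    have k1: "1 \<le> real k" using n assms by simp
    have "(real k + 1) / n \<le> (1 - 1 / real n) ^ k" using b nr by (simp add: field_simps)
    then have "(real k + 1) / n * ((real k + 1) / n) * (1 - 1 / real n)
        \<le> (1 - 1 / real n) ^ k * (1 - 1 / real n) ^ k * (1 - 1 / real n)"
      using assms by (intro mult_right_mono mult_mono) auto
    moreover have "1 / 4 \<le> (real k + 1) / n * ((real k + 1) / n) * (1 - 1 / real n)"
    proof -
      have "8 * real k * (real k + 1)\<^sup>2 - real n ^ 3 = 4 * real k ^ 2 + 2 * real k - 1"
        unfolding nr by (simp add: power2_eq_square power3_eq_cube algebra_simps)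
      then have "real n ^ 3 \<le> 8 * real k * (real k + 1)\<^sup>2"
        using k1 zero_le_power2[of "real k"] by linarith
      moreover have "(real k + 1) / n * ((real k + 1) / n) * (1 - 1 / real n) = 2 * real k * (real k + 1)\<^sup>2 / real n ^ 3"
        unfolding nr using k1 by (simp add: divide_simps power2_eq_square power3_eq_cube)
      moreover have "0 < real n ^ 3" using assms by simp
      ultimately show ?thesis by (simp only: pos_le_divide_eq)
    qed
    ultimately have "1 / 4 \<le> (1 - 1 / real n) ^ k * (1 - 1 / real n) ^ k * (1 - 1 / real n)" by linarith
    also have "\<dots> = (1 - 1 / real n) ^ (k + k + 1)" by (simp add: power_add)
    also have "k + k + 1 = n" using n by simp
    finally show ?thesis .
  qed
qed

lemma expect_unseen:
  assumes "dist_on S r" "x < S"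
  shows "expect S n r (\<lambda>xs. if x \<in> set xs then 0 else 1) = (1 - r x) ^ n"
proof -
  have 1: "(if x \<in> set xs then 0 else 1) = prod_list (map (\<lambda>y. if y = x then 0 else 1::real) xs)" for xs
    by (induction xs) auto
  have "(\<Sum>y<S. r y * (if y = x then 0 else 1)) = (\<Sum>y<S. r y - (if y = x then r y else 0))"
    by (intro sum.cong) auto
  also have "\<dots> = 1 - r x"
    using assms by (simp add: sum_subtractf dist_on_def)
  finally show ?thesis unfolding 1 expect_prod_list by simp
qed

text \<open>The counterexample spreads \<open>Q\<close> over \<open>m\<close> symbols and \<open>R\<close> over \<open>n = m\<^sup>2\<close> symbols of \<open>Q\<close>-mass
  zero: each of the latter is unseen with probability about \<open>1/e\<close>, and then misclassified.\<close>

lemma t_MLE_bad: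
  fixes m :: nat
  assumes m: "m \<ge> 2"
  defines "n \<equiv> m\<^sup>2"
  defines "q \<equiv> (\<lambda>x. if x < m then 1 / real m else 0)"
  shows "regime 2 4 (m + n) q n" "rate_ach (m + n) q n \<le> 1 / sqrt m"
    "1 / 8 \<le> worst_regret (m + n) q n (t_MLE q)"
proof -
  define S where "S = m + n"
  define r where "r = (\<lambda>x. if x < m then 0 else 1 / real n)"
  have n4: "4 \<le> n" using m power_mono[of 2 m 2] by (simp add: n_def)
  have split: "(\<Sum>x<S. f x) = (\<Sum>x<m. f x) + (\<Sum>x\<in>{m..<S}. f x)" for f :: "nat \<Rightarrow> real"
    unfolding S_def using sum.atLeastLessThan_concat[of 0 m "m + n" f] by (simp add: atLeast0LessThan)
  have qd: "dist_on S q" using m by (simp add: dist_on_def q_def split)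
  have rd: "dist_on S r" using n4 by (simp add: dist_on_def r_def split) (simp add: S_def)
  have mm: "real n = (real m)\<^sup>2" by (simp add: n_def)
  have ln4: "1 \<le> ln (real n)"
  proof -
    have "exp 1 \<le> real n" using n4 exp_le by linarith
    then show ?thesis using n4 by (subst ln_ge_iff) auto
  qed
  have "(\<Sum>i<S. min (sqrt (q i)) (q i * sqrt (n * ln n))) = (\<Sum>i<m. 1 / sqrt m)"
  proof -
    have "sqrt (1 / m) \<le> 1 / m * sqrt (n * ln n)"
    proof -
      have "sqrt m \<le> sqrt (n * ln n)"
      proof (rule real_sqrt_le_mono)
        have "real m \<le> real m * real m" using m by simp
        also have "\<dots> \<le> n * ln n" using ln4 mult_left_mono[OF ln4, of n] by (simp add: mm power2_eq_square)
        finally show "real m \<le> n * ln n" .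
      qed
      then have "sqrt m / m \<le> sqrt (n * ln n) / m" by (simp add: divide_right_mono)
      moreover have "sqrt (1 / m) = sqrt m / m" using m by (simp add: real_sqrt_divide sqrt_divide_self_eq inverse_eq_divide)
      ultimately show ?thesis by simp
    qed
    then show ?thesis by (simp add: split q_def real_sqrt_divide)
  qed
  also have "\<dots> = sqrt m" using m by (simp add: real_div_sqrt)
  finally have A: "(\<Sum>i<S. min (sqrt (q i)) (q i * sqrt (n * ln n))) = sqrt m" .
  \<comment> \<open>The constant 2 comes from \<open>m + n \<le> n * n\<close>. The constant 4 comes
    from the sum being \<open>sqrt m\<close>, the fourth root of \<open>n\<close>.\<close>
  show "regime 2 4 (m + n) q n"
    unfolding regime_def
  proof (intro conjI)
    show "2 \<le> n" using n4 by simp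
    show "dist_on (m + n) q" using qd by (simp add: S_def)
    have "real (m + n) \<le> real n ^ 2"
    proof -
      have "m + n \<le> n * n"
      proof -
        have "m \<le> n" by (simp add: n_def power2_eq_square)
        then have "m + n \<le> 2 * n" by simp
        also have "\<dots> \<le> n * n" using n4 by (intro mult_right_mono) auto
        finally show ?thesis .
      qed
      then have "real (m + n) \<le> real (n * n)" by (simp only: of_nat_le_iff)
      then show ?thesis by (simp add: power2_eq_square)
    qed
    then have "ln (real (m + n)) \<le> ln (real n ^ 2)" using n4 by (subst ln_le_cancel_iff) auto
    then show "ln (real (m + n)) \<le> 2 * ln (real n)" using n4 by (simp add: ln_realpow)
    show "ln (real n) \<le> 4 * ln (\<Sum>i<m + n. min (sqrt (q i)) (q i * sqrt (n * ln n)))"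
      using A m by (simp add: S_def mm ln_realpow ln_sqrt)
  qed
  have "rate_ach S q n = (\<Sum>i<m. min (1 / m) (sqrt (1 / m / n)))"
    by (simp add: rate_ach_def split q_def)
  also have "\<dots> \<le> (\<Sum>i<m. sqrt (1 / m / n))" by (intro sum_mono) simp
  also have "\<dots> = 1 / sqrt m" using m by (simp add: mm real_sqrt_divide real_sqrt_mult)
  finally show "rate_ach (m + n) q n \<le> 1 / sqrt m" by (simp add: S_def)
  have "1 / 8 \<le> regret S q n (t_MLE q) r"
  proof -
    \<comment> \<open>Only the \<open>n\<close> symbols of \<open>Q\<close>-mass zero are counted:
      each is missed with probability at least 1/4 and then costs its full mass
      \<open>1 / n\<close>.\<close>
    have "1 / 8 = 1 / 2 * (\<Sum>x\<in>{m..<S}. 1 / 4 * (1 / n))" using n4 by (simp add: S_def)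
    also have "\<dots> \<le> 1 / 2 * (\<Sum>x\<in>{m..<S}. expect S n r
           (\<lambda>xs. if t_MLE q xs x then max 0 (r x - q x) else max 0 (q x - r x)))"
    proof (intro mult_left_mono sum_mono)
      fix x assume x: "x \<in> {m..<S}"
      have "1 / 4 * (1 / n) \<le> (1 - r x) ^ n * (1 / n)"
        using one_minus_inverse_power_ge[of n] n4 x by (intro mult_right_mono) (auto simp: r_def)
      also have "\<dots> = expect S n r (\<lambda>xs. (1 / n) * (if x \<in> set xs then 0 else 1))"
        unfolding expect_cmult using expect_unseen[OF rd, of x n] x by simp
      also have "\<dots> \<le> expect S n r (\<lambda>xs. if t_MLE q xs x then max 0 (r x - q x) else max 0 (q x - r x))"
        using x by (intro expect_mono[OF rd]) (auto simp: t_MLE_def r_def q_def emp_def count_list_0_iff)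
      finally show "1 / 4 * (1 / n) \<le> expect S n r
           (\<lambda>xs. if t_MLE q xs x then max 0 (r x - q x) else max 0 (q x - r x))" .
    qed simp
    also have "\<dots> \<le> regret S q n (t_MLE q) r"
      unfolding regret_eq[OF qd rd] split by (simp add: sum_nonneg expect_nonneg[OF rd])
    finally show ?thesis .
  qed
  also have "\<dots> \<le> worst_regret S q n (t_MLE q)" by (rule regret_le_worst[OF qd rd])
  finally show "1 / 8 \<le> worst_regret (m + n) q n (t_MLE q)" by (simp add: S_def)
qed

lemma t_MLE_not_optimal:
  "\<exists>S q n. regime 2 4 S q n \<and> worst_regret S q n (t_MLE q) > C * rate_ach S q n"
proof -
  \<comment> \<open>The choice \<open>m > (8 * C)\<^sup>2\<close> makes \<open>C / sqrt m\<close>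
    smaller than the regret 1/8 of \<open>t_MLE_bad\<close>.\<close>
  obtain m0 :: nat where m0: "max 4 ((8 * C)\<^sup>2) < m0" using reals_Archimedean2 by blast
  define m where "m = m0"
  have m: "2 \<le> m" "(8 * C)\<^sup>2 < m" using m0 by (auto simp: m_def)
  let ?n = "m\<^sup>2" and ?q = "\<lambda>x. if x < m then 1 / real m else 0"
  note b = t_MLE_bad[OF m(1)]
  have "8 * C \<le> sqrt ((8 * C)\<^sup>2)" unfolding real_sqrt_abs by simp
  also have "\<dots> < sqrt m" using m(2) by (intro real_sqrt_less_mono)
  finally have c: "8 * C < sqrt m" .
  have "C * rate_ach (m + ?n) ?q ?n < 1 / 8"
  proof (cases "C \<le> 0")
    case True
    have "0 \<le> rate_ach (m + ?n) ?q ?n" unfolding rate_ach_def by (intro sum_nonneg) auto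
    then have "C * rate_ach (m + ?n) ?q ?n \<le> 0" using True by (rule mult_nonpos_nonneg[rotated])
    then show ?thesis by simp
  next
    case False
    then have "C * rate_ach (m + ?n) ?q ?n \<le> C * (1 / sqrt m)" using b(2) by (intro mult_left_mono) auto
    also have "\<dots> < 1 / 8" using c m(1) by (simp add: field_simps)
    finally show ?thesis .
  qed
  then show ?thesis using b(1,3) by (intro exI[of _ "m + ?n"] exI[of _ ?q] exI[of _ ?n]) auto
qed

section \<open>Lower bounds for the plug-in estimator and for classification\<close>

text \<open>A polynomial minorant of the absolute value, which bounds a mean absolute deviation from
  below by the second and fourth moments. In the variable \<open>w = \<bar>z\<bar> / a\<close> it
  says \<open>w ^ 3 - 4 * w + 4 \<ge> 0\<close>.\<close>

lemma abs_ge_quadratic_quartic: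
  fixes z a :: real
  assumes "a > 0"
  shows "z\<^sup>2 / a - z ^ 4 / (4 * a ^ 3) \<le> \<bar>z\<bar>"
proof -
  define w where "w = \<bar>z\<bar> / a"
  have w: "0 \<le> w" "\<bar>z\<bar> = a * w" using assms by (auto simp: w_def)
  \<comment> \<open>The cubic is expanded around 1.2, a rational point near its minimiser
    \<open>2 / sqrt 3\<close>.\<close>
  have "0 \<le> (w - 12 / 10)\<^sup>2 * (w + 24 / 10) + 32 / 100 * w + 544 / 1000" using w by simp
  also have "\<dots> = w ^ 3 - 4 * w + 4"
    by (simp add: power2_eq_square power3_eq_cube field_simps)
  finally have "0 \<le> a * w * (w ^ 3 - 4 * w + 4)" using w assms by simp
  moreover have "z\<^sup>2 = (a * w)\<^sup>2" "z ^ 4 = (a * w) ^ 4" unfolding w(2)[symmetric] by simp_all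
  moreover have "(a * w)\<^sup>2 / a = a * w\<^sup>2" "(a * w) ^ 4 / (4 * a ^ 3) = a * w ^ 4 / 4"
    using assms by (simp_all add: power_mult_distrib field_simps power2_eq_square power3_eq_cube power4_eq_xxxx)
  ultimately show ?thesis using w(2) by (simp add: algebra_simps power2_eq_square power3_eq_cube power4_eq_xxxx)
qed

text \<open>If \<open>q x < 1 / n\<close>, the symbol is unseen with probability at least 1/4 and
  the deviation is then \<open>q x\<close>. Otherwise the count has variance
  \<open>n * v \<ge> 1 / 2\<close>, its fourth moment is at most five times the squared variance,
  and \<open>abs_ge_quadratic_quartic\<close> applies.\<close>

lemma binomial_mean_deviation_ge:
  assumes q: "dist_on S q" and n: "n \<ge> 2" and x: "x < S" and half: "q x \<le> 1 / 2"
  shows "1 / 5 * min (q x) (sqrt (q x / n)) \<le> expect S n q (\<lambda>xs. \<bar>emp xs x - q x\<bar>)"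
proof (cases "q x < 1 / n")
  case True
  have q0: "0 \<le> q x" using dist_on_le_1[OF q x] by simp
  have "1 / 5 * q x \<le> q x * (1 / 4)" using q0 by simp
  also have "\<dots> \<le> q x * (1 - q x) ^ n"
  proof (intro mult_left_mono q0)
    have "(1 - 1 / real n) ^ n \<le> (1 - q x) ^ n" using True n by (intro power_mono) auto
    then show "1 / 4 \<le> (1 - q x) ^ n" using one_minus_inverse_power_ge[OF n] by linarith
  qed
  also have "\<dots> = expect S n q (\<lambda>xs. q x * (if x \<in> set xs then 0 else 1))"
    unfolding expect_cmult using expect_unseen[OF q x] by simp
  also have "\<dots> \<le> expect S n q (\<lambda>xs. \<bar>emp xs x - q x\<bar>)"
    using q0 by (intro expect_mono[OF q]) (auto simp: emp_def count_list_0_iff)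
  finally show ?thesis using min_rate_small[OF q0 True] by simp
next
  case False
  then have qn: "1 / n \<le> q x" by simp
  have n0: "n > 0" using n by simp
  have q0: "0 < q x" using qn n by (meson divide_pos_pos of_nat_0_less_iff order_less_le_trans zero_less_one n0)
  define \<phi> where "\<phi> = (\<lambda>y. (if y = x then 1 else 0) - q x)"
  have sel: "(\<Sum>i<S. g i * (if i = x then 1 else 0)) = g x" for g :: "nat \<Rightarrow> real"
    using x by (simp add: if_distrib cong: if_cong)
  have one: "(\<Sum>x<S. q x) = 1" using q by (simp add: dist_on_def)
  have m1: "(\<Sum>y<S. q y * \<phi> y) = 0"
    unfolding \<phi>_def right_diff_distrib sum_subtractf sel sum_distrib_right[symmetric] one by simp
  define v where "v = q x * (1 - q x)"
  have m2: "(\<Sum>y<S. q y * (\<phi> y)\<^sup>2) = v"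
  proof -
    have "(\<Sum>y<S. q y * (\<phi> y)\<^sup>2) = (\<Sum>y<S. q y * (if y = x then 1 else 0) * (1 - 2 * q x) + (q x)\<^sup>2 * q y)"
      by (intro sum.cong refl) (auto simp: \<phi>_def power2_eq_square algebra_simps)
    also have "\<dots> = q x * (1 - 2 * q x) + (q x)\<^sup>2"
      unfolding sum.distrib sum_distrib_right[symmetric] sum_distrib_left[symmetric] sel one by simp
    finally show ?thesis by (simp add: v_def power2_eq_square algebra_simps)
  qed
  have m4: "(\<Sum>y<S. q y * (\<phi> y) ^ 4) \<le> v"
    unfolding m2[symmetric]
  proof (intro sum_mono mult_left_mono)
    fix y assume y: "y \<in> {..<S}"
    have "(\<phi> y)\<^sup>2 \<le> 1" unfolding abs_square_le_1 using dist_on_le_1[OF q x] by (auto simp: \<phi>_def)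
    then have "(\<phi> y)\<^sup>2 * (\<phi> y)\<^sup>2 \<le> 1 * (\<phi> y)\<^sup>2" by (intro mult_right_mono) auto
    then show "(\<phi> y) ^ 4 \<le> (\<phi> y)\<^sup>2" by (simp add: power4_eq_xxxx power2_eq_square mult.assoc)
    show "0 \<le> q y" using y dist_on_le_1[OF q] by auto
  qed
  define \<sigma> where "\<sigma> = sqrt (n * v)"
  have nq: "1 \<le> n * q x" using qn n0 by (simp add: field_simps)
  have nv: "1 / 2 \<le> n * v"
    using mult_mono[of 1 "n * q x" "1 / 2" "1 - q x"] nq half by (simp add: v_def mult.assoc)
  have s0: "0 < \<sigma>" using nv by (simp add: \<sigma>_def)
  have s2: "\<sigma>\<^sup>2 = n * v" using nv by (simp add: \<sigma>_def)
  have Z: "sum_list (map \<phi> xs) = n * (emp xs x - q x)" if "xs \<in> samples S n" for xs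
  proof -
    have "(\<Sum>i<S. \<phi> i * emp xs i) = (\<Sum>i<S. emp xs i * (if i = x then 1 else 0) - q x * emp xs i)"
      by (intro sum.cong refl) (simp add: \<phi>_def algebra_simps)
    also have "\<dots> = emp xs x - q x"
      unfolding sum_subtractf sel sum_distrib_left[symmetric] using emp_dist_on[OF that n0] by (simp add: dist_on_def)
    finally show ?thesis unfolding emp_sum[OF that] using n0 by (simp add: field_simps)
  qed
  \<comment> \<open>The minorant is used at scale \<open>a = 2 * \<sigma>\<close>: the second moment
    contributes \<open>\<sigma> / 2\<close> and the fourth removes at most
    \<open>5 * \<sigma> / 32\<close>, leaving 11/32 of \<open>\<sigma>\<close>.\<close>
  have "\<sigma> / 3 \<le> \<sigma> / 2 - 5 * \<sigma> / 32" using s0 by simp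
  also have "\<dots> \<le> n * v / (2 * \<sigma>) - (n * v + 3 * n * (real n - 1) * v\<^sup>2) / (4 * (2 * \<sigma>) ^ 3)"
  proof -
    have "n * v + 3 * n * (real n - 1) * v\<^sup>2 \<le> 5 * \<sigma> ^ 4"
    proof -
      have "\<sigma> ^ 4 = (n * v)\<^sup>2" using s2 by (metis numeral_Bit0 numeral_code(1) power2_eq_square power_add power_mult_distrib mult_2 one_add_one s2)
      moreover have "n * v \<le> 2 * (n * v)\<^sup>2"
        using mult_right_mono[of "1 / 2" "n * v" "n * v"] nv by (simp add: power2_eq_square)
      moreover have "3 * n * (real n - 1) * v\<^sup>2 \<le> 3 * n * real n * v\<^sup>2"
        by (intro mult_right_mono mult_left_mono) auto
      then have "3 * n * (real n - 1) * v\<^sup>2 \<le> 3 * (n * v)\<^sup>2"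
        by (simp add: power2_eq_square mult_ac)
      ultimately show ?thesis by linarith
    qed
    then have "(n * v + 3 * n * (real n - 1) * v\<^sup>2) / (4 * (2 * \<sigma>) ^ 3) \<le> 5 * \<sigma> ^ 4 / (4 * (2 * \<sigma>) ^ 3)"
      using s0 by (intro divide_right_mono) auto
    also have "\<dots> = 5 * \<sigma> / 32" using s0 by (simp add: power3_eq_cube power4_eq_xxxx)
    finally have "(n * v + 3 * n * (real n - 1) * v\<^sup>2) / (4 * (2 * \<sigma>) ^ 3) \<le> 5 * \<sigma> / 32" .
    moreover have "n * v / (2 * \<sigma>) = \<sigma> / 2" using s0 s2 by (simp add: power2_eq_square field_simps)
    ultimately show ?thesis by linarith
  qed
  also have "\<dots> \<le> (1 / (2 * \<sigma>)) * expect S n q (\<lambda>xs. (sum_list (map \<phi> xs))\<^sup>2)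
       - (1 / (4 * (2 * \<sigma>) ^ 3)) * expect S n q (\<lambda>xs. (sum_list (map \<phi> xs)) ^ 4)"
    unfolding sum_list_moments(2,3)[OF q m1] m2
    using s0 m4 by (simp add: divide_right_mono mult_left_mono)
  also have "\<dots> = expect S n q (\<lambda>xs. (1 / (2 * \<sigma>)) * (sum_list (map \<phi> xs))\<^sup>2
       - (1 / (4 * (2 * \<sigma>) ^ 3)) * (sum_list (map \<phi> xs)) ^ 4)"
    by (simp only: expect_minus expect_cmult)
  also have "\<dots> \<le> expect S n q (\<lambda>xs. n * \<bar>emp xs x - q x\<bar>)"
  proof (intro expect_mono[OF q])
    fix xs assume xs: "xs \<in> samples S n"
    show "(1 / (2 * \<sigma>)) * (sum_list (map \<phi> xs))\<^sup>2
       - (1 / (4 * (2 * \<sigma>) ^ 3)) * (sum_list (map \<phi> xs)) ^ 4 \<le> n * \<bar>emp xs x - q x\<bar>"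
      using abs_ge_quadratic_quartic[of "2 * \<sigma>" "sum_list (map \<phi> xs)"] s0 Z[OF xs]
      by (simp add: abs_mult)
  qed
  finally have "\<sigma> / 3 \<le> n * expect S n q (\<lambda>xs. \<bar>emp xs x - q x\<bar>)" by (simp only: expect_cmult)
  moreover have "3 / 5 * n * sqrt (q x / n) \<le> \<sigma>"
    unfolding \<sigma>_def
  proof (rule real_le_rsqrt)
    have "(3 / 5 * n * sqrt (q x / n))\<^sup>2 = 9 / 25 * (n * q x)"
      using q0 n0 by (simp add: power_mult_distrib power2_eq_square field_simps)
    also have "\<dots> \<le> (1 - q x) * (n * q x)" using half nq by (intro mult_right_mono) auto
    finally show "(3 / 5 * n * sqrt (q x / n))\<^sup>2 \<le> n * v" by (simp add: v_def mult_ac)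
  qed
  ultimately have "n * (1 / 5 * sqrt (q x / n)) \<le> n * expect S n q (\<lambda>xs. \<bar>emp xs x - q x\<bar>)" by simp
  then show ?thesis using min_rate_large(1)[OF qn n0] n0 by simp
qed

text \<open>At \<open>R = Q\<close> the true distance is zero, so the error is a quarter of the sum
  of the absolute deviations and nothing cancels. One symbol is omitted because its mass may exceed
  1/2.\<close>

lemma R_PLU_ge:
  assumes q: "dist_on S q" and n: "n \<ge> 2" and k: "\<And>i. i < S \<Longrightarrow> i \<noteq> k \<Longrightarrow> q i \<le> 1 / 2"
  shows "1 / 20 * (\<Sum>i\<in>{..<S} - {k}. min (q i) (sqrt (q i / n))) \<le> R_PLU S q n"
proof -
  have "1 / 20 * (\<Sum>i\<in>{..<S} - {k}. min (q i) (sqrt (q i / n)))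
      \<le> 1 / 4 * (\<Sum>i\<in>{..<S} - {k}. expect S n q (\<lambda>xs. \<bar>emp xs i - q i\<bar>))"
  proof -
    have "(\<Sum>i\<in>{..<S} - {k}. 1 / 5 * min (q i) (sqrt (q i / n)))
        \<le> (\<Sum>i\<in>{..<S} - {k}. expect S n q (\<lambda>xs. \<bar>emp xs i - q i\<bar>))"
      using k by (intro sum_mono binomial_mean_deviation_ge[OF q n]) auto
    then show ?thesis unfolding sum_distrib_left[symmetric] by simp
  qed
  also have "\<dots> \<le> 1 / 4 * (\<Sum>i<S. expect S n q (\<lambda>xs. \<bar>emp xs i - q i\<bar>))"
    by (intro mult_left_mono sum_mono2) (auto intro!: expect_nonneg[OF q])
  also have "\<dots> = expect S n q (\<lambda>xs. \<bar>bayes_err S q (emp xs) - bayes_err S q q\<bar>)"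
    by (simp add: bayes_err_def sum_nonneg expect_sum[symmetric] expect_cmult[symmetric])
  also have "\<dots> \<le> R_PLU S q n" using R_PLU_ge_point[OF q q] n by simp
  finally show ?thesis .
qed

text \<open>The Hellinger affinity is multiplicative over the sample. The hypothesis makes it at
  least \<open>1 - 1 / (2 * n)\<close> for one draw, so its \<open>2 * n\<close>-th power is at
  least 1/4, and the overlap is at least half of that.\<close>

lemma likelihood_overlap_ge:
  assumes r1: "dist_on S r1" and r0: "dist_on S r0" and n: "n > 0"
    and chi: "(\<Sum>x<S. (r1 x - r0 x)\<^sup>2 / (2 * (r1 x + r0 x))) \<le> 1 / (2 * real n)"
  shows "1 / 8 \<le> (\<Sum>xs\<in>samples S n. min (prod_list (map r1 xs)) (prod_list (map r0 xs)))"
proof -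
  define P1 P0 where "P1 = (\<lambda>xs. prod_list (map r1 xs))" and "P0 = (\<lambda>xs. prod_list (map r0 xs))"
  have nn: "0 \<le> P1 xs" "0 \<le> P0 xs" if "xs \<in> samples S n" for xs
    using is_weightD(2)[OF is_weight_samples[OF r1] that] is_weightD(2)[OF is_weight_samples[OF r0] that]
    by (auto simp: P1_def P0_def)
  have tot: "(\<Sum>xs\<in>samples S n. P1 xs) = 1" "(\<Sum>xs\<in>samples S n. P0 xs) = 1"
    using is_weightD(3)[OF is_weight_samples[OF r1]] is_weightD(3)[OF is_weight_samples[OF r0]]
    by (auto simp: P1_def P0_def)
  define BC where "BC = (\<Sum>x<S. sqrt (r1 x * r0 x))"
  \<comment> \<open>With mean \<open>t\<close> and half-difference \<open>d\<close> this reads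
    \<open>t - d\<^sup>2 / t \<le> sqrt (t\<^sup>2 - d\<^sup>2)\<close>.\<close>
  have pt: "(r1 x + r0 x) / 2 - (r1 x - r0 x)\<^sup>2 / (2 * (r1 x + r0 x)) \<le> sqrt (r1 x * r0 x)" if x: "x < S" for x
  proof -
    have p: "0 \<le> r1 x" "0 \<le> r0 x" using x dist_on_le_1[OF r1] dist_on_le_1[OF r0] by auto
    show ?thesis
    proof (cases "r1 x + r0 x = 0")
      case True then show ?thesis using p by simp
    next
      case False
      then have s: "0 < r1 x + r0 x" using p by simp
      define t where "t = (r1 x + r0 x) / 2"
      define d where "d = (r1 x - r0 x) / 2"
      have t: "0 < t" using s by (simp add: t_def)
      have eq: "r1 x * r0 x = t\<^sup>2 - d\<^sup>2" by (simp add: t_def d_def power2_eq_square field_simps)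
      have dt: "d\<^sup>2 \<le> t\<^sup>2" using p eq by (metis diff_ge_0_iff_ge mult_nonneg_nonneg)
      have "(r1 x - r0 x)\<^sup>2 / (2 * (r1 x + r0 x)) = d\<^sup>2 / t"
        using s by (simp add: t_def d_def power2_eq_square field_simps)
      moreover have "t - d\<^sup>2 / t \<le> sqrt (t\<^sup>2 - d\<^sup>2)"
      proof (rule real_le_rsqrt)
        have "(t - d\<^sup>2 / t)\<^sup>2 = (t\<^sup>2 - d\<^sup>2) * (1 - d\<^sup>2 / t\<^sup>2)"
          using t by (simp add: power2_eq_square field_simps)
        also have "\<dots> \<le> (t\<^sup>2 - d\<^sup>2) * 1" using dt t by (intro mult_left_mono) auto
        finally show "(t - d\<^sup>2 / t)\<^sup>2 \<le> t\<^sup>2 - d\<^sup>2" by simp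
      qed
      ultimately show ?thesis unfolding eq by (simp add: t_def)
    qed
  qed
  have "1 - 1 / (2 * real n) \<le> (\<Sum>x<S. (r1 x + r0 x) / 2 - (r1 x - r0 x)\<^sup>2 / (2 * (r1 x + r0 x)))"
    using chi r1 r0 by (simp add: sum_subtractf sum.distrib sum_divide_distrib[symmetric] dist_on_def)
  also have "\<dots> \<le> BC" unfolding BC_def using pt by (intro sum_mono) auto
  finally have bc: "1 - 1 / real (2 * n) \<le> BC" by simp
  have "1 / 4 \<le> (1 - 1 / real (2 * n)) ^ (2 * n)" using n by (intro one_minus_inverse_power_ge) simp
  also have "\<dots> \<le> BC ^ (2 * n)" using bc n by (intro power_mono) auto
  also have "\<dots> = (BC ^ n)\<^sup>2" by (simp add: power_mult[symmetric] mult.commute)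
  also have "BC ^ n = (\<Sum>xs\<in>samples S n. sqrt (P1 xs * P0 xs))"
  proof -
    have "sqrt (P1 xs * P0 xs) = prod_list (map (\<lambda>x. sqrt (r1 x * r0 x)) xs)" for xs
      by (induction xs) (simp_all add: P1_def P0_def real_sqrt_mult mult_ac)
    moreover have "BC ^ n = expect S n (\<lambda>_. 1) (\<lambda>xs. prod_list (map (\<lambda>x. sqrt (r1 x * r0 x)) xs))"
      unfolding expect_prod_list by (simp add: BC_def)
    moreover have "prod_list (map (\<lambda>_. 1::real) xs) = 1" for xs :: "nat list" by (induction xs) auto
    ultimately show ?thesis by (simp add: expect_def)
  qed
  \<comment> \<open>The product is regrouped into minimum and maximum; after Cauchy-Schwarz the
    maxima sum to at most 2.\<close>
  also have "(\<Sum>xs\<in>samples S n. sqrt (P1 xs * P0 xs))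
     = (\<Sum>xs\<in>samples S n. sqrt (min (P1 xs) (P0 xs)) * sqrt (max (P1 xs) (P0 xs)))"
    by (intro sum.cong refl) (auto simp: real_sqrt_mult min_def max_def)
  also have "\<dots>\<^sup>2 \<le> (\<Sum>xs\<in>samples S n. (sqrt (min (P1 xs) (P0 xs)))\<^sup>2) * (\<Sum>xs\<in>samples S n. (sqrt (max (P1 xs) (P0 xs)))\<^sup>2)"
    by (rule Cauchy_Schwarz_ineq_sum)
  also have "(\<Sum>xs\<in>samples S n. (sqrt (min (P1 xs) (P0 xs)))\<^sup>2) = (\<Sum>xs\<in>samples S n. min (P1 xs) (P0 xs))"
    using nn by (intro sum.cong refl) auto
  also have "(\<Sum>xs\<in>samples S n. min (P1 xs) (P0 xs)) * (\<Sum>xs\<in>samples S n. (sqrt (max (P1 xs) (P0 xs)))\<^sup>2)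
      \<le> (\<Sum>xs\<in>samples S n. min (P1 xs) (P0 xs)) * 2"
  proof (intro mult_left_mono sum_nonneg)
    have "(\<Sum>xs\<in>samples S n. (sqrt (max (P1 xs) (P0 xs)))\<^sup>2) \<le> (\<Sum>xs\<in>samples S n. P1 xs + P0 xs)"
    proof (intro sum_mono)
      fix xs assume "xs \<in> samples S n"
      then show "(sqrt (max (P1 xs) (P0 xs)))\<^sup>2 \<le> P1 xs + P0 xs" using nn[of xs] by (simp add: max_def)
    qed
    then show "(\<Sum>xs\<in>samples S n. (sqrt (max (P1 xs) (P0 xs)))\<^sup>2) \<le> 2" using tot by (simp add: sum.distrib)
  qed (use nn in auto)
  finally show ?thesis by (simp add: P1_def P0_def)
qed

section \<open>Assouad's lower bound for classification\<close>

lemma descending_enumeration: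
  fixes q :: "nat \<Rightarrow> real"
  obtains \<pi> where "bij_betw \<pi> {..<S} {..<S}" "\<And>i j. i \<le> j \<Longrightarrow> j < S \<Longrightarrow> q (\<pi> j) \<le> q (\<pi> i)"
proof
  let ?ys = "sort_key (\<lambda>i. - q i) [0..<S]"
  have l: "length ?ys = S" by simp
  show "bij_betw (nth ?ys) {..<S} {..<S}"
    by (rule bij_betw_nth) auto
  show "q (?ys ! j) \<le> q (?ys ! i)" if "i \<le> j" "j < S" for i j
    using sorted_nth_mono[of "map (\<lambda>i. - q i) ?ys" i j] that by simp
qed

text \<open>Each odd position dominates the even position after it, so the lighter members of the
  pairs account for everything except position 0, up to a factor two.\<close>

lemma antimono_sum_le_odd_sum:
  fixes f :: "nat \<Rightarrow> real"
  assumes "\<And>i j. i \<le> j \<Longrightarrow> f j \<le> f i" "\<And>i. 0 \<le> f i"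
  shows "(\<Sum>p\<in>{1..<S}. f p) \<le> 2 * (\<Sum>j<S div 2. f (2 * j + 1))"
proof -
  have "(\<Sum>p\<in>{1..<S}. f p) \<le> (\<Sum>p\<in>{1..<2 * (S div 2) + 1}. f p)"
    using assms(2) by (intro sum_mono2) auto
  also have "(\<Sum>p\<in>{1..<2 * J + 1}. f p) \<le> 2 * (\<Sum>j<J. f (2 * j + 1))" for J
  proof (induction J)
    case (Suc J)
    have "(\<Sum>p\<in>{1..<2 * Suc J + 1}. f p) = (\<Sum>p\<in>{1..<2 * J + 1}. f p) + f (2 * J + 1) + f (2 * J + 2)"
      by simp
    then show ?case using Suc assms(1)[of "2 * J + 1" "2 * J + 2"] by simp
  qed simp
  finally show ?thesis by simp
qed

text \<open>Assouad's argument: the symbols are paired in decreasing order of their \<open>Q\<close>-mass, so that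
  moving a little mass within a pair keeps the total mass equal to one.\<close>

lemma worst_regret_ge_pairs:
  assumes q: "dist_on S q" and n: "n > 0" and \<pi>: "bij_betw \<pi> {..<S} {..<S}"
    and desc: "\<And>i j. i \<le> j \<Longrightarrow> j < S \<Longrightarrow> q (\<pi> j) \<le> q (\<pi> i)"
  shows "1 / 64 * (\<Sum>j<S div 2. min (q (\<pi> (2 * j + 1))) (sqrt (q (\<pi> (2 * j + 1)) / n))) \<le> worst_regret S q n th"
proof -
  define J where "J = S div 2"
  \<comment> \<open>The scale is set by the lighter member, at the odd position. The factor 1/2
    keeps all masses nonnegative and gives each of the two symbols a share of at most
    \<open>1 / (4 * n)\<close> in the divergence. For odd \<open>S\<close> the last symbol is not
    moved.\<close>
  define \<eta> where "\<eta> = (\<lambda>j. if j < J then 1 / 2 * min (q (\<pi> (2 * j + 1))) (sqrt (q (\<pi> (2 * j + 1)) / n)) else 0)"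
  define pos where "pos = inv_into {..<S} \<pi>"
  define sg where "sg = (\<lambda>e p. (if e (p div 2) then 1 else -1) * (if even p then 1 else -1) * \<eta> (p div 2))"
  define r where "r = (\<lambda>(e :: nat \<Rightarrow> bool) x. q x + sg e (pos x))"
  have pos: "pos (\<pi> p) = p" if "p < S" for p
    using \<pi> that by (simp add: pos_def bij_betw_def inv_into_f_f)
  have pi_S: "\<pi> p < S" if "p < S" for p using \<pi> that by (auto simp: bij_betw_def)
  have q0: "0 \<le> q x" if "x < S" for x using dist_on_le_1[OF q that] by simp
  have eta0: "0 \<le> \<eta> j" for j using q0 pi_S by (auto simp: \<eta>_def J_def)
  have eta_le: "\<eta> (p div 2) \<le> q (\<pi> p) / 2" if p: "p < S" for p
  proof (cases "p div 2 < J")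
    case True
    then have "2 * (p div 2) + 1 < S" "p \<le> 2 * (p div 2) + 1" by (auto simp: J_def)
    then have "q (\<pi> (2 * (p div 2) + 1)) \<le> q (\<pi> p)" by (intro desc)
    then show ?thesis using True by (simp add: \<eta>_def)
  next
    case False then show ?thesis using q0[OF pi_S[OF p]] by (simp add: \<eta>_def)
  qed
  have sg_abs: "\<bar>sg e p\<bar> = \<eta> (p div 2)" for e p using eta0 by (simp add: sg_def abs_mult)
  have sumpi: "(\<Sum>x<S. f x) = (\<Sum>p<S. f (\<pi> p))" for f :: "nat \<Rightarrow> real"
    by (rule sum.reindex_bij_betw[OF \<pi>, symmetric])
  have r_pi: "r e (\<pi> p) = q (\<pi> p) + sg e p" if "p < S" for e p using pos[OF that] by (simp add: r_def)
  have sg_sum: "(\<Sum>p<S. sg e p) = 0" for e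
  proof -
    have "(\<Sum>p<2 * K. sg e p) = 0" for K
      by (induction K) (auto simp: sg_def)
    then have 1: "(\<Sum>p<2 * J. sg e p) = 0" .
    show ?thesis
    proof (cases "even S")
      case True then show ?thesis using 1 by (auto simp: J_def)
    next
      case False
      then have "S = Suc (2 * J)" by (auto simp: J_def elim!: oddE)
      then show ?thesis using 1 by (simp add: sg_def \<eta>_def)
    qed
  qed
  have rd: "dist_on S (r e)" for e
  proof -
    have "(\<Sum>x<S. r e x) = (\<Sum>p<S. q (\<pi> p) + sg e p)"
      unfolding sumpi[of "r e"] by (intro sum.cong refl) (simp add: r_pi)
    also have "\<dots> = 1" using sumpi[of q] q sg_sum[of e] by (simp add: sum.distrib dist_on_def)
    finally have 1: "(\<Sum>x<S. r e x) = 1" .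
    have "0 \<le> r e x" if x: "x < S" for x
    proof -
      have "x \<in> \<pi> ` {..<S}" using x bij_betw_imp_surj_on[OF \<pi>] by simp
      then obtain p where p: "p < S" "x = \<pi> p" by auto
      show ?thesis using r_pi[OF p(1), of e] eta_le[OF p(1)] sg_abs[of e p] q0[OF x] p(2)
        by (simp add: abs_if split: if_splits)
    qed
    then show ?thesis using 1 by (simp add: dist_on_def)
  qed
  define w where "w = (\<lambda>(_::nat) (_::bool). 1 / 2 :: real)"
  have ww: "is_weight (UNIV :: bool set) (w i)" for i by (simp add: is_weight_def w_def UNIV_bool)
  have halves: "prod_exp UNIV w J g = prod_exp UNIV w J (\<lambda>e. 1 / 2 * g (e(j := True)) + 1 / 2 * g (e(j := False)))"
    if j: "j < J" for j g
  proof -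
    have "prod_exp UNIV w J g = (\<Sum>x\<in>UNIV. w j x * prod_exp UNIV w J (\<lambda>e. g (e(j := x))))"
      by (rule prod_exp_pull[OF ww j])
    also have "\<dots> = 1 / 2 * prod_exp UNIV w J (\<lambda>e. g (e(j := True))) + 1 / 2 * prod_exp UNIV w J (\<lambda>e. g (e(j := False)))"
      by (simp add: w_def UNIV_bool)
    finally show ?thesis by (simp only: prod_exp_add prod_exp_cmult)
  qed
  \<comment> \<open>Only the loss at the heavier member of each pair is charged; the losses
    elsewhere are nonnegative and are dropped.\<close>
  define a where "a = (\<lambda>j. \<pi> (2 * j))"
  have pair: "1 / 32 * \<eta> j \<le> prod_exp UNIV w J (\<lambda>e. 1 / 2 * expect S n (r e)
       (\<lambda>xs. if th xs (a j) then max 0 (r e (a j) - q (a j)) else max 0 (q (a j) - r e (a j))))"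
    if j: "j < J" for j
  proof -
    let ?g = "\<lambda>e. 1 / 2 * expect S n (r e)
       (\<lambda>xs. if th xs (a j) then max 0 (r e (a j) - q (a j)) else max 0 (q (a j) - r e (a j)))"
    have jS: "2 * j + 1 < S" using j by (auto simp: J_def)
    have "1 / 32 * \<eta> j \<le> 1 / 2 * ?g (e(j := True)) + 1 / 2 * ?g (e(j := False))" for e
    proof -
      let ?r1 = "r (e(j := True))" and ?r0 = "r (e(j := False))"
      have ra: "?r1 (a j) = q (a j) + \<eta> j" "?r0 (a j) = q (a j) - \<eta> j"
        unfolding a_def using jS by (simp_all add: r_pi sg_def)
      have chi: "(\<Sum>x<S. (?r1 x - ?r0 x)\<^sup>2 / (2 * (?r1 x + ?r0 x))) \<le> 1 / (2 * real n)"
      proof -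
        have other: "?r1 (\<pi> p) = ?r0 (\<pi> p)" if "p < S" "p div 2 \<noteq> j" for p
          using that by (simp add: r_pi sg_def)
        have "(\<Sum>x<S. (?r1 x - ?r0 x)\<^sup>2 / (2 * (?r1 x + ?r0 x)))
          = (\<Sum>p<S. (?r1 (\<pi> p) - ?r0 (\<pi> p))\<^sup>2 / (2 * (?r1 (\<pi> p) + ?r0 (\<pi> p))))"
          by (rule sumpi)
        also have "\<dots> = (\<Sum>p\<in>{2 * j, 2 * j + 1}. (?r1 (\<pi> p) - ?r0 (\<pi> p))\<^sup>2 / (2 * (?r1 (\<pi> p) + ?r0 (\<pi> p))))"
        proof (rule sum.mono_neutral_right)
          show "\<forall>p\<in>{..<S} - {2 * j, 2 * j + 1}. (?r1 (\<pi> p) - ?r0 (\<pi> p))\<^sup>2 / (2 * (?r1 (\<pi> p) + ?r0 (\<pi> p))) = 0"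
          proof
            fix p assume p: "p \<in> {..<S} - {2 * j, 2 * j + 1}"
            then have "p div 2 \<noteq> j" by auto
            then show "(?r1 (\<pi> p) - ?r0 (\<pi> p))\<^sup>2 / (2 * (?r1 (\<pi> p) + ?r0 (\<pi> p))) = 0"
              using other[of p] p by simp
          qed
        qed (use jS in auto)
        also have "\<dots> \<le> (\<Sum>p\<in>{2 * j, 2 * j + 1}. 1 / (4 * n))"
        proof (rule sum_mono)
          fix p assume p: "p \<in> {2 * j, 2 * j + 1}"
          then have pS: "p < S" and pj: "p div 2 = j" and ple: "p \<le> 2 * j + 1" using jS by auto
          have qq: "q (\<pi> (2 * j + 1)) \<le> q (\<pi> p)" by (rule desc[OF ple jS])
          have d: "(?r1 (\<pi> p) - ?r0 (\<pi> p))\<^sup>2 = 4 * (\<eta> j)\<^sup>2" "?r1 (\<pi> p) + ?r0 (\<pi> p) = 2 * q (\<pi> p)"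
            using pS pj by (auto simp: r_pi sg_def power2_eq_square)
          have "4 * (\<eta> j)\<^sup>2 \<le> q (\<pi> (2 * j + 1)) / n"
          proof -
            have "2 * \<eta> j \<le> sqrt (q (\<pi> (2 * j + 1)) / n)" using j by (simp add: \<eta>_def)
            then have "(2 * \<eta> j)\<^sup>2 \<le> (sqrt (q (\<pi> (2 * j + 1)) / n))\<^sup>2"
              using eta0[of j] by (intro power_mono) auto
            then show ?thesis using q0[OF pi_S[OF jS]] by simp
          qed
          then have "4 * (\<eta> j)\<^sup>2 \<le> q (\<pi> p) / n" using qq n by (meson divide_right_mono of_nat_0_le_iff order_trans)
          then show "(?r1 (\<pi> p) - ?r0 (\<pi> p))\<^sup>2 / (2 * (?r1 (\<pi> p) + ?r0 (\<pi> p))) \<le> 1 / (4 * n)"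
            unfolding d using q0[OF pi_S[OF pS]] n by (cases "q (\<pi> p) = 0") (auto simp: field_simps)
        qed
        also have "\<dots> = 1 / (2 * real n)" by simp
        finally show ?thesis .
      qed
      let ?P1 = "\<lambda>xs. prod_list (map ?r1 xs)" and ?P0 = "\<lambda>xs. prod_list (map ?r0 xs)"
      have "1 / 8 * \<eta> j \<le> (\<Sum>xs\<in>samples S n. min (?P1 xs) (?P0 xs)) * \<eta> j"
        using likelihood_overlap_ge[OF rd rd n chi] eta0 by (intro mult_right_mono)
      also have "\<dots> \<le> (\<Sum>xs\<in>samples S n. ?P1 xs * (if th xs (a j) then \<eta> j else 0) + ?P0 xs * (if th xs (a j) then 0 else \<eta> j))"
        unfolding sum_distrib_right using eta0 by (intro sum_mono) (auto intro: mult_right_mono)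
      also have "\<dots> = 2 * ?g (e(j := True)) + 2 * ?g (e(j := False))"
      proof -
        have mx: "max 0 (q (a j) + \<eta> j - q (a j)) = \<eta> j" "max 0 (q (a j) - (q (a j) + \<eta> j)) = 0"
          "max 0 (q (a j) - \<eta> j - q (a j)) = 0" "max 0 (q (a j) - (q (a j) - \<eta> j)) = \<eta> j"
          using eta0[of j] by auto
        show ?thesis unfolding ra mx expect_def sum.distrib by simp
      qed
      finally show ?thesis by simp
    qed
    then have "prod_exp UNIV w J (\<lambda>_. 1 / 32 * \<eta> j)
       \<le> prod_exp UNIV w J (\<lambda>e. 1 / 2 * ?g (e(j := True)) + 1 / 2 * ?g (e(j := False)))"
      by (intro prod_exp_mono ww) auto
    also have "\<dots> = prod_exp UNIV w J ?g"
      by (rule halves[OF j, symmetric])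
    finally show ?thesis by (simp add: prod_exp_const ww)
  qed
  have "1 / 64 * (\<Sum>j<J. min (q (\<pi> (2 * j + 1))) (sqrt (q (\<pi> (2 * j + 1)) / n))) = (\<Sum>j<J. 1 / 32 * \<eta> j)"
    unfolding sum_distrib_left by (intro sum.cong refl) (simp add: \<eta>_def)
  also have "\<dots> \<le> (\<Sum>j<J. prod_exp UNIV w J (\<lambda>e. 1 / 2 * expect S n (r e)
       (\<lambda>xs. if th xs (a j) then max 0 (r e (a j) - q (a j)) else max 0 (q (a j) - r e (a j)))))"
    by (intro sum_mono pair) simp
  also have "\<dots> = prod_exp UNIV w J (\<lambda>e. \<Sum>j<J. 1 / 2 * expect S n (r e)
       (\<lambda>xs. if th xs (a j) then max 0 (r e (a j) - q (a j)) else max 0 (q (a j) - r e (a j))))"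
    by (rule prod_exp_sum[symmetric])
  also have "\<dots> \<le> prod_exp UNIV w J (\<lambda>_. worst_regret S q n th)"
  proof (intro prod_exp_mono ww)
    fix e
    let ?h = "\<lambda>x. expect S n (r e) (\<lambda>xs. if th xs x then max 0 (r e x - q x) else max 0 (q x - r e x))"
    have inj: "inj_on a {..<J}"
    proof (rule inj_onI)
      fix i j assume ij: "i \<in> {..<J}" "j \<in> {..<J}" "a i = a j"
      then have "2 * i < S" "2 * j < S" by (auto simp: J_def)
      then have "pos (a i) = 2 * i" "pos (a j) = 2 * j" unfolding a_def by (auto intro: pos)
      then have "2 * i = 2 * j" using ij(3) by metis
      then show "i = j" by simp
    qed
    have "(\<Sum>j<J. ?h (a j)) = (\<Sum>x\<in>a ` {..<J}. ?h x)" by (subst sum.reindex[OF inj]) (simp only: comp_def)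
    also have "\<dots> \<le> (\<Sum>x<S. ?h x)"
    proof (intro sum_mono2)
      show "a ` {..<J} \<subseteq> {..<S}" by (auto simp: a_def J_def intro!: pi_S)
      show "0 \<le> ?h x" for x by (intro expect_nonneg[OF rd]) simp
    qed simp
    finally have "(\<Sum>j<J. 1 / 2 * ?h (a j)) \<le> regret S q n th (r e)"
      unfolding regret_eq[OF q rd] sum_distrib_left[symmetric] by simp
    then show "(\<Sum>j<J. 1 / 2 * ?h (a j)) \<le> worst_regret S q n th"
      using regret_le_worst[OF q rd, of n th e] by linarith
  qed simp
  also have "\<dots> = worst_regret S q n th" by (intro prod_exp_const ww) simp
  finally show ?thesis by (simp add: J_def)
qed

text \<open>The symbol lost by the pairing is \<open>\<pi> 0\<close>, the heaviest one. The same
  omission is convenient for the plug-in bound, since all other masses are then at most 1/2, and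
  \<open>regime_rest_ge\<close> shows that it costs only a constant.\<close>

lemma R_ACH_ge:
  assumes q: "dist_on S q" and n: "n > 0"
  obtains k where "k < S" "\<And>i. i < S \<Longrightarrow> q i \<le> q k"
    "1 / 128 * (\<Sum>i\<in>{..<S} - {k}. min (q i) (sqrt (q i / n))) \<le> R_ACH S q n"
proof -
  obtain \<pi> where \<pi>: "bij_betw \<pi> {..<S} {..<S}" and desc: "\<And>i j. i \<le> j \<Longrightarrow> j < S \<Longrightarrow> q (\<pi> j) \<le> q (\<pi> i)"
    using descending_enumeration[where q=q and S=S] by blast
  have S: "S > 0" using q by (cases S) (auto simp: dist_on_def)
  let ?d = "\<lambda>x. min (q x) (sqrt (q x / n))"
  define f where "f = (\<lambda>p. if p < S then ?d (\<pi> p) else 0)"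
  have q0: "0 \<le> q x" if "x < S" for x using dist_on_le_1[OF q that] by simp
  have pi_S: "\<pi> p < S" if "p < S" for p using \<pi> that by (auto simp: bij_betw_def)
  have f: "f j \<le> f i" "0 \<le> f i" if "i \<le> j" for i j
  proof -
    show "0 \<le> f i" using q0 pi_S by (simp add: f_def)
    show "f j \<le> f i"
    proof (cases "j < S")
      case True
      then have "q (\<pi> j) \<le> q (\<pi> i)" using desc that by simp
      then show ?thesis using True that
        unfolding f_def by (auto intro!: min.mono real_sqrt_le_mono divide_right_mono simp del: min.bounded_iff)
    next
      case False then show ?thesis using q0 pi_S by (simp add: f_def)
    qed
  qed
  have "\<pi> ` {..<S} = {..<S}" and inj: "inj_on \<pi> {..<S}" using \<pi> by (auto simp: bij_betw_def)
  moreover have "{1..<S} = {..<S} - {0}" by auto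
  ultimately have im: "\<pi> ` {1..<S} = {..<S} - {\<pi> 0}" using S by (simp add: inj_on_image_set_diff[of _ "{..<S}"])
  have "(\<Sum>i\<in>{..<S} - {\<pi> 0}. ?d i) = (\<Sum>p\<in>{1..<S}. ?d (\<pi> p))"
    unfolding im[symmetric] using inj by (subst sum.reindex) (auto intro: inj_on_subset)
  also have "\<dots> = (\<Sum>p\<in>{1..<S}. f p)" by (intro sum.cong) (auto simp: f_def)
  also have "\<dots> \<le> 2 * (\<Sum>j<S div 2. f (2 * j + 1))" using f by (intro antimono_sum_le_odd_sum) auto
  also have "(\<Sum>j<S div 2. f (2 * j + 1)) = (\<Sum>j<S div 2. ?d (\<pi> (2 * j + 1)))"
    by (intro sum.cong refl) (auto simp: f_def)
  finally have le: "1 / 128 * (\<Sum>i\<in>{..<S} - {\<pi> 0}. ?d i) \<le> 1 / 64 * (\<Sum>j<S div 2. ?d (\<pi> (2 * j + 1)))" by simp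
  show thesis
  proof (rule that)
    show "\<pi> 0 < S" using pi_S S by simp
    show "q i \<le> q (\<pi> 0)" if i: "i < S" for i
    proof -
      have "i \<in> \<pi> ` {..<S}" using i bij_betw_imp_surj_on[OF \<pi>] by simp
      then obtain p where "p < S" "i = \<pi> p" by auto
      then show ?thesis using desc[of 0 p] by simp
    qed
    show "1 / 128 * (\<Sum>i\<in>{..<S} - {\<pi> 0}. ?d i) \<le> R_ACH S q n"
      unfolding R_ACH_def
    proof (rule cINF_greatest)
      fix th
      show "1 / 128 * (\<Sum>i\<in>{..<S} - {\<pi> 0}. ?d i) \<le> worst_regret S q n th"
        using le worst_regret_ge_pairs[OF q n \<pi> desc, of th] by linarith
    qed simp
  qed
qed

section \<open>Consequences of the regime\<close>

lemma regimeD: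
  assumes "regime c1 c2 S q n"
  shows "2 \<le> n" "dist_on S q" "ln (real S) \<le> c1 * ln (real n)"
    "ln (real n) \<le> c2 * ln (\<Sum>i<S. min (sqrt (q i)) (q i * sqrt (real n * ln (real n))))"
  using assms by (auto simp: regime_def)

lemma regime_sum_ge:
  assumes r: "regime c1 c2 S q n" and c2: "c2 > 0"
  shows "real n powr (1 / c2) \<le> (\<Sum>i<S. min (sqrt (q i)) (q i * sqrt (real n * ln (real n))))"
proof -
  let ?A = "(\<Sum>i<S. min (sqrt (q i)) (q i * sqrt (real n * ln (real n))))"
  note R = regimeD[OF r]
  have n: "1 < real n" using R(1) by simp
  have "0 < ln (real n)" using n by simp
  then have "0 < c2 * ln ?A" using R(4) by linarith
  then have lnA: "0 < ln ?A" using c2 by (simp add: zero_less_mult_iff)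
  have "0 \<le> ?A"
  proof (intro sum_nonneg)
    fix i assume "i \<in> {..<S}"
    then have "0 \<le> q i" using dist_on_le_1[OF R(2)] by auto
    then show "0 \<le> min (sqrt (q i)) (q i * sqrt (real n * ln (real n)))" using n by simp
  qed
  \<comment> \<open>Here \<open>ln 0 = 0\<close>, so a positive logarithm excludes the value
    0.\<close>
  moreover have "?A \<noteq> 0" using lnA by auto
  ultimately have A0: "0 < ?A" by simp
  have "ln (real n powr (1 / c2)) = ln (real n) / c2" using n by (simp add: ln_powr)
  also have "\<dots> \<le> ln ?A" using R(4) c2 by (simp add: field_simps)
  finally show ?thesis using A0 n by (subst (asm) ln_le_cancel_iff) auto
qed

lemma rate_est_eq:
  assumes "2 \<le> n"
  shows "rate_est S q n = (\<Sum>i<S. min (sqrt (q i)) (q i * sqrt (real n * ln (real n)))) / sqrt (real n * ln (real n))"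
proof -
  have N: "0 < real n * ln (real n)" using assms by simp
  then have N': "0 < sqrt (real n * ln (real n))" by simp
  have md: "min x y / z = min (x / z) (y / z)" if "0 < z" for x y z :: real
    using that by (auto simp: min_def divide_right_mono dest: divide_right_mono[of _ _ z] divide_le_cancel[THEN iffD1])
  show ?thesis
    unfolding rate_est_def sum_divide_distrib md[OF N']
  proof (intro sum.cong refl)
    fix i
    have "q i * sqrt (real n * ln (real n)) / sqrt (real n * ln (real n)) = q i" using N' by (metis less_irrefl nonzero_mult_div_cancel_right)
    then show "min (q i) (sqrt (q i / (real n * ln (real n))))
      = min (sqrt (q i) / sqrt (real n * ln (real n))) (q i * sqrt (real n * ln (real n)) / sqrt (real n * ln (real n)))"
      by (simp only: real_sqrt_divide min.commute)
  qed
qed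

text \<open>The form in which the second regime condition is used: the regime sum is
  \<open>rate_est\<close> rescaled by \<open>sqrt (n * ln n)\<close>, so the rate exceeds the
  inverse of that scale by a fixed power of \<open>n\<close>.\<close>

lemma rate_est_ge:
  assumes "regime c1 c2 S q n" "c2 > 0"
  shows "real n powr (1 / c2) / sqrt (real n * ln (real n)) \<le> rate_est S q n"
  unfolding rate_est_eq[OF regimeD(1)[OF assms(1)]]
  using regime_sum_ge[OF assms] regimeD(1)[OF assms(1)] by (intro divide_right_mono) auto

lemma rate_est_pos:
  assumes "regime c1 c2 S q n" "c2 > 0"
  shows "0 < rate_est S q n"
proof -
  have "0 < real n powr (1 / c2) / sqrt (real n * ln (real n))"
    using regimeD(1)[OF assms(1)] by (intro divide_pos_pos) auto
  then show ?thesis using rate_est_ge[OF assms] by linarith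
qed

lemma rate_est_le_1:
  assumes "dist_on S q"
  shows "rate_est S q n \<le> 1"
proof -
  have "rate_est S q n \<le> (\<Sum>i<S. q i)" unfolding rate_est_def by (intro sum_mono) simp
  then show ?thesis using assms by (simp add: dist_on_def)
qed

lemma rate_est_le_rate_ach:
  assumes "dist_on S q" "1 \<le> ln (real n)"
  shows "rate_est S q n \<le> rate_ach S q n"
  unfolding rate_est_def rate_ach_def
proof (intro sum_mono min.mono order_refl real_sqrt_le_mono)
  fix i assume "i \<in> {..<S}"
  then have "0 \<le> q i" using dist_on_le_1[OF assms(1)] by auto
  moreover have "0 < real n" using assms(2) by (cases n) auto
  moreover from this have "real n * 1 \<le> real n * ln (real n)" using assms(2) by (intro mult_left_mono) auto
  ultimately show "q i / (real n * ln (real n)) \<le> q i / real n"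
    using frac_le[of "q i" "q i" "real n" "real n * ln (real n)"] by simp
qed

lemma regime_card:
  assumes "regime c1 c2 S q n"
  shows "1 \<le> S" "real S \<le> real n powr c1"
proof -
  note R = regimeD[OF assms]
  show S: "1 \<le> S" using R(2) by (cases S) (auto simp: dist_on_def)
  have "ln (real S) \<le> ln (real n powr c1)" using R(1,3) by (simp add: ln_powr)
  then show "real S \<le> real n powr c1" using S R(1) by (subst (asm) ln_le_cancel_iff) auto
qed

lemma sum_sqrt_le_one_plus:
  assumes "dist_on S q" "k < S"
  shows "(\<Sum>i<S. sqrt (q i)) \<le> 1 + sqrt (real S * (1 - q k))"
proof -
  have q0: "0 \<le> q i" if "i < S" for i using dist_on_le_1[OF assms(1) that] by simp
  have "(\<Sum>i\<in>{..<S} - {k}. 1 * sqrt (q i))\<^sup>2 \<le> (\<Sum>i\<in>{..<S} - {k}. 1\<^sup>2) * (\<Sum>i\<in>{..<S} - {k}. (sqrt (q i))\<^sup>2)"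
    by (rule Cauchy_Schwarz_ineq_sum)
  also have "(\<Sum>i\<in>{..<S} - {k}. (sqrt (q i))\<^sup>2) = (\<Sum>i\<in>{..<S} - {k}. q i)"
    using q0 by (intro sum.cong) auto
  also have "\<dots> = 1 - q k" using assms by (simp add: sum_diff1 dist_on_def)
  also have "(\<Sum>i\<in>{..<S} - {k}. 1\<^sup>2) * (1 - q k) \<le> real S * (1 - q k)"
    using dist_on_le_1[OF assms] assms(2) by (intro mult_right_mono) auto
  finally have "(\<Sum>i\<in>{..<S} - {k}. sqrt (q i)) \<le> sqrt (real S * (1 - q k))"
    by (intro real_le_rsqrt) simp
  moreover have "sqrt (q k) \<le> 1" using dist_on_le_1[OF assms] by simp
  moreover have "(\<Sum>i<S. sqrt (q i)) = sqrt (q k) + (\<Sum>i\<in>{..<S} - {k}. sqrt (q i))"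
    using assms(2) by (simp add: sum.remove[of "{..<S}" k])
  ultimately show ?thesis by linarith
qed

text \<open>No single symbol carries almost all of the rate. For large \<open>n\<close> one term is
  at most \<open>1 / sqrt n\<close>, whereas the total is at least \<open>2 / sqrt n\<close>. For
  bounded \<open>n\<close> also \<open>S\<close> is bounded, and a regime sum bounded away from 1
  keeps \<open>q k\<close> away from 1.\<close>

lemma regime_rest_ge:
  assumes c: "c1 > 0" "c2 > 0"
  shows "\<exists>c>0. \<forall>S q n k. regime c1 c2 S q n \<longrightarrow> k < S \<longrightarrow>
     c * rate_ach S q n \<le> (\<Sum>i\<in>{..<S} - {k}. min (q i) (sqrt (q i / n)))"
proof -
  have "eventually (\<lambda>n::nat. 1 \<le> ln (real n) \<and> 2 * sqrt (ln (real n)) \<le> real n powr (1 / c2)) at_top"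
    using c by (intro eventually_conj; real_asymp)
  then obtain n0 where n0: "\<And>n. n \<ge> n0 \<Longrightarrow> 1 \<le> ln (real n) \<and> 2 * sqrt (ln (real n)) \<le> real n powr (1 / c2)"
    by (auto simp: eventually_at_top_linorder)
  \<comment> \<open>Obtained by solving
    \<open>2 powr (1 / c2) \<le> 1 + sqrt (S * (1 - q k))\<close> for \<open>1 - q k\<close>, with
    \<open>S\<close> bounded through \<open>n < n0\<close>.\<close>
  define \<kappa> where "\<kappa> = ((2::real) powr (1 / c2) - 1)\<^sup>2 / real (max 1 n0) powr c1"
  have pow: "1 < (2::real) powr (1 / c2)" using c by simp
  have k0: "0 < \<kappa>" unfolding \<kappa>_def using pow by (intro divide_pos_pos) auto
  define c where "c = min (1 / 2) (\<kappa> / (1 + \<kappa>))"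
  have "c * rate_ach S q n \<le> (\<Sum>i\<in>{..<S} - {k}. min (q i) (sqrt (q i / n)))"
    if reg: "regime c1 c2 S q n" and k: "k < S" for S q n k
  proof -
    note R = regimeD[OF reg]
    let ?d = "\<lambda>i. min (q i) (sqrt (q i / n))"
    define Re where "Re = (\<Sum>i\<in>{..<S} - {k}. ?d i)"
    have n: "0 < n" using R(1) by simp
    have split: "rate_ach S q n = ?d k + Re"
      unfolding rate_ach_def Re_def using k by (simp add: sum.remove[of "{..<S}" k])
    have ra0: "0 \<le> rate_ach S q n"
      using rate_ach_ge[OF R(2) n] by (meson divide_nonneg_nonneg of_nat_0_le_iff order_trans real_sqrt_ge_zero zero_le_one)
    have dk: "?d k \<le> 1 / sqrt n"
    proof -
      have "?d k \<le> sqrt (q k / n)" by simp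
      also have "\<dots> \<le> sqrt (1 / n)" using dist_on_le_1[OF R(2) k]
        by (intro real_sqrt_le_mono divide_right_mono) auto
      finally show ?thesis by (simp add: real_sqrt_divide)
    qed
    show ?thesis
    proof (cases "n \<ge> n0")
      case True
      note n0[OF True]
      then have ln1: "1 \<le> ln (real n)" and pw: "2 * sqrt (ln (real n)) \<le> real n powr (1 / c2)" by auto
      have "2 / sqrt n = 2 * sqrt (ln (real n)) / sqrt (real n * ln (real n))"
        using ln1 by (simp add: real_sqrt_mult)
      also have "\<dots> \<le> real n powr (1 / c2) / sqrt (real n * ln (real n))"
        using pw ln1 by (intro divide_right_mono) auto
      also have "\<dots> \<le> rate_est S q n" by (rule rate_est_ge[OF reg assms(2)])
      also have "\<dots> \<le> rate_ach S q n" by (rule rate_est_le_rate_ach[OF R(2) ln1])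
      finally have "1 / 2 * rate_ach S q n \<le> Re" using dk split by simp
      moreover have "c * rate_ach S q n \<le> 1 / 2 * rate_ach S q n"
        unfolding c_def using ra0 by (intro mult_right_mono min.cobounded1)
      ultimately show ?thesis by (simp add: Re_def)
    next
      case False
      have Sb: "real S \<le> real (max 1 n0) powr c1"
        using regime_card(2)[OF reg] False powr_mono2[of c1 "real n" "real (max 1 n0)"] assms by simp
      have "(2::real) powr (1 / c2) \<le> real n powr (1 / c2)" using R(1) assms by (intro powr_mono2) auto
      also have "\<dots> \<le> (\<Sum>i<S. min (sqrt (q i)) (q i * sqrt (real n * ln (real n))))"
        by (rule regime_sum_ge[OF reg assms(2)])
      also have "\<dots> \<le> (\<Sum>i<S. sqrt (q i))" by (intro sum_mono) simp
      also have "\<dots> \<le> 1 + sqrt (real S * (1 - q k))" by (rule sum_sqrt_le_one_plus[OF R(2) k])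
      finally have "((2::real) powr (1 / c2) - 1)\<^sup>2 \<le> (sqrt (real S * (1 - q k)))\<^sup>2"
        using pow by (intro power_mono) auto
      also have "\<dots> = real S * (1 - q k)" using dist_on_le_1[OF R(2) k] by simp
      also have "\<dots> \<le> real (max 1 n0) powr c1 * (1 - q k)"
        using Sb dist_on_le_1[OF R(2) k] by (intro mult_right_mono) auto
      finally have kq: "\<kappa> \<le> 1 - q k" by (simp add: \<kappa>_def divide_le_eq mult.commute)
      have "\<kappa> * (1 / sqrt n) \<le> (1 - q k) / sqrt n" using kq divide_right_mono[OF kq, of "sqrt n"] by simp
      also have "\<dots> = (\<Sum>i\<in>{..<S} - {k}. q i / sqrt n)"
        using R(2) k by (simp add: sum_divide_distrib[symmetric] sum_diff1 dist_on_def)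
      also have "\<dots> \<le> Re"
        unfolding Re_def
      proof (rule sum_mono)
        fix i assume "i \<in> {..<S} - {k}"
        then have q: "0 \<le> q i" "q i \<le> 1" using dist_on_le_1[OF R(2)] by auto
        then have "(q i)\<^sup>2 \<le> q i" by (simp add: power2_eq_square mult_left_le)
        then have "q i \<le> sqrt (q i)" by (rule real_le_rsqrt)
        then have "q i / sqrt n \<le> sqrt (q i / n)" by (simp add: real_sqrt_divide divide_right_mono)
        moreover have "q i / sqrt n \<le> q i / 1" using q n by (intro divide_left_mono) auto
        ultimately show "q i / sqrt n \<le> ?d i" by simp
      qed
      finally have re: "\<kappa> * (1 / sqrt n) \<le> Re" .
      have "\<kappa> * rate_ach S q n \<le> (1 + \<kappa>) * Re"
        using split mult_left_mono[OF dk, of \<kappa>] k0 re by (simp add: algebra_simps)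
      then have "\<kappa> / (1 + \<kappa>) * rate_ach S q n \<le> Re" using k0 by (simp add: field_simps)
      moreover have "c * rate_ach S q n \<le> \<kappa> / (1 + \<kappa>) * rate_ach S q n"
        unfolding c_def using ra0 by (intro mult_right_mono min.cobounded2)
      ultimately show ?thesis by (simp add: Re_def)
    qed
  qed
  moreover have "0 < c" using k0 by (simp add: c_def)
  ultimately show ?thesis by blast
qed

lemma R_ACH_R_PLU_lower:
  assumes "c1 > 0" "c2 > 0"
  shows "\<exists>C>0. \<forall>S q n. regime c1 c2 S q n \<longrightarrow> rate_ach S q n \<le> C * R_ACH S q n \<and> rate_ach S q n \<le> C * R_PLU S q n"
proof -
  obtain c where c: "c > 0" "\<And>S q n k. regime c1 c2 S q n \<Longrightarrow> k < S \<Longrightarrow>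
     c * rate_ach S q n \<le> (\<Sum>i\<in>{..<S} - {k}. min (q i) (sqrt (q i / n)))"
    using regime_rest_ge[OF assms] by blast
  have "rate_ach S q n \<le> 128 / c * R_ACH S q n \<and> rate_ach S q n \<le> 128 / c * R_PLU S q n"
    if reg: "regime c1 c2 S q n" for S q n
  proof -
    note R = regimeD[OF reg]
    have n: "0 < n" using R(1) by simp
    obtain k where k: "k < S" "\<And>i. i < S \<Longrightarrow> q i \<le> q k"
      and ach: "1 / 128 * (\<Sum>i\<in>{..<S} - {k}. min (q i) (sqrt (q i / n))) \<le> R_ACH S q n"
      using R_ACH_ge[OF R(2) n] by blast
    let ?Re = "\<Sum>i\<in>{..<S} - {k}. min (q i) (sqrt (q i / n))"
    note re = c(2)[OF reg k(1)]
    have half: "q i \<le> 1 / 2" if i: "i < S" "i \<noteq> k" for i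
    proof -
      have "q i + q k = sum q {i, k}" using i by simp
      also have "\<dots> \<le> sum q {..<S}" using i k(1) dist_on_le_1[OF R(2)] by (intro sum_mono2) auto
      also have "\<dots> = 1" using R(2) by (simp add: dist_on_def)
      finally show ?thesis using k(2)[OF i(1)] by simp
    qed
    have "0 \<le> ?Re" using dist_on_le_1[OF R(2)] by (intro sum_nonneg) auto
    moreover have "1 / 20 * ?Re \<le> R_PLU S q n" using R_PLU_ge[OF R(2,1) half] by simp
    ultimately have "1 / 128 * ?Re \<le> R_PLU S q n" by simp
    then have "c * rate_ach S q n \<le> 128 * R_PLU S q n" "c * rate_ach S q n \<le> 128 * R_ACH S q n"
      using re ach by simp_all
    then show ?thesis using c(1) by (simp add: field_simps)
  qed
  then show ?thesis using c(1) by (intro exI[of _ "128 / c"]) auto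
qed

section \<open>Trigonometric kernels on equispaced nodes\<close>

text \<open>Jordan's inequality: a concave function lies above its chord.\<close>

lemma sin_ge_chord:
  assumes "0 \<le> x" "x \<le> pi / 2"
  shows "2 / pi * x \<le> sin x"
proof -
  have "concave_on {0..pi / 2} sin"
    unfolding concave_on_def
    by (rule f''_ge0_imp_convex[where f'="\<lambda>x. - cos x" and f''="sin"])
       (auto intro!: derivative_eq_intros sin_ge_zero)
  then have "(1 - 2 * x / pi) * sin 0 + (2 * x / pi) * sin (pi / 2) \<le> sin ((1 - 2 * x / pi) *\<^sub>R 0 + (2 * x / pi) *\<^sub>R (pi / 2))"
    using assms by (intro concave_onD) (auto simp: field_simps)
  then show ?thesis by simp
qed

text \<open>Multiplication by \<open>2 * sin (y / 2)\<close> makes the sum telescope over a full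
  period. The factor is nonzero because \<open>g\<close> is not a multiple of
  \<open>2 * N\<close>.\<close>

lemma node_sum_cos:
  fixes g :: int
  assumes "g \<noteq> 0" "\<bar>g\<bar> < 2 * int N"
  shows "(\<Sum>j<2 * N. cos (of_int g * (real j * (pi / N)) + c)) = 0"
proof -
  have N: "0 < N" using assms by (cases N) auto
  define y where "y = of_int g * (pi / N)"
  define t where "t = (\<lambda>j::nat. sin ((real j - 1 / 2) * y + c))"
  have step: "2 * sin (y / 2) * cos (real j * y + c) = t (Suc j) - t j" for j
  proof -
    have d: "((real (Suc j) - 1 / 2) * y + c - ((real j - 1 / 2) * y + c)) / 2 = y / 2"
      "((real (Suc j) - 1 / 2) * y + c + ((real j - 1 / 2) * y + c)) / 2 = real j * y + c"
      by (simp_all add: algebra_simps)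
    show ?thesis unfolding t_def sin_diff_sin d ..
  qed
  have "2 * sin (y / 2) * (\<Sum>j<2 * N. cos (real j * y + c)) = t (2 * N) - t 0"
    unfolding sum_distrib_left step by (rule sum_lessThan_telescope)
  also have "t (2 * N) = t 0"
  proof -
    have "(real (2 * N) - 1 / 2) * y + c = (- (1 / 2) * y + c) + 2 * pi * of_int g"
      using N by (simp add: y_def field_simps)
    then have "t (2 * N) = sin ((- (1 / 2) * y + c) + 2 * pi * of_int g)" unfolding t_def by (rule arg_cong)
    also have "\<dots> = sin (- (1 / 2) * y + c)"
      by (simp only: sin_add[of "- (1 / 2) * y + c"] cos_int_2pin sin_int_2pin)
    finally show ?thesis by (simp add: t_def)
  qed
  finally have "2 * sin (y / 2) * (\<Sum>j<2 * N. cos (real j * y + c)) = 0" by simp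
  moreover have "sin (y / 2) \<noteq> 0"
  proof
    assume "sin (y / 2) = 0"
    then obtain i :: int where "y / 2 = of_int i * pi" unfolding sin_zero_iff_int2 by auto
    then have "of_int g = (of_int (2 * int N * i) :: real)" using N by (simp add: y_def field_simps)
    then have "g = 2 * int N * i" by (simp only: of_int_eq_iff)
    then have "\<bar>g\<bar> = 2 * int N * \<bar>i\<bar>" by (simp add: abs_mult)
    moreover have "i \<noteq> 0" using \<open>g = _\<close> assms by auto
    ultimately have "2 * int N * 1 \<le> \<bar>g\<bar>" by (simp only:) (intro mult_left_mono; simp)
    then show False using assms by simp
  qed
  ultimately have "(\<Sum>j<2 * N. cos (real j * y + c)) = 0" by simp
  then show ?thesis by (simp add: y_def mult_ac)
qed

lemma node_sum_cos_shift_invariant: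
  fixes g :: int
  assumes "\<bar>g\<bar> < 2 * int N"
  shows "(\<Sum>j<2 * N. cos (of_int g * (real j * (pi / N) + c))) = (if g = 0 then 2 * real N else 0)"
  using node_sum_cos[of g N "of_int g * c"] assms by (simp add: distrib_left)

lemma node_sum_sin:
  fixes g :: int
  assumes "\<bar>g\<bar> < 2 * int N"
  shows "(\<Sum>j<2 * N. sin (of_int g * (real j * (pi / N) + c))) = 0"
proof (cases "g = 0")
  case False
  have "sin (of_int g * (real j * (pi / N) + c)) = cos (of_int g * (real j * (pi / N)) + (of_int g * c - pi / 2))" for j
    by (simp add: sin_cos_eq algebra_simps flip: cos_minus[of "_ - pi / 2"])
  then show ?thesis using node_sum_cos[OF False assms] by simp
qed simp

text \<open>On the nodes the sign \<open>(-1) ^ j\<close> is the frequency \<open>N\<close>, so it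
  merely shifts \<open>g\<close> to \<open>g + N\<close>.\<close>

lemma node_sum_alternating_cos:
  fixes g :: int
  assumes "\<bar>g\<bar> < int N"
  shows "(\<Sum>j<2 * N. (-1) ^ j * cos (of_int g * (real j * (pi / N)) + c)) = 0"
proof -
  have N: "0 < N" using assms by (cases N) auto
  have "(-1) ^ j * cos (of_int g * (real j * (pi / N)) + c) = cos (of_int (g + int N) * (real j * (pi / N)) + c)" for j
  proof -
    have e: "of_int (g + int N) * (real j * (pi / N)) + c = (of_int g * (real j * (pi / N)) + c) + real j * pi"
      using N by (simp add: field_simps)
    have c: "cos (X + real j * pi) = (-1) ^ j * cos X" for X by (simp add: cos_add mult.commute)
    show ?thesis unfolding e c ..
  qed
  then show ?thesis using node_sum_cos[of "g + int N" N c] assms by simp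
qed

text \<open>Over half a period the odd frequencies survive. Multiplication by
  \<open>2 * cos (y / 2)\<close> makes the alternating sum telescope, which produces the tangent.
  This surviving term is the source of the gap in \<open>jackson_gap\<close>.\<close>

lemma node_sum_alternating_sin_half:
  fixes l :: int
  assumes l: "\<bar>l\<bar> < int N" and N: "even N"
  shows "(\<Sum>j<N. (-1) ^ j * sin (of_int l * (real j * (pi / N)))) = (if odd l then - tan (of_int l * pi / (2 * N)) else 0)"
proof -
  have N0: "0 < N" using assms by (cases N) auto
  define y where "y = of_int l * (pi / N)"
  define t where "t = (\<lambda>j::nat. (-1) ^ j * sin ((real j - 1 / 2) * y))"
  have step: "2 * cos (y / 2) * ((-1) ^ j * sin (real j * y)) = t j - t (Suc j)" for j
  proof -
    have "sin ((real j - 1 / 2) * y) + sin ((real (Suc j) - 1 / 2) * y) = 2 * sin (real j * y) * cos (y / 2)"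
      unfolding sin_plus_sin by (simp add: field_simps)
    moreover have "t j - t (Suc j) = (-1) ^ j * (sin ((real j - 1 / 2) * y) + sin ((real (Suc j) - 1 / 2) * y))"
      by (simp add: t_def distrib_left)
    ultimately show ?thesis by simp
  qed
  have cp: "0 < cos (y / 2)"
  proof (rule cos_gt_zero_pi)
    have "\<bar>of_int l * pi\<bar> < real N * pi"
      using l by (simp add: abs_mult flip: of_int_abs)
    then have "\<bar>y\<bar> < pi" using N0 by (simp add: y_def abs_mult field_simps)
    then show "- (pi / 2) < y / 2" "y / 2 < pi / 2" by auto
  qed
  have "2 * cos (y / 2) * (\<Sum>j<N. (-1) ^ j * sin (real j * y)) = (\<Sum>j<N. t j - t (Suc j))"
    unfolding sum_distrib_left step ..
  also have "\<dots> = t 0 - t N" by (rule sum_lessThan_telescope')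
  also have "t 0 = - sin (y / 2)" by (simp add: t_def)
  also have "t N = (if odd l then sin (y / 2) else - sin (y / 2))"
  proof -
    have "(real N - 1 / 2) * y = of_int l * pi - y / 2" using N0 by (simp add: y_def field_simps)
    then have "t N = sin (of_int l * pi - y / 2)" using N by (simp add: t_def)
    also have "\<dots> = - (cos (of_int l * pi) * sin (y / 2))"
      by (simp add: sin_diff sin_int_times_real sin_zero_iff_int2 mult.commute)
    also have "\<dots> = (if odd l then sin (y / 2) else - sin (y / 2))"
    proof (cases "odd l")
      case True
      then obtain b where "l = 2 * b + 1" by (auto elim: oddE)
      then have "of_int l * pi = (2 * pi) * of_int b + pi" by (simp add: algebra_simps)
      then have "cos (of_int l * pi) = -1" by (simp only: cos_add cos_int_2pin sin_int_2pin) simp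
      then show ?thesis using True by simp
    next
      case False
      then obtain b where "l = 2 * b" by (auto elim: evenE)
      then have "of_int l * pi = (2 * pi) * of_int b" by simp
      then have "cos (of_int l * pi) = 1" by (simp only: cos_int_2pin)
      then show ?thesis using False by simp
    qed
    finally show ?thesis .
  qed
  finally have "cos (y / 2) * (\<Sum>j<N. (-1) ^ j * sin (real j * y)) = (if odd l then - sin (y / 2) else 0)" by auto
  then have "(\<Sum>j<N. (-1) ^ j * sin (real j * y)) = (if odd l then - tan (y / 2) else 0)"
    using cp by (auto simp: tan_def field_simps split: if_splits)
  then show ?thesis by (simp add: y_def mult_ac)
qed

text \<open>The Fejer kernel without normalisation, the squared modulus of the sum of
  \<open>exp (i * k * x)\<close> over \<open>k < M\<close>. The double sum shows its frequencies,
  all below \<open>M\<close> in absolute value, as the node sums require.\<close>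

definition fejer :: "nat \<Rightarrow> real \<Rightarrow> real" where
  "fejer M x = (\<Sum>k<M. \<Sum>l<M. cos (of_int (int k - int l) * x))"

lemma fejer_eq_squares: "fejer M x = (\<Sum>k<M. cos (real k * x))\<^sup>2 + (\<Sum>k<M. sin (real k * x))\<^sup>2"
proof -
  have "fejer M x = (\<Sum>k<M. \<Sum>l<M. cos (real k * x) * cos (real l * x) + sin (real k * x) * sin (real l * x))"
    unfolding fejer_def by (intro sum.cong refl) (simp add: left_diff_distrib cos_diff)
  then show ?thesis by (simp add: sum.distrib power2_eq_square sum_product)
qed

lemma fejer_nonneg: "0 \<le> fejer M x"
  unfolding fejer_eq_squares by simp

lemma fejer_le: "fejer M x \<le> real M ^ 2"
proof -
  have "fejer M x \<le> (\<Sum>k<M. \<Sum>l<M. 1)" unfolding fejer_def by (intro sum_mono) simp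
  then show ?thesis by (simp add: power2_eq_square)
qed

lemma fejer_0: "fejer M 0 = real M ^ 2"
  by (simp add: fejer_def power2_eq_square)

lemma fejer_periodic: "fejer M (2 * pi - x) = fejer M x"
proof -
  have "cos (of_int i * (2 * pi - x)) = cos (of_int i * x)" for i :: int
  proof -
    have "of_int i * (2 * pi - x) = (2 * pi) * of_int i - of_int i * x" by (simp add: algebra_simps)
    then show ?thesis by (simp only: cos_diff cos_int_2pin sin_int_2pin mult_1 mult_zero_left add_0_right)
  qed
  then show ?thesis unfolding fejer_def by (intro sum.cong refl)
qed

text \<open>The usual closed form with the denominator multiplied out, so that it also covers the
  zeros of \<open>sin (x / 2)\<close>.\<close>

lemma fejer_sin: "(sin (x / 2))\<^sup>2 * fejer M x = (sin (real M * x / 2))\<^sup>2"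
proof -
  have c: "2 * sin (x / 2) * (\<Sum>k<M. cos (real k * x)) = sin ((real M - 1 / 2) * x) + sin (x / 2)"
  proof -
    have "2 * sin (x / 2) * cos (real k * x) = sin ((real (Suc k) - 1 / 2) * x) - sin ((real k - 1 / 2) * x)" for k
      unfolding sin_diff_sin by (simp add: field_simps)
    then have "2 * sin (x / 2) * (\<Sum>k<M. cos (real k * x)) = sin ((real M - 1 / 2) * x) - sin ((real 0 - 1 / 2) * x)"
      unfolding sum_distrib_left by (simp only: sum_lessThan_telescope[of "\<lambda>k. sin ((real k - 1 / 2) * x)"])
    then show ?thesis by simp
  qed
  have s: "2 * sin (x / 2) * (\<Sum>k<M. sin (real k * x)) = cos (x / 2) - cos ((real M - 1 / 2) * x)"
  proof -
    have "2 * sin (x / 2) * sin (real k * x) = cos ((real k - 1 / 2) * x) - cos ((real (Suc k) - 1 / 2) * x)" for k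
      unfolding cos_diff_cos by (simp add: field_simps)
    then have "2 * sin (x / 2) * (\<Sum>k<M. sin (real k * x)) = cos ((real 0 - 1 / 2) * x) - cos ((real M - 1 / 2) * x)"
      unfolding sum_distrib_left by (simp only: sum_lessThan_telescope'[of "\<lambda>k. cos ((real k - 1 / 2) * x)"])
    then show ?thesis by simp
  qed
  have "4 * ((sin (x / 2))\<^sup>2 * fejer M x)
      = (2 * sin (x / 2) * (\<Sum>k<M. cos (real k * x)))\<^sup>2 + (2 * sin (x / 2) * (\<Sum>k<M. sin (real k * x)))\<^sup>2"
    by (simp add: fejer_eq_squares power2_eq_square algebra_simps)
  also have "\<dots> = 2 - 2 * cos ((real M - 1 / 2) * x + x / 2)"
  proof -
    have "(sin A + sin B)\<^sup>2 + (cos B - cos A)\<^sup>2 = 2 - 2 * cos (A + B)" for A B :: real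
    proof -
      have "(sin A + sin B)\<^sup>2 + (cos B - cos A)\<^sup>2
        = ((sin A)\<^sup>2 + (cos A)\<^sup>2) + ((sin B)\<^sup>2 + (cos B)\<^sup>2) - 2 * (cos A * cos B - sin A * sin B)"
        by algebra
      then show ?thesis by (simp add: cos_add)
    qed
    then show ?thesis unfolding c s .
  qed
  also have "(real M - 1 / 2) * x + x / 2 = 2 * (real M * x / 2)" by (simp add: field_simps)
  also have "2 - 2 * cos (2 * (real M * x / 2)) = 4 * (sin (real M * x / 2))\<^sup>2"
    unfolding cos_double_sin by simp
  finally show ?thesis by simp
qed

lemma one_minus_cos: "1 - cos x = 2 * (sin (x / 2))\<^sup>2" for x :: real
  using cos_double_sin[of "x / 2"] by simp

text \<open>The Jackson kernel without normalisation. The square gives enough decay for the mean of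
  \<open>1 - cos x\<close> to be of order \<open>1 / M\<^sup>2\<close> after normalisation.\<close>

definition jackson :: "nat \<Rightarrow> real \<Rightarrow> real" where
  "jackson M x = (fejer M x)\<^sup>2"

lemma jackson_nonneg: "0 \<le> jackson M x"
  by (simp add: jackson_def)

lemma jackson_0: "jackson M 0 = real M ^ 4"
  by (simp add: jackson_def fejer_0 flip: power_mult)

text \<open>One of the two Fejer factors is spent on \<open>1 - cos x\<close> by
  \<open>fejer_sin\<close>; the node sum of the other is known exactly.\<close>

lemma jackson_times_one_minus_cos: "jackson M x * (1 - cos x) \<le> 2 * fejer M x"
proof -
  have "jackson M x * (1 - cos x) = 2 * fejer M x * ((sin (x / 2))\<^sup>2 * fejer M x)"
    by (simp add: jackson_def one_minus_cos power2_eq_square)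
  also have "\<dots> \<le> 2 * fejer M x * 1"
    unfolding fejer_sin using fejer_nonneg[of M x] by (intro mult_left_mono) (auto simp: abs_square_le_1)
  finally show ?thesis by simp
qed

text \<open>Every frequency is at most \<open>2 * (M - 1)\<close> in absolute value. This bound
  makes the node sums below exact.\<close>

lemma jackson_expand:
  "jackson M x = (\<Sum>k<M. \<Sum>l<M. \<Sum>k'<M. \<Sum>l'<M.
      (cos (of_int ((int k - int l) + (int k' - int l')) * x) + cos (of_int ((int k - int l) - (int k' - int l')) * x)) / 2)"
proof -
  have "jackson M x = (\<Sum>k<M. \<Sum>l<M. cos (of_int (int k - int l) * x) * fejer M x)"
    by (simp add: jackson_def power2_eq_square fejer_def sum_distrib_right)
  also have "\<dots> = (\<Sum>k<M. \<Sum>l<M. \<Sum>k'<M. \<Sum>l'<M. cos (of_int (int k - int l) * x) * cos (of_int (int k' - int l') * x))"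
    by (simp only: fejer_def sum_distrib_left)
  also have "\<dots> = (\<Sum>k<M. \<Sum>l<M. \<Sum>k'<M. \<Sum>l'<M.
      (cos (of_int ((int k - int l) + (int k' - int l')) * x) + cos (of_int ((int k - int l) - (int k' - int l')) * x)) / 2)"
    by (intro sum.cong refl) (simp only: of_int_add of_int_diff[of "_ - _"] distrib_right left_diff_distrib[of "of_int (_ - _)"] cos_times_cos add.commute)
  finally show ?thesis .
qed

lemma sum_four_const: "(\<Sum>k<M. \<Sum>l<M. \<Sum>k'<M. \<Sum>l'<M. c) = real M ^ 4 * (c::real)"
  by (simp add: power4_eq_xxxx)

lemma fejer_node_sum:
  assumes "M \<le> N"
  shows "(\<Sum>j<2 * N. fejer M (real j * (pi / N) + c)) = 2 * real N * real M"
proof -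
  have "(\<Sum>j<2 * N. fejer M (real j * (pi / N) + c))
      = (\<Sum>k<M. \<Sum>l<M. \<Sum>j<2 * N. cos (of_int (int k - int l) * (real j * (pi / N) + c)))"
    unfolding fejer_def by (subst sum.swap, rule sum.cong[OF refl], rule sum.swap)
  also have "\<dots> = (\<Sum>k<M. \<Sum>l<M. if l = k then 2 * real N else 0)"
  proof (intro sum.cong refl)
    fix k l assume "k \<in> {..<M}" "l \<in> {..<M}"
    then have "\<bar>int k - int l\<bar> < 2 * int N" using assms by auto
    from node_sum_cos_shift_invariant[OF this, of c]
    show "(\<Sum>j<2 * N. cos (of_int (int k - int l) * (real j * (pi / N) + c))) = (if l = k then 2 * real N else 0)"
      by auto
  qed
  also have "\<dots> = 2 * real N * real M" by (simp add: mult.commute)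
  finally show ?thesis .
qed

lemma jackson_node_sum_linear:
  "(\<Sum>j\<in>A. w j * jackson M (f j)) = (\<Sum>k<M. \<Sum>l<M. \<Sum>k'<M. \<Sum>l'<M.
     ((\<Sum>j\<in>A. w j * cos (of_int ((int k - int l) + (int k' - int l')) * f j))
    + (\<Sum>j\<in>A. w j * cos (of_int ((int k - int l) - (int k' - int l')) * f j))) / 2)"
proof -
  have "(\<Sum>j\<in>A. w j * jackson M (f j)) = (\<Sum>k<M. \<Sum>l<M. \<Sum>k'<M. \<Sum>l'<M. \<Sum>j\<in>A.
     w j * ((cos (of_int ((int k - int l) + (int k' - int l')) * f j)
    + cos (of_int ((int k - int l) - (int k' - int l')) * f j)) / 2))"
    unfolding jackson_expand sum_distrib_left
    by (subst sum.swap, rule sum.cong[OF refl], subst sum.swap, rule sum.cong[OF refl],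
        subst sum.swap, rule sum.cong[OF refl], rule sum.swap)
  then show ?thesis by (simp add: sum.distrib distrib_left sum_divide_distrib add_divide_distrib)
qed

text \<open>A node sum sees only the constant term of a trigonometric polynomial of degree below
  \<open>2 * N\<close>, and a shift does not change that term.\<close>

lemma jackson_node_sum_shift:
  assumes "M \<le> N"
  shows "(\<Sum>j<2 * N. jackson M (real j * (pi / N) + c)) = (\<Sum>j<2 * N. jackson M (real j * (pi / N)))"
proof -
  have z: "(\<Sum>j<2 * N. 1 * cos (of_int g * (real j * (pi / N) + c))) = (\<Sum>j<2 * N. 1 * cos (of_int g * (real j * (pi / N) + 0)))"
    if "\<bar>g\<bar> < 2 * int N" for g
    unfolding mult_1 node_sum_cos_shift_invariant[OF that] ..
  have "(\<Sum>j<2 * N. 1 * jackson M (real j * (pi / N) + c)) = (\<Sum>j<2 * N. 1 * jackson M (real j * (pi / N) + 0))"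
    unfolding jackson_node_sum_linear
  proof (intro sum.cong refl)
    fix k l k' l' assume a: "k \<in> {..<M}" "l \<in> {..<M}" "k' \<in> {..<M}" "l' \<in> {..<M}"
    let ?a = "(int k - int l) + (int k' - int l')" and ?b = "(int k - int l) - (int k' - int l')"
    have "\<bar>?a\<bar> < 2 * int N" "\<bar>?b\<bar> < 2 * int N" using assms a by auto
    from this[THEN z]
    show "((\<Sum>j<2 * N. 1 * cos (of_int ?a * (real j * (pi / N) + c))) + (\<Sum>j<2 * N. 1 * cos (of_int ?b * (real j * (pi / N) + c)))) / 2
      = ((\<Sum>j<2 * N. 1 * cos (of_int ?a * (real j * (pi / N) + 0))) + (\<Sum>j<2 * N. 1 * cos (of_int ?b * (real j * (pi / N) + 0)))) / 2"
      by (simp only:)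
  qed
  then show ?thesis by simp
qed

definition jackson_mass :: "nat \<Rightarrow> nat \<Rightarrow> real" where
  "jackson_mass M N = (\<Sum>j<2 * N. jackson M (real j * (pi / N)))"

text \<open>The node 0 alone contributes this much. With \<open>N = 4 * M\<close> this lemma and the
  next place the mass between \<open>M ^ 4\<close> and \<open>8 * M ^ 4\<close>.\<close>

lemma jackson_mass_ge:
  assumes "N > 0"
  shows "real M ^ 4 \<le> jackson_mass M N"
proof -
  have "jackson M (real 0 * (pi / N)) \<le> jackson_mass M N"
    unfolding jackson_mass_def using assms by (intro member_le_sum) (auto simp: jackson_nonneg)
  then show ?thesis by (simp add: jackson_0)
qed

lemma jackson_mass_le:
  assumes "M \<le> N"
  shows "jackson_mass M N \<le> 2 * real N * real M ^ 3"
proof -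
  have "jackson_mass M N \<le> (\<Sum>j<2 * N. (real M)\<^sup>2 * fejer M (real j * (pi / N) + 0))"
    unfolding jackson_mass_def jackson_def power2_eq_square[of "fejer _ _"]
    by (intro sum_mono) (auto intro!: mult_right_mono fejer_nonneg fejer_le)
  also have "\<dots> = 2 * real N * real M ^ 3"
    unfolding sum_distrib_left[symmetric] fejer_node_sum[OF assms] by (simp add: power2_eq_square power3_eq_cube)
  finally show ?thesis .
qed

lemma jackson_one_minus_cos_sum:
  assumes "M \<le> N"
  shows "(\<Sum>j<2 * N. jackson M (real j * (pi / N) + c) * (1 - cos (real j * (pi / N) + c))) \<le> 4 * real N * real M"
proof -
  have "(\<Sum>j<2 * N. jackson M (real j * (pi / N) + c) * (1 - cos (real j * (pi / N) + c)))
      \<le> (\<Sum>j<2 * N. 2 * fejer M (real j * (pi / N) + c))"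
    by (intro sum_mono jackson_times_one_minus_cos)
  also have "\<dots> = 4 * real N * real M" unfolding sum_distrib_left[symmetric] fejer_node_sum[OF assms] by simp
  finally show ?thesis .
qed

text \<open>Cauchy-Schwarz between the total mass and the second moment, with
  \<open>(sin x)\<^sup>2 \<le> 2 * (1 - cos x)\<close>.\<close>

lemma jackson_abs_sin_sum:
  assumes "M \<le> N"
  shows "(\<Sum>j<2 * N. jackson M (real j * (pi / N) + c) * \<bar>sin (real j * (pi / N) + c)\<bar>)
    \<le> sqrt (jackson_mass M N * (8 * real N * real M))"
proof -
  let ?x = "\<lambda>j. real j * (pi / N) + c"
  have "(\<Sum>j<2 * N. jackson M (?x j) * \<bar>sin (?x j)\<bar>)\<^sup>2
     \<le> (\<Sum>j<2 * N. jackson M (?x j)) * (\<Sum>j<2 * N. jackson M (?x j) * \<bar>sin (?x j)\<bar>\<^sup>2)"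
    by (rule weighted_sum_square_le) (rule jackson_nonneg)
  also have "(\<Sum>j<2 * N. jackson M (?x j)) = jackson_mass M N"
    unfolding jackson_mass_def by (rule jackson_node_sum_shift[OF assms])
  also have "(\<Sum>j<2 * N. jackson M (?x j) * \<bar>sin (?x j)\<bar>\<^sup>2) \<le> (\<Sum>j<2 * N. 2 * (jackson M (?x j) * (1 - cos (?x j))))"
  proof (intro sum_mono)
    fix j
    have "(sin (?x j))\<^sup>2 = (1 - cos (?x j)) * (1 + cos (?x j))"
      by (simp add: sin_squared_eq power2_eq_square algebra_simps)
    also have "\<dots> \<le> (1 - cos (?x j)) * 2" by (intro mult_left_mono) auto
    finally have "jackson M (?x j) * (sin (?x j))\<^sup>2 \<le> jackson M (?x j) * ((1 - cos (?x j)) * 2)"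
      by (intro mult_left_mono jackson_nonneg)
    then show "jackson M (?x j) * \<bar>sin (?x j)\<bar>\<^sup>2 \<le> 2 * (jackson M (?x j) * (1 - cos (?x j)))"
      unfolding power2_abs by (simp only: mult_ac)
  qed
  also have "\<dots> \<le> 2 * (4 * real N * real M)"
    unfolding sum_distrib_left[symmetric] by (intro mult_left_mono jackson_one_minus_cos_sum[OF assms]) simp
  finally have "(\<Sum>j<2 * N. jackson M (?x j) * \<bar>sin (?x j)\<bar>)\<^sup>2 \<le> jackson_mass M N * (8 * real N * real M)"
    unfolding jackson_mass_def by (simp add: mult_left_mono sum_nonneg jackson_nonneg)
  then show ?thesis by (rule real_le_rsqrt)
qed

text \<open>The kernel is even and the quadrature is exact, so the first moment vanishes for every
  shift \<open>c\<close>, even when the nodes are not symmetric about 0.\<close>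

lemma jackson_sin_sum:
  assumes "M \<le> N" "M > 0"
  shows "(\<Sum>j<2 * N. jackson M (real j * (pi / N) + c) * sin (real j * (pi / N) + c)) = 0"
proof -
  let ?x = "\<lambda>j. real j * (pi / N) + c"
  have z: "(\<Sum>j<2 * N. sin (?x j) * cos (of_int g * ?x j)) = 0" if g: "\<bar>g\<bar> < 2 * int N - 1" for g :: int
  proof -
    have "sin (?x j) * cos (of_int g * ?x j) = (sin (of_int (1 + g) * ?x j) + sin (of_int (1 - g) * ?x j)) / 2" for j
      by (simp add: sin_times_cos distrib_right left_diff_distrib)
    then have "(\<Sum>j<2 * N. sin (?x j) * cos (of_int g * ?x j))
      = ((\<Sum>j<2 * N. sin (of_int (1 + g) * ?x j)) + (\<Sum>j<2 * N. sin (of_int (1 - g) * ?x j))) / 2"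
      by (simp only: sum.distrib sum_divide_distrib[symmetric])
    moreover have "\<bar>1 + g\<bar> < 2 * int N" "\<bar>1 - g\<bar> < 2 * int N" using g by auto
    ultimately show ?thesis using node_sum_sin[of "1 + g" N c] node_sum_sin[of "1 - g" N c] by simp
  qed
  have "(\<Sum>j<2 * N. sin (?x j) * jackson M (?x j)) = (\<Sum>k<M. \<Sum>l<M. \<Sum>k'<M. \<Sum>l'<M. 0)"
    unfolding jackson_node_sum_linear
  proof (intro sum.cong refl)
    fix k l k' l' assume a: "k \<in> {..<M}" "l \<in> {..<M}" "k' \<in> {..<M}" "l' \<in> {..<M}"
    have "\<bar>(int k - int l) + (int k' - int l')\<bar> < 2 * int N - 1" "\<bar>(int k - int l) - (int k' - int l')\<bar> < 2 * int N - 1"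
      using assms a by auto
    then show "((\<Sum>j<2 * N. sin (?x j) * cos (of_int ((int k - int l) + (int k' - int l')) * ?x j))
      + (\<Sum>j<2 * N. sin (?x j) * cos (of_int ((int k - int l) - (int k' - int l')) * ?x j))) / 2 = 0"
      by (simp only: z add_0_left div_0)
  qed
  then show ?thesis by (simp add: mult.commute)
qed

text \<open>The sign has frequency \<open>N\<close>, the kernel frequencies below
  \<open>2 * M\<close> and the power of the cosine frequencies up to \<open>k\<close>. Under the
  hypothesis they cannot cancel, so no constant term arises. For \<open>N = 4 * M\<close> this
  covers all \<open>k \<le> 2 * M\<close>.\<close>

lemma jackson_alternating_kills:
  assumes "2 * M + k \<le> N"
  shows "(\<Sum>j<2 * N. (-1) ^ j * jackson M (real j * (pi / N)) * cos (\<theta> + real j * (pi / N)) ^ k) = 0"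
proof (cases "M = 0")
  case True then show ?thesis by (simp add: jackson_def fejer_def)
next
  case False
  let ?x = "\<lambda>j. real j * (pi / N)"
  have z: "(\<Sum>j<2 * N. (-1) ^ j * cos (of_int g * ?x j + c) * cos (\<theta> + ?x j) ^ k) = 0"
    if "\<bar>g\<bar> + int k < int N" for g :: int and c k
    using that
  proof (induction k arbitrary: g c)
    case 0
    then show ?case using node_sum_alternating_cos[of g N c] by simp
  next
    case (Suc k)
    have "(-1) ^ j * cos (of_int g * ?x j + c) * cos (\<theta> + ?x j) ^ Suc k
       = ((-1) ^ j * cos (of_int (g + 1) * ?x j + (c + \<theta>)) * cos (\<theta> + ?x j) ^ k
        + (-1) ^ j * cos (of_int (g - 1) * ?x j + (c - \<theta>)) * cos (\<theta> + ?x j) ^ k) / 2" for j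
    proof -
      have e: "cos (of_int g * ?x j + c) * cos (\<theta> + ?x j)
        = (cos (of_int (g - 1) * ?x j + (c - \<theta>)) + cos (of_int (g + 1) * ?x j + (c + \<theta>))) / 2"
      proof -
        have "of_int g * X + c - (\<theta> + X) = of_int (g - 1) * X + (c - \<theta>)"
          "of_int g * X + c + (\<theta> + X) = of_int (g + 1) * X + (c + \<theta>)" for X
          by (simp_all add: left_diff_distrib distrib_right)
        then show ?thesis by (simp only: cos_times_cos)
      qed
      have "(-1) ^ j * cos (of_int g * ?x j + c) * cos (\<theta> + ?x j) ^ Suc k
        = (-1) ^ j * (cos (of_int g * ?x j + c) * cos (\<theta> + ?x j)) * cos (\<theta> + ?x j) ^ k"
        by (simp only: power_Suc mult_ac)
      moreover have "x * ((C + D) / 2) * b = (x * D * b + x * C * b) / 2" for x C D b :: real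
        by (simp add: field_simps)
      ultimately show ?thesis unfolding e by (simp only:)
    qed
    then have "(\<Sum>j<2 * N. (-1) ^ j * cos (of_int g * ?x j + c) * cos (\<theta> + ?x j) ^ Suc k)
       = ((\<Sum>j<2 * N. (-1) ^ j * cos (of_int (g + 1) * ?x j + (c + \<theta>)) * cos (\<theta> + ?x j) ^ k)
        + (\<Sum>j<2 * N. (-1) ^ j * cos (of_int (g - 1) * ?x j + (c - \<theta>)) * cos (\<theta> + ?x j) ^ k)) / 2"
      by (simp only: sum.distrib sum_divide_distrib[symmetric])
    moreover have "\<bar>g + 1\<bar> + int k < int N" "\<bar>g - 1\<bar> + int k < int N" using Suc.prems by auto
    ultimately show ?case using Suc.IH by (simp only: add_0_left div_0)
  qed
  have "(\<Sum>j<2 * N. ((-1) ^ j * cos (\<theta> + ?x j) ^ k) * jackson M (?x j)) = (\<Sum>a<M. \<Sum>l<M. \<Sum>k'<M. \<Sum>l'<M. 0)"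
    unfolding jackson_node_sum_linear
  proof (intro sum.cong refl)
    fix a l k' l' assume b: "a \<in> {..<M}" "l \<in> {..<M}" "k' \<in> {..<M}" "l' \<in> {..<M}"
    have "\<bar>(int a - int l) + (int k' - int l')\<bar> + int k < int N" "\<bar>(int a - int l) - (int k' - int l')\<bar> + int k < int N"
      using assms b by auto
    from this[THEN z, where c=0]
    show "((\<Sum>j<2 * N. (-1) ^ j * cos (\<theta> + ?x j) ^ k * cos (of_int ((int a - int l) + (int k' - int l')) * ?x j))
      + (\<Sum>j<2 * N. (-1) ^ j * cos (\<theta> + ?x j) ^ k * cos (of_int ((int a - int l) - (int k' - int l')) * ?x j))) / 2 = 0"
      by (simp add: mult_ac)
  qed
  then show ?thesis by (simp add: mult_ac)
qed

section \<open>Moment matching and approximation of the absolute value\<close>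

text \<open>For even \<open>g\<close> both frequencies \<open>1 + g\<close> and \<open>1 - g\<close>
  are odd, and the tangents of the two half-angles add up to \<open>sin (pi / N)\<close> divided by
  a product of cosines that lies between 0 and 1. For odd \<open>g\<close> the sum vanishes.\<close>

lemma alternating_sin_cos_le:
  fixes g :: int
  assumes g: "\<bar>g\<bar> + 1 < int N" and N: "even N"
  shows "(\<Sum>j<N. (-1) ^ j * sin (real j * (pi / N)) * cos (of_int g * (real j * (pi / N))))
     \<le> (if even g then - (1 / 2) * sin (pi / N) else 0)"
proof -
  let ?x = "\<lambda>j. real j * (pi / N)"
  have N0: "0 < real N" using g by linarith
  have lt: "\<bar>1 + g\<bar> < int N" "\<bar>1 - g\<bar> < int N" using g by auto
  have "(-1) ^ j * sin (?x j) * cos (of_int g * ?x j)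
    = ((-1) ^ j * sin (of_int (1 + g) * ?x j) + (-1) ^ j * sin (of_int (1 - g) * ?x j)) / 2" for j
  proof -
    have e: "sin X * cos (of_int g * X) = (sin (of_int (1 + g) * X) + sin (of_int (1 - g) * X)) / 2" for X :: real
      by (simp add: sin_times_cos distrib_right left_diff_distrib)
    have gen: "a * ((B + C) / 2) = (a * B + a * C) / 2" for a B C :: real by (simp add: field_simps)
    show ?thesis unfolding mult.assoc[of "(-1) ^ j" "sin _"] e gen ..
  qed
  then have "(\<Sum>j<N. (-1) ^ j * sin (?x j) * cos (of_int g * ?x j))
    = ((\<Sum>j<N. (-1) ^ j * sin (of_int (1 + g) * ?x j)) + (\<Sum>j<N. (-1) ^ j * sin (of_int (1 - g) * ?x j))) / 2"
    by (simp only: sum.distrib sum_divide_distrib[symmetric])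
  also have "\<dots> \<le> (if even g then - (1 / 2) * sin (pi / N) else 0)"
  proof (cases "even g")
    case False
    then show ?thesis unfolding node_sum_alternating_sin_half[OF lt(1) N] node_sum_alternating_sin_half[OF lt(2) N] by simp
  next
    case True
    let ?u = "of_int (1 + g) * pi / (2 * N)" and ?v = "of_int (1 - g) * pi / (2 * N)"
    have b: "\<bar>of_int l * pi / (2 * N)\<bar> < pi / 2" if "\<bar>l\<bar> < int N" for l :: int
    proof -
      have "\<bar>of_int l :: real\<bar> < real N" using that by linarith
      then have "\<bar>of_int l :: real\<bar> * pi < real N * pi" by simp
      then show ?thesis using N0 by (simp add: abs_mult field_simps)
    qed
    have cp: "0 < cos y" if "\<bar>y\<bar> < pi / 2" for y :: real
      using that by (intro cos_gt_zero_pi) auto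
    have c: "0 < cos ?u" "0 < cos ?v" using cp[OF b[OF lt(1)]] cp[OF b[OF lt(2)]] by auto
    have uv: "?u + ?v = pi / N" using N0 by (simp add: field_simps)
    have s: "0 \<le> sin (pi / N)" using N0 g by (intro sin_ge_zero) (auto simp: field_simps)
    have "sin (pi / N) \<le> sin (pi / N) / (cos ?u * cos ?v)"
    proof -
      have p: "0 < cos ?u * cos ?v" using c by simp
      have "cos ?u * cos ?v \<le> 1 * 1" using c by (intro mult_mono) auto
      then have "sin (pi / N) * (cos ?u * cos ?v) \<le> sin (pi / N) * 1" using s by (intro mult_left_mono) auto
      then show ?thesis using p by (simp only: pos_le_divide_eq mult_1_right)
    qed
    also have "\<dots> = tan ?u + tan ?v" using c unfolding uv[symmetric] by (intro add_tan_eq[symmetric]) auto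
    finally show ?thesis
      unfolding node_sum_alternating_sin_half[OF lt(1) N] node_sum_alternating_sin_half[OF lt(2) N] using True by simp
  qed
  finally show ?thesis .
qed

text \<open>All frequencies contribute with the same sign, and the even ones contribute at least
  \<open>sin (pi / N) / 2\<close> each; it remains to count the even combinations.\<close>

lemma jackson_alternating_sin_le:
  assumes "2 * M \<le> N" "even N" "0 < N"
  shows "(\<Sum>j<N. (-1) ^ j * jackson M (real j * (pi / N)) * sin (real j * (pi / N))) \<le> - (1 / 4) * real M ^ 4 * sin (pi / N)"
proof -
  let ?x = "\<lambda>j. real j * (pi / N)"
  have s: "0 \<le> sin (pi / N)" using assms by (intro sin_ge_zero) (auto simp: field_simps)
  have "(\<Sum>j<N. ((-1) ^ j * sin (?x j)) * jackson M (?x j))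
     \<le> (\<Sum>k<M. \<Sum>l<M. \<Sum>k'<M. \<Sum>l'<M. - (1 / 4) * sin (pi / N) * (1 + (-1) ^ k * (-1) ^ l * (-1) ^ k' * (-1) ^ l'))"
    unfolding jackson_node_sum_linear
  proof (intro sum_mono)
    fix k l k' l' assume b: "k \<in> {..<M}" "l \<in> {..<M}" "k' \<in> {..<M}" "l' \<in> {..<M}"
    let ?g = "(int k - int l) + (int k' - int l')" and ?h = "(int k - int l) - (int k' - int l')"
    have "\<bar>?g\<bar> + 1 < int N" "\<bar>?h\<bar> + 1 < int N" using assms b by auto
    from this[THEN alternating_sin_cos_le, OF assms(2)]
    have "((\<Sum>j<N. (-1) ^ j * sin (?x j) * cos (of_int ?g * ?x j)) + (\<Sum>j<N. (-1) ^ j * sin (?x j) * cos (of_int ?h * ?x j))) / 2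
       \<le> ((if even ?g then - (1 / 2) * sin (pi / N) else 0) + (if even ?h then - (1 / 2) * sin (pi / N) else 0)) / 2"
      by (intro divide_right_mono add_mono) auto
    also have "\<dots> = - (1 / 4) * sin (pi / N) * (1 + (-1) ^ k * (-1) ^ l * (-1) ^ k' * (-1) ^ l')"
      by (cases "even k"; cases "even l"; cases "even k'"; cases "even l'") auto
    finally show "((\<Sum>j<N. (-1) ^ j * sin (?x j) * cos (of_int ?g * ?x j)) + (\<Sum>j<N. (-1) ^ j * sin (?x j) * cos (of_int ?h * ?x j))) / 2
       \<le> - (1 / 4) * sin (pi / N) * (1 + (-1) ^ k * (-1) ^ l * (-1) ^ k' * (-1) ^ l')" .
  qed
  also have "\<dots> = - (1 / 4) * sin (pi / N) * (\<Sum>k<M. \<Sum>l<M. \<Sum>k'<M. \<Sum>l'<M. 1 + (-1) ^ k * (-1) ^ l * (-1) ^ k' * (-1) ^ l')"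
    by (simp only: sum_distrib_left)
  also have "(\<Sum>k<M. \<Sum>l<M. \<Sum>k'<M. \<Sum>l'<M. 1 + (-1) ^ k * (-1) ^ l * (-1) ^ k' * (-1) ^ l')
     = real M ^ 4 * 1 + (\<Sum>k<M. (-1) ^ k) * (\<Sum>k<M. (-1) ^ k) * (\<Sum>k<M. (-1) ^ k) * (\<Sum>k<M. (-1) ^ k)"
    unfolding sum.distrib sum_four_const by (simp only: sum_distrib_left[symmetric] sum_distrib_right[symmetric])
  \<comment> \<open>The sum of the parity signs is a fourth power, hence nonnegative, so at least
    half of the \<open>M ^ 4\<close> combinations are even.\<close>
  also have "- (1 / 4) * sin (pi / N) * (real M ^ 4 * 1 + (\<Sum>k<M. (-1) ^ k) * (\<Sum>k<M. (-1) ^ k) * (\<Sum>k<M. (-1) ^ k) * (\<Sum>k<M. (-1) ^ k))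
     \<le> - (1 / 4) * sin (pi / N) * real M ^ 4"
  proof (intro mult_left_mono_neg)
    have "0 \<le> ((\<Sum>k<M. (-1::real) ^ k) * (\<Sum>k<M. (-1) ^ k)) * ((\<Sum>k<M. (-1) ^ k) * (\<Sum>k<M. (-1) ^ k))" by simp
    then show "real M ^ 4 \<le> real M ^ 4 * 1 + (\<Sum>k<M. (-1) ^ k) * (\<Sum>k<M. (-1) ^ k) * (\<Sum>k<M. (-1) ^ k) * (\<Sum>k<M. (-1) ^ k)"
      by (simp only: mult.assoc)
  qed (use s in simp)
  finally show ?thesis by (simp add: mult_ac)
qed

lemma sum_inverse_squares_tail:
  fixes X :: real
  assumes "1 \<le> X"
  shows "(\<Sum>j\<in>{1..N}. if X \<le> real j then 1 / (real j)\<^sup>2 else 0) \<le> 2 / X"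
proof -
  define m where "m = nat \<lceil>X\<rceil>"
  have m: "X \<le> real m" "1 \<le> m" using assms by (auto simp: m_def of_nat_ceiling le_nat_iff)
  have "(\<Sum>j\<in>{1..N}. if X \<le> real j then 1 / (real j)\<^sup>2 else 0) = (\<Sum>j\<in>{1..N} \<inter> {j. X \<le> real j}. 1 / (real j)\<^sup>2)"
    by (simp add: sum.inter_restrict)
  also have "\<dots> \<le> (\<Sum>j\<in>{m..<m + N}. 1 / (real j)\<^sup>2)"
  proof (rule sum_mono2)
    show "{1..N} \<inter> {j. X \<le> real j} \<subseteq> {m..<m + N}"
      using m by (auto simp: m_def nat_le_iff ceiling_le_iff)
  qed auto
  also have "\<dots> \<le> (\<Sum>j\<in>{m..<m + N}. 2 / real j - 2 / real (Suc j))"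
  proof (rule sum_mono)
    fix j assume "j \<in> {m..<m + N}"
    then have j: "1 \<le> real j" using m by auto
    then have "1 / (real j)\<^sup>2 \<le> 2 / (real j * real (Suc j))"
      by (simp add: divide_simps power2_eq_square)
    also have "\<dots> = 2 / real j - 2 / real (Suc j)" using j by (simp add: field_simps)
    finally show "1 / (real j)\<^sup>2 \<le> 2 / real j - 2 / real (Suc j)" .
  qed
  also have "\<dots> = 2 / real m - 2 / real (m + N)"
    using sum_Suc_diff'[of m "m + N" "\<lambda>j. - 2 / real j"] by simp
  also have "\<dots> \<le> 2 / real m" by simp
  also have "\<dots> \<le> 2 / X" using m assms by (intro divide_left_mono) auto
  finally show ?thesis .
qed

text \<open>Pairing the node \<open>j\<close> with its mirror \<open>2 * N - j\<close> cancels the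
  smooth part of \<open>\<bar>cos \<phi> - cos \<theta>\<bar>\<close> around \<theta> and leaves
  \<open>2 * sin \<theta> * sin x\<close>, whose alternating kernel sum is negative of order
  \<open>M ^ 3 * sin \<theta>\<close>. The error \<open>p\<close> occurs only at nodes beyond the
  second zero, at \<open>- \<theta>\<close>, where the kernel is already small.\<close>

lemma jackson_gap:
  fixes \<theta> :: real
  assumes M: "1 \<le> M" and \<theta>: "0 < \<theta>" "\<theta> \<le> pi / 2" and big: "21 \<le> real M * sin \<theta>"
  defines "N \<equiv> 4 * M"
  shows "(\<Sum>j<2 * N. (-1) ^ j * jackson M (real j * (pi / N)) * \<bar>cos (\<theta> + real j * (pi / N)) - cos \<theta>\<bar>)
     \<le> - (1 / 8) * real M ^ 3 * sin \<theta>"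
proof -
  let ?x = "\<lambda>j. real j * (pi / N)"
  let ?K = "\<lambda>j. jackson M (?x j)"
  define h where "h = (\<lambda>j. \<bar>cos (\<theta> + ?x j) - cos \<theta>\<bar>)"
  define p where "p = (\<lambda>j. max 0 (cos \<theta> * (1 - cos (?x j)) - sin \<theta> * sin (?x j)))"
  have N0: "0 < N" "0 < real N" using M by (auto simp: N_def)
  have s0: "0 < sin \<theta>" using \<theta> by (intro sin_gt_zero) auto
  have c0: "0 \<le> cos \<theta>" using \<theta> by (intro cos_ge_zero) auto
  have st: "sin \<theta> \<le> \<theta>" using \<theta> by (simp add: sin_x_le_x)
  have x2: "?x (2 * N - j) = 2 * pi - ?x j" if "j \<le> 2 * N" for j
    using that N0 by (simp add: of_nat_diff field_simps)
  have Ksym: "?K (2 * N - j) = ?K j" if "j \<le> 2 * N" for j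
    unfolding jackson_def x2[OF that] fejer_periodic ..
  have xr: "0 \<le> ?x j" "?x j \<le> pi" if "j \<le> N" for j
    using that N0 by (auto simp: field_simps)
  have hj: "h j = cos \<theta> * (1 - cos (?x j)) + sin \<theta> * sin (?x j)" if "j \<le> N" for j
  proof -
    have "cos (\<theta> + ?x j) - cos \<theta> = - (cos \<theta> * (1 - cos (?x j)) + sin \<theta> * sin (?x j))"
      by (simp add: cos_add algebra_simps)
    moreover have "0 \<le> cos \<theta> * (1 - cos (?x j)) + sin \<theta> * sin (?x j)"
      using c0 s0 xr[OF that] by (intro add_nonneg_nonneg mult_nonneg_nonneg sin_ge_zero[of "?x j"]) auto
    ultimately show ?thesis by (simp add: h_def)
  qed
  \<comment> \<open>The node \<open>2 * N - j\<close> is the angle \<open>\<theta> - x\<close>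
    modulo a full turn. There the sign inside the absolute value flips once \<open>x\<close> exceeds
    \<open>2 * \<theta>\<close>; \<open>p j\<close> is the excess after the flip.\<close>
  have hj': "h (2 * N - j) = 2 * p j - (cos \<theta> * (1 - cos (?x j)) - sin \<theta> * sin (?x j))" if "j \<le> N" for j
  proof -
    have "cos (\<theta> + ?x (2 * N - j)) = cos (\<theta> - ?x j + 2 * pi)"
      using x2[of j] that by (simp add: algebra_simps)
    also have "\<dots> = cos (\<theta> - ?x j)" by (simp only: cos_periodic)
    finally have "cos (\<theta> + ?x (2 * N - j)) - cos \<theta> = - (cos \<theta> * (1 - cos (?x j)) - sin \<theta> * sin (?x j))"
      by (simp add: cos_diff algebra_simps)
    then show ?thesis by (simp add: h_def p_def abs_if max_def)
  qed
  have split: "(\<Sum>j<2 * N. f j) = f 0 + f N + (\<Sum>j\<in>{1..<N}. f j + f (2 * N - j))" for f :: "nat \<Rightarrow> real"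
  proof -
    have "(\<Sum>j<2 * N. f j) = (\<Sum>j\<in>{0..<N}. f j) + (\<Sum>j\<in>{N..<2 * N}. f j)"
      using sum.atLeastLessThan_concat[of 0 N "2 * N" f] by (simp add: atLeast0LessThan)
    also have "(\<Sum>j\<in>{0..<N}. f j) = f 0 + (\<Sum>j\<in>{1..<N}. f j)"
      using N0 by (simp add: sum.atLeast_Suc_lessThan)
    also have "(\<Sum>j\<in>{N..<2 * N}. f j) = f N + (\<Sum>j\<in>{Suc N..<2 * N}. f j)"
      using N0 by (simp add: sum.atLeast_Suc_lessThan)
    also have "(\<Sum>j\<in>{Suc N..<2 * N}. f j) = (\<Sum>j\<in>{1..<N}. f (2 * N - j))"
      by (rule sum.reindex_bij_witness[where i="\<lambda>j. 2 * N - j" and j="\<lambda>j. 2 * N - j"]) auto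
    finally show ?thesis by (simp add: sum.distrib)
  qed
  have evN: "even N" by (simp add: N_def)
  have sg: "(-1::real) ^ (2 * N - j) = (-1) ^ j" if "j \<le> 2 * N" for j
    using that by (simp add: uminus_power_if)
  have "(\<Sum>j<2 * N. (-1) ^ j * ?K j * h j) = ?K N * h N + (\<Sum>j\<in>{1..<N}. (-1) ^ j * ?K j * h j + (-1) ^ j * ?K j * h (2 * N - j))"
  proof -
    have "(\<Sum>j\<in>{1..<N}. (-1) ^ j * ?K j * h j + (-1) ^ (2 * N - j) * ?K (2 * N - j) * h (2 * N - j))
        = (\<Sum>j\<in>{1..<N}. (-1) ^ j * ?K j * h j + (-1) ^ j * ?K j * h (2 * N - j))"
    proof (intro sum.cong refl)
      fix j assume "j \<in> {1..<N}"
      then have j: "j \<le> 2 * N" by simp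
      show "(-1) ^ j * ?K j * h j + (-1) ^ (2 * N - j) * ?K (2 * N - j) * h (2 * N - j)
        = (-1) ^ j * ?K j * h j + (-1) ^ j * ?K j * h (2 * N - j)"
        unfolding sg[OF j] Ksym[OF j] ..
    qed
    moreover have "h 0 = 0" by (simp add: h_def)
    ultimately show ?thesis unfolding split[of "\<lambda>j. (-1) ^ j * ?K j * h j"] using evN by simp
  qed
  also have "\<dots> \<le> ?K N * (2 * p N) + (\<Sum>j\<in>{1..<N}. 2 * sin \<theta> * ((-1) ^ j * ?K j * sin (?x j)) + ?K j * (2 * p j))"
  proof (rule add_mono)
    have "?x N = pi" using N0 by simp
    then have "h N = 2 * cos \<theta>" "p N = 2 * cos \<theta>" using hj[of N] c0 by (auto simp: p_def)
    then show "?K N * h N \<le> ?K N * (2 * p N)" using c0 by (intro mult_left_mono jackson_nonneg) auto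
    show "(\<Sum>j\<in>{1..<N}. (-1) ^ j * ?K j * h j + (-1) ^ j * ?K j * h (2 * N - j))
      \<le> (\<Sum>j\<in>{1..<N}. 2 * sin \<theta> * ((-1) ^ j * ?K j * sin (?x j)) + ?K j * (2 * p j))"
    proof (rule sum_mono)
    fix j assume "j \<in> {1..<N}"
    then have j: "j \<le> N" by simp
    have "(-1) ^ j * ?K j * h j + (-1) ^ j * ?K j * h (2 * N - j)
        = 2 * sin \<theta> * ((-1) ^ j * ?K j * sin (?x j)) + (-1) ^ j * (?K j * (2 * p j))"
      unfolding hj[OF j] hj'[OF j] by (simp add: algebra_simps)
    also have "(-1) ^ j * (?K j * (2 * p j)) \<le> ?K j * (2 * p j)"
    proof -
      have "0 \<le> ?K j * (2 * p j)" by (intro mult_nonneg_nonneg jackson_nonneg) (auto simp: p_def)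
      then show ?thesis by (cases "even j") auto
    qed
    finally show "(-1) ^ j * ?K j * h j + (-1) ^ j * ?K j * h (2 * N - j)
        \<le> 2 * sin \<theta> * ((-1) ^ j * ?K j * sin (?x j)) + ?K j * (2 * p j)" by simp
    qed
  qed
  also have "\<dots> = 2 * sin \<theta> * (\<Sum>j\<in>{1..<N}. (-1) ^ j * ?K j * sin (?x j)) + 2 * (\<Sum>j\<in>{1..N}. ?K j * p j)"
  proof -
    have "{1..N} = insert N {1..<N}" using N0 by auto
    then have "(\<Sum>j\<in>{1..N}. ?K j * p j) = ?K N * p N + (\<Sum>j\<in>{1..<N}. ?K j * p j)" by simp
    then show ?thesis by (simp add: sum.distrib sum_distrib_left mult_ac distrib_left)
  qed
  also have "(\<Sum>j\<in>{1..<N}. (-1) ^ j * ?K j * sin (?x j)) = (\<Sum>j<N. (-1) ^ j * ?K j * sin (?x j))"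
    using N0 by (simp add: sum.atLeast_Suc_lessThan flip: atLeast0LessThan)
  \<comment> \<open>With \<open>N = 4 * M\<close> the chord bound gives
    \<open>sin (pi / N) \<ge> 1 / (2 * M)\<close>, which turns \<open>M ^ 4\<close> into
    \<open>M ^ 3\<close>.\<close>
  also have "2 * sin \<theta> * (\<Sum>j<N. (-1) ^ j * ?K j * sin (?x j)) \<le> 2 * sin \<theta> * (- (1 / 4) * real M ^ 4 * (1 / (2 * real M)))"
  proof (intro mult_left_mono)
    have "1 / (2 * real M) = 2 / pi * (pi / N)" using M by (simp add: N_def)
    also have "\<dots> \<le> sin (pi / N)" using M by (intro sin_ge_chord) (auto simp: N_def field_simps)
    finally have "real M ^ 4 * (1 / (2 * real M)) \<le> real M ^ 4 * sin (pi / N)" by (intro mult_left_mono) auto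
    moreover have "(\<Sum>j<N. (-1) ^ j * ?K j * sin (?x j)) \<le> - (1 / 4) * real M ^ 4 * sin (pi / N)"
      using N0 evN by (intro jackson_alternating_sin_le) (auto simp: N_def)
    ultimately show "(\<Sum>j<N. (-1) ^ j * ?K j * sin (?x j)) \<le> - (1 / 4) * real M ^ 4 * (1 / (2 * real M))" by simp
  qed (use s0 in simp)
  also have "2 * sin \<theta> * (- (1 / 4) * real M ^ 4 * (1 / (2 * real M))) = - (1 / 4) * real M ^ 3 * sin \<theta>"
    using M by (simp add: power4_eq_xxxx power3_eq_cube)
  also have "2 * (\<Sum>j\<in>{1..N}. ?K j * p j) \<le> 16 * pi * real M / sin \<theta>"
  proof -
    \<comment> \<open>The index at which the half-angle \<open>u\<close> of the node reaches
      \<theta>. Below it \<open>sin (u - \<theta>) \<le> 0\<close>, hence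
      \<open>p j = 0\<close>.\<close>
    define X where "X = 2 * \<theta> * N / pi"
    have X1: "1 \<le> X"
    proof -
      have "21 \<le> real M * \<theta>" using big st mult_left_mono[OF st, of "real M"] by linarith
      then have "pi \<le> 2 * (4 * real M * \<theta>)" using pi_less_4 by linarith
      then show ?thesis by (simp add: X_def N_def field_simps)
    qed
    have pt: "?K j * p j \<le> 2 * (real N)\<^sup>2 * (if X \<le> real j then 1 / (real j)\<^sup>2 else 0)" if j: "j \<in> {1..N}" for j
    proof -
      have jN: "j \<le> N" "0 < real j" using j by auto
      define u where "u = ?x j / 2"
      have u: "0 < u" "u \<le> pi / 2" using jN N0 xr[of j] by (auto simp: u_def)
      have su: "real j / N \<le> sin u"
      proof -
        have "real j / N = 2 / pi * u" using N0 by (simp add: u_def)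
        then show ?thesis using sin_ge_chord[of u] u by simp
      qed
      have jn0: "0 < real j / N" using jN N0 by simp
      have eq: "cos \<theta> * (1 - cos (?x j)) - sin \<theta> * sin (?x j) = 2 * sin u * sin (u - \<theta>)"
      proof -
        have tr: "1 - cos (?x j) = 2 * (sin u)\<^sup>2" "sin (?x j) = 2 * sin u * cos u"
          using one_minus_cos[of "?x j"] sin_double[of u] by (auto simp: u_def)
        show ?thesis unfolding tr by (simp add: sin_diff power2_eq_square algebra_simps)
      qed
      show ?thesis
      proof (cases "X \<le> real j")
        case True
        have "p j \<le> 1 - cos (?x j)"
        proof -
          have "cos \<theta> * (1 - cos (?x j)) \<le> 1 * (1 - cos (?x j))" by (intro mult_right_mono) auto
          moreover have "0 \<le> sin \<theta> * sin (?x j)" using s0 xr[OF jN(1)] by (intro mult_nonneg_nonneg sin_ge_zero[of "?x j"]) auto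
          ultimately show ?thesis by (auto simp: p_def)
        qed
        then have "?K j * p j \<le> ?K j * (1 - cos (?x j))" by (intro mult_left_mono jackson_nonneg)
        also have "\<dots> \<le> 2 * fejer M (?x j)" by (rule jackson_times_one_minus_cos)
        also have "\<dots> \<le> 2 * (1 / (real j / N)\<^sup>2)"
        proof -
          have "(real j / N)\<^sup>2 * fejer M (?x j) \<le> (sin u)\<^sup>2 * fejer M (?x j)"
            using su jn0 by (intro mult_right_mono power_mono fejer_nonneg) auto
          also have "\<dots> \<le> 1" unfolding u_def fejer_sin by (simp add: abs_square_le_1)
          finally have "fejer M (?x j) \<le> 1 / (real j / N)\<^sup>2" using jn0 by (simp only: pos_le_divide_eq zero_less_power mult.commute)
          then show ?thesis by simp
        qed
        finally show ?thesis using True by (simp add: power_divide)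
      next
        case False
        then have "u < \<theta>" using N0 by (simp add: X_def u_def field_simps)
        then have "sin (u - \<theta>) \<le> 0" using u \<theta> sin_ge_zero[of "\<theta> - u"] sin_minus[of "\<theta> - u"] by simp
        moreover have "0 \<le> sin u" using u by (intro sin_ge_zero) auto
        ultimately have "2 * sin u * sin (u - \<theta>) \<le> 0" by (intro mult_nonneg_nonpos) auto
        then have "p j = 0" unfolding p_def eq by (rule max_absorb1)
        then show ?thesis using False by simp
      qed
    qed
    have "2 * (\<Sum>j\<in>{1..N}. ?K j * p j) \<le> 2 * (\<Sum>j\<in>{1..N}. 2 * (real N)\<^sup>2 * (if X \<le> real j then 1 / (real j)\<^sup>2 else 0))"
      using pt by (intro mult_left_mono sum_mono) auto
    also have "\<dots> = 4 * (real N)\<^sup>2 * (\<Sum>j\<in>{1..N}. if X \<le> real j then 1 / (real j)\<^sup>2 else 0)"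
      by (simp only: sum_distrib_left[symmetric])
    also have "\<dots> \<le> 4 * (real N)\<^sup>2 * (2 / X)" by (intro mult_left_mono sum_inverse_squares_tail X1) simp
    also have "\<dots> = 16 * pi * real M / \<theta>" using \<theta> N0 by (simp add: X_def N_def power2_eq_square field_simps)
    also have "\<dots> \<le> 16 * pi * real M / sin \<theta>" using s0 st by (intro divide_left_mono) auto
    finally show ?thesis .
  qed
  \<comment> \<open>The origin of the constant 21: the error is at most half of the main term when
    \<open>128 * pi \<le> (M * sin \<theta>)\<^sup>2\<close>, and 21 is the least integer whose
    square exceeds \<open>128 * pi\<close>.\<close>
  also have "16 * pi * real M / sin \<theta> \<le> (1 / 8) * real M ^ 3 * sin \<theta>"
  proof -
    have "21 * 21 \<le> (real M * sin \<theta>) * (real M * sin \<theta>)" using big by (intro mult_mono) auto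
    moreover have "pi < 3.2" using pi_approx by simp
    ultimately have "128 * pi \<le> (real M * sin \<theta>) * (real M * sin \<theta>)" by simp
    then have "real M * (128 * pi) \<le> real M * ((real M * sin \<theta>) * (real M * sin \<theta>))" by (intro mult_left_mono) auto
    then show ?thesis using s0 by (simp add: divide_le_eq power3_eq_cube field_simps)
  qed
  finally show ?thesis unfolding h_def by (simp add: mult_ac)
qed

text \<open>The two laws are the normalised kernel on the even and on the odd nodes.
  \<open>jackson_alternating_kills\<close> gives equal moments, and its case \<open>k = 0\<close>
  equal total mass. The last two bounds say that both laws concentrate near
  \<open>cos \<theta>\<close>; they later keep the mean mass of a symbol comparable with its
  \<open>Q\<close>-mass.\<close>

lemma moment_matching_weights:
  fixes \<theta> :: real
  assumes M: "1 \<le> M" and \<theta>: "0 < \<theta>" "\<theta> \<le> pi / 2" and big: "21 \<le> real M * sin \<theta>"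
  obtains y \<mu>0 \<mu>1 :: "nat \<Rightarrow> real" where
    "is_weight {..<8 * M} \<mu>0" "is_weight {..<8 * M} \<mu>1" "\<And>j. \<bar>y j\<bar> \<le> 1"
    "\<And>k. k \<le> 2 * M \<Longrightarrow> (\<Sum>j<8 * M. \<mu>0 j * y j ^ k) = (\<Sum>j<8 * M. \<mu>1 j * y j ^ k)"
    "sin \<theta> / (32 * real M) \<le> (\<Sum>j<8 * M. \<mu>1 j * \<bar>y j - cos \<theta>\<bar>) - (\<Sum>j<8 * M. \<mu>0 j * \<bar>y j - cos \<theta>\<bar>)"
    "(\<Sum>j<8 * M. \<mu>0 j * \<bar>y j - cos \<theta>\<bar>) \<le> 32 / (real M)\<^sup>2 + 12 * sin \<theta> / real M"
    "(\<Sum>j<8 * M. \<mu>1 j * \<bar>y j - cos \<theta>\<bar>) \<le> 32 / (real M)\<^sup>2 + 12 * sin \<theta> / real M"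
proof -
  define N where "N = 4 * M"
  let ?x = "\<lambda>j. real j * (pi / N)"
  let ?K = "\<lambda>j. jackson M (?x j)"
  define T where "T = jackson_mass M N"
  have MN: "M \<le> N" "0 < N" "2 * N = 8 * M" using M by (auto simp: N_def)
  have M0: "0 < real M" using M by simp
  have Tge: "real M ^ 4 \<le> T" and Tle: "T \<le> 8 * real M ^ 4"
    using jackson_mass_ge[OF MN(2)] jackson_mass_le[OF MN(1)] by (auto simp: T_def N_def power4_eq_xxxx power3_eq_cube)
  have T0: "0 < T" using Tge M0 by (meson less_le_trans zero_less_power)
  define y where "y = (\<lambda>j. cos (\<theta> + ?x j))"
  define \<mu>0 where "\<mu>0 = (\<lambda>j. if even j then 2 * ?K j / T else 0)"
  define \<mu>1 where "\<mu>1 = (\<lambda>j. if odd j then 2 * ?K j / T else 0)"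
  have s0: "0 < sin \<theta>" using \<theta> by (intro sin_gt_zero) auto
  have diff: "(\<Sum>j<8 * M. \<mu>0 j * f j) - (\<Sum>j<8 * M. \<mu>1 j * f j) = 2 / T * (\<Sum>j<2 * N. (-1) ^ j * ?K j * f j)" for f :: "nat \<Rightarrow> real"
    unfolding sum_subtractf[symmetric] sum_distrib_left MN(3)[symmetric]
    by (intro sum.cong refl) (auto simp: \<mu>0_def \<mu>1_def)
  have sum: "(\<Sum>j<8 * M. \<mu>0 j * f j) + (\<Sum>j<8 * M. \<mu>1 j * f j) = 2 / T * (\<Sum>j<2 * N. ?K j * f j)" for f :: "nat \<Rightarrow> real"
    unfolding sum.distrib[symmetric] sum_distrib_left MN(3)[symmetric]
    by (intro sum.cong refl) (auto simp: \<mu>0_def \<mu>1_def)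
  have nn: "0 \<le> \<mu>0 j" "0 \<le> \<mu>1 j" for j using T0 by (auto simp: \<mu>0_def \<mu>1_def jackson_nonneg)
  have mm: "(\<Sum>j<8 * M. \<mu>0 j * y j ^ k) = (\<Sum>j<8 * M. \<mu>1 j * y j ^ k)" if k: "k \<le> 2 * M" for k
  proof -
    have "(\<Sum>j<2 * N. (-1) ^ j * ?K j * cos (\<theta> + ?x j) ^ k) = 0"
      by (rule jackson_alternating_kills) (use k in \<open>simp add: N_def\<close>)
    then show ?thesis using diff[of "\<lambda>j. y j ^ k"] by (simp add: y_def)
  qed
  have tot: "(\<Sum>j<8 * M. \<mu>0 j) + (\<Sum>j<8 * M. \<mu>1 j) = 2"
    using sum[of "\<lambda>_. 1"] T0 by (simp add: T_def jackson_mass_def)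
  have eq: "(\<Sum>j<8 * M. \<mu>0 j) = (\<Sum>j<8 * M. \<mu>1 j)" using mm[of 0] by simp
  have w: "is_weight {..<8 * M} \<mu>0" "is_weight {..<8 * M} \<mu>1" using tot eq nn by (auto simp: is_weight_def)
  have gap: "sin \<theta> / (32 * real M) \<le> (\<Sum>j<8 * M. \<mu>1 j * \<bar>y j - cos \<theta>\<bar>) - (\<Sum>j<8 * M. \<mu>0 j * \<bar>y j - cos \<theta>\<bar>)"
  proof -
    have "(\<Sum>j<2 * N. (-1) ^ j * ?K j * \<bar>y j - cos \<theta>\<bar>) \<le> - (1 / 8) * real M ^ 3 * sin \<theta>"
      unfolding y_def N_def by (rule jackson_gap[OF M \<theta> big])
    then have "(\<Sum>j<8 * M. \<mu>0 j * \<bar>y j - cos \<theta>\<bar>) - (\<Sum>j<8 * M. \<mu>1 j * \<bar>y j - cos \<theta>\<bar>)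
       \<le> 2 / T * (- (1 / 8) * real M ^ 3 * sin \<theta>)"
      unfolding diff using T0 by (intro mult_left_mono) auto
    moreover have "sin \<theta> / (32 * real M) \<le> 2 / T * ((1 / 8) * real M ^ 3 * sin \<theta>)"
    proof -
      have "T * sin \<theta> \<le> 8 * real M ^ 4 * sin \<theta>" using Tle s0 by (intro mult_right_mono) auto
      then show ?thesis using T0 M0 by (simp add: field_simps power4_eq_xxxx power3_eq_cube)
    qed
    ultimately show ?thesis by simp
  qed
  have dev: "2 / T * (\<Sum>j<2 * N. ?K j * \<bar>y j - cos \<theta>\<bar>) \<le> 32 / (real M)\<^sup>2 + 12 * sin \<theta> / real M"
  proof -
    have "(\<Sum>j<2 * N. ?K j * \<bar>y j - cos \<theta>\<bar>) \<le> (\<Sum>j<2 * N. ?K j * (1 - cos (?x j)) + sin \<theta> * (?K j * \<bar>sin (?x j)\<bar>))"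
    proof (intro sum_mono)
      fix j
      have "y j - cos \<theta> = - (cos \<theta> * (1 - cos (?x j))) - sin \<theta> * sin (?x j)"
        by (simp add: y_def cos_add algebra_simps)
      then have "\<bar>y j - cos \<theta>\<bar> \<le> \<bar>cos \<theta> * (1 - cos (?x j))\<bar> + \<bar>sin \<theta> * sin (?x j)\<bar>" by linarith
      also have "\<dots> = \<bar>cos \<theta>\<bar> * (1 - cos (?x j)) + sin \<theta> * \<bar>sin (?x j)\<bar>"
        using s0 by (simp add: abs_mult)
      also have "\<bar>cos \<theta>\<bar> * (1 - cos (?x j)) \<le> 1 * (1 - cos (?x j))" by (intro mult_right_mono) auto
      finally have "?K j * \<bar>y j - cos \<theta>\<bar> \<le> ?K j * ((1 - cos (?x j)) + sin \<theta> * \<bar>sin (?x j)\<bar>)"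
        by (intro mult_left_mono jackson_nonneg) simp
      then show "?K j * \<bar>y j - cos \<theta>\<bar> \<le> ?K j * (1 - cos (?x j)) + sin \<theta> * (?K j * \<bar>sin (?x j)\<bar>)"
        by (simp add: distrib_left mult_ac)
    qed
    also have "\<dots> = (\<Sum>j<2 * N. ?K j * (1 - cos (?x j))) + sin \<theta> * (\<Sum>j<2 * N. ?K j * \<bar>sin (?x j)\<bar>)"
      by (simp add: sum.distrib sum_distrib_left)
    also have "\<dots> \<le> 4 * real N * real M + sin \<theta> * sqrt (T * (8 * real N * real M))"
      using jackson_one_minus_cos_sum[OF MN(1), of 0] jackson_abs_sin_sum[OF MN(1), of 0] s0
      by (intro add_mono mult_left_mono) (auto simp: T_def)
    also have "\<dots> = 16 * (real M)\<^sup>2 + sin \<theta> * sqrt (32 * T * (real M)\<^sup>2)"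
      by (simp add: N_def power2_eq_square mult_ac)
    finally have "2 / T * (\<Sum>j<2 * N. ?K j * \<bar>y j - cos \<theta>\<bar>) \<le> 2 / T * (16 * (real M)\<^sup>2 + sin \<theta> * sqrt (32 * T * (real M)\<^sup>2))"
      using T0 by (intro mult_left_mono) auto
    also have "\<dots> = 32 * (real M)\<^sup>2 / T + 2 * sin \<theta> * (sqrt (32 * T * (real M)\<^sup>2) / T)"
      using T0 by (simp add: field_simps)
    also have "\<dots> \<le> 32 / (real M)\<^sup>2 + 2 * sin \<theta> * (6 / real M)"
    proof (intro add_mono mult_left_mono)
      show "32 * (real M)\<^sup>2 / T \<le> 32 / (real M)\<^sup>2"
        using Tge T0 M0 by (simp add: field_simps power4_eq_xxxx power2_eq_square)
      have "sqrt (32 * T * (real M)\<^sup>2) \<le> 6 * T / real M"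
      proof (rule real_le_lsqrt)
        have "32 * T * (real M)\<^sup>2 * (real M)\<^sup>2 \<le> 36 * T * T"
          using mult_left_mono[OF Tge, of "32 * T"] T0 mult_right_mono[of "32" 36 "T * T"]
          by (simp add: power4_eq_xxxx power2_eq_square mult_ac)
        then show "32 * T * (real M)\<^sup>2 \<le> (6 * T / real M)\<^sup>2"
          using M0 by (simp add: power_divide power2_eq_square field_simps)
      qed (use T0 in auto)
      then have "sqrt (32 * T * (real M)\<^sup>2) / T \<le> 6 * T / real M / T" using T0 by (intro divide_right_mono) auto
      then show "sqrt (32 * T * (real M)\<^sup>2) / T \<le> 6 / real M" using T0 by simp
    qed (use s0 in simp)
    finally show ?thesis by simp
  qed
  have nn2: "0 \<le> (\<Sum>j<8 * M. \<mu>0 j * \<bar>y j - cos \<theta>\<bar>)" "0 \<le> (\<Sum>j<8 * M. \<mu>1 j * \<bar>y j - cos \<theta>\<bar>)"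
    using nn by (auto intro!: sum_nonneg)
  show thesis
  proof (rule that[of \<mu>0 \<mu>1 y])
    show "\<bar>y j\<bar> \<le> 1" for j by (simp add: y_def)
    show "(\<Sum>j<8 * M. \<mu>0 j * \<bar>y j - cos \<theta>\<bar>) \<le> 32 / (real M)\<^sup>2 + 12 * sin \<theta> / real M"
      using dev nn2 sum[of "\<lambda>j. \<bar>y j - cos \<theta>\<bar>"] by linarith
    show "(\<Sum>j<8 * M. \<mu>1 j * \<bar>y j - cos \<theta>\<bar>) \<le> 32 / (real M)\<^sup>2 + 12 * sin \<theta> / real M"
      using dev nn2 sum[of "\<lambda>j. \<bar>y j - cos \<theta>\<bar>"] by linarith
  qed (use w mm gap in auto)
qed

text \<open>Besides the degree, the sum of the absolute coefficients is tracked, because it enters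
  the variance of the estimator in \<open>block_estimator_error\<close>.\<close>

definition cos_poly :: "nat \<Rightarrow> real \<Rightarrow> (real \<Rightarrow> real) \<Rightarrow> bool" where
  "cos_poly d B f \<longleftrightarrow> (\<exists>b. (\<forall>x. f x = (\<Sum>k\<le>d. b k * cos x ^ k)) \<and> (\<Sum>k\<le>d. \<bar>b k\<bar>) \<le> B)"

lemma cos_poly_add:
  assumes "cos_poly d B f" "cos_poly d C g"
  shows "cos_poly d (B + C) (\<lambda>x. f x + g x)"
proof -
  obtain b c where b: "\<And>x. f x = (\<Sum>k\<le>d. b k * cos x ^ k)" "(\<Sum>k\<le>d. \<bar>b k\<bar>) \<le> B"
    and c: "\<And>x. g x = (\<Sum>k\<le>d. c k * cos x ^ k)" "(\<Sum>k\<le>d. \<bar>c k\<bar>) \<le> C"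
    using assms by (auto simp: cos_poly_def)
  have "(\<Sum>k\<le>d. \<bar>b k + c k\<bar>) \<le> (\<Sum>k\<le>d. \<bar>b k\<bar> + \<bar>c k\<bar>)" by (intro sum_mono) simp
  also have "\<dots> \<le> B + C" using b c by (simp add: sum.distrib)
  finally show ?thesis unfolding cos_poly_def
    by (intro exI[of _ "\<lambda>k. b k + c k"]) (simp add: b c distrib_right sum.distrib)
qed

lemma cos_poly_cmult:
  assumes "cos_poly d B f"
  shows "cos_poly d (\<bar>c\<bar> * B) (\<lambda>x. c * f x)"
proof -
  obtain b where b: "\<And>x. f x = (\<Sum>k\<le>d. b k * cos x ^ k)" "(\<Sum>k\<le>d. \<bar>b k\<bar>) \<le> B"
    using assms by (auto simp: cos_poly_def)
  show ?thesis unfolding cos_poly_def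
    using mult_left_mono[OF b(2), of "\<bar>c\<bar>"]
    by (intro exI[of _ "\<lambda>k. c * b k"]) (simp add: b(1) abs_mult sum_distrib_left mult_ac)
qed

lemma cos_poly_mono: "cos_poly d B f \<Longrightarrow> B \<le> C \<Longrightarrow> cos_poly d C f"
  unfolding cos_poly_def by (meson order_trans)

lemma cos_poly_sum:
  assumes "finite I" "\<And>i. i \<in> I \<Longrightarrow> cos_poly d (B i) (f i)"
  shows "cos_poly d (\<Sum>i\<in>I. B i) (\<lambda>x. \<Sum>i\<in>I. f i x)"
  using assms
proof (induction I rule: finite_induct)
  case empty
  then show ?case unfolding cos_poly_def by (intro exI[of _ "\<lambda>_. 0"]) auto
next
  case (insert i I)
  then show ?case using cos_poly_add[of d "B i" "f i"] by simp
qed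

lemma cos_poly_times_cos:
  assumes "cos_poly d B f"
  shows "cos_poly (Suc d) B (\<lambda>x. cos x * f x)"
proof -
  obtain b where b: "\<And>x. f x = (\<Sum>k\<le>d. b k * cos x ^ k)" "(\<Sum>k\<le>d. \<bar>b k\<bar>) \<le> B"
    using assms by (auto simp: cos_poly_def)
  show ?thesis unfolding cos_poly_def
    by (intro exI[of _ "\<lambda>k. case k of 0 \<Rightarrow> 0 | Suc j \<Rightarrow> b j"])
       (use b(2) in \<open>simp add: b(1) sum.atMost_Suc_shift sum_distrib_left mult_ac del: sum.atMost_Suc\<close>)
qed

lemma cos_poly_Suc:
  assumes "cos_poly d B f"
  shows "cos_poly (Suc d) B f"
proof -
  obtain b where b: "\<And>x. f x = (\<Sum>k\<le>d. b k * cos x ^ k)" "(\<Sum>k\<le>d. \<bar>b k\<bar>) \<le> B"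
    using assms by (auto simp: cos_poly_def)
  have "(\<Sum>k\<le>d. (if k \<le> d then b k else 0) * cos x ^ k) = (\<Sum>k\<le>d. b k * cos x ^ k)" for x
    by (intro sum.cong) auto
  moreover have "(\<Sum>k\<le>d. \<bar>if k \<le> d then b k else 0\<bar>) = (\<Sum>k\<le>d. \<bar>b k\<bar>)"
    by (intro sum.cong) auto
  ultimately show ?thesis unfolding cos_poly_def
    by (intro exI[of _ "\<lambda>k. if k \<le> d then b k else 0"]) (use b in auto)
qed

lemma cos_poly_le:
  assumes "cos_poly d B f" "d \<le> e"
  shows "cos_poly e B f"
  using assms(2,1) by (induction e rule: dec_induct) (auto intro: cos_poly_Suc)

text \<open>The Chebyshev recursion \<open>cos (n * x) = 2 * cos x * cos ((n - 1) * x) - cos ((n -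
  2) * x)\<close>. The bound is propagated by \<open>2 * 3 + 1 \<le> 9\<close>.\<close>

lemma cos_poly_cos_multiple: "cos_poly n (3 ^ n) (\<lambda>x. cos (real n * x))"
proof (induction n rule: less_induct)
  case (less n)
  show ?case
  proof (cases "n \<ge> 2")
    case False
    then consider "n = 0" | "n = 1" by linarith
    then show ?thesis
    proof cases
      case 1
      then show ?thesis unfolding cos_poly_def by (intro exI[of _ "\<lambda>_. 1"]) simp
    next
      case 2
      then show ?thesis unfolding cos_poly_def by (intro exI[of _ "\<lambda>k. if k = 1 then 1 else 0"]) simp
    qed
  next
    case True
    then obtain m where m: "n = Suc (Suc m)" by (metis add_2_eq_Suc le_Suc_ex)
    have eq: "cos (real n * x) = 2 * (cos x * cos (real (Suc m) * x)) + (-1) * cos (real m * x)" for x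
    proof -
      have "real n * x = real (Suc m) * x + x" "real m * x = real (Suc m) * x - x"
        by (simp_all add: m algebra_simps)
      then show ?thesis by (simp only: cos_add cos_diff) simp
    qed
    have "cos_poly n (\<bar>2\<bar> * 3 ^ Suc m + \<bar>-1\<bar> * 3 ^ m) (\<lambda>x. 2 * (cos x * cos (real (Suc m) * x)) + (-1) * cos (real m * x))"
    proof (intro cos_poly_add cos_poly_cmult)
      show "cos_poly n (3 ^ Suc m) (\<lambda>x. cos x * cos (real (Suc m) * x))"
        unfolding m by (rule cos_poly_times_cos) (use less[of "Suc m"] m in simp)
      show "cos_poly n (3 ^ m) (\<lambda>x. cos (real m * x))"
        by (rule cos_poly_le[OF less[of m]]) (use m in auto)
    qed
    then have "cos_poly n (\<bar>2\<bar> * 3 ^ Suc m + \<bar>-1\<bar> * 3 ^ m) (\<lambda>x. cos (real n * x))" unfolding eq .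
    then show ?thesis by (rule cos_poly_mono) (simp add: m)
  qed
qed

text \<open>The difference is expanded around the end point whose cosine has absolute value at least
  \<open>\<bar>a\<bar>\<close>: there the sine is at most \<open>sqrt (1 - a\<^sup>2)\<close>. This
  produces the improved error near the ends of the interval.\<close>

lemma cos_crossing:
  fixes a u v :: real
  assumes "cos u \<le> a" "a \<le> cos v"
  shows "cos v - cos u \<le> (1 - cos (u - v)) + sqrt (1 - a\<^sup>2) * \<bar>sin (u - v)\<bar>"
proof -
  have sin_le: "\<bar>sin z\<bar> \<le> sqrt (1 - a\<^sup>2)" if "a\<^sup>2 \<le> (cos z)\<^sup>2" for z
    using that by (intro real_le_rsqrt) (simp add: sin_squared_eq)
  show ?thesis
  proof (cases "0 \<le> a")
    case True
    then have "a\<^sup>2 \<le> (cos v)\<^sup>2" using assms by (intro power_mono)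
    note s = sin_le[OF this]
    have "cos u = cos (v + (u - v))" by simp
    then have "cos v - cos u = cos v * (1 - cos (u - v)) + sin v * sin (u - v)"
      unfolding cos_add by (simp add: algebra_simps)
    also have "\<dots> \<le> 1 * (1 - cos (u - v)) + \<bar>sin v * sin (u - v)\<bar>"
      by (intro add_mono mult_right_mono) auto
    also have "\<bar>sin v * sin (u - v)\<bar> \<le> sqrt (1 - a\<^sup>2) * \<bar>sin (u - v)\<bar>"
      unfolding abs_mult by (intro mult_right_mono s) auto
    finally show ?thesis by simp
  next
    case False
    then have "(- a)\<^sup>2 \<le> (- cos u)\<^sup>2" using assms by (intro power_mono) auto
    then have s: "\<bar>sin u\<bar> \<le> sqrt (1 - a\<^sup>2)" by (intro sin_le) simp
    have "cos v = cos (u - (u - v))" by simp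
    then have "cos v - cos u = (- cos u) * (1 - cos (u - v)) + sin u * sin (u - v)"
      unfolding cos_diff by (simp add: algebra_simps)
    also have "\<dots> \<le> 1 * (1 - cos (u - v)) + \<bar>sin u * sin (u - v)\<bar>"
      by (intro add_mono mult_right_mono) (auto simp: minus_le_iff)
    also have "\<bar>sin u * sin (u - v)\<bar> \<le> sqrt (1 - a\<^sup>2) * \<bar>sin (u - v)\<bar>"
      unfolding abs_mult by (intro mult_right_mono s) auto
    finally show ?thesis by simp
  qed
qed

text \<open>A translate of the kernel is not even in \<open>x\<close>; averaging over
  \<open>x\<close> and \<open>- x\<close> removes the sine part, and what remains is a polynomial in
  \<open>cos x\<close>. The frequencies are at most \<open>2 * M\<close>, hence
  \<open>3 ^ (2 * M) = 9 ^ M\<close>.\<close>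

lemma cos_poly_jackson_symmetrized:
  "cos_poly (2 * M) (real M ^ 4 * 9 ^ M) (\<lambda>x. (jackson M (c - x) + jackson M (c + x)) / 2)"
proof -
  have base: "cos_poly (2 * M) (9 ^ M) (\<lambda>x. cos (of_int g * c) * cos (of_int g * x))" if g: "\<bar>g\<bar> \<le> 2 * int M" for g
  proof -
    define n where "n = nat \<bar>g\<bar>"
    have n: "n \<le> 2 * M" using g by (simp add: n_def)
    have "cos (of_int g * x) = cos (real n * x)" for x
      by (cases "g \<ge> 0") (auto simp: n_def)
    moreover have "cos_poly (2 * M) (3 ^ n) (\<lambda>x. cos (real n * x))"
      by (rule cos_poly_le[OF cos_poly_cos_multiple n])
    ultimately have "cos_poly (2 * M) (\<bar>cos (of_int g * c)\<bar> * 3 ^ n) (\<lambda>x. cos (of_int g * c) * cos (of_int g * x))"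
      using cos_poly_cmult by simp
    moreover have "\<bar>cos (of_int g * c)\<bar> * 3 ^ n \<le> 1 * (9::real) ^ M"
    proof (intro mult_mono)
      have "(3::real) ^ n \<le> 3 ^ (2 * M)" using n by (intro power_increasing) auto
      then show "(3::real) ^ n \<le> 9 ^ M" by (simp add: power_mult)
    qed auto
    ultimately show ?thesis unfolding mult_1 by (rule cos_poly_mono)
  qed
  have "cos_poly (2 * M) (\<Sum>k<M. \<Sum>l<M. \<Sum>k'<M. \<Sum>l'<M. \<bar>1 / 2\<bar> * (9 ^ M + 9 ^ M))
    (\<lambda>x. \<Sum>k<M. \<Sum>l<M. \<Sum>k'<M. \<Sum>l'<M. 1 / 2 *
      (cos (of_int ((int k - int l) + (int k' - int l')) * c) * cos (of_int ((int k - int l) + (int k' - int l')) * x)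
     + cos (of_int ((int k - int l) - (int k' - int l')) * c) * cos (of_int ((int k - int l) - (int k' - int l')) * x)))"
    by (intro cos_poly_sum finite_lessThan cos_poly_cmult cos_poly_add base) auto
  moreover have "(\<Sum>k<M. \<Sum>l<M. \<Sum>k'<M. \<Sum>l'<M. \<bar>1 / 2\<bar> * (9 ^ M + 9 ^ M)) = real M ^ 4 * 9 ^ M"
    by (subst sum_four_const) simp
  moreover have "(jackson M (c - x) + jackson M (c + x)) / 2 = (\<Sum>k<M. \<Sum>l<M. \<Sum>k'<M. \<Sum>l'<M. 1 / 2 *
      (cos (of_int ((int k - int l) + (int k' - int l')) * c) * cos (of_int ((int k - int l) + (int k' - int l')) * x)
     + cos (of_int ((int k - int l) - (int k' - int l')) * c) * cos (of_int ((int k - int l) - (int k' - int l')) * x)))" for x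
    unfolding jackson_expand sum.distrib[symmetric] sum_divide_distrib
  proof (intro sum.cong refl)
    have *: "cos (g * (c - x)) + cos (g * (c + x)) = 2 * (cos (g * c) * cos (g * x))" for g :: real
      by (simp add: right_diff_distrib distrib_left cos_add cos_diff)
    have gen: "((A + B) / 2 + (A' + B') / 2) / 2 = 1 / 2 * (P + Q)" if "A + A' = 2 * P" "B + B' = 2 * Q" for A B A' B' P Q :: real
      using that by (simp add: field_simps)
    fix k l k' l' :: nat
    let ?g = "real_of_int ((int k - int l) + (int k' - int l'))" and ?h = "real_of_int ((int k - int l) - (int k' - int l'))"
    show "((cos (?g * (c - x)) + cos (?h * (c - x))) / 2 + (cos (?g * (c + x)) + cos (?h * (c + x))) / 2) / 2
      = 1 / 2 * (cos (?g * c) * cos (?g * x) + cos (?h * c) * cos (?h * x))"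
      by (rule gen) (rule *)+
  qed
  ultimately show ?thesis by (simp only:)
qed

text \<open>Jackson's theorem with the sharper error near the end points: the symmetrized kernel mean of
  \<open>h(\<phi>) = \<bar>cos \<phi> - a\<bar>\<close> over equispaced nodes. The kernel annihilates the odd part of \<open>h\<close> around a point,
  and only nodes on the other side of the kink contribute beyond \<open>1 - cos\<close>.\<close>

lemma abs_polynomial_approx:
  fixes a :: real
  assumes M: "1 \<le> M" and a: "\<bar>a\<bar> \<le> 1"
  obtains b where
    "\<And>t. \<bar>t\<bar> \<le> 1 \<Longrightarrow> \<bar>(\<Sum>k\<le>2 * M. b k * t ^ k) - \<bar>t - a\<bar>\<bar> \<le> 48 / (real M)\<^sup>2 + 12 * sqrt (1 - a\<^sup>2) / real M"
    "(\<Sum>k\<le>2 * M. \<bar>b k\<bar>) \<le> 16 * real M * 9 ^ M"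
proof -
  define N where "N = 4 * M"
  define s where "s = sqrt (1 - a\<^sup>2)"
  have MN: "M \<le> N" "0 < N" "0 < M" "2 * N = 8 * M" using M by (auto simp: N_def)
  have M0: "0 < real M" using M by simp
  have s0: "0 \<le> s" using a by (simp add: s_def abs_square_le_1)
  define T where "T = jackson_mass M N"
  have Tge: "real M ^ 4 \<le> T" using jackson_mass_ge[OF MN(2)] by (simp add: T_def)
  have T0: "0 < T" using Tge M0 by (meson less_le_trans zero_less_power)
  let ?n = "\<lambda>j. real j * (pi / N)"
  define h where "h = (\<lambda>x. \<bar>cos x - a\<bar>)"
  define P where "P = (\<lambda>x. (\<Sum>j<2 * N. h (?n j) * ((jackson M (?n j - x) + jackson M (?n j + x)) / 2)) / T)"
  define E where "E = 48 / (real M)\<^sup>2 + 12 * s / real M"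
  have half: "\<bar>(\<Sum>j<2 * N. h (?n j) * jackson M (?n j + c)) / T - h c\<bar> \<le> E" for c
  proof -
    let ?x = "\<lambda>j. ?n j + c"
    let ?K = "\<lambda>j. jackson M (?x j)"
    define x where "x = - c"
    have hc: "h c = h x" by (simp add: h_def x_def)
    have nx: "?n j = x + ?x j" for j by (simp add: x_def)
    \<comment> \<open>On the side of the kink where \<open>x\<close> lies, \<open>h\<close> is
      linear in the cosine with slope \<sigma>. A node on the other side adds twice its distance
      \<rho> beyond the kink.\<close>
    define \<sigma> :: real where "\<sigma> = (if a \<le> cos x then 1 else -1)"
    define \<rho> where "\<rho> = (\<lambda>j. if a \<le> cos x then max 0 (a - cos (?n j)) else max 0 (cos (?n j) - a))"
    have dec: "h (?n j) - h x = \<sigma> * (cos (?n j) - cos x) + 2 * \<rho> j" for j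
      by (auto simp: h_def \<sigma>_def \<rho>_def max_def abs_if)
    have rho: "0 \<le> \<rho> j" "\<rho> j \<le> (1 - cos (?x j)) + s * \<bar>sin (?x j)\<bar>" for j
    proof -
      show "0 \<le> \<rho> j" by (simp add: \<rho>_def)
      have nn: "0 \<le> (1 - cos (?x j)) + s * \<bar>sin (?x j)\<bar>" using s0 by (intro add_nonneg_nonneg mult_nonneg_nonneg) auto
      have d: "?n j - x = ?x j" "x - ?n j = - ?x j" by (simp_all add: x_def)
      show "\<rho> j \<le> (1 - cos (?x j)) + s * \<bar>sin (?x j)\<bar>"
      proof (cases "a \<le> cos x")
        case True
        show ?thesis
        proof (cases "cos (?n j) \<le> a")
          case True': True
          have "a - cos (?n j) \<le> cos x - cos (?n j)" using True by simp
          also have "\<dots> \<le> (1 - cos (?x j)) + s * \<bar>sin (?x j)\<bar>"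
            using cos_crossing[OF True' True] unfolding d s_def .
          finally show ?thesis using True nn by (simp add: \<rho>_def)
        qed (use True nn in \<open>simp add: \<rho>_def\<close>)
      next
        case False
        show ?thesis
        proof (cases "a \<le> cos (?n j)")
          case True': True
          have "cos (?n j) - a \<le> cos (?n j) - cos x" using False by simp
          also have "\<dots> \<le> (1 - cos (?x j)) + s * \<bar>sin (?x j)\<bar>"
            using cos_crossing[of x a "?n j"] True' False unfolding d(2) cos_minus sin_minus abs_minus_cancel s_def by linarith
          finally show ?thesis using False nn by (simp add: \<rho>_def)
        qed (use False nn in \<open>simp add: \<rho>_def\<close>)
      qed
    qed
    have mass: "(\<Sum>j<2 * N. ?K j) = T" unfolding T_def jackson_mass_def by (rule jackson_node_sum_shift[OF MN(1)])
    have m1: "(\<Sum>j<2 * N. ?K j * (1 - cos (?x j))) \<le> 16 * (real M)\<^sup>2"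
      using jackson_one_minus_cos_sum[OF MN(1), of c] by (simp add: N_def power2_eq_square)
    have m1': "0 \<le> (\<Sum>j<2 * N. ?K j * (1 - cos (?x j)))" by (intro sum_nonneg mult_nonneg_nonneg jackson_nonneg) auto
    have m2: "(\<Sum>j<2 * N. ?K j * sin (?x j)) = 0" by (rule jackson_sin_sum[OF MN(1,3)])
    have m3: "(\<Sum>j<2 * N. ?K j * \<bar>sin (?x j)\<bar>) \<le> sqrt (T * (32 * (real M)\<^sup>2))"
      using jackson_abs_sin_sum[OF MN(1), of c] by (simp add: N_def T_def power2_eq_square mult.assoc)
    \<comment> \<open>The increment of the cosine has a part in \<open>1 - cos\<close> and a part in
      \<open>sin\<close>; the latter has kernel mean zero by \<open>jackson_sin_sum\<close>.\<close>
    have lin: "\<bar>\<Sum>j<2 * N. ?K j * (cos (?n j) - cos x)\<bar> \<le> 16 * (real M)\<^sup>2"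
    proof -
      have "?K j * (cos (?n j) - cos x) = - cos x * (?K j * (1 - cos (?x j))) - sin x * (?K j * sin (?x j))" for j
      proof -
        have "cos (?n j) = cos (x + ?x j)" by (rule arg_cong[OF nx])
        also have "\<dots> = cos x * cos (?x j) - sin x * sin (?x j)" by (rule cos_add)
        finally have e: "cos (?n j) = cos x * cos (?x j) - sin x * sin (?x j)" .
        have gen: "k * (A - B) = - cx * (k * (1 - C)) - sx * (k * D)" if "A = cx * C - sx * D" "B = cx" for k A B cx C sx D :: real
          unfolding that by (simp add: algebra_simps)
        show ?thesis by (rule gen[OF e refl])
      qed
      then have e: "(\<Sum>j<2 * N. ?K j * (cos (?n j) - cos x)) = - cos x * (\<Sum>j<2 * N. ?K j * (1 - cos (?x j)))"
        by (simp only: sum_subtractf sum_distrib_left[symmetric] m2)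
      have "\<bar>cos x\<bar> * (\<Sum>j<2 * N. ?K j * (1 - cos (?x j))) \<le> 1 * (\<Sum>j<2 * N. ?K j * (1 - cos (?x j)))"
        by (rule mult_right_mono[OF abs_cos_le_one m1'])
      then show ?thesis using m1 unfolding e abs_mult abs_minus_cancel abs_of_nonneg[OF m1'] by linarith
    qed
    have quad: "(\<Sum>j<2 * N. ?K j * \<rho> j) \<le> 16 * (real M)\<^sup>2 + s * sqrt (T * (32 * (real M)\<^sup>2))"
    proof -
      have "(\<Sum>j<2 * N. ?K j * \<rho> j) \<le> (\<Sum>j<2 * N. ?K j * (1 - cos (?x j)) + s * (?K j * \<bar>sin (?x j)\<bar>))"
      proof (intro sum_mono)
        fix j
        have "?K j * \<rho> j \<le> ?K j * ((1 - cos (?x j)) + s * \<bar>sin (?x j)\<bar>)"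
          by (intro mult_left_mono rho jackson_nonneg)
        then show "?K j * \<rho> j \<le> ?K j * (1 - cos (?x j)) + s * (?K j * \<bar>sin (?x j)\<bar>)"
          by (simp only: distrib_left mult_ac)
      qed
      also have "\<dots> = (\<Sum>j<2 * N. ?K j * (1 - cos (?x j))) + s * (\<Sum>j<2 * N. ?K j * \<bar>sin (?x j)\<bar>)"
        by (simp only: sum.distrib sum_distrib_left)
      also have "\<dots> \<le> 16 * (real M)\<^sup>2 + s * sqrt (T * (32 * (real M)\<^sup>2))"
        using m1 m3 s0 by (intro add_mono mult_left_mono)
      finally show ?thesis .
    qed
    have quad0: "0 \<le> (\<Sum>j<2 * N. ?K j * \<rho> j)" using rho by (intro sum_nonneg mult_nonneg_nonneg jackson_nonneg)
    have e1: "(\<Sum>j<2 * N. h (?n j) * ?K j) - T * h x = (\<Sum>j<2 * N. ?K j * (h (?n j) - h x))"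
      unfolding mass[symmetric] sum_distrib_right sum_subtractf[symmetric]
      by (intro sum.cong refl) (simp only: right_diff_distrib left_diff_distrib mult.commute)
    have e2: "(\<Sum>j<2 * N. ?K j * (h (?n j) - h x))
      = \<sigma> * (\<Sum>j<2 * N. ?K j * (cos (?n j) - cos x)) + 2 * (\<Sum>j<2 * N. ?K j * \<rho> j)"
      unfolding dec sum_distrib_left sum.distrib[symmetric]
      by (intro sum.cong refl) (simp only: distrib_left distrib_right mult.left_commute)
    have sabs: "\<bar>\<sigma> * A + 2 * B\<bar> \<le> \<bar>A\<bar> + 2 * B" if "0 \<le> B" for A B
      using that by (cases "a \<le> cos x") (auto simp: \<sigma>_def abs_if)
    have "\<bar>(\<Sum>j<2 * N. h (?n j) * ?K j) - T * h x\<bar> \<le> \<bar>\<Sum>j<2 * N. ?K j * (cos (?n j) - cos x)\<bar> + 2 * (\<Sum>j<2 * N. ?K j * \<rho> j)"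
      unfolding e1 e2 by (rule sabs[OF quad0])
    \<comment> \<open>The constant is 16 from the linear part plus twice 16 from the crossing
      part.\<close>
    also have "\<dots> \<le> 48 * (real M)\<^sup>2 + 2 * s * sqrt (T * (32 * (real M)\<^sup>2))" using lin quad by linarith
    also have "\<dots> \<le> T * E"
    proof -
      have "48 * (real M)\<^sup>2 \<le> T * (48 / (real M)\<^sup>2)"
        using Tge M0 by (simp add: field_simps power4_eq_xxxx power2_eq_square)
      moreover have "sqrt (T * (32 * (real M)\<^sup>2)) \<le> 6 * T / real M"
      proof (rule real_le_lsqrt)
        have "T * (32 * (real M)\<^sup>2) * (real M)\<^sup>2 \<le> 36 * T * T"
          using mult_left_mono[OF Tge, of "32 * T"] T0 mult_right_mono[of "32" 36 "T * T"]
          by (simp add: power4_eq_xxxx power2_eq_square mult_ac)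
        then show "T * (32 * (real M)\<^sup>2) \<le> (6 * T / real M)\<^sup>2"
          using M0 by (simp add: power_divide power2_eq_square field_simps)
      qed (use T0 in auto)
      then have "2 * s * sqrt (T * (32 * (real M)\<^sup>2)) \<le> 2 * s * (6 * T / real M)"
        using s0 by (intro mult_left_mono) auto
      then have "2 * s * sqrt (T * (32 * (real M)\<^sup>2)) \<le> T * (12 * s / real M)" by (simp add: mult_ac)
      ultimately show ?thesis unfolding E_def distrib_left by linarith
    qed
    finally have "\<bar>(\<Sum>j<2 * N. h (?n j) * ?K j) - T * h x\<bar> \<le> T * E" .
    then have "\<bar>((\<Sum>j<2 * N. h (?n j) * ?K j) - T * h x) / T\<bar> \<le> E" using T0 by (simp add: divide_le_eq mult.commute)
    then show ?thesis unfolding hc using T0 by (simp add: diff_divide_distrib)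
  qed
  \<comment> \<open>The polynomial averages the kernel means for the shifts \<open>x\<close> and
    \<open>- x\<close>. Each of them is within \<open>E\<close> of the same value because
    \<open>h\<close> is even.\<close>
  have err: "\<bar>P x - h x\<bar> \<le> E" for x
  proof -
    have gen: "(\<Sum>j<2 * N. F j * ((A j + B j) / 2)) / T - z
       = (((\<Sum>j<2 * N. F j * A j) / T - z) + ((\<Sum>j<2 * N. F j * B j) / T - z)) / 2" for F A B :: "nat \<Rightarrow> real" and z
    proof -
      have "(\<Sum>j<2 * N. F j * ((A j + B j) / 2)) = ((\<Sum>j<2 * N. F j * A j) + (\<Sum>j<2 * N. F j * B j)) / 2"
        unfolding sum.distrib[symmetric] sum_divide_distrib by (intro sum.cong refl) (simp add: field_simps)
      then show ?thesis using T0 by (simp add: field_simps)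
    qed
    have hx: "h (- x) = h x" by (simp add: h_def)
    have sh: "?n j - x = ?n j + (- x)" for j by simp
    have avg: "\<bar>(u + v) / 2\<bar> \<le> E" if "\<bar>u\<bar> \<le> E" "\<bar>v\<bar> \<le> E" for u v
    proof -
      have "\<bar>u + v\<bar> \<le> E + E" by (rule order_trans[OF abs_triangle_ineq add_mono[OF that]])
      then show ?thesis by (simp add: abs_divide)
    qed
    have eq: "P x - h x = (((\<Sum>j<2 * N. h (?n j) * jackson M (?n j + (- x))) / T - h (- x))
        + ((\<Sum>j<2 * N. h (?n j) * jackson M (?n j + x)) / T - h x)) / 2"
      unfolding P_def hx sh by (rule gen)
    show ?thesis unfolding eq by (rule avg[OF half half])
  qed
  have "cos_poly (2 * M) (\<bar>1 / T\<bar> * (\<Sum>j<2 * N. \<bar>h (?n j)\<bar> * (real M ^ 4 * 9 ^ M)))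
      (\<lambda>x. 1 / T * (\<Sum>j<2 * N. h (?n j) * ((jackson M (?n j - x) + jackson M (?n j + x)) / 2)))"
    by (intro cos_poly_cmult cos_poly_sum cos_poly_jackson_symmetrized) simp
  then have "cos_poly (2 * M) (16 * real M * 9 ^ M) (\<lambda>x. 1 / T * (\<Sum>j<2 * N. h (?n j) * ((jackson M (?n j - x) + jackson M (?n j + x)) / 2)))"
  proof (rule cos_poly_mono)
    \<comment> \<open>The factor \<open>M ^ 4\<close> of the coefficient bound cancels against the
      normalisation \<open>T \<ge> M ^ 4\<close>; what is left is 2 for each of the
      \<open>8 * M\<close> nodes.\<close>
    have "(\<Sum>j<2 * N. \<bar>h (?n j)\<bar> * (real M ^ 4 * 9 ^ M)) \<le> (\<Sum>j<2 * N. 2 * (T * 9 ^ M))"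
    proof (intro sum_mono mult_mono)
      fix j
      have "\<bar>cos (?n j) - a\<bar> \<le> \<bar>cos (?n j)\<bar> + \<bar>a\<bar>" by (rule abs_triangle_ineq4)
      also have "\<dots> \<le> 1 + 1" by (intro add_mono abs_cos_le_one a)
      finally show "\<bar>h (?n j)\<bar> \<le> 2" by (simp add: h_def)
    qed (use Tge T0 in auto)
    then have "\<bar>1 / T\<bar> * (\<Sum>j<2 * N. \<bar>h (?n j)\<bar> * (real M ^ 4 * 9 ^ M)) \<le> \<bar>1 / T\<bar> * (\<Sum>j<2 * N. 2 * (T * 9 ^ M))"
      by (intro mult_left_mono) auto
    also have "\<dots> = 16 * real M * 9 ^ M" using T0 by (simp add: N_def)
    finally show "\<bar>1 / T\<bar> * (\<Sum>j<2 * N. \<bar>h (?n j)\<bar> * (real M ^ 4 * 9 ^ M)) \<le> 16 * real M * 9 ^ M" .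
  qed
  then obtain b where b: "\<And>x. P x = (\<Sum>k\<le>2 * M. b k * cos x ^ k)" "(\<Sum>k\<le>2 * M. \<bar>b k\<bar>) \<le> 16 * real M * 9 ^ M"
    unfolding cos_poly_def by (auto simp: P_def)
  show thesis
  proof (rule that[of b])
    fix t :: real assume t: "\<bar>t\<bar> \<le> 1"
    then have "cos (arccos t) = t" by (simp add: cos_arccos_abs)
    then show "\<bar>(\<Sum>k\<le>2 * M. b k * t ^ k) - \<bar>t - a\<bar>\<bar> \<le> 48 / (real M)\<^sup>2 + 12 * sqrt (1 - a\<^sup>2) / real M"
      using err[of "arccos t"] b(1)[of "arccos t"] by (simp add: h_def E_def s_def)
  qed (rule b(2))
qed

section \<open>The polynomial estimator\<close>

lemma expect_emp:
  assumes r: "dist_on S r" and n: "n > 0" and x: "x < S"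
  shows "expect S n r (\<lambda>xs. emp xs x) = r x"
proof -
  define \<phi> where "\<phi> = (\<lambda>y. (if y = x then 1 else 0) - r x)"
  have sel: "(\<Sum>i<S. g i * (if i = x then 1 else 0)) = g x" for g :: "nat \<Rightarrow> real"
    using x by (simp add: if_distrib cong: if_cong)
  have one: "(\<Sum>x<S. r x) = 1" using r by (simp add: dist_on_def)
  have m1: "(\<Sum>y<S. r y * \<phi> y) = 0"
    unfolding \<phi>_def right_diff_distrib sum_subtractf sel sum_distrib_right[symmetric] one by simp
  have "emp xs x = 1 / n * sum_list (map \<phi> xs) + r x" if xs: "xs \<in> samples S n" for xs
  proof -
    have "(\<Sum>i<S. \<phi> i * emp xs i) = (\<Sum>i<S. emp xs i * (if i = x then 1 else 0) - r x * emp xs i)"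
      by (intro sum.cong refl) (simp add: \<phi>_def algebra_simps)
    also have "\<dots> = emp xs x - r x"
      unfolding sum_subtractf sel sum_distrib_left[symmetric] using emp_dist_on[OF xs n] by (simp add: dist_on_def)
    finally show ?thesis unfolding emp_sum[OF xs] by simp
  qed
  then have "expect S n r (\<lambda>xs. emp xs x) = expect S n r (\<lambda>xs. 1 / n * sum_list (map \<phi> xs) + r x)"
    by (intro expect_cong) auto
  then show ?thesis
    unfolding expect_plus expect_cmult sum_list_moments(1)[OF r m1] expect_const[OF r] by simp
qed

text \<open>Consecutive blocks of an i.i.d. sample are independent samples. The hypothesis bridges
  two encodings: \<open>take\<close> and \<open>drop\<close> give a list for every \<open>b\<close>,
  while a point of the product space is \<open>undefined\<close> from \<open>L\<close> on.\<close>

lemma expect_blocks: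
  assumes "\<And>\<xi> \<xi>'. (\<And>b. b < L \<Longrightarrow> \<xi> b = \<xi>' b) \<Longrightarrow> f \<xi> = f \<xi>'"
  shows "expect S (L * m) r (\<lambda>zs. f (\<lambda>b. take m (drop (b * m) zs)))
     = prod_exp (samples S m) (\<lambda>_ zs. prod_list (map r zs)) L f"
  using assms
proof (induction L arbitrary: f)
  case 0
  have "f (\<lambda>b. take m (drop (b * m) [])) = f (\<lambda>_. undefined)" by (rule 0) simp
  then show ?case by (simp add: expect_0 prod_exp_0)
next
  case (Suc L)
  have "expect S (Suc L * m) r (\<lambda>zs. f (\<lambda>b. take m (drop (b * m) zs)))
     = expect S (L * m) r (\<lambda>xs. expect S m r (\<lambda>ys. f (\<lambda>b. take m (drop (b * m) (xs @ ys)))))"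
    by (simp only: mult_Suc add.commute[of m] expect_add)
  also have "\<dots> = expect S (L * m) r (\<lambda>xs. expect S m r (\<lambda>ys. f ((\<lambda>b. take m (drop (b * m) xs))(L := ys))))"
  proof (intro expect_cong Suc.prems)
    fix xs ys b assume xs: "xs \<in> samples S (L * m)" and ys: "ys \<in> samples S m" and b: "b < Suc L"
    have l: "length xs = L * m" "length ys = m" using xs ys by (auto simp: samples_def)
    show "take m (drop (b * m) (xs @ ys)) = ((\<lambda>b. take m (drop (b * m) xs))(L := ys)) b"
    proof (cases "b = L")
      case True then show ?thesis using l by simp
    next
      case False
      then have "Suc b * m \<le> L * m" using b by (intro mult_right_mono) auto
      moreover have "b * m \<le> L * m" using b False by (intro mult_right_mono) auto
      ultimately have "m \<le> L * m - b * m" "b * m \<le> L * m" by auto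
      then show ?thesis using False l by simp
    qed
  qed
  also have "\<dots> = (\<Sum>ys\<in>samples S m. prod_list (map r ys) * expect S (L * m) r (\<lambda>xs. f ((\<lambda>b. take m (drop (b * m) xs))(L := ys))))"
    unfolding expect_def[of S m] by (simp only: expect_sum expect_cmult)
  also have "\<dots> = (\<Sum>ys\<in>samples S m. prod_list (map r ys) * prod_exp (samples S m) (\<lambda>_ zs. prod_list (map r zs)) L (\<lambda>\<xi>. f (\<xi>(L := ys))))"
  proof (intro sum.cong refl arg_cong2[where f="(*)"] Suc.IH)
    fix ys and \<xi> \<xi>' :: "nat \<Rightarrow> nat list" assume "\<And>b. b < L \<Longrightarrow> \<xi> b = \<xi>' b"
    then show "f (\<xi>(L := ys)) = f (\<xi>'(L := ys))" by (intro Suc.prems) auto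
  qed
  finally show ?case unfolding prod_exp_Suc .
qed

text \<open>Unbiased estimation of \<open>\<Sum>\<^sub>j a\<^sub>j ((r - c)/W)\<^sup>j\<close>: the \<open>j\<close>-th power is estimated by the product of
  the normalized frequencies of \<open>j\<close> independent blocks. The estimator is affine in each block, so
  the Efron--Stein inequality bounds its variance.\<close>

definition block_estimator :: "nat \<Rightarrow> nat \<Rightarrow> (nat \<Rightarrow> nat \<Rightarrow> real) \<Rightarrow> (nat \<Rightarrow> real) \<Rightarrow> (nat \<Rightarrow> real) \<Rightarrow> (nat \<Rightarrow> nat list) \<Rightarrow> real" where
  "block_estimator S L a c W \<xi> = (\<Sum>i<S. \<Sum>j\<le>L. a i j * (\<Prod>b<j. (emp (\<xi> b) i - c i) / W i))"

text \<open>By \<open>second\<close> every normalised factor has second moment at most 2, so a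
  product of at most \<open>L\<close> of them costs \<open>2 ^ L\<close>. By \<open>coeff\<close>
  the scale \<open>W i\<close> cancels against the normalisation, leaving the weights
  \<open>r i\<close>, which sum to one whatever \<open>S\<close> is.\<close>

lemma block_estimator_error:
  assumes r: "dist_on S r" and m: "m > 0" and W: "\<And>i. i < S \<Longrightarrow> 0 < W i"
    and second: "\<And>i. i < S \<Longrightarrow> (r i - c i)\<^sup>2 + r i / m \<le> 2 * (W i)\<^sup>2"
    and coeff: "\<And>i. i < S \<Longrightarrow> (\<Sum>j\<in>{1..L}. \<bar>a i j\<bar>) \<le> W i * B"
  shows "prod_exp (samples S m) (\<lambda>_ zs. prod_list (map r zs)) L
      (\<lambda>\<xi>. \<bar>block_estimator S L a c W \<xi> - (\<Sum>i<S. \<Sum>j\<le>L. a i j * ((r i - c i) / W i) ^ j)\<bar>)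
     \<le> sqrt (L / m * B\<^sup>2 * 2 ^ L)"
proof -
  let ?X = "samples S m" and ?p = "\<lambda>(_::nat) zs. prod_list (map r zs)"
  let ?E = "prod_exp ?X ?p L"
  define Z where "Z = (\<lambda>i zs. (emp zs i - c i) / W i)"
  define v where "v = (\<lambda>i. (r i - c i) / W i)"
  define f where "f = block_estimator S L a c W"
  define F where "F = (\<Sum>i<S. \<Sum>j\<le>L. a i j * v i ^ j)"
  have w: "is_weight ?X (?p i)" for i by (rule is_weight_samples[OF r])
  have fin: "finite ?X" by (rule finite_samples)
  have f: "f \<xi> = (\<Sum>i<S. \<Sum>j\<le>L. a i j * (\<Prod>b<j. Z i (\<xi> b)))" for \<xi>
    by (simp add: f_def block_estimator_def Z_def)
  have r0: "0 \<le> r i" if "i < S" for i using dist_on_le_1[OF r that] by simp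
  have EZ: "(\<Sum>zs\<in>?X. prod_list (map r zs) * Z i zs) = v i" if i: "i < S" for i
  proof -
    have "expect S m r (\<lambda>zs. 1 / W i * (emp zs i - c i)) = v i"
      unfolding expect_cmult expect_minus expect_emp[OF r m i] expect_const[OF r] by (simp add: v_def)
    then show ?thesis by (simp add: expect_def Z_def)
  qed
  have EZ2: "(\<Sum>zs\<in>?X. prod_list (map r zs) * (Z i zs)\<^sup>2) \<le> 2" "0 \<le> (\<Sum>zs\<in>?X. prod_list (map r zs) * (Z i zs)\<^sup>2)" if i: "i < S" for i
  proof -
    have "(emp zs i - c i)\<^sup>2 = (emp zs i - r i)\<^sup>2 + 2 * (r i - c i) * (emp zs i - r i) + (r i - c i)\<^sup>2" for zs
      by (simp add: power2_eq_square algebra_simps)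
    then have "expect S m r (\<lambda>zs. (emp zs i - c i)\<^sup>2) = r i * (1 - r i) / m + (r i - c i)\<^sup>2"
      by (simp only: expect_plus expect_cmult expect_minus expect_const[OF r] expect_emp[OF r m i] expect_emp_variance[OF r m i]) simp
    also have "\<dots> \<le> r i / m + (r i - c i)\<^sup>2"
      using dist_on_le_1[OF r i] by (intro add_right_mono divide_right_mono) (auto simp: mult_left_le)
    also have "\<dots> \<le> 2 * (W i)\<^sup>2" using second[OF i] by simp
    finally have "1 / (W i)\<^sup>2 * expect S m r (\<lambda>zs. (emp zs i - c i)\<^sup>2) \<le> 1 / (W i)\<^sup>2 * (2 * (W i)\<^sup>2)"
      by (intro mult_left_mono) auto
    also have "\<dots> = 2" using W[OF i] by simp
    finally show "(\<Sum>zs\<in>?X. prod_list (map r zs) * (Z i zs)\<^sup>2) \<le> 2"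
      unfolding expect_cmult[symmetric] by (simp add: expect_def Z_def power_divide)
    show "0 \<le> (\<Sum>zs\<in>?X. prod_list (map r zs) * (Z i zs)\<^sup>2)"
      using is_weightD(2)[OF is_weight_samples[OF r]] by (intro sum_nonneg mult_nonneg_nonneg) auto
  qed
  have mean: "?E f = F"
  proof -
    have "?E f = (\<Sum>i<S. \<Sum>j\<le>L. a i j * ?E (\<lambda>\<xi>. \<Prod>b<j. Z i (\<xi> b)))"
      unfolding f by (simp only: prod_exp_sum prod_exp_cmult)
    also have "\<dots> = F" unfolding F_def
    proof (intro sum.cong refl arg_cong2[where f="(*)"])
      fix i j assume ij: "i \<in> {..<S}" "j \<in> {..L}"
      then have "?E (\<lambda>\<xi>. \<Prod>b\<in>{..<j}. Z i (\<xi> b)) = (\<Prod>b\<in>{..<j}. \<Sum>zs\<in>?X. prod_list (map r zs) * Z i zs)"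
        by (intro prod_exp_prod_subset[OF fin w]) auto
      then show "?E (\<lambda>\<xi>. \<Prod>b<j. Z i (\<xi> b)) = v i ^ j" using ij EZ[of i] by simp
    qed
    finally show ?thesis .
  qed
  define Bk where "Bk = (\<lambda>k \<xi> i. \<Sum>j\<in>{Suc k..L}. a i j * (\<Prod>b\<in>{..<j} - {k}. Z i (\<xi> b)))"
  define d where "d = (\<lambda>k \<xi>. (\<Sum>i<S. \<Sum>j\<le>L. a i j * (\<Prod>b<j. if b = k then v i else Z i (\<xi> b))))"
  \<comment> \<open>Replacing block \<open>k\<close> by its mean is the predictor. The remaining
    difference is one linear functional of the frequencies of that block, so
    \<open>expect_emp_deviation_le\<close> treats all symbols jointly, including their
    dependence.\<close>
  have step: "f (\<xi>(k := zs)) - d k \<xi> = (\<Sum>i<S. Bk k \<xi> i / W i * (emp zs i - r i))" if k: "k < L" for k \<xi> zs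
  proof -
    have "f (\<xi>(k := zs)) - d k \<xi>
       = (\<Sum>i<S. \<Sum>j\<le>L. a i j * ((\<Prod>b<j. if b = k then Z i zs else Z i (\<xi> b)) - (\<Prod>b<j. if b = k then v i else Z i (\<xi> b))))"
      unfolding f d_def sum_subtractf[symmetric] right_diff_distrib[symmetric]
      by (intro sum.cong refl arg_cong2[where f="(*)"] arg_cong2[where f="(-)"] prod.cong) auto
    also have "\<dots> = (\<Sum>i<S. Bk k \<xi> i / W i * (emp zs i - r i))"
    proof (intro sum.cong refl)
      fix i assume "i \<in> {..<S}"
      have pull: "(\<Prod>b<j. if b = k then z else Z i (\<xi> b)) = (if k < j then z * (\<Prod>b\<in>{..<j} - {k}. Z i (\<xi> b)) else (\<Prod>b<j. Z i (\<xi> b)))" for j z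
      proof (cases "k < j")
        case True
        then have "(\<Prod>b<j. if b = k then z else Z i (\<xi> b)) = z * (\<Prod>b\<in>{..<j} - {k}. if b = k then z else Z i (\<xi> b))"
          by (subst prod.remove[of _ k]) auto
        also have "(\<Prod>b\<in>{..<j} - {k}. if b = k then z else Z i (\<xi> b)) = (\<Prod>b\<in>{..<j} - {k}. Z i (\<xi> b))"
          by (intro prod.cong) auto
        finally show ?thesis using True by simp
      next
        case False
        then show ?thesis by (auto intro!: prod.cong)
      qed
      have zv: "Z i zs - v i = (emp zs i - r i) / W i" by (simp add: Z_def v_def diff_divide_distrib)
      have "(\<Sum>j\<le>L. a i j * ((\<Prod>b<j. if b = k then Z i zs else Z i (\<xi> b)) - (\<Prod>b<j. if b = k then v i else Z i (\<xi> b))))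
          = (\<Sum>j\<le>L. if k < j then (Z i zs - v i) * (a i j * (\<Prod>b\<in>{..<j} - {k}. Z i (\<xi> b))) else 0)"
        unfolding pull by (intro sum.cong refl) (simp add: algebra_simps)
      also have "\<dots> = (\<Sum>j\<in>{Suc k..L}. (Z i zs - v i) * (a i j * (\<Prod>b\<in>{..<j} - {k}. Z i (\<xi> b))))"
        by (rule sum.mono_neutral_cong_right) auto
      also have "\<dots> = Bk k \<xi> i / W i * (emp zs i - r i)"
        unfolding sum_distrib_left[symmetric] zv by (simp add: Bk_def)
      finally show "(\<Sum>j\<le>L. a i j * ((\<Prod>b<j. if b = k then Z i zs else Z i (\<xi> b)) - (\<Prod>b<j. if b = k then v i else Z i (\<xi> b))))
          = Bk k \<xi> i / W i * (emp zs i - r i)" by (simp add: Bk_def)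
    qed
    finally show ?thesis .
  qed
  have EB: "?E (\<lambda>\<xi>. (Bk k \<xi> i)\<^sup>2) \<le> (W i * B)\<^sup>2 * 2 ^ L" if i: "i < S" for k i
  proof -
    let ?A = "\<Sum>j\<in>{Suc k..L}. \<bar>a i j\<bar>"
    let ?Pr = "\<lambda>j \<xi>. \<Prod>b\<in>{..<j} - {k}. Z i (\<xi> b)"
    have A0: "0 \<le> ?A" by (intro sum_nonneg) auto
    have "?A \<le> (\<Sum>j\<in>{1..L}. \<bar>a i j\<bar>)" by (intro sum_mono2) auto
    then have A: "?A \<le> W i * B" using coeff[OF i] by linarith
    have EP: "?E (\<lambda>\<xi>. (?Pr j \<xi>)\<^sup>2) \<le> 2 ^ L" if j: "j \<le> L" for j
    proof -
      have "?E (\<lambda>\<xi>. (?Pr j \<xi>)\<^sup>2) = ?E (\<lambda>\<xi>. \<Prod>b\<in>{..<j} - {k}. (Z i (\<xi> b))\<^sup>2)" by (simp add: prod_power_distrib)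
      also have "\<dots> = (\<Prod>b\<in>{..<j} - {k}. \<Sum>zs\<in>?X. prod_list (map r zs) * (Z i zs)\<^sup>2)"
        using j by (intro prod_exp_prod_subset[OF fin w]) auto
      also have "\<dots> = (\<Sum>zs\<in>?X. prod_list (map r zs) * (Z i zs)\<^sup>2) ^ card ({..<j} - {k})" by simp
      also have "\<dots> \<le> 2 ^ card ({..<j} - {k})" using EZ2[OF i] by (intro power_mono) auto
      also have "\<dots> \<le> 2 ^ L"
      proof (intro power_increasing)
        have "card ({..<j} - {k}) \<le> card {..<j}" by (intro card_mono) auto
        then show "card ({..<j} - {k}) \<le> L" using j by simp
      qed simp
      finally show ?thesis .
    qed
    \<comment> \<open>Cauchy-Schwarz with the weights \<open>\<bar>a i j\<bar>\<close>; the signs of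
      the coefficients are moved into the products.\<close>
    have "?E (\<lambda>\<xi>. (Bk k \<xi> i)\<^sup>2) \<le> ?E (\<lambda>\<xi>. ?A * (\<Sum>j\<in>{Suc k..L}. \<bar>a i j\<bar> * (?Pr j \<xi>)\<^sup>2))"
    proof (intro prod_exp_mono w fin)
      fix \<xi>
      have "Bk k \<xi> i = (\<Sum>j\<in>{Suc k..L}. \<bar>a i j\<bar> * (sgn (a i j) * ?Pr j \<xi>))"
        unfolding Bk_def by (intro sum.cong refl) (simp add: mult.assoc[symmetric] mult.commute[of "\<bar>_\<bar>"] sgn_mult_abs)
      then have "(Bk k \<xi> i)\<^sup>2 \<le> ?A * (\<Sum>j\<in>{Suc k..L}. \<bar>a i j\<bar> * (sgn (a i j) * ?Pr j \<xi>)\<^sup>2)"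
        using weighted_sum_square_le[of "{Suc k..L}" "\<lambda>j. \<bar>a i j\<bar>" "\<lambda>j. sgn (a i j) * ?Pr j \<xi>"] by simp
      also have "\<dots> \<le> ?A * (\<Sum>j\<in>{Suc k..L}. \<bar>a i j\<bar> * (?Pr j \<xi>)\<^sup>2)"
      proof (intro mult_left_mono sum_mono A0)
        fix j
        have "(sgn (a i j))\<^sup>2 \<le> 1" by (simp add: sgn_if)
        then have "(sgn (a i j))\<^sup>2 * (?Pr j \<xi>)\<^sup>2 \<le> 1 * (?Pr j \<xi>)\<^sup>2" by (intro mult_right_mono) auto
        then show "(sgn (a i j) * ?Pr j \<xi>)\<^sup>2 \<le> (?Pr j \<xi>)\<^sup>2" by (simp add: power_mult_distrib)
      qed auto
      finally show "(Bk k \<xi> i)\<^sup>2 \<le> ?A * (\<Sum>j\<in>{Suc k..L}. \<bar>a i j\<bar> * (?Pr j \<xi>)\<^sup>2)" .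
    qed
    also have "\<dots> = ?A * (\<Sum>j\<in>{Suc k..L}. \<bar>a i j\<bar> * ?E (\<lambda>\<xi>. (?Pr j \<xi>)\<^sup>2))"
      by (simp only: prod_exp_cmult prod_exp_sum)
    also have "\<dots> \<le> ?A * (\<Sum>j\<in>{Suc k..L}. \<bar>a i j\<bar> * 2 ^ L)"
      using EP by (intro mult_left_mono sum_mono A0) auto
    also have "\<dots> = ?A * ?A * 2 ^ L" by (simp only: sum_distrib_right[symmetric] mult.assoc)
    also have "\<dots> \<le> (W i * B) * (W i * B) * 2 ^ L" using mult_mono[OF A A order_trans[OF A0 A] A0] by (intro mult_right_mono) auto
    finally show ?thesis by (simp add: power2_eq_square)
  qed
  have var: "?E (\<lambda>\<xi>. (f \<xi>)\<^sup>2) - (?E f)\<^sup>2 \<le> L / m * B\<^sup>2 * 2 ^ L"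
  proof -
    have "?E (\<lambda>\<xi>. (f \<xi>)\<^sup>2) - (?E f)\<^sup>2 \<le> (\<Sum>k<L. ?E (\<lambda>\<xi>. \<Sum>zs\<in>?X. prod_list (map r zs) * (f (\<xi>(k := zs)) - d k \<xi>)\<^sup>2))"
      by (rule efron_stein[OF w fin])
    also have "\<dots> \<le> (\<Sum>k<L. B\<^sup>2 * 2 ^ L / m)"
    proof (rule sum_mono)
      fix k assume k: "k \<in> {..<L}"
      have "?E (\<lambda>\<xi>. \<Sum>zs\<in>?X. prod_list (map r zs) * (f (\<xi>(k := zs)) - d k \<xi>)\<^sup>2)
         \<le> ?E (\<lambda>\<xi>. 1 / m * (\<Sum>i<S. r i / (W i)\<^sup>2 * (Bk k \<xi> i)\<^sup>2))"
      proof (intro prod_exp_mono w fin)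
        fix \<xi>
        have "(\<Sum>zs\<in>?X. prod_list (map r zs) * (f (\<xi>(k := zs)) - d k \<xi>)\<^sup>2)
           = expect S m r (\<lambda>zs. (\<Sum>i<S. Bk k \<xi> i / W i * (emp zs i - r i))\<^sup>2)"
          using k by (simp add: step expect_def)
        also have "\<dots> \<le> (\<Sum>i<S. r i * (Bk k \<xi> i / W i)\<^sup>2) / m" by (rule expect_emp_deviation_le[OF r m])
        also have "\<dots> = 1 / m * (\<Sum>i<S. r i / (W i)\<^sup>2 * (Bk k \<xi> i)\<^sup>2)" by (simp add: power_divide)
        finally show "(\<Sum>zs\<in>?X. prod_list (map r zs) * (f (\<xi>(k := zs)) - d k \<xi>)\<^sup>2)
           \<le> 1 / m * (\<Sum>i<S. r i / (W i)\<^sup>2 * (Bk k \<xi> i)\<^sup>2)" .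
      qed
      also have "\<dots> = 1 / m * (\<Sum>i<S. r i / (W i)\<^sup>2 * ?E (\<lambda>\<xi>. (Bk k \<xi> i)\<^sup>2))"
        by (simp only: prod_exp_cmult prod_exp_sum)
      also have "\<dots> \<le> 1 / m * (\<Sum>i<S. r i / (W i)\<^sup>2 * ((W i * B)\<^sup>2 * 2 ^ L))"
        using EB r0 by (intro mult_left_mono sum_mono) auto
      also have "(\<Sum>i<S. r i / (W i)\<^sup>2 * ((W i * B)\<^sup>2 * 2 ^ L)) = (\<Sum>i<S. r i * (B\<^sup>2 * 2 ^ L))"
      proof (intro sum.cong refl)
        fix i assume "i \<in> {..<S}"
        then have "W i \<noteq> 0" using W[of i] by simp
        then show "r i / (W i)\<^sup>2 * ((W i * B)\<^sup>2 * 2 ^ L) = r i * (B\<^sup>2 * 2 ^ L)" by (simp add: power_mult_distrib)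
      qed
      also have "1 / m * (\<Sum>i<S. r i * (B\<^sup>2 * 2 ^ L)) = B\<^sup>2 * 2 ^ L / m"
        using r by (simp add: sum_distrib_right[symmetric] dist_on_def)
      finally show "?E (\<lambda>\<xi>. \<Sum>zs\<in>?X. prod_list (map r zs) * (f (\<xi>(k := zs)) - d k \<xi>)\<^sup>2) \<le> B\<^sup>2 * 2 ^ L / m" .
    qed
    also have "\<dots> = L / m * B\<^sup>2 * 2 ^ L" by simp
    finally show ?thesis .
  qed
  have "?E (\<lambda>\<xi>. \<bar>f \<xi> - F\<bar>) \<le> sqrt (?E (\<lambda>\<xi>. (f \<xi> - F)\<^sup>2))" by (rule prod_exp_abs_le_sqrt[OF w fin])
  also have "?E (\<lambda>\<xi>. (f \<xi> - F)\<^sup>2) = ?E (\<lambda>\<xi>. (f \<xi>)\<^sup>2) - (?E f)\<^sup>2"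
  proof -
    have "(f \<xi> - F)\<^sup>2 = (f \<xi>)\<^sup>2 - 2 * F * f \<xi> + F\<^sup>2" for \<xi> by (simp add: power2_eq_square algebra_simps)
    then have "?E (\<lambda>\<xi>. (f \<xi> - F)\<^sup>2) = ?E (\<lambda>\<xi>. (f \<xi>)\<^sup>2) - 2 * F * ?E f + F\<^sup>2"
      by (simp only: prod_exp_add prod_exp_diff prod_exp_cmult prod_exp_const[OF w fin])
    then show ?thesis unfolding mean by (simp add: power2_eq_square)
  qed
  also have "sqrt (?E (\<lambda>\<xi>. (f \<xi>)\<^sup>2) - (?E f)\<^sup>2) \<le> sqrt (L / m * B\<^sup>2 * 2 ^ L)" by (rule real_sqrt_le_mono[OF var])
  finally show ?thesis unfolding f_def F_def v_def .
qed

section \<open>Chernoff bounds and the preliminary decision on the sign\<close>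

lemma chernoff_upper:
  assumes r: "dist_on S r" and n: "n > 0" and x: "x < S" and u: "r x \<le> u" "u \<le> B" and t: "0 \<le> t" "t \<le> B" and B: "0 < B"
  shows "expect S n r (\<lambda>xs. if u + t \<le> emp xs x then 1 else 0) \<le> exp (- (n * t\<^sup>2 / (4 * B)))"
proof -
  \<comment> \<open>The slope minimises the exponent \<open>n * (B * l\<^sup>2 - l * t)\<close>,
    which is quadratic in \<open>l\<close> thanks to
    \<open>exp l - 1 \<le> l + l\<^sup>2\<close>.\<close>
  define l where "l = t / (2 * B)"
  have l: "0 \<le> l" "l \<le> 1" using t B by (auto simp: l_def field_simps)
  have r0: "0 \<le> r x" using dist_on_le_1[OF r x] by simp
  have "expect S n r (\<lambda>xs. if u + t \<le> emp xs x then 1 else 0)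
     \<le> expect S n r (\<lambda>xs. exp (- (l * n * (u + t))) * exp (l * real (count_list xs x)))"
  proof (intro expect_mono[OF r])
    fix xs assume xs: "xs \<in> samples S n"
    show "(if u + t \<le> emp xs x then 1 else 0) \<le> exp (- (l * n * (u + t))) * exp (l * real (count_list xs x))"
    proof (cases "u + t \<le> emp xs x")
      case True
      then have "n * (u + t) \<le> count_list xs x" using xs n by (simp add: emp_def samples_def field_simps)
      then have "l * (n * (u + t)) \<le> l * count_list xs x" using l by (intro mult_left_mono) auto
      then show ?thesis using True by (simp add: exp_add[symmetric] mult.assoc)
    qed simp
  qed
  also have "\<dots> = exp (- (l * n * (u + t))) * (1 + r x * (exp l - 1)) ^ n"
    unfolding expect_cmult expect_exp_count[OF r x] ..
  also have "\<dots> \<le> exp (- (l * n * (u + t))) * exp (n * (u * l + B * l\<^sup>2))"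
  proof (intro mult_left_mono)
    have "exp l - 1 \<le> l + l\<^sup>2" using exp_bound[OF l] by simp
    then have "r x * (exp l - 1) \<le> u * (l + l\<^sup>2)" using u r0 l by (intro mult_mono) auto
    also have "\<dots> \<le> u * l + B * l\<^sup>2" using u by (simp add: distrib_left mult_right_mono)
    finally have "1 + r x * (exp l - 1) \<le> exp (u * l + B * l\<^sup>2)"
      using exp_ge_add_one_self[of "u * l + B * l\<^sup>2"] by linarith
    then have "(1 + r x * (exp l - 1)) ^ n \<le> exp (u * l + B * l\<^sup>2) ^ n"
      using r0 l by (intro power_mono) auto
    then show "(1 + r x * (exp l - 1)) ^ n \<le> exp (n * (u * l + B * l\<^sup>2))" by (simp add: exp_of_nat_mult)
  qed simp
  also have "\<dots> = exp (- (n * t\<^sup>2 / (4 * B)))"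
    using B by (simp add: exp_add[symmetric] l_def field_simps power2_eq_square)
  finally show ?thesis .
qed

lemma chernoff_lower:
  assumes r: "dist_on S r" and n: "n > 0" and x: "x < S" and u: "u \<le> r x" "u \<le> B" "0 \<le> u" and t: "0 \<le> t" "t \<le> B" and B: "0 < B"
  shows "expect S n r (\<lambda>xs. if emp xs x \<le> u - t then 1 else 0) \<le> exp (- (n * t\<^sup>2 / (4 * B)))"
proof -
  define l where "l = t / (2 * B)"
  have l: "0 \<le> l" "l \<le> 1" using t B by (auto simp: l_def field_simps)
  have r0: "0 \<le> r x" "r x \<le> 1" using dist_on_le_1[OF r x] by auto
  have el: "exp (- l) - 1 \<le> - l + l\<^sup>2"
  proof -
    have "exp (- l) \<le> 1 / (1 + l)" using exp_ge_add_one_self[of l] l by (simp add: exp_minus field_simps)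
    also have "\<dots> \<le> 1 - l + l\<^sup>2" using l by (simp add: field_simps power2_eq_square)
    finally show ?thesis by simp
  qed
  have "expect S n r (\<lambda>xs. if emp xs x \<le> u - t then 1 else 0)
     \<le> expect S n r (\<lambda>xs. exp (l * n * (u - t)) * exp (- l * real (count_list xs x)))"
  proof (intro expect_mono[OF r])
    fix xs assume xs: "xs \<in> samples S n"
    show "(if emp xs x \<le> u - t then 1 else 0) \<le> exp (l * n * (u - t)) * exp (- l * real (count_list xs x))"
    proof (cases "emp xs x \<le> u - t")
      case True
      then have "count_list xs x \<le> n * (u - t)" using xs n by (simp add: emp_def samples_def field_simps)
      then have "l * count_list xs x \<le> l * (n * (u - t))" using l by (intro mult_left_mono) auto
      then show ?thesis using True by (simp add: exp_add[symmetric] mult.assoc)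
    qed simp
  qed
  also have "\<dots> = exp (l * n * (u - t)) * (1 + r x * (exp (- l) - 1)) ^ n"
    unfolding expect_cmult expect_exp_count[OF r x] ..
  also have "\<dots> \<le> exp (l * n * (u - t)) * exp (n * (- u * l + B * l\<^sup>2))"
  proof (intro mult_left_mono)
    have "r x * (exp (- l) - 1) \<le> u * (exp (- l) - 1)" using u l by (intro mult_right_mono_neg) auto
    also have "\<dots> \<le> u * (- l + l\<^sup>2)" using u el by (intro mult_left_mono) auto
    also have "\<dots> \<le> - u * l + B * l\<^sup>2"
      using mult_right_mono[OF u(2), of "l\<^sup>2"] by (simp add: algebra_simps)
    finally have "1 + r x * (exp (- l) - 1) \<le> exp (- u * l + B * l\<^sup>2)"
      using exp_ge_add_one_self[of "- u * l + B * l\<^sup>2"] by linarith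
    moreover have "0 \<le> 1 + r x * (exp (- l) - 1)"
      using mult_left_mono[of "-1" "exp (- l) - 1" "r x"] r0 by simp
    ultimately have "(1 + r x * (exp (- l) - 1)) ^ n \<le> exp (- u * l + B * l\<^sup>2) ^ n"
      by (intro power_mono) auto
    then show "(1 + r x * (exp (- l) - 1)) ^ n \<le> exp (n * (- u * l + B * l\<^sup>2))" by (simp add: exp_of_nat_mult)
  qed simp
  also have "\<dots> = exp (- (n * t\<^sup>2 / (4 * B)))"
    using B by (simp add: exp_add[symmetric] l_def field_simps power2_eq_square)
  finally show ?thesis .
qed

lemma R_EST_le:
  assumes q: "dist_on S q" and bound: "\<And>r. dist_on S r \<Longrightarrow> expect S n r (\<lambda>xs. \<bar>Uh xs - bayes_err S q r\<bar>) \<le> C"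
  shows "R_EST S q n \<le> C"
proof -
  have "R_EST S q n \<le> (SUP r\<in>{r. dist_on S r}. expect S n r (\<lambda>xs. \<bar>Uh xs - bayes_err S q r\<bar>))"
    unfolding R_EST_def
  proof (rule cINF_lower)
    show "bdd_below ((\<lambda>Uh. SUP r\<in>{r. dist_on S r}. expect S n r (\<lambda>xs. \<bar>Uh xs - bayes_err S q r\<bar>)) ` UNIV)"
    proof (rule bdd_belowI2[where m=0])
      fix Uh :: "nat list \<Rightarrow> real"
      \<comment> \<open>The infimum and supremum are taken in the reals and must be shown bounded.
        For a fixed \<open>Uh\<close> the loss is bounded because there are finitely many
        samples.\<close>
      define K where "K = (\<Sum>xs\<in>samples S n. \<bar>Uh xs\<bar>) + 1"
      have "0 \<le> expect S n q (\<lambda>xs. \<bar>Uh xs - bayes_err S q q\<bar>)" by (intro expect_nonneg[OF q]) simp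
      also have "\<dots> \<le> (SUP r\<in>{r. dist_on S r}. expect S n r (\<lambda>xs. \<bar>Uh xs - bayes_err S q r\<bar>))"
      proof (rule cSUP_upper)
        show "bdd_above ((\<lambda>r. expect S n r (\<lambda>xs. \<bar>Uh xs - bayes_err S q r\<bar>)) ` {r. dist_on S r})"
        proof (rule bdd_aboveI2[where M=K])
          fix r assume "r \<in> {r. dist_on S r}"
          then have r: "dist_on S r" by simp
          show "expect S n r (\<lambda>xs. \<bar>Uh xs - bayes_err S q r\<bar>) \<le> K"
          proof (rule expect_le_const[OF r])
            fix xs assume "xs \<in> samples S n"
            then have "\<bar>Uh xs\<bar> \<le> (\<Sum>xs\<in>samples S n. \<bar>Uh xs\<bar>)"
              by (intro member_le_sum) (auto simp: finite_samples)
            then show "\<bar>Uh xs - bayes_err S q r\<bar> \<le> K"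
              using dist_on_emp_bayes_range[OF q r] by (simp add: K_def abs_if split: if_splits)
          qed
        qed
      qed (use q in simp)
      finally show "0 \<le> (SUP r\<in>{r. dist_on S r}. expect S n r (\<lambda>xs. \<bar>Uh xs - bayes_err S q r\<bar>))" .
    qed
  qed simp
  also have "\<dots> \<le> C" by (rule cSUP_least) (use q bound in auto)
  finally show ?thesis .
qed

lemma R_EST_le_1: "dist_on S q \<Longrightarrow> R_EST S q n \<le> 1"
proof (rule R_EST_le[where Uh="\<lambda>_. 0"], assumption)
  fix r assume q: "dist_on S q" and r: "dist_on S r"
  show "expect S n r (\<lambda>xs. \<bar>0 - bayes_err S q r\<bar>) \<le> 1"
    using dist_on_emp_bayes_range[OF q r] by (intro expect_le_const[OF r]) simp
qed

text \<open>With \<Delta> of order \<open>ln n / n\<close> this is the deviation scale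
  \<open>sqrt (q * ln n / n)\<close> of the frequency of a symbol, floored at \<Delta> for light
  symbols.\<close>

definition radius :: "real \<Rightarrow> real \<Rightarrow> real" where
  "radius \<Delta> q = sqrt (\<Delta> * max q \<Delta>)"

lemma radius_facts:
  assumes "0 < \<Delta>" "0 \<le> q"
  shows "(radius \<Delta> q)\<^sup>2 = \<Delta> * max q \<Delta>" "\<Delta> \<le> radius \<Delta> q" "radius \<Delta> q \<le> max q \<Delta>" "0 < radius \<Delta> q"
    "\<Delta> / 12 \<le> (radius \<Delta> q)\<^sup>2 / (4 * (q + 2 * radius \<Delta> q))"
proof -
  have p: "0 \<le> \<Delta> * max q \<Delta>" using assms by simp
  show sq: "(radius \<Delta> q)\<^sup>2 = \<Delta> * max q \<Delta>" unfolding radius_def using p by simp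
  have "\<Delta>\<^sup>2 \<le> \<Delta> * max q \<Delta>" using assms by (simp add: power2_eq_square)
  then show ge: "\<Delta> \<le> radius \<Delta> q" unfolding radius_def by (rule real_le_rsqrt)
  then show pos: "0 < radius \<Delta> q" using assms by simp
  have "\<Delta> * max q \<Delta> \<le> (max q \<Delta>)\<^sup>2" using assms by (simp add: power2_eq_square mult_right_mono)
  then show le: "radius \<Delta> q \<le> max q \<Delta>" unfolding radius_def using assms by (intro real_le_lsqrt) auto
  have "4 * (q + 2 * radius \<Delta> q) \<le> 12 * max q \<Delta>" using le by simp
  then have "\<Delta> * (4 * (q + 2 * radius \<Delta> q)) \<le> \<Delta> * (12 * max q \<Delta>)" using assms by (intro mult_left_mono) auto
  moreover have "0 < 4 * (q + 2 * radius \<Delta> q)" using pos assms by simp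
  ultimately show "\<Delta> / 12 \<le> (radius \<Delta> q)\<^sup>2 / (4 * (q + 2 * radius \<Delta> q))"
    unfolding sq by (simp only: pos_le_divide_eq)
qed

text \<open>A wrong decision at one symbol: the first half of the sample declares \<open>r > q\<close>, \<open>r < q\<close> or \<open>r\<close> near
  \<open>q\<close>, and each declaration must be (weakly) correct.\<close>

definition misled :: "real \<Rightarrow> real \<Rightarrow> real \<Rightarrow> real \<Rightarrow> bool" where
  "misled \<Delta> q r e \<longleftrightarrow> (q + radius \<Delta> q < e \<and> r < q) \<or> (e < q - radius \<Delta> q \<and> q < r)
     \<or> (q - radius \<Delta> q \<le> e \<and> e \<le> q + radius \<Delta> q \<and> (r < q - 2 * radius \<Delta> q \<or> q + 2 * radius \<Delta> q < r))"

text \<open>The event splits into four one-sided ones, each a deviation by at least \<open>t\<close>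
  from a bound on \<open>r x\<close>. A common variance proxy \<open>B = q + 2 * t\<close> serves
  all four, and \<open>radius_facts\<close> turns \<open>t\<^sup>2 / (4 * B)\<close> into
  \<open>\<Delta> / 12\<close>.\<close>

lemma misled_probability:
  fixes n :: nat and q \<Delta> :: real
  assumes r: "dist_on S r" and n: "n > 0" and x: "x < S" and q: "0 \<le> q" and \<Delta>: "0 < \<Delta>"
  shows "expect S n r (\<lambda>xs. if misled \<Delta> q (r x) (emp xs x) then 1 else 0) \<le> 4 * exp (- (n * \<Delta> / 12))"
proof -
  define t where "t = radius \<Delta> q"
  define B where "B = q + 2 * t"
  note R = radius_facts[OF \<Delta> q, folded t_def]
  have B: "0 < B" "q \<le> B" "t \<le> B" using R(4) q by (auto simp: B_def)
  have r0: "0 \<le> r x" using dist_on_le_1[OF r x] by simp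
  let ?e = "exp (- (n * \<Delta> / 12))"
  have bnd: "exp (- (n * t\<^sup>2 / (4 * B))) \<le> ?e"
    using mult_left_mono[OF R(5), of n] by (simp add: B_def)
  define I where "I = (\<lambda>P. if P then 1 else 0 :: real)"
  have 1: "expect S n r (\<lambda>xs. I (q + t < emp xs x \<and> r x < q)) \<le> ?e"
  proof (cases "r x < q")
    case True
    have "expect S n r (\<lambda>xs. I (q + t < emp xs x \<and> r x < q)) \<le> expect S n r (\<lambda>xs. if q + t \<le> emp xs x then 1 else 0)"
      by (intro expect_mono[OF r]) (auto simp: I_def)
    also have "\<dots> \<le> exp (- (n * t\<^sup>2 / (4 * B)))"
      using True R B by (intro chernoff_upper[OF r n x]) auto
    finally show ?thesis using bnd by (rule order_trans)
  qed (simp add: I_def expect_const[OF r])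
  have 2: "expect S n r (\<lambda>xs. I (emp xs x < q - t \<and> q < r x)) \<le> ?e"
  proof (cases "q < r x")
    case True
    have "expect S n r (\<lambda>xs. I (emp xs x < q - t \<and> q < r x)) \<le> expect S n r (\<lambda>xs. if emp xs x \<le> q - t then 1 else 0)"
      by (intro expect_mono[OF r]) (auto simp: I_def)
    also have "\<dots> \<le> exp (- (n * t\<^sup>2 / (4 * B)))"
      using True R B q by (intro chernoff_lower[OF r n x]) auto
    finally show ?thesis using bnd by (rule order_trans)
  qed (simp add: I_def expect_const[OF r])
  have 3: "expect S n r (\<lambda>xs. I (q - t \<le> emp xs x \<and> r x < q - 2 * t)) \<le> ?e"
  proof (cases "r x < q - 2 * t")
    case True
    have "expect S n r (\<lambda>xs. I (q - t \<le> emp xs x \<and> r x < q - 2 * t)) \<le> expect S n r (\<lambda>xs. if (q - 2 * t) + t \<le> emp xs x then 1 else 0)"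
      by (intro expect_mono[OF r]) (auto simp: I_def)
    also have "\<dots> \<le> exp (- (n * t\<^sup>2 / (4 * B)))"
      using True R B by (intro chernoff_upper[OF r n x]) auto
    finally show ?thesis using bnd by (rule order_trans)
  qed (simp add: I_def expect_const[OF r])
  have 4: "expect S n r (\<lambda>xs. I (emp xs x \<le> q + t \<and> q + 2 * t < r x)) \<le> ?e"
  proof (cases "q + 2 * t < r x")
    case True
    have "expect S n r (\<lambda>xs. I (emp xs x \<le> q + t \<and> q + 2 * t < r x)) \<le> expect S n r (\<lambda>xs. if emp xs x \<le> (q + 2 * t) - t then 1 else 0)"
      by (intro expect_mono[OF r]) (auto simp: I_def)
    also have "\<dots> \<le> exp (- (n * t\<^sup>2 / (4 * B)))"
      using True R B q by (intro chernoff_lower[OF r n x]) (auto simp: B_def)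
    finally show ?thesis using bnd by (rule order_trans)
  qed (simp add: I_def expect_const[OF r])
  have "expect S n r (\<lambda>xs. if misled \<Delta> q (r x) (emp xs x) then 1 else 0)
     \<le> expect S n r (\<lambda>xs. I (q + t < emp xs x \<and> r x < q) + I (emp xs x < q - t \<and> q < r x)
        + I (q - t \<le> emp xs x \<and> r x < q - 2 * t) + I (emp xs x \<le> q + t \<and> q + 2 * t < r x))"
    by (intro expect_mono[OF r]) (auto simp: misled_def I_def t_def)
  also have "\<dots> \<le> 4 * ?e" unfolding expect_plus using 1 2 3 4 by linarith
  finally show ?thesis .
qed

text \<open>\<open>abs_polynomial_approx\<close> transported from the interval
  \<open>[-1, 1]\<close>. Clipping the left end at 0 puts a light \<open>q\<close> close to that
  end, where the approximation is better.\<close>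

lemma local_abs_approx:
  fixes M :: nat and q \<Delta> :: real
  assumes q: "0 \<le> q" and \<Delta>: "0 < \<Delta>" and M: "1 \<le> M"
  defines "l \<equiv> max 0 (q - 2 * radius \<Delta> q)" and "u \<equiv> q + 2 * radius \<Delta> q"
  obtains b where
    "\<And>x. l \<le> x \<Longrightarrow> x \<le> u \<Longrightarrow> \<bar>(\<Sum>j\<le>2 * M. (u - l) / 2 * b j * ((x - (u + l) / 2) / ((u - l) / 2)) ^ j) - \<bar>x - q\<bar>\<bar>
       \<le> 96 * radius \<Delta> q / (real M)\<^sup>2 + 24 * sqrt (q * \<Delta>) / real M"
    "(\<Sum>j\<le>2 * M. \<bar>b j\<bar>) \<le> 16 * real M * 9 ^ M"
proof -
  note R = radius_facts[OF \<Delta> q]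
  define W where "W = (u - l) / 2"
  define c where "c = (u + l) / 2"
  have W0: "0 < W" using R(4) q by (auto simp: W_def l_def u_def)
  have lq: "l \<le> q" "q \<le> u" using R(4) q by (auto simp: l_def u_def)
  define a where "a = (q - c) / W"
  have nm: "\<bar>(x - c) / W\<bar> \<le> 1" if "l \<le> x" "x \<le> u" for x
  proof -
    have "x - c \<le> W" "- (x - c) \<le> W" using that unfolding c_def W_def by (simp_all add: field_simps)
    then have "\<bar>x - c\<bar> \<le> W" by (simp only: abs_le_iff)
    then show ?thesis using W0 by (simp add: abs_divide)
  qed
  have a: "\<bar>a\<bar> \<le> 1" unfolding a_def by (rule nm[OF lq])
  obtain b where b: "\<And>t. \<bar>t\<bar> \<le> 1 \<Longrightarrow> \<bar>(\<Sum>k\<le>2 * M. b k * t ^ k) - \<bar>t - a\<bar>\<bar> \<le> 48 / (real M)\<^sup>2 + 12 * sqrt (1 - a\<^sup>2) / real M"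
    "(\<Sum>k\<le>2 * M. \<bar>b k\<bar>) \<le> 16 * real M * 9 ^ M"
    using abs_polynomial_approx[OF M a] by blast
  \<comment> \<open>The rescaled \<open>sqrt (1 - a\<^sup>2)\<close> is the geometric mean of the
    distances from \<open>q\<close> to the two ends of the interval.\<close>
  have Ws: "W * sqrt (1 - a\<^sup>2) \<le> 2 * sqrt (q * \<Delta>)"
  proof -
    have "W * sqrt (1 - a\<^sup>2) = sqrt (W\<^sup>2 * (1 - a\<^sup>2))" using W0 by (simp add: real_sqrt_mult)
    also have "W\<^sup>2 * (1 - a\<^sup>2) = (q - l) * (u - q)"
    proof -
      have "W\<^sup>2 * (1 - a\<^sup>2) = W\<^sup>2 - (q - c)\<^sup>2" using W0 by (simp add: a_def power_divide right_diff_distrib)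
      also have "\<dots> = (q - l) * (u - q)" by (simp add: W_def c_def power2_eq_square field_simps)
      finally show ?thesis .
    qed
    also have "sqrt ((q - l) * (u - q)) \<le> sqrt (4 * (q * \<Delta>))"
    proof (rule real_sqrt_le_mono)
      have uq: "u - q = 2 * radius \<Delta> q" by (simp add: u_def)
      show "(q - l) * (u - q) \<le> 4 * (q * \<Delta>)"
      proof (cases "q \<le> \<Delta>")
        case True
        then have "radius \<Delta> q = \<Delta>" using \<Delta> by (simp add: radius_def max_def)
        then have "(q - l) * (u - q) \<le> q * (2 * \<Delta>)" unfolding uq using \<Delta> lq by (intro mult_mono) (auto simp: l_def)
        then show ?thesis using mult_nonneg_nonneg[OF q less_imp_le[OF \<Delta>]] by simp
      next
        case False
        have "(q - l) * (u - q) \<le> (2 * radius \<Delta> q) * (2 * radius \<Delta> q)"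
          unfolding uq using R(4) by (intro mult_right_mono) (auto simp: l_def)
        also have "\<dots> = 4 * (radius \<Delta> q)\<^sup>2" by (simp add: power2_eq_square)
        also have "\<dots> = 4 * (q * \<Delta>)" unfolding R(1) using False by (simp add: max_def)
        finally show ?thesis .
      qed
    qed
    also have "\<dots> = 2 * sqrt (q * \<Delta>)" by (simp only: real_sqrt_mult real_sqrt_four)
    finally show ?thesis .
  qed
  have Wt: "W \<le> 2 * radius \<Delta> q" by (simp add: W_def l_def u_def)
  show thesis
  proof (rule that[of b])
    fix x assume x: "l \<le> x" "x \<le> u"
    define y where "y = (x - c) / W"
    have y: "\<bar>y\<bar> \<le> 1" unfolding y_def by (rule nm[OF x])
    have "\<bar>x - q\<bar> = W * \<bar>y - a\<bar>"
    proof -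
      have "x - q = W * (y - a)" using W0 by (simp add: y_def a_def field_simps)
      then show ?thesis using W0 by (simp add: abs_mult)
    qed
    then have "(\<Sum>j\<le>2 * M. W * b j * y ^ j) - \<bar>x - q\<bar> = W * ((\<Sum>j\<le>2 * M. b j * y ^ j) - \<bar>y - a\<bar>)"
      by (simp add: sum_distrib_left right_diff_distrib mult.assoc)
    then have "\<bar>(\<Sum>j\<le>2 * M. W * b j * y ^ j) - \<bar>x - q\<bar>\<bar> = W * \<bar>(\<Sum>j\<le>2 * M. b j * y ^ j) - \<bar>y - a\<bar>\<bar>"
      using W0 by (simp add: abs_mult)
    also have "\<dots> \<le> W * (48 / (real M)\<^sup>2 + 12 * sqrt (1 - a\<^sup>2) / real M)"
      using b(1)[OF y] W0 by (intro mult_left_mono) auto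
    also have "\<dots> = 48 * W / (real M)\<^sup>2 + 12 * (W * sqrt (1 - a\<^sup>2)) / real M" by (simp add: distrib_left mult_ac)
    also have "\<dots> \<le> 48 * (2 * radius \<Delta> q) / (real M)\<^sup>2 + 12 * (2 * sqrt (q * \<Delta>)) / real M"
      using Wt Ws by (intro add_mono divide_right_mono mult_left_mono) auto
    finally show "\<bar>(\<Sum>j\<le>2 * M. (u - l) / 2 * b j * ((x - (u + l) / 2) / ((u - l) / 2)) ^ j) - \<bar>x - q\<bar>\<bar>
       \<le> 96 * radius \<Delta> q / (real M)\<^sup>2 + 24 * sqrt (q * \<Delta>) / real M"
      by (simp add: W_def c_def y_def)
  qed (rule b(2))
qed

text \<open>With \<open>M\<close> of order \<open>ln n\<close> and \<Delta> of order
  \<open>ln n / n\<close>, the quotient \<open>\<Delta> / M\<^sup>2\<close> has the order of \<tau>,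
  which stands for \<open>1 / (n * ln n)\<close>. The constant is \<open>96 + 24\<close>.\<close>

lemma local_bias_le_rate:
  fixes M :: nat and q \<Delta> \<tau> C0 :: real
  assumes q: "\<tau> \<le> q" and \<tau>: "0 < \<tau>" and \<Delta>: "0 < \<Delta>" and M: "1 \<le> M" and C0: "1 \<le> C0" and small: "\<Delta> \<le> C0 * (real M)\<^sup>2 * \<tau>"
  shows "96 * radius \<Delta> q / (real M)\<^sup>2 + 24 * sqrt (q * \<Delta>) / real M \<le> 120 * C0 * sqrt (q * \<tau>)"
proof -
  have q0: "0 < q" using q \<tau> by simp
  have M1: "1 \<le> real M" using M by simp
  have A: "sqrt (q * \<Delta>) / real M \<le> C0 * sqrt (q * \<tau>)"
  proof -
    have "sqrt (q * \<Delta>) \<le> sqrt (q * (C0\<^sup>2 * (real M)\<^sup>2 * \<tau>))"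
    proof (intro real_sqrt_le_mono mult_left_mono)
      have "C0 * ((real M)\<^sup>2 * \<tau>) \<le> C0\<^sup>2 * ((real M)\<^sup>2 * \<tau>)"
        using C0 \<tau> by (intro mult_right_mono) (auto simp: power2_eq_square)
      then show "\<Delta> \<le> C0\<^sup>2 * (real M)\<^sup>2 * \<tau>" using small by (simp add: mult_ac)
    qed (use q0 in simp)
    also have "\<dots> = C0 * real M * sqrt (q * \<tau>)" using C0 by (simp add: real_sqrt_mult)
    finally show ?thesis using M1 by (simp add: divide_le_eq mult_ac)
  qed
  have B: "radius \<Delta> q / (real M)\<^sup>2 \<le> C0 * sqrt (q * \<tau>)"
  proof (cases "q \<le> \<Delta>")
    case True
    then have "radius \<Delta> q / (real M)\<^sup>2 = \<Delta> / (real M)\<^sup>2" using \<Delta> by (simp add: radius_def max_def)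
    also have "\<dots> \<le> C0 * \<tau>" using small M1 by (simp add: divide_le_eq mult_ac)
    also have "\<tau> \<le> sqrt (q * \<tau>)" using q \<tau> by (intro real_le_rsqrt) (simp add: power2_eq_square mult_right_mono)
    finally show ?thesis using C0 by (simp add: mult_left_mono)
  next
    case False
    then have "radius \<Delta> q / (real M)\<^sup>2 = sqrt (q * \<Delta>) / (real M)\<^sup>2" by (simp add: radius_def max_def mult.commute)
    also have "\<dots> \<le> sqrt (q * \<Delta>) / real M"
      using M1 q0 \<Delta> by (intro divide_left_mono) (auto simp: power2_eq_square)
    finally show ?thesis using A by simp
  qed
  show ?thesis using A B by simp
qed

text \<open>The three terms are a union bound over wrong decisions, the bias of the local
  polynomials, and the standard deviation of the block estimator. Given the decisions, the second
  stage is an unbiased estimate of a fixed polynomial expression in \<open>r\<close>, because it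
  uses fresh observations.\<close>

lemma R_EST_upper:
  fixes M m n n1 :: nat and \<Delta> \<tau> C0 :: real
  assumes q: "dist_on S q" and M: "1 \<le> M" and m: "0 < m" and n1: "0 < n1" and n: "n1 + 2 * M * m \<le> n"
    and \<tau>: "\<tau> = 1 / (real n * ln (real n))" "0 < \<tau>" and \<Delta>: "0 < \<Delta>" and C0: "1 \<le> C0"
    and small: "\<Delta> \<le> C0 * (real M)\<^sup>2 * \<tau>" and large: "3 \<le> \<Delta> * m"
  shows "R_EST S q n \<le> 2 * real S * exp (- (n1 * \<Delta> / 12)) + 30 * C0 * rate_est S q n
     + sqrt (real (2 * M) / m * (16 * real M * 9 ^ M)\<^sup>2 * 2 ^ (2 * M))"
proof -
  define L where "L = 2 * M"
  define B where "B = 16 * real M * 9 ^ M"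
  have B1: "1 \<le> B"
  proof -
    have "1 * 1 \<le> (16 * real M) * (9 ^ M)" using M by (intro mult_mono) auto
    then show ?thesis by (simp add: B_def)
  qed
  have q0: "0 \<le> q i" if "i < S" for i using dist_on_le_1[OF q that] by simp
  define t where "t = (\<lambda>i. radius \<Delta> (q i))"
  define lo where "lo = (\<lambda>i. max 0 (q i - 2 * t i))"
  define hi where "hi = (\<lambda>i. q i + 2 * t i)"
  define P where "P = (\<lambda>i b. (\<forall>x. lo i \<le> x \<longrightarrow> x \<le> hi i \<longrightarrow>
       \<bar>(\<Sum>j\<le>L. (hi i - lo i) / 2 * b j * ((x - (hi i + lo i) / 2) / ((hi i - lo i) / 2)) ^ j) - \<bar>x - q i\<bar>\<bar>
       \<le> 96 * t i / (real M)\<^sup>2 + 24 * sqrt (q i * \<Delta>) / real M) \<and> (\<Sum>j\<le>L. \<bar>b j\<bar>) \<le> B)"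
  have "\<forall>i\<in>{..<S}. \<exists>b. P i b"
  proof
    fix i assume "i \<in> {..<S}"
    then have i: "i < S" by simp
    show "\<exists>b. P i b"
    proof (rule local_abs_approx[OF q0[OF i] \<Delta> M], goal_cases)
      case (1 b)
      have "P i b" unfolding P_def lo_def hi_def t_def L_def B_def
        using 1 by (intro conjI allI impI)
      then show ?case by (rule exI[of _ b])
    qed
  qed
  from bchoice[OF this] obtain pb where P: "\<forall>i\<in>{..<S}. P i (pb i)" by blast
  have pb: "\<bar>(\<Sum>j\<le>L. (hi i - lo i) / 2 * pb i j * ((x - (hi i + lo i) / 2) / ((hi i - lo i) / 2)) ^ j) - \<bar>x - q i\<bar>\<bar>
       \<le> 96 * t i / (real M)\<^sup>2 + 24 * sqrt (q i * \<Delta>) / real M" if "i < S" "lo i \<le> x" "x \<le> hi i" for i x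
    using P that unfolding P_def by blast
  have pb2: "(\<Sum>j\<le>L. \<bar>pb i j\<bar>) \<le> B" if "i < S" for i
    using P that unfolding P_def by blast
  \<comment> \<open>The value 0 stands for "near \<open>q\<close>". Symbols lighter than \<tau>
    always receive the sign 1: replacing \<open>\<bar>r - q\<bar>\<close> by \<open>r - q\<close>
    errs by at most \<open>2 * q\<close>, which is within the rate there.\<close>
  define st :: "nat list \<Rightarrow> nat \<Rightarrow> real" where
    "st = (\<lambda>ys i. if q i < \<tau> \<or> q i + t i < emp ys i then 1 else if emp ys i < q i - t i then -1 else 0)"
  \<comment> \<open>A decided symbol is cast into the same form, as the degree-one polynomial
    \<open>st * (r - q)\<close> with scale 1, so that one block estimator covers both cases.\<close>
  define c where "c = (\<lambda>ys i. if st ys i = 0 then (hi i + lo i) / 2 else q i)"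
  define W where "W = (\<lambda>ys i. if st ys i = 0 then (hi i - lo i) / 2 else 1)"
  define a where "a = (\<lambda>ys i j. if st ys i = 0 then (hi i - lo i) / 2 * pb i j else if j = 1 then st ys i else 0)"
  define est where "est = (\<lambda>ys. block_estimator S L (a ys) (c ys) (W ys))"
  define blk where "blk = (\<lambda>(zs::nat list) b. take m (drop (b * m) zs))"
  \<comment> \<open>The distance lies between 0 and 2; truncation to this range limits the damage of
    a wrong decision.\<close>
  define Uh where "Uh = (\<lambda>xs. 1 / 2 - 1 / 4 * min 2 (max 0 (est (take n1 xs) (blk (drop n1 xs)))))"
  define E0 where "E0 = sqrt (real (2 * M) / m * (16 * real M * 9 ^ M)\<^sup>2 * 2 ^ (2 * M))"
  have E0: "E0 = sqrt (L / m * B\<^sup>2 * 2 ^ L)" "0 \<le> E0" by (simp_all add: E0_def L_def B_def)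
  have local: "est ys \<xi> = est ys \<xi>'" if "\<And>b. b < L \<Longrightarrow> \<xi> b = \<xi>' b" for ys \<xi> \<xi>'
    unfolding est_def block_estimator_def using that
    by (intro sum.cong refl arg_cong2[where f="(*)"] prod.cong) auto
  have "expect S n r (\<lambda>xs. \<bar>Uh xs - bayes_err S q r\<bar>)
      \<le> 2 * real S * exp (- (n1 * \<Delta> / 12)) + 30 * C0 * rate_est S q n + E0" if r: "dist_on S r" for r
  proof -
    have r0: "0 \<le> r i" "r i \<le> 1" if "i < S" for i using dist_on_le_1[OF r that] by auto
    define F where "F = (\<Sum>i<S. \<bar>r i - q i\<bar>)"
    have bF: "bayes_err S q r = 1 / 2 - 1 / 4 * F" by (simp add: bayes_err_def F_def)
    have F: "0 \<le> F" "F \<le> 2" using dist_on_emp_bayes_range[OF q r] by (auto simp: bF)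
    define bad where "bad = (\<lambda>ys. \<exists>i<S. misled \<Delta> (q i) (r i) (emp ys i))"
    define G where "G = (\<lambda>ys \<xi>. min 2 (max 0 (est ys \<xi>)))"
    have Gr: "0 \<le> G ys \<xi>" "G ys \<xi> \<le> 2" for ys \<xi> by (auto simp: G_def)
    have GF: "\<bar>G ys \<xi> - F\<bar> \<le> 2" for ys \<xi> using Gr[of ys \<xi>] F unfolding abs_le_iff by linarith
    have main: "prod_exp (samples S m) (\<lambda>_ zs. prod_list (map r zs)) L (\<lambda>\<xi>. \<bar>G ys \<xi> - F\<bar>)
        \<le> 2 * (if bad ys then 1 else 0) + 120 * C0 * rate_est S q n + E0" for ys
    proof (cases "bad ys")
      case True
      have "prod_exp (samples S m) (\<lambda>_ zs. prod_list (map r zs)) L (\<lambda>\<xi>. \<bar>G ys \<xi> - F\<bar>)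
         \<le> prod_exp (samples S m) (\<lambda>_ zs. prod_list (map r zs)) L (\<lambda>\<xi>. 2)"
        by (rule prod_exp_mono[OF is_weight_samples[OF r] finite_samples GF])
      also have "\<dots> = 2" by (intro prod_exp_const is_weight_samples[OF r] finite_samples)
      finally have le2: "prod_exp (samples S m) (\<lambda>_ zs. prod_list (map r zs)) L (\<lambda>\<xi>. \<bar>G ys \<xi> - F\<bar>) \<le> 2" .
      have "0 \<le> rate_est S q n" unfolding rate_est_def using q0 \<tau>
        by (intro sum_nonneg) (auto intro!: divide_nonneg_nonneg simp: zero_less_mult_iff less_imp_le)
      then have "0 \<le> 120 * C0 * rate_est S q n" using C0 by simp
      then show ?thesis using le2 True E0(2) by simp
    next
      case False
      then have ok: "\<not> misled \<Delta> (q i) (r i) (emp ys i)" if "i < S" for i using that by (auto simp: bad_def)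
      define F' where "F' = (\<Sum>i<S. \<Sum>j\<le>L. a ys i j * ((r i - c ys i) / W ys i) ^ j)"
      have tt: "(t i)\<^sup>2 = \<Delta> * max (q i) \<Delta>" "\<Delta> \<le> t i" "t i \<le> max (q i) \<Delta>" "0 < t i" if "i < S" for i
        using radius_facts[OF \<Delta> q0[OF that]] by (auto simp: t_def)
      have hl: "t i \<le> (hi i - lo i) / 2" if "i < S" for i using tt[OF that] q0[OF that] by (auto simp: hi_def lo_def)
      have near: "lo i \<le> r i" "r i \<le> hi i" if i: "i < S" and s0: "st ys i = 0" for i
      proof -
        have "q i - t i \<le> emp ys i" "emp ys i \<le> q i + t i" using s0 by (auto simp: st_def split: if_splits)
        then show "lo i \<le> r i" "r i \<le> hi i" using ok[OF i] r0[OF i] by (auto simp: misled_def t_def lo_def hi_def)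
      qed
      have err: "prod_exp (samples S m) (\<lambda>_ zs. prod_list (map r zs)) L (\<lambda>\<xi>. \<bar>est ys \<xi> - F'\<bar>) \<le> E0"
        unfolding E0 est_def F'_def
      proof (rule block_estimator_error[OF r m])
        fix i assume i: "i < S"
        show W0: "0 < W ys i" using hl[OF i] tt[OF i] by (auto simp: W_def)
        show "(r i - c ys i)\<^sup>2 + r i / m \<le> 2 * (W ys i)\<^sup>2"
        proof (cases "st ys i = 0")
          case True
          have "\<bar>r i - (hi i + lo i) / 2\<bar> \<le> (hi i - lo i) / 2" using near[OF i True] by (auto simp: abs_le_iff field_simps)
          then have "\<bar>r i - c ys i\<bar> \<le> W ys i" using True by (simp add: c_def W_def)
          then have 1: "(r i - c ys i)\<^sup>2 \<le> (W ys i)\<^sup>2" by (metis abs_ge_zero power2_abs power_mono)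
          \<comment> \<open>This is the purpose of \<open>large\<close>: a near symbol has
            \<open>r i \<le> 3 * max (q i) \<Delta>\<close>, so a block length with
            \<open>\<Delta> * m \<ge> 3\<close> keeps the sampling variance \<open>r i / m\<close>
            below the squared scale.\<close>
          have "r i * \<Delta> \<le> 3 * (t i)\<^sup>2"
          proof -
            have "r i \<le> 3 * max (q i) \<Delta>" using near[OF i True] tt[OF i] by (simp add: hi_def)
            then have "r i * \<Delta> \<le> 3 * max (q i) \<Delta> * \<Delta>" using \<Delta> by (intro mult_right_mono) auto
            then show ?thesis unfolding tt(1)[OF i] by (simp add: mult_ac)
          qed
          also have "\<dots> \<le> (\<Delta> * m) * (t i)\<^sup>2" using large by (intro mult_right_mono) auto
          finally have "\<Delta> * r i \<le> \<Delta> * (m * (t i)\<^sup>2)" by (simp add: mult_ac)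
          then have "r i / m \<le> (t i)\<^sup>2" using \<Delta> m by (simp add: divide_le_eq mult_ac)
          also have "\<dots> \<le> (W ys i)\<^sup>2" using hl[OF i] tt[OF i] True by (intro power_mono) (auto simp: W_def)
          finally show ?thesis using 1 by simp
        next
          case False
          have "\<bar>r i - q i\<bar> \<le> 1" using r0[OF i] dist_on_le_1[OF q i] by (auto simp: abs_le_iff)
          then have "(r i - q i)\<^sup>2 \<le> 1" by (simp add: abs_square_le_1)
          moreover have "r i / m \<le> 1" using r0[OF i] m by (simp add: divide_le_eq)
          ultimately show ?thesis using False by (simp add: c_def W_def)
        qed
        show "(\<Sum>j\<in>{1..L}. \<bar>a ys i j\<bar>) \<le> W ys i * B"
        proof (cases "st ys i = 0")
          case True
          have "(\<Sum>j\<in>{1..L}. \<bar>a ys i j\<bar>) = W ys i * (\<Sum>j\<in>{1..L}. \<bar>pb i j\<bar>)"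
            using True W0 by (simp add: a_def W_def abs_mult sum_distrib_left)
          also have "\<dots> \<le> W ys i * (\<Sum>j\<le>L. \<bar>pb i j\<bar>)" using W0 by (intro mult_left_mono sum_mono2) auto
          also have "\<dots> \<le> W ys i * B" using W0 pb2[OF i] by (intro mult_left_mono) auto
          finally show ?thesis .
        next
          case False
          have "(\<Sum>j\<in>{1..L}. \<bar>a ys i j\<bar>) = (\<Sum>j\<in>{1..L}. if j = 1 then \<bar>st ys i\<bar> else 0)"
            using False by (intro sum.cong) (auto simp: a_def)
          also have "\<dots> \<le> 1" by (simp add: st_def)
          finally show ?thesis using False B1 by (simp add: W_def)
        qed
      qed
      have bias: "\<bar>F' - F\<bar> \<le> 120 * C0 * rate_est S q n"
      proof -
        have "\<bar>F' - F\<bar> \<le> (\<Sum>i<S. \<bar>(\<Sum>j\<le>L. a ys i j * ((r i - c ys i) / W ys i) ^ j) - \<bar>r i - q i\<bar>\<bar>)"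
          unfolding F'_def F_def sum_subtractf[symmetric] by (rule sum_abs)
        also have "\<dots> \<le> (\<Sum>i<S. 120 * C0 * min (q i) (sqrt (q i / (real n * ln (real n)))))"
        proof (rule sum_mono)
          fix i assume "i \<in> {..<S}"
          then have i: "i < S" by simp
          have qt: "sqrt (q i / (real n * ln (real n))) = sqrt (q i * \<tau>)" by (simp add: \<tau>(1))
          show "\<bar>(\<Sum>j\<le>L. a ys i j * ((r i - c ys i) / W ys i) ^ j) - \<bar>r i - q i\<bar>\<bar> \<le> 120 * C0 * min (q i) (sqrt (q i / (real n * ln (real n))))"
          proof (cases "st ys i = 0")
            case True
            then have qi: "\<tau> \<le> q i" by (auto simp: st_def split: if_splits)
            have "q i * \<tau> \<le> (q i)\<^sup>2" using qi q0[OF i] by (simp add: power2_eq_square mult_left_mono)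
            then have "sqrt (q i * \<tau>) \<le> q i" using q0[OF i] by (simp add: real_le_lsqrt)
            then have mn: "min (q i) (sqrt (q i / (real n * ln (real n)))) = sqrt (q i * \<tau>)" unfolding qt by simp
            have "\<bar>(\<Sum>j\<le>L. a ys i j * ((r i - c ys i) / W ys i) ^ j) - \<bar>r i - q i\<bar>\<bar>
               \<le> 96 * t i / (real M)\<^sup>2 + 24 * sqrt (q i * \<Delta>) / real M"
              using pb[OF i near[OF i True]] True by (simp add: a_def c_def W_def)
            also have "\<dots> \<le> 120 * C0 * sqrt (q i * \<tau>)"
              unfolding t_def by (rule local_bias_le_rate[OF qi \<tau>(2) \<Delta> M C0 small])
            finally show ?thesis unfolding mn .
          next
            case False
            have lin: "(\<Sum>j\<le>L. a ys i j * ((r i - c ys i) / W ys i) ^ j) = st ys i * (r i - q i)"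
            proof -
              have "(\<Sum>j\<le>L. a ys i j * ((r i - c ys i) / W ys i) ^ j) = (\<Sum>j\<le>L. if j = 1 then st ys i * (r i - q i) else 0)"
                using False by (intro sum.cong) (auto simp: a_def c_def W_def)
              then show ?thesis using M by (simp add: L_def)
            qed
            have C: "2 \<le> 120 * C0" using C0 by simp
            show ?thesis
            proof (cases "q i < \<tau>")
              case True
              have "(q i)\<^sup>2 \<le> q i * \<tau>" using True q0[OF i] by (simp add: power2_eq_square mult_left_mono)
              then have "q i \<le> sqrt (q i * \<tau>)" by (rule real_le_rsqrt)
              then have mn: "min (q i) (sqrt (q i / (real n * ln (real n)))) = q i" unfolding qt by simp
              have "st ys i = 1" using True by (simp add: st_def)
              then have "\<bar>st ys i * (r i - q i) - \<bar>r i - q i\<bar>\<bar> \<le> 2 * q i" using r0[OF i] q0[OF i] by (simp add: abs_if)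
              also have "\<dots> \<le> 120 * C0 * q i" using C q0[OF i] by (intro mult_right_mono)
              finally show ?thesis unfolding lin mn .
            next
              case nt: False
              have rt: "radius \<Delta> (q i) = t i" by (simp add: t_def)
              have "st ys i * (r i - q i) = \<bar>r i - q i\<bar>"
                using False nt ok[OF i] tt(4)[OF i] unfolding misled_def rt by (auto simp: st_def split: if_splits)
              then show ?thesis unfolding lin using C0 q0[OF i] \<tau> qt by simp
            qed
          qed
        qed
        also have "\<dots> = 120 * C0 * rate_est S q n" by (simp add: rate_est_def sum_distrib_left)
        finally show ?thesis .
      qed
      have "prod_exp (samples S m) (\<lambda>_ zs. prod_list (map r zs)) L (\<lambda>\<xi>. \<bar>G ys \<xi> - F\<bar>)
         \<le> prod_exp (samples S m) (\<lambda>_ zs. prod_list (map r zs)) L (\<lambda>\<xi>. \<bar>est ys \<xi> - F'\<bar> + \<bar>F' - F\<bar>)"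
      proof (intro prod_exp_mono is_weight_samples[OF r] finite_samples)
        fix \<xi>
        have "\<bar>G ys \<xi> - F\<bar> \<le> \<bar>est ys \<xi> - F\<bar>" using F by (auto simp: G_def min_def max_def)
        also have "\<dots> \<le> \<bar>est ys \<xi> - F'\<bar> + \<bar>F' - F\<bar>" by linarith
        finally show "\<bar>G ys \<xi> - F\<bar> \<le> \<bar>est ys \<xi> - F'\<bar> + \<bar>F' - F\<bar>" .
      qed
      also have "\<dots> \<le> E0 + 120 * C0 * rate_est S q n"
        unfolding prod_exp_add prod_exp_const[OF is_weight_samples[OF r] finite_samples] using err bias by linarith
      finally show ?thesis using False by simp
    qed
    \<comment> \<open>Observations left over after the blocks are ignored.\<close>
    define rest where "rest = n - n1 - L * m"
    have ns: "n = n1 + (L * m + rest)" using n by (simp add: rest_def L_def)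
    have sp: "expect S n r (\<lambda>xs. \<bar>Uh xs - bayes_err S q r\<bar>)
       = expect S n1 r (\<lambda>ys. expect S (L * m) r (\<lambda>zs. 1 / 4 * \<bar>G ys (blk zs) - F\<bar>))"
    proof -
      have "expect S n r (\<lambda>xs. \<bar>Uh xs - bayes_err S q r\<bar>)
         = expect S n1 r (\<lambda>ys. expect S (L * m) r (\<lambda>zs. expect S rest r (\<lambda>ws. \<bar>Uh (ys @ zs @ ws) - bayes_err S q r\<bar>)))"
        by (subst ns) (simp only: expect_add)
      also have "\<dots> = expect S n1 r (\<lambda>ys. expect S (L * m) r (\<lambda>zs. expect S rest r (\<lambda>ws. 1 / 4 * \<bar>G ys (blk zs) - F\<bar>)))"
      proof (intro expect_cong)
        fix ys zs ws assume ys: "ys \<in> samples S n1" and zs: "zs \<in> samples S (L * m)"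
        have l: "length ys = n1" "length zs = L * m" using ys zs by (auto simp: samples_def)
        have "est ys (blk (zs @ ws)) = est ys (blk zs)"
        proof (rule local)
          fix b assume b: "b < L"
          then have "Suc b * m \<le> L * m" by (intro mult_right_mono) auto
          then have "m + b * m \<le> length zs" using l by simp
          then show "blk (zs @ ws) b = blk zs b" by (simp add: blk_def)
        qed
        then have "Uh (ys @ zs @ ws) = 1 / 2 - 1 / 4 * G ys (blk zs)" using l by (simp add: Uh_def G_def)
        then have e: "Uh (ys @ zs @ ws) - bayes_err S q r = - ((1 / 4) * (G ys (blk zs) - F))" by (simp add: bF field_simps)
        show "\<bar>Uh (ys @ zs @ ws) - bayes_err S q r\<bar> = 1 / 4 * \<bar>G ys (blk zs) - F\<bar>"
          unfolding e abs_minus_cancel abs_mult by simp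
      qed
      finally show ?thesis by (simp only: expect_const[OF r])
    qed
    also have "\<dots> = 1 / 4 * expect S n1 r (\<lambda>ys. prod_exp (samples S m) (\<lambda>_ zs. prod_list (map r zs)) L (\<lambda>\<xi>. \<bar>G ys \<xi> - F\<bar>))"
    proof -
      have "expect S (L * m) r (\<lambda>zs. \<bar>G ys (blk zs) - F\<bar>)
         = prod_exp (samples S m) (\<lambda>_ zs. prod_list (map r zs)) L (\<lambda>\<xi>. \<bar>G ys \<xi> - F\<bar>)" for ys
        unfolding blk_def
      proof (rule expect_blocks[where f="\<lambda>\<xi>. \<bar>G ys \<xi> - F\<bar>"])
        fix \<xi> \<xi>' :: "nat \<Rightarrow> nat list" assume "\<And>b. b < L \<Longrightarrow> \<xi> b = \<xi>' b"
        then have "est ys \<xi> = est ys \<xi>'" by (rule local)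
        then show "\<bar>G ys \<xi> - F\<bar> = \<bar>G ys \<xi>' - F\<bar>" by (simp only: G_def)
      qed
      then show ?thesis by (simp only: expect_cmult)
    qed
    also have "\<dots> \<le> 1 / 4 * expect S n1 r (\<lambda>ys. 2 * (if bad ys then 1 else 0) + 120 * C0 * rate_est S q n + E0)"
      by (intro mult_left_mono expect_mono[OF r] main) simp
    also have "\<dots> = 1 / 2 * expect S n1 r (\<lambda>ys. if bad ys then 1 else 0) + 30 * C0 * rate_est S q n + 1 / 4 * E0"
      by (simp only: expect_plus expect_cmult expect_const[OF r]) simp
    also have "expect S n1 r (\<lambda>ys. if bad ys then 1 else 0) \<le> S * (4 * exp (- (n1 * \<Delta> / 12)))"
    proof -
      have "expect S n1 r (\<lambda>ys. if bad ys then 1 else 0) \<le> expect S n1 r (\<lambda>ys. \<Sum>i<S. if misled \<Delta> (q i) (r i) (emp ys i) then 1 else 0)"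
      proof (intro expect_mono[OF r])
        fix ys
        show "(if bad ys then 1 else 0) \<le> (\<Sum>i<S. if misled \<Delta> (q i) (r i) (emp ys i) then 1 else (0::real))"
        proof (cases "bad ys")
          case True
          then obtain i where "i < S" "misled \<Delta> (q i) (r i) (emp ys i)" by (auto simp: bad_def)
          then show ?thesis
            using True member_le_sum[of i "{..<S}" "\<lambda>i. if misled \<Delta> (q i) (r i) (emp ys i) then 1 else (0::real)"] by simp
        qed (simp add: sum_nonneg)
      qed
      also have "\<dots> \<le> (\<Sum>i<S. 4 * exp (- (n1 * \<Delta> / 12)))"
        unfolding expect_sum by (intro sum_mono misled_probability[OF r n1 _ _ \<Delta>]) (auto simp: q0)
      finally show ?thesis by simp
    qed
    finally show ?thesis using E0(2) by simp
  qed
  then show ?thesis unfolding E0_def by (rule R_EST_le[OF q])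
qed

section \<open>Choice of parameters for the estimation upper bound\<close>

lemma inverse_n_le_rate_est:
  assumes "regime c1 c2 S q n" "c2 > 0"
  shows "1 / real n \<le> rate_est S q n"
proof -
  have n: "2 \<le> n" by (rule regimeD(1)[OF assms(1)])
  have "sqrt (real n * ln (real n)) \<le> real n"
  proof (rule real_le_lsqrt)
    have "ln (real n) \<le> real n" using n ln_le_minus_one[of "real n"] by simp
    then have "real n * ln (real n) \<le> real n * real n" by (intro mult_left_mono) auto
    then show "real n * ln (real n) \<le> (real n)\<^sup>2" by (simp add: power2_eq_square)
  qed simp
  moreover have "0 < sqrt (real n * ln (real n))" using n by simp
  ultimately have "1 / real n \<le> 1 / sqrt (real n * ln (real n))" by (intro frac_le) auto
  also have "\<dots> \<le> real n powr (1 / c2) / sqrt (real n * ln (real n))"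
    using n assms(2) ge_one_powr_ge_zero[of "real n" "1 / c2"] by (intro divide_right_mono) auto
  also have "\<dots> \<le> rate_est S q n" by (rule rate_est_ge[OF assms])
  finally show ?thesis .
qed

lemma R_EST_upper_regime:
  assumes c: "c1 > 0" "c2 > 0"
  shows "\<exists>C>0. \<forall>S q n. regime c1 c2 S q n \<longrightarrow> R_EST S q n \<le> C * rate_est S q n"
proof -
  \<comment> \<open>With at least \<open>n / 3\<close> observations in the first half, the exponent
    \<open>n1 * \<Delta> / 12\<close> is at least \<open>(c1 + 1) * ln n\<close>. This beats
    \<open>S \<le> n powr c1\<close> with a factor \<open>1 / n\<close> to spare.\<close>
  define \<kappa> where "\<kappa> = 36 * (c1 + 1)"
  \<comment> \<open>The degree is about \<open>\<epsilon> * ln n\<close>. The variance grows like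
    \<open>(81 * 4) ^ M = 324 ^ M\<close>, which is at most \<open>exp (9 * M)\<close>, hence at
    most \<open>n powr (1 / c2)\<close>.\<close>
  define \<epsilon> where "\<epsilon> = min 1 (1 / (9 * c2))"
  have e: "0 < \<epsilon>" "\<epsilon> \<le> 1" "9 * \<epsilon> \<le> 1 / c2"
  proof -
    show "0 < \<epsilon>" "\<epsilon> \<le> 1" using c by (auto simp: \<epsilon>_def)
    have "\<epsilon> \<le> 1 / (9 * c2)" by (simp add: \<epsilon>_def)
    then show "9 * \<epsilon> \<le> 1 / c2" using c by (simp add: field_simps)
  qed
  have k: "36 \<le> \<kappa>" using c by (simp add: \<kappa>_def)
  \<comment> \<open>From \<open>M \<ge> \<epsilon> * ln n / 2\<close>: the constant that makes
    \<open>\<Delta> \<le> C0 * M\<^sup>2 * \<tau>\<close> true.\<close>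
  define C0 where "C0 = max 1 (4 * \<kappa> / \<epsilon>\<^sup>2)"
  have "eventually (\<lambda>n::nat. 2 \<le> \<epsilon> * ln (real n) \<and> 24 * ln (real n) \<le> real n \<and> 3 \<le> real n
      \<and> 4096 * ln (real n) ^ 5 \<le> real n powr (1 / c2)) at_top"
    using c e by (intro eventually_conj; real_asymp)
  then obtain n0 where n0: "\<And>n. n \<ge> n0 \<Longrightarrow> 2 \<le> \<epsilon> * ln (real n) \<and> 24 * ln (real n) \<le> real n \<and> 3 \<le> real n
      \<and> 4096 * ln (real n) ^ 5 \<le> real n powr (1 / c2)"
    by (auto simp: eventually_at_top_linorder)
  have large: "R_EST S q n \<le> (3 + 30 * C0) * rate_est S q n" if reg: "regime c1 c2 S q n" and nn: "n \<ge> n0" for S q n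
  proof -
    note R = regimeD[OF reg]
    define l where "l = ln (real n)"
    have l: "2 \<le> \<epsilon> * l" "24 * l \<le> real n" "3 \<le> real n" "4096 * l ^ 5 \<le> real n powr (1 / c2)"
      using n0[OF nn] by (auto simp: l_def)
    have n: "0 < real n" using l(3) by simp
    have l0: "0 < l" using l(3) by (simp add: l_def)
    have el: "\<epsilon> * l \<le> l" using e l0 mult_right_mono[of \<epsilon> 1 l] by simp
    define M where "M = nat \<lfloor>\<epsilon> * l\<rfloor>"
    have M: "real M \<le> \<epsilon> * l" "\<epsilon> * l / 2 \<le> real M" "1 \<le> M"
    proof -
      have "real M = of_int \<lfloor>\<epsilon> * l\<rfloor>" using l(1) by (simp add: M_def)
      then show A: "real M \<le> \<epsilon> * l" "\<epsilon> * l / 2 \<le> real M" using l(1) by linarith+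
      then show "1 \<le> M" using l(1) by linarith
    qed
    have Ml: "real M \<le> l" using M(1) el by simp
    have M1: "1 \<le> real M" using M(3) by simp
    define n1 where "n1 = n div 2"
    define m where "m = n1 div (2 * M)"
    define \<Delta> where "\<Delta> = \<kappa> * l / n"
    define \<tau> where "\<tau> = 1 / (real n * ln (real n))"
    have n1: "real n / 3 \<le> real n1"
    proof -
      have "n \<le> 2 * n1 + 1" by (simp add: n1_def)
      then have "real n \<le> 2 * real n1 + 1" by linarith
      then show ?thesis using l(3) by linarith
    qed
    have mM: "real n \<le> 8 * real M * real m"
    proof -
      have "n1 < (m + 1) * (2 * M)"
        using M(3) dividend_less_div_times[of "2 * M" n1] by (simp add: m_def)
      then have "real n1 \<le> (real m + 1) * (2 * real M)"
        by (metis (no_types, lifting) less_imp_le of_nat_1 of_nat_add of_nat_le_iff of_nat_mult of_nat_numeral)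
      then have "real n1 \<le> 2 * real M * real m + 2 * real M" by (simp add: algebra_simps)
      moreover have "24 * real M \<le> real n" using l(2) Ml by linarith
      ultimately show ?thesis using n1 by linarith
    qed
    have m0: "0 < m" using mM n by (cases m) auto
    have \<tau>0: "0 < \<tau>" using n l0 by (simp add: \<tau>_def l_def)
    have \<Delta>0: "0 < \<Delta>" using k l0 n by (simp add: \<Delta>_def)
    have small: "\<Delta> \<le> C0 * (real M)\<^sup>2 * \<tau>"
    proof -
      have "\<kappa> * l * l \<le> 4 * \<kappa> / \<epsilon>\<^sup>2 * (\<epsilon> * l / 2)\<^sup>2" using e by (simp add: power2_eq_square field_simps)
      also have "\<dots> \<le> C0 * (real M)\<^sup>2"
        using M(2) l(1) k by (intro mult_mono power_mono) (auto simp: C0_def)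
      finally have "\<kappa> * l \<le> C0 * (real M)\<^sup>2 / l" using l0 by (simp add: pos_le_divide_eq)
      then have "\<kappa> * l / n \<le> C0 * (real M)\<^sup>2 / l / n" using n by (intro divide_right_mono) auto
      then show ?thesis by (simp add: \<Delta>_def \<tau>_def l_def mult.commute)
    qed
    have big: "3 \<le> \<Delta> * m"
    proof -
      have "3 * real n \<le> 3 * (8 * real M * real m)" using mM by simp
      also have "\<dots> = 24 * real M * real m" by simp
      also have "\<dots> \<le> \<kappa> * l * real m" using k Ml M1 by (intro mult_right_mono mult_mono) auto
      finally show ?thesis using n by (simp add: \<Delta>_def field_simps)
    qed
    have tail: "real S * exp (- (n1 * \<Delta> / 12)) \<le> rate_est S q n"
    proof -
      have "(c1 + 1) * l \<le> n1 * \<Delta> / 12"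
      proof -
        have "(real n / 3) * \<Delta> \<le> n1 * \<Delta>" using n1 \<Delta>0 by (intro mult_right_mono) auto
        moreover have "(c1 + 1) * l = (real n / 3) * \<Delta> / 12" using n by (simp add: \<Delta>_def \<kappa>_def)
        ultimately show ?thesis by linarith
      qed
      then have "real S * exp (- (n1 * \<Delta> / 12)) \<le> real n powr c1 * exp (- ((c1 + 1) * l))"
        using regime_card(2)[OF reg] by (intro mult_mono) auto
      also have "\<dots> = 1 / real n"
      proof -
        have "real n powr c1 * exp (- ((c1 + 1) * l)) = exp (c1 * l + - ((c1 + 1) * l))"
          using n by (simp only: powr_def l_def exp_add) simp
        also have "c1 * l + - ((c1 + 1) * l) = - l" by (simp add: algebra_simps)
        finally show ?thesis using n by (simp add: l_def exp_minus inverse_eq_divide)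
      qed
      also have "\<dots> \<le> rate_est S q n" by (rule inverse_n_le_rate_est[OF reg c(2)])
      finally show ?thesis .
    qed
    have var: "sqrt (real (2 * M) / m * (16 * real M * 9 ^ M)\<^sup>2 * 2 ^ (2 * M)) \<le> rate_est S q n"
    proof -
      have p324: "(324::real) ^ M \<le> real n powr (1 / c2)"
      proof -
        have e1: "(2::real) \<le> exp 1" using exp_ge_add_one_self[of 1] by simp
        have "(324::real) ^ M \<le> (2 ^ 9) ^ M" by (intro power_mono) auto
        also have "\<dots> \<le> (exp 1 ^ 9) ^ M" using e1 by (intro power_mono) auto
        also have "\<dots> = exp (9 * real M)" by (simp add: exp_of_nat_mult[symmetric] power_mult[symmetric] flip: exp_of_nat_mult)
        also have "\<dots> \<le> exp (1 / c2 * l)"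
        proof -
          have "9 * real M \<le> 9 * \<epsilon> * l" using M(1) by simp
          also have "\<dots> \<le> 1 / c2 * l" using e(3) l0 by (intro mult_right_mono) auto
          finally show ?thesis by simp
        qed
        also have "\<dots> = real n powr (1 / c2)" using n by (simp add: powr_def l_def)
        finally show ?thesis .
      qed
      have "real (2 * M) / m \<le> 16 * (real M)\<^sup>2 / n"
        using mM m0 n M1 mult_left_mono[OF mM, of "2 * real M"] by (simp add: field_simps power2_eq_square)
      then have "real (2 * M) / m * (16 * real M * 9 ^ M)\<^sup>2 * 2 ^ (2 * M) \<le> 16 * (real M)\<^sup>2 / n * (16 * real M * 9 ^ M)\<^sup>2 * 2 ^ (2 * M)"
        by (intro mult_right_mono) auto
      also have "\<dots> = 4096 * real M ^ 4 * 324 ^ M / n"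
      proof -
        have "(9 ^ M)\<^sup>2 * 2 ^ (2 * M) = (324::real) ^ M"
          by (simp add: power_mult[symmetric] mult.commute[of M 2] power_mult power_mult_distrib[symmetric])
        then show ?thesis by (simp add: power_mult_distrib power4_eq_xxxx power2_eq_square mult_ac)
      qed
      also have "\<dots> \<le> 4096 * l ^ 4 * real n powr (1 / c2) / n"
        using Ml M1 p324 n l0 by (intro divide_right_mono mult_mono power_mono) auto
      also have "\<dots> \<le> (real n powr (1 / c2) / sqrt (real n * ln (real n)))\<^sup>2"
      proof -
        \<comment> \<open>The squared rate is at least \<open>?P\<^sup>2 / (n * l)\<close>; one
          factor \<open>?P\<close> pays for the exponential in \<open>M\<close> and the other for
          the powers of the logarithm.\<close>
        let ?P = "real n powr (1 / c2)"
        have "4096 * l ^ 4 * ?P * l \<le> ?P * ?P"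
          using mult_right_mono[OF l(4), of ?P] by (simp add: mult_ac power_Suc numeral_eq_Suc)
        then have "4096 * l ^ 4 * ?P \<le> ?P * ?P / l" using l0 by (simp add: pos_le_divide_eq)
        then have "4096 * l ^ 4 * ?P / n \<le> ?P * ?P / l / n" using n by (intro divide_right_mono) auto
        then show ?thesis using n l0 by (simp add: power_divide l_def power2_eq_square mult.commute)
      qed
      finally have "sqrt (real (2 * M) / m * (16 * real M * 9 ^ M)\<^sup>2 * 2 ^ (2 * M)) \<le> real n powr (1 / c2) / sqrt (real n * ln (real n))"
        using n l0 by (intro real_le_lsqrt) (auto simp: l_def)
      then show ?thesis using rate_est_ge[OF reg c(2)] by linarith
    qed
    have n10: "0 < n1" using n1 n by (cases n1) auto
    have nle: "n1 + 2 * M * m \<le> n"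
    proof -
      have "2 * M * m \<le> n1" by (simp add: m_def)
      moreover have "2 * n1 \<le> n" by (simp add: n1_def)
      ultimately show ?thesis by linarith
    qed
    have "R_EST S q n \<le> 2 * real S * exp (- (n1 * \<Delta> / 12)) + 30 * C0 * rate_est S q n
     + sqrt (real (2 * M) / m * (16 * real M * 9 ^ M)\<^sup>2 * 2 ^ (2 * M))"
      by (rule R_EST_upper[OF R(2) M(3) m0 n10 nle \<tau>_def \<tau>0 \<Delta>0 _ small big]) (simp add: C0_def)
    also have "\<dots> \<le> (3 + 30 * C0) * rate_est S q n" using tail var by (simp add: algebra_simps)
    finally show ?thesis .
  qed
  define C where "C = 3 + 30 * C0 + real n0"
  have "R_EST S q n \<le> C * rate_est S q n" if reg: "regime c1 c2 S q n" for S q n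
  proof (cases "n \<ge> n0")
    case True
    have "(3 + 30 * C0) * rate_est S q n \<le> C * rate_est S q n"
      using rate_est_pos[OF reg c(2)] by (intro mult_right_mono) (auto simp: C_def)
    then show ?thesis using large[OF reg True] by linarith
  next
    case False
    have n: "0 < real n" using regimeD(1)[OF reg] by simp
    \<comment> \<open>For small \<open>n\<close> the constant estimator has risk at most 1, while
      the rate is at least \<open>1 / n\<close>.\<close>
    have "R_EST S q n \<le> 1" by (rule R_EST_le_1[OF regimeD(2)[OF reg]])
    also have "1 \<le> real n0 * (1 / real n)" using False n by (simp add: field_simps)
    also have "\<dots> \<le> C * rate_est S q n"
      using inverse_n_le_rate_est[OF reg c(2)] by (intro mult_mono) (auto simp: C_def C0_def)
    finally show ?thesis .
  qed
  moreover have "0 < C" by (simp add: C_def C0_def)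
  ultimately show ?thesis by blast
qed

section \<open>Lower bound for estimation: two fuzzy hypotheses\<close>

text \<open>Two laws \<open>\<mu>0\<close>, \<open>\<mu>1\<close> of the mass \<open>c - W y\<^sub>j\<close> of a symbol with \<open>Q\<close>-mass \<open>q\<close>; \<open>D\<close> will be of order \<open>ln n / n\<close>.
  For \<open>q < D\<close> the masses fill \<open>[0, 2 W]\<close> and \<open>q\<close> lies near its left end.\<close>

definition local_pair :: "real \<Rightarrow> real \<Rightarrow> nat \<Rightarrow> real \<Rightarrow> real \<Rightarrow> (nat \<Rightarrow> real) \<Rightarrow> (nat \<Rightarrow> real) \<Rightarrow> (nat \<Rightarrow> real) \<Rightarrow> bool" where
  "local_pair q D M c W y \<mu>0 \<mu>1 \<longleftrightarrow> 0 < W \<and> W \<le> c \<and> c \<le> max q D \<and> W\<^sup>2 \<le> D * c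
    \<and> is_weight {..<8 * M} \<mu>0 \<and> is_weight {..<8 * M} \<mu>1 \<and> (\<forall>j. \<bar>y j\<bar> \<le> 1)
    \<and> (\<forall>k\<le>2 * M. (\<Sum>j<8 * M. \<mu>0 j * y j ^ k) = (\<Sum>j<8 * M. \<mu>1 j * y j ^ k))
    \<and> min (sqrt (q * D) / (32 * real M)) (q / 672)
        \<le> (\<Sum>j<8 * M. \<mu>1 j * \<bar>c - W * y j - q\<bar>) - (\<Sum>j<8 * M. \<mu>0 j * \<bar>c - W * y j - q\<bar>)
    \<and> (\<Sum>j<8 * M. \<mu>0 j * (c - W * y j)) \<le> 4 * q \<and> (\<Sum>j<8 * M. \<mu>1 j * (c - W * y j)) \<le> 4 * q
    \<and> (\<forall>j. (max 0 (q - (c - W * y j)))\<^sup>2 \<le> q * D)"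

text \<open>\<open>moment_matching_weights\<close> scaled so that \<open>cos \<theta>\<close>
  corresponds to the kink \<open>q\<close>. For \<open>D \<le> q\<close> the masses are centred at
  \<open>q\<close> and the kink is in the middle. For a lighter \<open>q\<close> they fill
  \<open>[0, 2 * W]\<close> and the kink is near an end, where the gap shrinks by
  \<open>sin \<theta>\<close>.\<close>

lemma local_prior:
  fixes q D :: real and M :: nat
  assumes M: "21 \<le> M" and q: "0 < q" and D: "0 < D"
  shows "\<exists>c W y \<mu>0 \<mu>1. local_pair q D M c W y \<mu>0 \<mu>1"
proof -
  have M0: "21 \<le> real M" using M by simp
  have main: ?thesis
    if W: "0 < W" "W \<le> c" "c \<le> max q D" "W\<^sup>2 \<le> D * c" and \<theta>: "0 < \<theta>" "\<theta> \<le> pi / 2" "21 \<le> real M * sin \<theta>"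
      and qc: "q = c - W * cos \<theta>" and g: "min (sqrt (q * D) / (32 * real M)) (q / 672) \<le> W * (sin \<theta> / (32 * real M))"
      and dv: "W * (32 / (real M)\<^sup>2 + 12 * sin \<theta> / real M) \<le> 3 * q"
      and sq: "\<And>y. \<bar>y\<bar> \<le> 1 \<Longrightarrow> (max 0 (q - (c - W * y)))\<^sup>2 \<le> q * D" for c W \<theta>
  proof -
    have M1: "1 \<le> M" using M by simp
    obtain \<mu>0 \<mu>1 y :: "nat \<Rightarrow> real" where mm:
      "is_weight {..<8 * M} \<mu>0" "is_weight {..<8 * M} \<mu>1" "\<And>j. \<bar>y j\<bar> \<le> 1"
      "\<And>k. k \<le> 2 * M \<Longrightarrow> (\<Sum>j<8 * M. \<mu>0 j * y j ^ k) = (\<Sum>j<8 * M. \<mu>1 j * y j ^ k)"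
      "sin \<theta> / (32 * real M) \<le> (\<Sum>j<8 * M. \<mu>1 j * \<bar>y j - cos \<theta>\<bar>) - (\<Sum>j<8 * M. \<mu>0 j * \<bar>y j - cos \<theta>\<bar>)"
      "(\<Sum>j<8 * M. \<mu>0 j * \<bar>y j - cos \<theta>\<bar>) \<le> 32 / (real M)\<^sup>2 + 12 * sin \<theta> / real M"
      "(\<Sum>j<8 * M. \<mu>1 j * \<bar>y j - cos \<theta>\<bar>) \<le> 32 / (real M)\<^sup>2 + 12 * sin \<theta> / real M"
    proof (rule moment_matching_weights[OF M1 \<theta>], goal_cases)
      case (1 y \<mu>0 \<mu>1)
      show ?case by (rule that[of \<mu>0 \<mu>1 y]) (fact 1)+
    qed
    have ab: "\<bar>c - W * y j - q\<bar> = W * \<bar>y j - cos \<theta>\<bar>" for j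
    proof -
      have "c - W * y j - q = - (W * (y j - cos \<theta>))" by (simp add: qc algebra_simps)
      then show ?thesis using W(1) by (simp add: abs_mult)
    qed
    have sc: "(\<Sum>j<8 * M. \<mu> j * \<bar>c - W * y j - q\<bar>) = W * (\<Sum>j<8 * M. \<mu> j * \<bar>y j - cos \<theta>\<bar>)" for \<mu> :: "nat \<Rightarrow> real"
      unfolding ab by (simp add: sum_distrib_left mult_ac)
    have mean: "(\<Sum>j<8 * M. \<mu> j * (c - W * y j)) \<le> 4 * q"
      if w: "is_weight {..<8 * M} \<mu>" and d: "(\<Sum>j<8 * M. \<mu> j * \<bar>y j - cos \<theta>\<bar>) \<le> 32 / (real M)\<^sup>2 + 12 * sin \<theta> / real M" for \<mu>
    proof -
      have "(\<Sum>j<8 * M. \<mu> j * (c - W * y j)) \<le> (\<Sum>j<8 * M. \<mu> j * (\<bar>c - W * y j - q\<bar> + q))"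
        by (intro weighted_mean_mono[OF w]) linarith
      also have "\<dots> = W * (\<Sum>j<8 * M. \<mu> j * \<bar>y j - cos \<theta>\<bar>) + q"
        unfolding distrib_left sum.distrib sc weighted_mean_const[OF w] ..
      also have "\<dots> \<le> W * (32 / (real M)\<^sup>2 + 12 * sin \<theta> / real M) + q" using d W(1) by simp
      also have "\<dots> \<le> 4 * q" using dv by simp
      finally show ?thesis .
    qed
    have gap: "min (sqrt (q * D) / (32 * real M)) (q / 672)
        \<le> (\<Sum>j<8 * M. \<mu>1 j * \<bar>c - W * y j - q\<bar>) - (\<Sum>j<8 * M. \<mu>0 j * \<bar>c - W * y j - q\<bar>)"
      unfolding sc right_diff_distrib[symmetric] using g mult_left_mono[OF mm(5), of W] W(1) by linarith
    show ?thesis unfolding local_pair_def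
      by (intro exI[of _ c] exI[of _ W] exI[of _ y] exI[of _ \<mu>0] exI[of _ \<mu>1] conjI allI impI W mm(1-4) gap
          mean[OF mm(1,6)] mean[OF mm(2,7)] sq[OF mm(3)])
  qed
  show ?thesis
  proof (cases "D \<le> q")
    case True
    define W where "W = sqrt (q * D)"
    have W0: "0 < W" using q D by (simp add: W_def)
    have W2: "W\<^sup>2 = q * D" using q D by (simp add: W_def)
    have Wq: "W \<le> q" unfolding W_def using True q by (intro real_le_lsqrt) (auto simp: power2_eq_square mult_left_mono)
    have M2: "441 \<le> (real M)\<^sup>2" using power_mono[OF M0, of 2] by simp
    show ?thesis
    proof (rule main[of W q "pi / 2"])
      show "W * (32 / (real M)\<^sup>2 + 12 * sin (pi / 2) / real M) \<le> 3 * q"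
      proof -
        have "32 / (real M)\<^sup>2 \<le> 1" "12 / real M \<le> 1" using M2 M0 by (auto simp: divide_le_eq)
        then have "W * (32 / (real M)\<^sup>2 + 12 * sin (pi / 2) / real M) \<le> W * 2" using W0 by (intro mult_left_mono) auto
        then show ?thesis using Wq q by linarith
      qed
      show "(max 0 (q - (q - W * y)))\<^sup>2 \<le> q * D" if "\<bar>y\<bar> \<le> 1" for y
      proof -
        have "max 0 (q - (q - W * y)) \<le> W" using that W0 mult_left_mono[of y 1 W] by (auto simp: abs_le_iff)
        then have "(max 0 (q - (q - W * y)))\<^sup>2 \<le> W\<^sup>2" by (intro power_mono) auto
        then show ?thesis unfolding W2 .
      qed
    qed (use W0 W2 Wq M0 in \<open>auto simp: W_def mult.commute\<close>)
  next
    case False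
    \<comment> \<open>The cap keeps the kink far enough from the end for
      \<open>21 \<le> M * sin \<theta>\<close>, since
      \<open>(sin \<theta>)\<^sup>2 \<ge> q / W\<close>. When the cap is active the gap becomes
      \<open>q / 672\<close>, with \<open>672 = 21 * 32\<close>.\<close>
    define W where "W = min D (q * (real M)\<^sup>2 / 441)"
    have M2: "441 \<le> (real M)\<^sup>2" using power_mono[OF M0, of 2] by simp
    have qW: "q \<le> W"
    proof -
      have "q * 441 \<le> q * (real M)\<^sup>2" using M2 q by (intro mult_left_mono) auto
      then show ?thesis using False by (simp add: W_def)
    qed
    have W0: "0 < W" using qW q by simp
    have WD: "W \<le> D" "441 * W \<le> q * (real M)\<^sup>2" by (auto simp: W_def min_def)
    define \<theta> where "\<theta> = arccos (1 - q / W)"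
    have v: "0 \<le> 1 - q / W" "1 - q / W < 1" using qW W0 q by auto
    have cs: "cos \<theta> = 1 - q / W" unfolding \<theta>_def using v by (intro cos_arccos) auto
    have th: "0 < \<theta>" "\<theta> \<le> pi / 2"
    proof -
      show "\<theta> \<le> pi / 2" unfolding \<theta>_def using v by (intro arccos_le_pi2) auto
      have "0 \<le> \<theta>" unfolding \<theta>_def using v by (intro arccos_lbound) auto
      moreover have "\<theta> \<noteq> 0" using cs v(2) cos_zero by (metis less_irrefl)
      ultimately show "0 < \<theta>" by simp
    qed
    have s0: "0 < sin \<theta>" using th by (intro sin_gt_zero) auto
    have s2: "(sin \<theta>)\<^sup>2 = 2 * (q / W) - (q / W)\<^sup>2"
      unfolding sin_squared_eq cs by (simp add: power2_eq_square algebra_simps)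
    have "q / W \<le> 1" "0 < q / W" using qW W0 q by auto
    then have qw2: "(q / W)\<^sup>2 \<le> q / W" unfolding power2_eq_square by (intro mult_left_le) auto
    have sge: "q / W \<le> (sin \<theta>)\<^sup>2" and sle: "(sin \<theta>)\<^sup>2 \<le> 2 * (q / W)" using s2 qw2 by auto
    have Ws: "sqrt (q * W) \<le> W * sin \<theta>" "W * sin \<theta> \<le> 2 * sqrt (q * W)"
    proof -
      have "q * W = W\<^sup>2 * (q / W)" using W0 by (simp add: power2_eq_square)
      also have "\<dots> \<le> W\<^sup>2 * (sin \<theta>)\<^sup>2" using sge by (intro mult_left_mono) auto
      finally have "q * W \<le> (W * sin \<theta>)\<^sup>2" by (simp add: power_mult_distrib)
      then show "sqrt (q * W) \<le> W * sin \<theta>" using W0 s0 by (intro real_le_lsqrt) auto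
      have "(W * sin \<theta>)\<^sup>2 \<le> W\<^sup>2 * (2 * (q / W))" unfolding power_mult_distrib using sle by (intro mult_left_mono) auto
      also have "\<dots> \<le> 4 * (q * W)" using W0 q by (simp add: power2_eq_square)
      finally have "W * sin \<theta> \<le> sqrt (4 * (q * W))" by (rule real_le_rsqrt)
      then show "W * sin \<theta> \<le> 2 * sqrt (q * W)" by (simp only: real_sqrt_mult real_sqrt_four)
    qed
    have qWM: "sqrt (q * W) \<le> q * real M / 21"
    proof (rule real_le_lsqrt)
      have "q * (441 * W) \<le> q * (q * (real M)\<^sup>2)" using WD(2) q by (intro mult_left_mono) auto
      then show "q * W \<le> (q * real M / 21)\<^sup>2" by (simp add: power_divide power_mult_distrib power2_eq_square mult_ac)
    qed (use q in auto)
    show ?thesis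
    proof (rule main[of W W \<theta>])
      show "W\<^sup>2 \<le> D * W" using WD(1) W0 by (simp add: power2_eq_square)
      show "21 \<le> real M * sin \<theta>"
      proof -
        have "441 \<le> (real M)\<^sup>2 * (q / W)" using WD(2) W0 by (simp add: field_simps)
        also have "\<dots> \<le> (real M)\<^sup>2 * (sin \<theta>)\<^sup>2" using sge by (intro mult_left_mono) auto
        finally have "21\<^sup>2 \<le> (real M * sin \<theta>)\<^sup>2" by (simp add: power_mult_distrib)
        then show ?thesis using M0 s0 by (subst (asm) power2_le_iff_abs_le) auto
      qed
      show "q = W - W * cos \<theta>" unfolding cs using W0 by (simp add: algebra_simps)
      show "min (sqrt (q * D) / (32 * real M)) (q / 672) \<le> W * (sin \<theta> / (32 * real M))"
      proof -
        have "min (sqrt (q * D) / (32 * real M)) (q / 672) \<le> sqrt (q * W) / (32 * real M)"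
        proof (cases "D \<le> q * (real M)\<^sup>2 / 441")
          case True
          then have "W = D" by (simp add: W_def)
          then show ?thesis by simp
        next
          case False
          then have "W = q * (real M)\<^sup>2 / 441" by (simp add: W_def)
          then have "q * W = (q * real M / 21)\<^sup>2" by (simp add: power_divide power_mult_distrib power2_eq_square mult_ac)
          then have "sqrt (q * W) = q * real M / 21" using q by simp
          then have "sqrt (q * W) / (32 * real M) = (q * real M / 21) / (32 * real M)" by (simp only:)
          then have "sqrt (q * W) / (32 * real M) = q / 672" using M0 by simp
          then show ?thesis by simp
        qed
        also have "\<dots> \<le> W * sin \<theta> / (32 * real M)" using Ws(1) by (intro divide_right_mono) auto
        finally show ?thesis by simp
      qed
      show "W * (32 / (real M)\<^sup>2 + 12 * sin \<theta> / real M) \<le> 3 * q"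
      proof -
        have "W * 32 / (real M)\<^sup>2 \<le> q"
        proof -
          have "W * 32 \<le> q * (real M)\<^sup>2" using WD(2) W0 by linarith
          moreover have "0 < (real M)\<^sup>2" using M2 by linarith
          ultimately show ?thesis by (simp only: pos_divide_le_eq)
        qed
        moreover have "12 * (W * sin \<theta>) / real M \<le> 2 * q"
        proof -
          have "12 * (W * sin \<theta>) \<le> 12 * (2 * (q * real M / 21))" using Ws(2) qWM by linarith
          also have "\<dots> \<le> 2 * q * real M" using q M0 by simp
          finally show ?thesis using M0 by (simp add: divide_le_eq)
        qed
        ultimately show ?thesis by (simp add: distrib_left mult_ac)
      qed
      show "(max 0 (q - (W - W * y)))\<^sup>2 \<le> q * D" if "\<bar>y\<bar> \<le> 1" for y
      proof -
        have "0 \<le> W - W * y" using that W0 mult_left_mono[of y 1 W] by (auto simp: abs_le_iff)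
        then have "max 0 (q - (W - W * y)) \<le> q" using q by auto
        then have "(max 0 (q - (W - W * y)))\<^sup>2 \<le> q\<^sup>2" by (intro power_mono) auto
        also have "\<dots> \<le> q * D" using False q by (simp add: power2_eq_square)
        finally show ?thesis .
      qed
    qed (use W0 WD th in auto)
  qed
qed

text \<open>On the tail each term may be multiplied by \<open>exp (k - L) \<ge> 1\<close>, which
  turns it into a term of the series for \<open>exp (exp 1 * z)\<close>; finally
  \<open>exp 1 \<le> 3\<close>.\<close>

lemma exp_series_tail_le:
  fixes z :: real
  assumes "0 \<le> z"
  shows "(\<Sum>k\<in>{Suc L..n}. z ^ k / fact k) \<le> exp (3 * z - real L)"
proof -
  have "(\<Sum>k\<in>{Suc L..n}. z ^ k / fact k) \<le> (\<Sum>k\<in>{Suc L..n}. exp (- real L) * ((exp 1 * z) ^ k / fact k))"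
  proof (rule sum_mono)
    fix k assume k: "k \<in> {Suc L..n}"
    have "1 \<le> exp (- real L) * exp 1 ^ k"
    proof -
      have "exp (- real L) * exp 1 ^ k = exp (real k - real L)"
        by (simp add: exp_of_nat_mult[symmetric] exp_add[symmetric] flip: exp_of_nat_mult)
      then show ?thesis using k by simp
    qed
    then have "1 * (z ^ k / fact k) \<le> (exp (- real L) * exp 1 ^ k) * (z ^ k / fact k)"
      using assms by (intro mult_right_mono) auto
    then show "z ^ k / fact k \<le> exp (- real L) * ((exp 1 * z) ^ k / fact k)" by (simp add: power_mult_distrib mult_ac)
  qed
  also have "\<dots> = exp (- real L) * (\<Sum>k\<in>{Suc L..n}. (exp 1 * z) ^ k / fact k)" by (simp only: sum_distrib_left)
  also have "\<dots> \<le> exp (- real L) * exp (exp 1 * z)"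
  proof (intro mult_left_mono)
    have "(\<Sum>k\<in>{Suc L..n}. (exp 1 * z) ^ k /\<^sub>R fact k) \<le> (\<Sum>k. (exp 1 * z) ^ k /\<^sub>R fact k)"
      using assms by (intro sum_le_suminf summable_exp_generic) auto
    then show "(\<Sum>k\<in>{Suc L..n}. (exp 1 * z) ^ k / fact k) \<le> exp (exp 1 * z)"
      by (simp add: exp_def divide_inverse mult.commute)
  qed simp
  also have "\<dots> \<le> exp (- real L) * exp (3 * z)"
    using exp_le assms by (intro mult_left_mono) (auto intro: mult_right_mono)
  also have "\<dots> = exp (3 * z - real L)" by (simp add: exp_add[symmetric] algebra_simps)
  finally show ?thesis .
qed

text \<open>Two mixtures over the mass of a single symbol \<open>i\<close>, compensated at the symbol \<open>k\<close>. Relative to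
  the centre of the mixtures, the likelihood ratio has second moment \<open>\<Sum> \<sigma> \<sigma>' (1 + \<beta> y y')\<^sup>n\<close>, of which
  the matched moments remove all low order terms.\<close>

lemma single_symbol_mixture:
  fixes \<sigma> y :: "nat \<Rightarrow> real"
  assumes \<rho>: "dist_on S \<rho>" and i: "i < S" "k < S" "i \<noteq> k" and pos: "0 < \<rho> i" "\<rho> i \<le> \<rho> k"
    and y: "\<And>j. \<bar>y j\<bar> \<le> 1" and mom: "\<And>p. p \<le> L \<Longrightarrow> (\<Sum>j<J. \<sigma> j * y j ^ p) = 0" and \<sigma>: "(\<Sum>j<J. \<bar>\<sigma> j\<bar>) \<le> 2"
    and W: "6 * real n * W\<^sup>2 \<le> L / 2 * \<rho> i"
    and r: "\<And>j x. x < S \<Longrightarrow> r j x = \<rho> x + (if x = i then - W * y j else if x = k then W * y j else 0)"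
  shows "(\<Sum>xs\<in>samples S n. \<bar>\<Sum>j<J. \<sigma> j * prod_list (map (r j) xs)\<bar>) \<le> 2 * exp (- (real L / 4))"
proof -
  \<comment> \<open>The relative perturbation: \<open>r j\<close> has density \<open>1 + d j\<close>
    with respect to the centre \<rho>.\<close>
  define d where "d = (\<lambda>j x. - W * y j * ((if x = i then 1 / \<rho> i else 0) - (if x = k then 1 / \<rho> k else 0)))"
  have pk: "0 < \<rho> k" using pos by simp
  have rd: "r j x = \<rho> x * (1 + d j x)" if "x < S" for j x
    using i pos pk r[OF that, of j] by (auto simp: d_def field_simps)
  define g where "g = (\<lambda>xs. \<Sum>j<J. \<sigma> j * prod_list (map (\<lambda>x. 1 + d j x) xs))"
  have pl: "prod_list (map (r j) xs) = prod_list (map \<rho> xs) * prod_list (map (\<lambda>x. 1 + d j x) xs)" if "xs \<in> samples S n" for j xs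
  proof -
    have "set xs \<subseteq> {..<S}" using that by (simp add: samples_def)
    then show ?thesis by (induction xs) (auto simp: rd mult_ac)
  qed
  have "(\<Sum>xs\<in>samples S n. \<bar>\<Sum>j<J. \<sigma> j * prod_list (map (r j) xs)\<bar>) = expect S n \<rho> (\<lambda>xs. \<bar>g xs\<bar>)"
    unfolding expect_def
  proof (intro sum.cong refl)
    fix xs assume xs: "xs \<in> samples S n"
    have "(\<Sum>j<J. \<sigma> j * prod_list (map (r j) xs)) = prod_list (map \<rho> xs) * g xs"
      unfolding g_def sum_distrib_left pl[OF xs] by (simp add: mult_ac)
    then show "\<bar>\<Sum>j<J. \<sigma> j * prod_list (map (r j) xs)\<bar> = prod_list (map \<rho> xs) * \<bar>g xs\<bar>"
      using is_weightD(2)[OF is_weight_samples[OF \<rho>] xs] by (simp add: abs_mult)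
  qed
  also have "\<dots> \<le> sqrt (expect S n \<rho> (\<lambda>xs. (g xs)\<^sup>2))" by (rule expect_abs_le_sqrt[OF \<rho>])
  also have "\<dots> \<le> sqrt (4 * exp (- (real L / 2)))"
  proof (rule real_sqrt_le_mono)
    \<comment> \<open>The chi-square coefficient: the inner product of the densities for
      \<open>j\<close> and \<open>l\<close> is \<open>1 + b * y j * y l\<close>, since the
      first-order terms at \<open>i\<close> and \<open>k\<close> cancel.\<close>
    define b where "b = W\<^sup>2 * (1 / \<rho> i + 1 / \<rho> k)"
    have b0: "0 \<le> b" using pos pk by (simp add: b_def)
    have inner: "(\<Sum>x<S. \<rho> x * ((1 + d j x) * (1 + d l x))) = 1 + b * (y j * y l)" for j l
    proof -
      have sel: "(\<Sum>x<S. h x * (if x = a then u else 0)) = h a * u" if "a < S" for h :: "nat \<Rightarrow> real" and a u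
        using that by (simp add: if_distrib cong: if_cong)
      have "(\<Sum>x<S. \<rho> x * ((1 + d j x) * (1 + d l x))) = (\<Sum>x<S. \<rho> x
         + \<rho> x * (if x = i then - W * (y j + y l) / \<rho> i + W\<^sup>2 * (y j * y l) / (\<rho> i)\<^sup>2 else 0)
         + \<rho> x * (if x = k then W * (y j + y l) / \<rho> k + W\<^sup>2 * (y j * y l) / (\<rho> k)\<^sup>2 else 0))"
        using i(3) pos pk by (intro sum.cong refl) (auto simp: d_def field_simps power2_eq_square)
      also have "\<dots> = 1 + \<rho> i * (- W * (y j + y l) / \<rho> i + W\<^sup>2 * (y j * y l) / (\<rho> i)\<^sup>2)
          + \<rho> k * (W * (y j + y l) / \<rho> k + W\<^sup>2 * (y j * y l) / (\<rho> k)\<^sup>2)"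
        unfolding sum.distrib sel[OF i(1)] sel[OF i(2)] using \<rho> by (simp add: dist_on_def)
      also have "\<dots> = 1 + b * (y j * y l)"
        using pos pk by (simp add: b_def power2_eq_square field_simps)
      finally show ?thesis .
    qed
    have "expect S n \<rho> (\<lambda>xs. (g xs)\<^sup>2)
       = expect S n \<rho> (\<lambda>xs. \<Sum>j<J. \<Sum>l<J. (\<sigma> j * \<sigma> l) * prod_list (map (\<lambda>x. (1 + d j x) * (1 + d l x)) xs))"
    proof (intro expect_cong)
      fix xs :: "nat list"
      have "prod_list (map (\<lambda>x. (1 + d j x) * (1 + d l x)) xs) = prod_list (map (\<lambda>x. 1 + d j x) xs) * prod_list (map (\<lambda>x. 1 + d l x) xs)" for j l
        by (induction xs) (auto simp: mult_ac)
      then show "(g xs)\<^sup>2 = (\<Sum>j<J. \<Sum>l<J. (\<sigma> j * \<sigma> l) * prod_list (map (\<lambda>x. (1 + d j x) * (1 + d l x)) xs))"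
        unfolding g_def power2_eq_square sum_product by (intro sum.cong refl) (simp add: mult_ac)
    qed
    also have "\<dots> = (\<Sum>j<J. \<Sum>l<J. (\<sigma> j * \<sigma> l) * (1 + b * (y j * y l)) ^ n)"
      by (simp only: expect_sum expect_cmult expect_prod_list inner)
    also have "\<dots> = (\<Sum>j<J. \<Sum>l<J. \<Sum>p\<le>n. real (n choose p) * b ^ p * ((\<sigma> j * y j ^ p) * (\<sigma> l * y l ^ p)))"
    proof (intro sum.cong refl)
      fix j l
      have "(1 + b * (y j * y l)) ^ n = (\<Sum>p\<le>n. real (n choose p) * (b * (y j * y l)) ^ p)"
        using binomial_ring[of "b * (y j * y l)" 1 n] by (simp add: add.commute)
      then show "(\<sigma> j * \<sigma> l) * (1 + b * (y j * y l)) ^ n = (\<Sum>p\<le>n. real (n choose p) * b ^ p * ((\<sigma> j * y j ^ p) * (\<sigma> l * y l ^ p)))"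
        by (simp add: sum_distrib_left power_mult_distrib mult_ac)
    qed
    also have "\<dots> = (\<Sum>j<J. \<Sum>p\<le>n. \<Sum>l<J. real (n choose p) * b ^ p * ((\<sigma> j * y j ^ p) * (\<sigma> l * y l ^ p)))"
      by (rule sum.cong[OF refl], rule sum.swap)
    also have "\<dots> = (\<Sum>p\<le>n. \<Sum>j<J. \<Sum>l<J. real (n choose p) * b ^ p * ((\<sigma> j * y j ^ p) * (\<sigma> l * y l ^ p)))"
      by (rule sum.swap)
    also have "\<dots> = (\<Sum>p\<le>n. real (n choose p) * b ^ p * (\<Sum>j<J. \<sigma> j * y j ^ p)\<^sup>2)"
      unfolding power2_eq_square sum_product by (simp only: sum_distrib_left)
    \<comment> \<open>The binomial expansion has separated \<open>j\<close> from \<open>l\<close>: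
      each order carries the square of one signed moment, which is zero up to order \<open>L\<close>
      and at most 4 beyond.\<close>
    also have "\<dots> \<le> (\<Sum>p\<le>n. if L < p then 4 * ((real n * b) ^ p / fact p) else 0)"
    proof (rule sum_mono)
      fix p assume p: "p \<in> {..n}"
      show "real (n choose p) * b ^ p * (\<Sum>j<J. \<sigma> j * y j ^ p)\<^sup>2 \<le> (if L < p then 4 * ((real n * b) ^ p / fact p) else 0)"
      proof (cases "L < p")
        case False then show ?thesis using mom[of p] by simp
      next
        case True
        have "\<bar>\<Sum>j<J. \<sigma> j * y j ^ p\<bar> \<le> (\<Sum>j<J. \<bar>\<sigma> j\<bar> * 1)"
        proof (rule order_trans[OF sum_abs], rule sum_mono)
          fix j
          have "\<bar>y j\<bar> ^ p \<le> 1" using y[of j] by (intro power_le_one) auto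
          then show "\<bar>\<sigma> j * y j ^ p\<bar> \<le> \<bar>\<sigma> j\<bar> * 1" unfolding abs_mult power_abs by (intro mult_left_mono) auto
        qed
        then have "\<bar>\<Sum>j<J. \<sigma> j * y j ^ p\<bar> \<le> 2" using \<sigma> by simp
        then have s4: "(\<Sum>j<J. \<sigma> j * y j ^ p)\<^sup>2 \<le> 2\<^sup>2" by (metis abs_ge_zero power2_abs power_mono)
        have ch: "real (n choose p) \<le> real n ^ p / fact p"
        proof -
          have "real (n choose p) * fact p = (\<Prod>i<p. real n - real i)"
            using p by (simp add: binomial_gbinomial gbinomial_prod_rev atLeast0LessThan)
          also have "\<dots> \<le> (\<Prod>i<p. real n)" using p by (intro prod_mono) auto
          finally show ?thesis by (simp add: pos_le_divide_eq)
        qed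
        have "real (n choose p) * b ^ p * (\<Sum>j<J. \<sigma> j * y j ^ p)\<^sup>2 \<le> (real n ^ p / fact p) * b ^ p * 4"
          using ch s4 b0 by (intro mult_mono) auto
        then show ?thesis using True by (simp add: power_mult_distrib mult_ac)
      qed
    qed
    also have "\<dots> = (\<Sum>p\<in>{Suc L..n}. 4 * ((real n * b) ^ p / fact p))"
      by (rule sum.mono_neutral_cong_right) auto
    also have "\<dots> = 4 * (\<Sum>p\<in>{Suc L..n}. (real n * b) ^ p / fact p)" by (simp only: sum_distrib_left)
    also have "\<dots> \<le> 4 * exp (3 * (real n * b) - real L)"
      using b0 by (intro mult_left_mono exp_series_tail_le) auto
    \<comment> \<open>The hypothesis on \<open>W\<close> together with
      \<open>\<rho> i \<le> \<rho> k\<close> gives \<open>3 * n * b \<le> L / 2\<close>, half of the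
      gain from the matched moments.\<close>
    also have "\<dots> \<le> 4 * exp (- (real L / 2))"
    proof -
      have "b \<le> W\<^sup>2 * (2 / \<rho> i)"
        unfolding b_def using pos pk by (intro mult_left_mono) (auto simp: field_simps)
      then have "3 * (real n * b) \<le> 3 * (real n * (W\<^sup>2 * (2 / \<rho> i)))" by (intro mult_left_mono) auto
      also have "\<dots> = 6 * real n * W\<^sup>2 / \<rho> i" by simp
      also have "\<dots> \<le> L / 2" using W pos by (simp add: divide_le_eq)
      finally show ?thesis by simp
    qed
    finally show "expect S n \<rho> (\<lambda>xs. (g xs)\<^sup>2) \<le> 4 * exp (- (real L / 2))" .
  qed
  also have "\<dots> = 2 * exp (- (real L / 4))"
  proof -
    have "exp (- (real L / 2)) = (exp (- (real L / 4)))\<^sup>2" by (simp add: power2_eq_square exp_add[symmetric])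
    then show ?thesis by (simp add: real_sqrt_mult)
  qed
  finally show ?thesis .
qed

section \<open>Le Cam's method for mixtures\<close>

lemma R_EST_ge:
  assumes q: "dist_on S q"
    and bound: "\<And>Uh \<rho>. (\<And>r. dist_on S r \<Longrightarrow> expect S n r (\<lambda>xs. \<bar>Uh xs - bayes_err S q r\<bar>) \<le> \<rho>) \<Longrightarrow> B \<le> \<rho>"
  shows "B \<le> R_EST S q n"
  unfolding R_EST_def
proof (rule cINF_greatest)
  fix Uh :: "nat list \<Rightarrow> real"
  define K where "K = (\<Sum>xs\<in>samples S n. \<bar>Uh xs\<bar>) + 1"
  have bdd: "bdd_above ((\<lambda>r. expect S n r (\<lambda>xs. \<bar>Uh xs - bayes_err S q r\<bar>)) ` {r. dist_on S r})"
  proof (rule bdd_aboveI2[where M=K])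
    fix r assume "r \<in> {r. dist_on S r}"
    then have r: "dist_on S r" by simp
    show "expect S n r (\<lambda>xs. \<bar>Uh xs - bayes_err S q r\<bar>) \<le> K"
    proof (rule expect_le_const[OF r])
      fix xs assume "xs \<in> samples S n"
      then have "\<bar>Uh xs\<bar> \<le> (\<Sum>xs\<in>samples S n. \<bar>Uh xs\<bar>)"
        by (intro member_le_sum) (auto simp: finite_samples)
      then show "\<bar>Uh xs - bayes_err S q r\<bar> \<le> K"
        using dist_on_emp_bayes_range[OF q r] by (simp add: K_def abs_if split: if_splits)
    qed
  qed
  show "B \<le> (SUP r\<in>{r. dist_on S r}. expect S n r (\<lambda>xs. \<bar>Uh xs - bayes_err S q r\<bar>))"
    by (rule bound[of Uh], rule cSUP_upper[OF _ bdd]) simp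
qed simp

text \<open>At each sample the smaller mixture likelihood times \<open>\<bar>u0 - u1\<bar>\<close>
  is paid by the two errors around \<open>u0\<close> and \<open>u1\<close>; these likelihoods have
  total mass at least \<open>1 - T / 2\<close>. The functional is only close to \<open>u0\<close> or
  \<open>u1\<close> in mean, which costs \<open>e0 + e1\<close>.\<close>

lemma R_EST_ge_two_mixtures:
  fixes r :: "'a \<Rightarrow> nat \<Rightarrow> real" and w0 w1 :: "'a \<Rightarrow> real" and T u0 u1 e0 e1 :: real
  assumes q: "dist_on S q" and w: "is_weight \<Omega> w0" "is_weight \<Omega> w1"
    and r: "\<And>z. z \<in> \<Omega> \<Longrightarrow> dist_on S (r z)"
    and T: "(\<Sum>xs\<in>samples S n. \<bar>(\<Sum>z\<in>\<Omega>. w0 z * prod_list (map (r z) xs)) - (\<Sum>z\<in>\<Omega>. w1 z * prod_list (map (r z) xs))\<bar>) \<le> T"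
    and e: "(\<Sum>z\<in>\<Omega>. w0 z * \<bar>bayes_err S q (r z) - u0\<bar>) \<le> e0" "(\<Sum>z\<in>\<Omega>. w1 z * \<bar>bayes_err S q (r z) - u1\<bar>) \<le> e1"
  shows "((1 - T / 2) * \<bar>u0 - u1\<bar> - e0 - e1) / 2 \<le> R_EST S q n"
proof (rule R_EST_ge[OF q])
  fix Uh :: "nat list \<Rightarrow> real" and \<rho> :: real
  assume risk: "\<And>r. dist_on S r \<Longrightarrow> expect S n r (\<lambda>xs. \<bar>Uh xs - bayes_err S q r\<bar>) \<le> \<rho>"
  define p where "p = (\<lambda>w xs. \<Sum>z\<in>\<Omega>. w z * prod_list (map (r z) xs))"
  have sw: "(\<Sum>xs\<in>samples S n. p w xs * f xs) = (\<Sum>z\<in>\<Omega>. w z * expect S n (r z) f)" for w f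
  proof -
    have "(\<Sum>xs\<in>samples S n. p w xs * f xs) = (\<Sum>xs\<in>samples S n. \<Sum>z\<in>\<Omega>. w z * (prod_list (map (r z) xs) * f xs))"
      by (simp add: p_def sum_distrib_right mult.assoc)
    also have "\<dots> = (\<Sum>z\<in>\<Omega>. \<Sum>xs\<in>samples S n. w z * (prod_list (map (r z) xs) * f xs))" by (rule sum.swap)
    finally show ?thesis by (simp add: expect_def sum_distrib_left)
  qed
  have half: "(\<Sum>xs\<in>samples S n. p w xs * \<bar>Uh xs - u\<bar>) \<le> \<rho> + e"
    if w: "is_weight \<Omega> w" and e: "(\<Sum>z\<in>\<Omega>. w z * \<bar>bayes_err S q (r z) - u\<bar>) \<le> e" for w u e
  proof -
    have "(\<Sum>xs\<in>samples S n. p w xs * \<bar>Uh xs - u\<bar>) = (\<Sum>z\<in>\<Omega>. w z * expect S n (r z) (\<lambda>xs. \<bar>Uh xs - u\<bar>))" by (rule sw)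
    also have "\<dots> \<le> (\<Sum>z\<in>\<Omega>. w z * (\<rho> + \<bar>bayes_err S q (r z) - u\<bar>))"
    proof (rule weighted_mean_mono[OF w])
      fix z assume z: "z \<in> \<Omega>"
      have "expect S n (r z) (\<lambda>xs. \<bar>Uh xs - u\<bar>)
          \<le> expect S n (r z) (\<lambda>xs. \<bar>Uh xs - bayes_err S q (r z)\<bar> + \<bar>bayes_err S q (r z) - u\<bar>)"
        by (intro expect_mono r z) linarith
      also have "\<dots> \<le> \<rho> + \<bar>bayes_err S q (r z) - u\<bar>"
        unfolding expect_plus expect_const[OF r[OF z]] using risk[OF r[OF z]] by simp
      finally show "expect S n (r z) (\<lambda>xs. \<bar>Uh xs - u\<bar>) \<le> \<rho> + \<bar>bayes_err S q (r z) - u\<bar>" .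
    qed
    also have "\<dots> \<le> \<rho> + e" unfolding distrib_left sum.distrib weighted_mean_const[OF w] using e by simp
    finally show ?thesis .
  qed
  have p0: "0 \<le> p w xs" if "is_weight \<Omega> w" "xs \<in> samples S n" for w xs
    unfolding p_def using that is_weightD(2)[OF is_weight_samples[OF r]] is_weightD(2)[OF that(1)]
    by (intro sum_nonneg mult_nonneg_nonneg) auto
  have p1: "(\<Sum>xs\<in>samples S n. p w xs) = 1" if "is_weight \<Omega> w" for w
  proof -
    have "(\<Sum>xs\<in>samples S n. p w xs * 1) = (\<Sum>z\<in>\<Omega>. w z * expect S n (r z) (\<lambda>_. 1))" by (rule sw)
    also have "\<dots> = (\<Sum>z\<in>\<Omega>. w z * 1)" by (intro sum.cong refl) (simp only: expect_const[OF r])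
    finally show ?thesis using is_weightD(3)[OF that] by simp
  qed
  let ?d = "\<bar>u0 - u1\<bar>"
  have "(1 - T / 2) * ?d \<le> (\<Sum>xs\<in>samples S n. (p w0 xs + p w1 xs - \<bar>p w0 xs - p w1 xs\<bar>) / 2 * ?d)"
  proof -
    have "(\<Sum>xs\<in>samples S n. (p w0 xs + p w1 xs - \<bar>p w0 xs - p w1 xs\<bar>) / 2 * ?d)
        = (1 - (\<Sum>xs\<in>samples S n. \<bar>p w0 xs - p w1 xs\<bar>) / 2) * ?d"
      unfolding sum_distrib_right[symmetric] sum_divide_distrib[symmetric] sum_subtractf sum.distrib p1[OF w(1)] p1[OF w(2)] by simp
    moreover have "(1 - T / 2) * ?d \<le> (1 - (\<Sum>xs\<in>samples S n. \<bar>p w0 xs - p w1 xs\<bar>) / 2) * ?d"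
      using T by (intro mult_right_mono) (auto simp: p_def)
    ultimately show ?thesis by linarith
  qed
  also have "\<dots> \<le> (\<Sum>xs\<in>samples S n. p w0 xs * \<bar>Uh xs - u0\<bar> + p w1 xs * \<bar>Uh xs - u1\<bar>)"
  proof (rule sum_mono)
    fix xs assume xs: "xs \<in> samples S n"
    define m where "m = min (p w0 xs) (p w1 xs)"
    have m: "0 \<le> m" "m \<le> p w0 xs" "m \<le> p w1 xs" using p0[OF w(1) xs] p0[OF w(2) xs] by (auto simp: m_def)
    have "(p w0 xs + p w1 xs - \<bar>p w0 xs - p w1 xs\<bar>) / 2 = m" by (simp add: m_def min_def abs_if)
    then have "(p w0 xs + p w1 xs - \<bar>p w0 xs - p w1 xs\<bar>) / 2 * ?d \<le> m * (\<bar>Uh xs - u0\<bar> + \<bar>Uh xs - u1\<bar>)"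
      using m(1) by (auto intro!: mult_left_mono)
    also have "\<dots> \<le> p w0 xs * \<bar>Uh xs - u0\<bar> + p w1 xs * \<bar>Uh xs - u1\<bar>"
      unfolding distrib_left using m by (intro add_mono mult_right_mono) auto
    finally show "(p w0 xs + p w1 xs - \<bar>p w0 xs - p w1 xs\<bar>) / 2 * ?d \<le> p w0 xs * \<bar>Uh xs - u0\<bar> + p w1 xs * \<bar>Uh xs - u1\<bar>" .
  qed
  also have "\<dots> \<le> (\<rho> + e0) + (\<rho> + e1)"
    unfolding sum.distrib by (rule add_mono[OF half[OF w(1) e(1)] half[OF w(2) e(2)]])
  finally have fin: "(1 - T / 2) * ?d \<le> (\<rho> + e0) + (\<rho> + e1)" .
  have "(z - e0 - e1) / 2 \<le> \<rho>" if "z \<le> (\<rho> + e0) + (\<rho> + e1)" for z using that by (simp add: field_simps)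
  from this[OF fin] show "((1 - T / 2) * ?d - e0 - e1) / 2 \<le> \<rho>" .
qed

text \<open>Swapping the coordinate laws one at a time.\<close>

lemma hybrid_bound:
  fixes a0 a1 :: "nat \<Rightarrow> 'a \<Rightarrow> real" and F :: "'b \<Rightarrow> (nat \<Rightarrow> 'a) \<Rightarrow> real"
  assumes a: "\<And>i. i < m \<Longrightarrow> is_weight X (a0 i)" "\<And>i. i < m \<Longrightarrow> is_weight X (a1 i)" and X: "finite X"
  shows "(\<Sum>s\<in>A. \<bar>prod_exp X a0 m (F s) - prod_exp X a1 m (F s)\<bar>)
    \<le> (\<Sum>k<m. prod_exp X (\<lambda>i. if i < k then a1 i else a0 i) m
          (\<lambda>\<xi>. \<Sum>s\<in>A. \<bar>\<Sum>x\<in>X. (a0 k x - a1 k x) * F s (\<xi>(k := x))\<bar>))"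
proof -
  \<comment> \<open>In \<open>p k\<close> the first \<open>k\<close> coordinates already follow
    \<open>a1\<close>. Neighbouring hybrids differ at coordinate \<open>k\<close> alone, and after
    \<open>prod_exp_pull\<close> the integrand no longer reads it.\<close>
  define p where "p = (\<lambda>k i. if i < k then a1 i else a0 i)"
  have pw: "is_weight X (p k i)" if "i < m" for k i using a that by (simp add: p_def)
  have ends: "prod_exp X (p 0) m f = prod_exp X a0 m f" "prod_exp X (p m) m f = prod_exp X a1 m f" for f
    by (intro prod_exp_cong; simp add: p_def)+
  have step: "\<bar>prod_exp X (p k) m f - prod_exp X (p (Suc k)) m f\<bar>
      \<le> prod_exp X (p k) m (\<lambda>\<xi>. \<bar>\<Sum>x\<in>X. (a0 k x - a1 k x) * f (\<xi>(k := x))\<bar>)" if k: "k < m" for k f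
  proof -
    have "prod_exp X (p k) m f = (\<Sum>x\<in>X. p k k x * prod_exp X (p k) m (\<lambda>\<xi>. f (\<xi>(k := x))))"
      using pw k by (intro prod_exp_pull) auto
    moreover have "prod_exp X (p (Suc k)) m f = (\<Sum>x\<in>X. p (Suc k) k x * prod_exp X (p (Suc k)) m (\<lambda>\<xi>. f (\<xi>(k := x))))"
      using pw k by (intro prod_exp_pull) auto
    moreover have "prod_exp X (p (Suc k)) m (\<lambda>\<xi>. f (\<xi>(k := x))) = prod_exp X (p k) m (\<lambda>\<xi>. f (\<xi>(k := x)))" for x
      by (rule prod_exp_upd_cong[OF pw pw k]) (auto simp: p_def)
    ultimately have "prod_exp X (p k) m f - prod_exp X (p (Suc k)) m f
        = (\<Sum>x\<in>X. (a0 k x - a1 k x) * prod_exp X (p k) m (\<lambda>\<xi>. f (\<xi>(k := x))))"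
      by (simp add: p_def sum_subtractf[symmetric] left_diff_distrib)
    also have "\<dots> = prod_exp X (p k) m (\<lambda>\<xi>. \<Sum>x\<in>X. (a0 k x - a1 k x) * f (\<xi>(k := x)))"
      by (simp only: prod_exp_sum prod_exp_cmult)
    finally show ?thesis using prod_exp_abs_le[of m X "p k" "\<lambda>\<xi>. \<Sum>x\<in>X. (a0 k x - a1 k x) * f (\<xi>(k := x))"] pw X by simp
  qed
  have "(\<Sum>s\<in>A. \<bar>prod_exp X a0 m (F s) - prod_exp X a1 m (F s)\<bar>)
      \<le> (\<Sum>s\<in>A. \<Sum>k<m. \<bar>prod_exp X (p k) m (F s) - prod_exp X (p (Suc k)) m (F s)\<bar>)"
  proof (rule sum_mono)
    fix s
    have "prod_exp X a0 m (F s) - prod_exp X a1 m (F s) = (\<Sum>k<m. prod_exp X (p k) m (F s) - prod_exp X (p (Suc k)) m (F s))"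
      unfolding ends(1)[symmetric] ends(2)[symmetric] by (rule sum_lessThan_telescope'[symmetric])
    then show "\<bar>prod_exp X a0 m (F s) - prod_exp X a1 m (F s)\<bar> \<le> (\<Sum>k<m. \<bar>prod_exp X (p k) m (F s) - prod_exp X (p (Suc k)) m (F s)\<bar>)"
      by (simp only: sum_abs)
  qed
  also have "\<dots> \<le> (\<Sum>s\<in>A. \<Sum>k<m. prod_exp X (p k) m (\<lambda>\<xi>. \<bar>\<Sum>x\<in>X. (a0 k x - a1 k x) * F s (\<xi>(k := x))\<bar>))"
    by (intro sum_mono step) simp
  also have "\<dots> = (\<Sum>k<m. prod_exp X (p k) m (\<lambda>\<xi>. \<Sum>s\<in>A. \<bar>\<Sum>x\<in>X. (a0 k x - a1 k x) * F s (\<xi>(k := x))\<bar>))"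
    by (subst sum.swap) (simp only: prod_exp_sum)
  finally show ?thesis unfolding p_def .
qed

text \<open>Splits the symbols into 64 consecutive groups of small total mass and keeps the heaviest one.\<close>

lemma heavy_light_subset:
  fixes q g :: "nat \<Rightarrow> real"
  assumes q: "\<And>i. i \<in> I0 \<Longrightarrow> 0 \<le> q i" "\<And>i. i \<in> I0 \<Longrightarrow> q i \<le> 1 / 64" "(\<Sum>i\<in>I0. q i) \<le> 1"
    and I0: "finite I0" and g: "\<And>i. i \<in> I0 \<Longrightarrow> 0 \<le> g i"
  shows "\<exists>I\<subseteq>I0. (\<Sum>i\<in>I. q i) \<le> 1 / 32 \<and> (\<Sum>i\<in>I0. g i) / 65 \<le> (\<Sum>i\<in>I. g i)"
proof -
  \<comment> \<open>The mass of the symbols before \<open>i\<close>; consecutive groups are level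
    sets of its integer part on the scale 1/64.\<close>
  define s where "s = (\<lambda>i. \<Sum>j\<in>{j \<in> I0. j < i}. q j)"
  have s: "0 \<le> s i" "s i \<le> 1" for i
  proof -
    show "0 \<le> s i" unfolding s_def using q(1) by (intro sum_nonneg) auto
    have "s i \<le> (\<Sum>i\<in>I0. q i)" unfolding s_def using q(1) I0 by (intro sum_mono2) auto
    then show "s i \<le> 1" using q(3) by linarith
  qed
  \<comment> \<open>The bound \<open>s i \<le> 1\<close> is not strict, so index 64 is allowed for
    as well and there are 65 possible values.\<close>
  define b where "b = (\<lambda>i. nat \<lfloor>64 * s i\<rfloor>)"
  have b: "b i < 65" for i
  proof -
    have "nat \<lfloor>64 * s i\<rfloor> \<le> nat 64" using s(2)[of i] by (intro nat_mono) linarith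
    then show ?thesis by (simp add: b_def)
  qed
  have bs: "real (b i) \<le> 64 * s i" "64 * s i < real (b i) + 1" for i
    using s(1)[of i] by (auto simp: b_def)
  define G where "G = (\<lambda>v. {i \<in> I0. b i = v})"
  have "\<exists>v<65. (\<Sum>i\<in>I0. g i) / 65 \<le> (\<Sum>i\<in>G v. g i)"
  proof (rule ccontr)
    assume "\<not> ?thesis"
    then have lt: "\<And>v. v < 65 \<Longrightarrow> (\<Sum>i\<in>G v. g i) < (\<Sum>i\<in>I0. g i) / 65" by (auto simp: not_le)
    have "(\<Sum>i\<in>I0. g i) = (\<Sum>v<65. \<Sum>i\<in>G v. g i)"
      unfolding G_def using b by (intro sum.group[symmetric] I0) auto
    also have "\<dots> < (\<Sum>v<(65::nat). (\<Sum>i\<in>I0. g i) / 65)" using lt by (intro sum_strict_mono) (auto simp: lessThan_empty_iff)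
    also have "\<dots> = (\<Sum>i\<in>I0. g i)" by simp
    finally show False by simp
  qed
  then obtain v where v: "(\<Sum>i\<in>I0. g i) / 65 \<le> (\<Sum>i\<in>G v. g i)" by auto
  have "(\<Sum>i\<in>G v. q i) \<le> 1 / 32"
  proof (cases "G v = {}")
    case True then show ?thesis by simp
  next
    case False
    have fin: "finite (G v)" using I0 by (simp add: G_def)
    define l where "l = Min (G v)"
    define h where "h = Max (G v)"
    have lh: "l \<in> G v" "h \<in> G v" "\<And>i. i \<in> G v \<Longrightarrow> l \<le> i" "\<And>i. i \<in> G v \<Longrightarrow> i \<le> h"
      using fin False by (auto simp: l_def h_def)
    \<comment> \<open>Up to its last member the group carries at most the increment of
      \<open>s\<close>, below 1/64; the last member adds at most another 1/64.\<close>
    have "(\<Sum>i\<in>G v. q i) \<le> (\<Sum>i\<in>insert h ({j \<in> I0. j < h} - {j \<in> I0. j < l}). q i)"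
    proof (rule sum_mono2)
      show "G v \<subseteq> insert h ({j \<in> I0. j < h} - {j \<in> I0. j < l})"
      proof
        fix x assume x: "x \<in> G v"
        then have "x \<le> h" "\<not> x < l" using lh(3,4)[OF x] by auto
        then show "x \<in> insert h ({j \<in> I0. j < h} - {j \<in> I0. j < l})" using x by (auto simp: G_def)
      qed
      fix i assume "i \<in> insert h ({j \<in> I0. j < h} - {j \<in> I0. j < l}) - G v"
      then have "i \<in> I0" using lh(2) by (auto simp: G_def)
      then show "0 \<le> q i" by (rule q(1))
    qed (use I0 in simp)
    also have "\<dots> = q h + (\<Sum>i\<in>{j \<in> I0. j < h} - {j \<in> I0. j < l}. q i)"
      using I0 by (subst sum.insert) auto
    also have "\<dots> = q h + (s h - s l)"
      unfolding s_def using I0 lh(3)[OF lh(2)] by (subst sum_diff) auto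
    also have "\<dots> \<le> 1 / 64 + 1 / 64"
    proof -
      have "b h = v" "b l = v" "h \<in> I0" using lh by (auto simp: G_def)
      then show ?thesis using bs(2)[of h] bs(1)[of l] q(2)[of h] by simp
    qed
    finally show ?thesis by simp
  qed
  then show ?thesis using v by (intro exI[of _ "G v"]) (auto simp: G_def)
qed

text \<open>The symbols in \<open>I\<close> receive independent masses \<open>c i - W i * y i j\<close>, the index \<open>j\<close> having law \<open>a0 i\<close> or \<open>a1 i\<close>;
  the remaining mass goes to \<open>k0\<close>. Coordinates outside \<open>I\<close> are dummies. In the rare event that \<open>I\<close>
  receives too much mass, \<open>R = Q\<close> is used instead.\<close>

locale fuzzy_masses =
  fixes S n M k0 :: nat and q c W :: "nat \<Rightarrow> real" and y a0 a1 :: "nat \<Rightarrow> nat \<Rightarrow> real"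
    and D \<Lambda> :: real and I :: "nat set"
  assumes q: "dist_on S q" and k0: "k0 < S" "k0 \<notin> I" "q k0 \<le> 1 / 4" and I: "I \<subseteq> {..<S}"
    and D: "0 < D" "6 * real n * D \<le> real M" and \<Lambda>: "8 \<le> \<Lambda>"
    and W: "\<And>i. i \<in> I \<Longrightarrow> 0 < W i" "\<And>i. i \<in> I \<Longrightarrow> W i \<le> c i" "\<And>i. i \<in> I \<Longrightarrow> (W i)\<^sup>2 \<le> D * c i"
    and c: "\<And>i. i \<in> I \<Longrightarrow> \<Lambda> * (2 * c i) \<le> 1"
    and y: "\<And>i j. i \<in> I \<Longrightarrow> \<bar>y i j\<bar> \<le> 1"
    and weight: "\<And>i. i < S \<Longrightarrow> is_weight {..<8 * M} (a0 i)" "\<And>i. i < S \<Longrightarrow> is_weight {..<8 * M} (a1 i)"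
    and off: "\<And>i. i \<notin> I \<Longrightarrow> a0 i = a1 i"
    and moments: "\<And>i k. i \<in> I \<Longrightarrow> k \<le> 2 * M \<Longrightarrow> (\<Sum>j<8 * M. a0 i j * y i j ^ k) = (\<Sum>j<8 * M. a1 i j * y i j ^ k)"
    and means: "\<And>i. i \<in> I \<Longrightarrow> (\<Sum>j<8 * M. a0 i j * (c i - W i * y i j)) \<le> 4 * q i"
      "\<And>i. i \<in> I \<Longrightarrow> (\<Sum>j<8 * M. a1 i j * (c i - W i * y i j)) \<le> 4 * q i"
    and defect_le: "\<And>i j. i \<in> I \<Longrightarrow> (max 0 (q i - (c i - W i * y i j)))\<^sup>2 \<le> q i * D"
    and light: "(\<Sum>i\<in>I. q i) \<le> 1 / 32"
begin

abbreviation "J \<equiv> {..<8 * M}"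

definition "mass i j = c i - W i * y i j"
definition "load \<xi> = (\<Sum>i\<in>I. mass i (\<xi> i))"
text \<open>The threshold 3/4 leaves at least 1/4, hence at least \<open>q k0\<close>, for the
  compensating symbol. Tail estimates use 1/2 instead: one coordinate moves the load by at most 1/4
  and so cannot carry it from 1/2 past 3/4.\<close>

definition "mixed \<xi> = (if load \<xi> \<le> 3 / 4
  then (\<lambda>x. if x \<in> I then mass x (\<xi> x) else if x = k0 then 1 - load \<xi> else 0) else q)"
text \<open>For two distributions half the distance is the sum of the positive parts of
  \<open>q - r\<close>. This form leaves out the compensating symbol, whose positive part is zero,
  so the distance becomes a sum of independent terms.\<close>

definition "defect \<xi> = (\<Sum>i\<in>I. max 0 (q i - mass i (\<xi> i)))"
definition "rest = (\<Sum>x\<in>{..<S} - I - {k0}. q x)"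
text \<open>Captures what the two priors share with all hybrids between them, so that tail bounds
  apply during the exchange.\<close>

definition "admissible p \<longleftrightarrow> (\<forall>i<S. is_weight J (p i)) \<and> (\<forall>i\<in>I. (\<Sum>j<8 * M. p i j * mass i j) \<le> 4 * q i)"

lemma admissible_weights: "admissible a0" "admissible a1" "admissible (\<lambda>i. if i < k then a1 i else a0 i)"
  using weight means by (auto simp: admissible_def mass_def)

lemma fin_I: "finite I" using I finite_subset by blast

lemma c_bounds: assumes "i \<in> I" shows "0 < c i" "c i \<le> 1 / 16"
proof -
  show "0 < c i" using W(1,2)[OF assms] by linarith
  then have "8 * (2 * c i) \<le> \<Lambda> * (2 * c i)" using \<Lambda> by (intro mult_right_mono) auto
  then show "c i \<le> 1 / 16" using c[OF assms] by linarith
qed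

lemma mass_bounds:
  assumes i: "i \<in> I" shows "0 \<le> mass i j" "mass i j \<le> 2 * c i" "\<Lambda> * mass i j \<le> 1" "mass i j \<le> 1 / 4"
proof -
  have "\<bar>W i * y i j\<bar> \<le> W i * 1"
    unfolding abs_mult using W(1)[OF i] y[OF i, of j] by (intro mult_mono) auto
  then have "\<bar>W i * y i j\<bar> \<le> c i" using W(2)[OF i] by linarith
  then show a: "0 \<le> mass i j" and b: "mass i j \<le> 2 * c i" unfolding mass_def by linarith+
  have "\<Lambda> * mass i j \<le> \<Lambda> * (2 * c i)" using b \<Lambda> by (intro mult_left_mono) auto
  then show "\<Lambda> * mass i j \<le> 1" using c[OF i] by linarith
  show "mass i j \<le> 1 / 4" using b c_bounds(2)[OF i] by linarith
qed

lemma split_sum: "(\<Sum>x<S. if x \<in> I then f x else if x = k0 then b else 0) = (\<Sum>x\<in>I. f x) + (b :: real)"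
proof -
  have "(\<Sum>x<S. if x \<in> I then f x else if x = k0 then b else 0) = (\<Sum>x<S. (if x \<in> I then f x else 0) + (if x = k0 then b else 0))"
    using k0(2) by (intro sum.cong refl) auto
  also have "\<dots> = (\<Sum>x\<in>{..<S} \<inter> I. f x) + b"
    using k0(1) by (simp add: sum.distrib sum.inter_restrict)
  also have "{..<S} \<inter> I = I" using I by auto
  finally show ?thesis .
qed

lemma mixed_dist: "dist_on S (mixed \<xi>)"
proof (cases "load \<xi> \<le> 3 / 4")
  case True
  have "(\<Sum>x<S. mixed \<xi> x) = 1" using True by (simp add: mixed_def split_sum) (simp add: load_def)
  then show ?thesis using True mass_bounds(1) by (auto simp: dist_on_def mixed_def)
next
  case False then show ?thesis using q by (simp add: mixed_def)
qed

text \<open>Exponential Markov inequality with slope \<Lambda>. Single masses satisfy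
  \<open>\<Lambda> * mass \<le> 1\<close>, so the exponential is at most linear with slope 2. The
  mean load is at most \<open>4 / 32\<close>, giving the exponent
  \<open>8 * \<Lambda> / 32 - \<Lambda> / 2\<close>.\<close>

lemma load_tail:
  assumes p: "admissible p"
  shows "prod_exp J p S (\<lambda>\<xi>. if 1 / 2 < load \<xi> then 1 else 0) \<le> exp (- (\<Lambda> / 4))"
proof -
  have pw: "\<And>i. i < S \<Longrightarrow> is_weight J (p i)" using p by (simp add: admissible_def)
  have "prod_exp J p S (\<lambda>\<xi>. if 1 / 2 < load \<xi> then 1 else 0)
      \<le> prod_exp J p S (\<lambda>\<xi>. exp (- (\<Lambda> / 2)) * (\<Prod>i\<in>I. exp (\<Lambda> * mass i (\<xi> i))))"
  proof (rule prod_exp_mono[OF pw], assumption, simp)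
    fix \<xi>
    have e: "exp (- (\<Lambda> / 2)) * (\<Prod>i\<in>I. exp (\<Lambda> * mass i (\<xi> i))) = exp (\<Lambda> * load \<xi> - \<Lambda> / 2)"
      by (simp add: load_def sum_distrib_left exp_sum[OF fin_I, symmetric] exp_add[symmetric])
    show "(if 1 / 2 < load \<xi> then 1 else 0) \<le> exp (- (\<Lambda> / 2)) * (\<Prod>i\<in>I. exp (\<Lambda> * mass i (\<xi> i)))"
    proof (cases "1 / 2 < load \<xi>")
      case True
      then have "\<Lambda> * (1 / 2) \<le> \<Lambda> * load \<xi>" using \<Lambda> by (intro mult_left_mono) auto
      then show ?thesis unfolding e using True by simp
    qed (simp add: e)
  qed
  also have "\<dots> = exp (- (\<Lambda> / 2)) * (\<Prod>i\<in>I. \<Sum>x\<in>J. p i x * exp (\<Lambda> * mass i x))"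
    unfolding prod_exp_cmult by (subst prod_exp_prod_subset[where h="\<lambda>i x. exp (\<Lambda> * mass i x)"]) (use pw I in auto)
  also have "\<dots> \<le> exp (- (\<Lambda> / 2)) * (\<Prod>i\<in>I. exp (8 * \<Lambda> * q i))"
  proof (intro mult_left_mono prod_mono conjI)
    fix i assume i: "i \<in> I"
    then have w: "is_weight J (p i)" using pw I by auto
    show "0 \<le> (\<Sum>x\<in>J. p i x * exp (\<Lambda> * mass i x))"
      using is_weightD(2)[OF w] by (intro sum_nonneg mult_nonneg_nonneg) auto
    have "(\<Sum>x\<in>J. p i x * exp (\<Lambda> * mass i x)) \<le> (\<Sum>x\<in>J. p i x * (1 + (2 * \<Lambda>) * mass i x))"
    proof (rule weighted_mean_mono[OF w])
      fix x
      have z: "0 \<le> \<Lambda> * mass i x" "\<Lambda> * mass i x \<le> 1" using mass_bounds[OF i] \<Lambda> by auto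
      then have "(\<Lambda> * mass i x)\<^sup>2 \<le> \<Lambda> * mass i x" unfolding power2_eq_square by (intro mult_left_le) auto
      then show "exp (\<Lambda> * mass i x) \<le> 1 + (2 * \<Lambda>) * mass i x" using exp_bound[OF z] by (simp only: mult.assoc)
    qed
    also have "\<dots> = 1 + (2 * \<Lambda>) * (\<Sum>x\<in>J. p i x * mass i x)"
    proof -
      have "(\<Sum>x\<in>J. p i x * (1 + (2 * \<Lambda>) * mass i x)) = (\<Sum>x\<in>J. p i x * 1) + (\<Sum>x\<in>J. (2 * \<Lambda>) * (p i x * mass i x))"
        unfolding sum.distrib[symmetric] by (intro sum.cong refl) (simp add: algebra_simps)
      then show ?thesis unfolding weighted_mean_const[OF w] sum_distrib_left .
    qed
    also have "\<dots> \<le> 1 + (2 * \<Lambda>) * (4 * q i)"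
      using p i \<Lambda> by (intro add_left_mono mult_left_mono) (auto simp: admissible_def)
    also have "\<dots> \<le> exp (8 * \<Lambda> * q i)" using exp_ge_add_one_self[of "8 * \<Lambda> * q i"] by (simp add: mult_ac)
    finally show "(\<Sum>x\<in>J. p i x * exp (\<Lambda> * mass i x)) \<le> exp (8 * \<Lambda> * q i)" .
  qed simp
  also have "\<dots> = exp (8 * \<Lambda> * (\<Sum>i\<in>I. q i) - \<Lambda> / 2)"
    by (simp add: sum_distrib_left exp_sum[OF fin_I, symmetric] exp_add[symmetric])
  also have "\<dots> \<le> exp (- (\<Lambda> / 4))"
  proof -
    have "8 * \<Lambda> * (\<Sum>i\<in>I. q i) \<le> 8 * \<Lambda> * (1 / 32)" using light \<Lambda> by (intro mult_left_mono) auto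
    then show ?thesis by simp
  qed
  finally show ?thesis .
qed

text \<open>If the other symbols load at most 1/2, then 3/4 is never exceeded, whatever the mass of
  \<open>k\<close>, and \<open>single_symbol_mixture\<close> applies with centre \<open>c k\<close>
  at \<open>k\<close>; \<open>k0\<close> then keeps at least 7/16, more than \<open>c k\<close>.
  Otherwise the trivial bound 2 is charged to the load event.\<close>

lemma one_coordinate:
  assumes k: "k \<in> I"
  shows "(\<Sum>xs\<in>samples S n. \<bar>\<Sum>j\<in>J. (a0 k j - a1 k j) * prod_list (map (mixed (\<xi>(k := j))) xs)\<bar>)
    \<le> 2 * exp (- (real M / 2)) + 2 * (if 1 / 2 < load \<xi> then 1 else 0)"
proof -
  have kS: "k < S" "k \<noteq> k0" using k I k0(2) by auto
  have "(\<Sum>j\<in>J. \<bar>a0 k j - a1 k j\<bar>) \<le> (\<Sum>j\<in>J. a0 k j + a1 k j)"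
  proof (rule sum_mono)
    fix j assume "j \<in> J"
    then have "0 \<le> a0 k j" "0 \<le> a1 k j" using is_weightD(2)[OF weight(1)[OF kS(1)]] is_weightD(2)[OF weight(2)[OF kS(1)]] by auto
    then show "\<bar>a0 k j - a1 k j\<bar> \<le> a0 k j + a1 k j" by linarith
  qed
  also have "\<dots> = 2" using is_weightD(3)[OF weight(1)[OF kS(1)]] is_weightD(3)[OF weight(2)[OF kS(1)]] by (simp add: sum.distrib)
  finally have s2: "(\<Sum>j\<in>J. \<bar>a0 k j - a1 k j\<bar>) \<le> 2" .
  define Z where "Z = (\<Sum>i\<in>I - {k}. mass i (\<xi> i))"
  have tot: "load (\<xi>(k := j)) = mass k j + Z" for j
    unfolding load_def Z_def by (subst sum.remove[OF fin_I k]) simp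
  have Z0: "0 \<le> Z" unfolding Z_def using mass_bounds(1) by (intro sum_nonneg) auto
  show ?thesis
  proof (cases "Z \<le> 1 / 2")
    case True
    define \<rho> where "\<rho> = (\<lambda>x. if x \<in> I then (if x = k then c k else mass x (\<xi> x)) else if x = k0 then 1 - Z - c k else 0)"
    note ck = c_bounds[OF k]
    have "(\<Sum>x\<in>I. if x = k then c k else mass x (\<xi> x)) = c k + Z"
      unfolding Z_def by (subst sum.remove[OF fin_I k]) (auto intro: sum.cong)
    then have "(\<Sum>x<S. \<rho> x) = 1" unfolding \<rho>_def split_sum by simp
    then have \<rho>: "dist_on S \<rho>" using ck True mass_bounds(1) by (auto simp: dist_on_def \<rho>_def)
    have "(\<Sum>xs\<in>samples S n. \<bar>\<Sum>j<8 * M. (a0 k j - a1 k j) * prod_list (map (mixed (\<xi>(k := j))) xs)\<bar>) \<le> 2 * exp (- (real (2 * M) / 4))"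
    proof (rule single_symbol_mixture[OF \<rho> kS(1) k0(1) kS(2), where y="y k" and W="W k"])
      show "0 < \<rho> k" "\<rho> k \<le> \<rho> k0" using k k0(2) ck True by (auto simp: \<rho>_def)
      show "\<bar>y k j\<bar> \<le> 1" for j by (rule y[OF k])
      show "(\<Sum>j<8 * M. (a0 k j - a1 k j) * y k j ^ p) = 0" if "p \<le> 2 * M" for p
        using moments[OF k that] by (simp add: left_diff_distrib sum_subtractf)
      show "(\<Sum>j<8 * M. \<bar>a0 k j - a1 k j\<bar>) \<le> 2" by (rule s2)
      have "6 * real n * (W k)\<^sup>2 \<le> 6 * real n * (D * c k)" using W(3)[OF k] by (intro mult_left_mono) auto
      also have "\<dots> = (6 * real n * D) * c k" by simp
      also have "\<dots> \<le> real M * c k" using D(2) ck by (intro mult_right_mono) auto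
      finally show "6 * real n * (W k)\<^sup>2 \<le> real (2 * M) / 2 * \<rho> k" using k by (simp add: \<rho>_def)
      show "mixed (\<xi>(k := j)) x = \<rho> x + (if x = k then - W k * y k j else if x = k0 then W k * y k j else 0)" for j x
      proof -
        have "load (\<xi>(k := j)) \<le> 3 / 4" unfolding tot using True mass_bounds(4)[OF k, of j] by linarith
        then show ?thesis using k k0(2) by (auto simp: mixed_def \<rho>_def tot mass_def)
      qed
    qed
    then show ?thesis by (auto simp: algebra_simps)
  next
    case False
    have "(\<Sum>xs\<in>samples S n. \<bar>\<Sum>j\<in>J. (a0 k j - a1 k j) * prod_list (map (mixed (\<xi>(k := j))) xs)\<bar>)
        \<le> (\<Sum>xs\<in>samples S n. \<Sum>j\<in>J. \<bar>a0 k j - a1 k j\<bar> * prod_list (map (mixed (\<xi>(k := j))) xs))"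
    proof (rule sum_mono)
      fix xs assume xs: "xs \<in> samples S n"
      have "0 \<le> prod_list (map (mixed (\<xi>(k := j))) xs)" for j by (rule is_weightD(2)[OF is_weight_samples[OF mixed_dist] xs])
      then have "\<bar>(a0 k j - a1 k j) * prod_list (map (mixed (\<xi>(k := j))) xs)\<bar> = \<bar>a0 k j - a1 k j\<bar> * prod_list (map (mixed (\<xi>(k := j))) xs)" for j
        by (simp only: abs_mult abs_of_nonneg)
      then show "\<bar>\<Sum>j\<in>J. (a0 k j - a1 k j) * prod_list (map (mixed (\<xi>(k := j))) xs)\<bar>
          \<le> (\<Sum>j\<in>J. \<bar>a0 k j - a1 k j\<bar> * prod_list (map (mixed (\<xi>(k := j))) xs))"
        using sum_abs[of "\<lambda>j. (a0 k j - a1 k j) * prod_list (map (mixed (\<xi>(k := j))) xs)" J] by simp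
    qed
    also have "\<dots> = (\<Sum>j\<in>J. \<bar>a0 k j - a1 k j\<bar> * (\<Sum>xs\<in>samples S n. prod_list (map (mixed (\<xi>(k := j))) xs)))"
      by (subst sum.swap) (simp only: sum_distrib_left)
    also have "\<dots> = (\<Sum>j\<in>J. \<bar>a0 k j - a1 k j\<bar>)" by (simp only: is_weightD(3)[OF is_weight_samples[OF mixed_dist]] mult_1_right)
    also have "\<dots> \<le> 2" by (rule s2)
    also have "2 \<le> 2 * exp (- (real M / 2)) + 2 * (if 1 / 2 < load \<xi> then 1 else 0)"
    proof -
      have "load \<xi> = mass k (\<xi> k) + Z" unfolding load_def Z_def by (rule sum.remove[OF fin_I k])
      then show ?thesis using False mass_bounds(1)[OF k, of "\<xi> k"] by simp
    qed
    finally show ?thesis .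
  qed
qed

text \<open>Symbols outside \<open>I\<close> other than \<open>k0\<close> receive no mass and
  contribute their full \<open>q x\<close>, a constant. The symbol \<open>k0\<close> receives at
  least 1/4 and contributes nothing.\<close>

lemma bayes_mixed:
  assumes "load \<xi> \<le> 3 / 4"
  shows "bayes_err S q (mixed \<xi>) = 1 / 2 - (defect \<xi> + rest) / 2"
proof -
  have "(\<Sum>x<S. \<bar>mixed \<xi> x - q x\<bar>) = (\<Sum>x<S. 2 * max 0 (q x - mixed \<xi> x) + (mixed \<xi> x - q x))"
    by (intro sum.cong refl) (auto simp: max_def)
  also have "\<dots> = 2 * (\<Sum>x<S. max 0 (q x - mixed \<xi> x))"
    using mixed_dist[of \<xi>] q by (simp add: sum.distrib sum_subtractf dist_on_def sum_distrib_left)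
  also have "(\<Sum>x<S. max 0 (q x - mixed \<xi> x)) = (\<Sum>x\<in>I. max 0 (q x - mixed \<xi> x)) + (\<Sum>x\<in>{..<S} - I. max 0 (q x - mixed \<xi> x))"
    using I by (subst sum.subset_diff[of I "{..<S}"]) auto
  also have "(\<Sum>x\<in>I. max 0 (q x - mixed \<xi> x)) = defect \<xi>"
    using assms by (simp add: defect_def mixed_def)
  also have "(\<Sum>x\<in>{..<S} - I. max 0 (q x - mixed \<xi> x)) = max 0 (q k0 - mixed \<xi> k0) + (\<Sum>x\<in>{..<S} - I - {k0}. max 0 (q x - mixed \<xi> x))"
    using k0 by (intro sum.remove) auto
  also have "max 0 (q k0 - mixed \<xi> k0) = 0" using assms k0 by (simp add: mixed_def)
  also have "(\<Sum>x\<in>{..<S} - I - {k0}. max 0 (q x - mixed \<xi> x)) = rest"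
    unfolding rest_def using assms dist_on_le_1(1)[OF q] by (intro sum.cong refl) (auto simp: mixed_def)
  finally show ?thesis by (simp add: bayes_err_def)
qed

lemma defect_rest_range: "0 \<le> defect \<xi> + rest" "defect \<xi> + rest \<le> 1"
proof -
  have q0: "\<And>x. x < S \<Longrightarrow> 0 \<le> q x" using dist_on_le_1(1)[OF q] .
  have r0: "0 \<le> rest" unfolding rest_def using q0 by (intro sum_nonneg) auto
  have "0 \<le> defect \<xi>" unfolding defect_def by (intro sum_nonneg) auto
  then show "0 \<le> defect \<xi> + rest" using r0 by simp
  have "defect \<xi> \<le> (\<Sum>i\<in>I. q i)"
    unfolding defect_def using mass_bounds(1) q0 I by (intro sum_mono) (auto simp: subset_eq)
  also have "\<dots> + rest = (\<Sum>i\<in>I \<union> ({..<S} - I - {k0}). q i)"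
    unfolding rest_def using fin_I by (intro sum.union_disjoint[symmetric]) auto
  also have "\<dots> \<le> (\<Sum>i<S. q i)" using I q0 by (intro sum_mono2) auto
  also have "\<dots> = 1" using q by (simp add: dist_on_def)
  finally show "defect \<xi> + rest \<le> 1" by simp
qed

text \<open>\<open>efron_stein\<close> with the predictor that drops the k-th summand: its square is
  at most \<open>q k * D\<close>, and these bounds add up to \<open>D\<close>. On the rare heavy
  loads the error beyond the deviation of the defect is at most 1.\<close>

lemma bayes_concentration:
  assumes p: "admissible p"
  shows "prod_exp J p S (\<lambda>\<xi>. \<bar>bayes_err S q (mixed \<xi>) - (1 / 2 - (prod_exp J p S defect + rest) / 2)\<bar>)
    \<le> sqrt D + exp (- (\<Lambda> / 4))"
proof -
  have pw: "\<And>i. i < S \<Longrightarrow> is_weight J (p i)" using p by (simp add: admissible_def)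
  let ?E = "prod_exp J p S"
  define m where "m = ?E defect"
  have "?E (\<lambda>\<xi>. (defect \<xi> - m)\<^sup>2) = ?E (\<lambda>\<xi>. (defect \<xi>)\<^sup>2 - 2 * m * defect \<xi> + m\<^sup>2)"
    by (intro arg_cong[where f="?E"] ext) (simp add: power2_eq_square algebra_simps)
  also have "\<dots> = ?E (\<lambda>\<xi>. (defect \<xi>)\<^sup>2) - (?E defect)\<^sup>2"
    unfolding prod_exp_add prod_exp_diff prod_exp_cmult using prod_exp_const[of S J p "m\<^sup>2"] pw by (simp add: m_def power2_eq_square)
  also have "\<dots> \<le> (\<Sum>k<S. ?E (\<lambda>\<xi>. \<Sum>x\<in>J. p k x * (defect (\<xi>(k := x)) - (\<Sum>i\<in>I - {k}. max 0 (q i - mass i (\<xi> i))))\<^sup>2))"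
    by (rule efron_stein) (use pw in auto)
  also have "\<dots> \<le> (\<Sum>k<S. if k \<in> I then q k * D else 0)"
  proof (rule sum_mono)
    fix k assume kS: "k \<in> {..<S}"
    have "?E (\<lambda>\<xi>. \<Sum>x\<in>J. p k x * (defect (\<xi>(k := x)) - (\<Sum>i\<in>I - {k}. max 0 (q i - mass i (\<xi> i))))\<^sup>2)
      \<le> ?E (\<lambda>\<xi>. if k \<in> I then q k * D else 0)"
    proof (rule prod_exp_mono[OF pw], assumption, simp)
      fix \<xi>
      have "(\<Sum>x\<in>J. p k x * (defect (\<xi>(k := x)) - (\<Sum>i\<in>I - {k}. max 0 (q i - mass i (\<xi> i))))\<^sup>2)
          \<le> (\<Sum>x\<in>J. p k x * (if k \<in> I then q k * D else 0))"
      proof (rule weighted_mean_mono)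
        show "is_weight J (p k)" using pw kS by simp
        fix x
        show "(defect (\<xi>(k := x)) - (\<Sum>i\<in>I - {k}. max 0 (q i - mass i (\<xi> i))))\<^sup>2 \<le> (if k \<in> I then q k * D else 0)"
        proof (cases "k \<in> I")
          case True
          have "defect (\<xi>(k := x)) = max 0 (q k - mass k x) + (\<Sum>i\<in>I - {k}. max 0 (q i - mass i (\<xi> i)))"
            unfolding defect_def by (subst sum.remove[OF fin_I True]) simp
          then show ?thesis using True defect_le[OF True, of x] by (simp add: mass_def)
        next
          case False
          have "defect (\<xi>(k := x)) = (\<Sum>i\<in>I - {k}. max 0 (q i - mass i (\<xi> i)))"
            unfolding defect_def using False by (intro sum.cong) auto
          then show ?thesis using False by simp
        qed
      qed
      also have "\<dots> = (if k \<in> I then q k * D else 0)" by (rule weighted_mean_const) (use pw kS in simp)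
      finally show "(\<Sum>x\<in>J. p k x * (defect (\<xi>(k := x)) - (\<Sum>i\<in>I - {k}. max 0 (q i - mass i (\<xi> i))))\<^sup>2) \<le> (if k \<in> I then q k * D else 0)" .
    qed
    then show "?E (\<lambda>\<xi>. \<Sum>x\<in>J. p k x * (defect (\<xi>(k := x)) - (\<Sum>i\<in>I - {k}. max 0 (q i - mass i (\<xi> i))))\<^sup>2) \<le> (if k \<in> I then q k * D else 0)"
      using prod_exp_const[of S J p "if k \<in> I then q k * D else 0"] pw by simp
  qed
  also have "\<dots> \<le> D"
  proof -
    have "(\<Sum>k<S. if k \<in> I then q k * D else 0) \<le> (\<Sum>k<S. q k * D)"
      using D(1) dist_on_le_1(1)[OF q] by (intro sum_mono) auto
    also have "\<dots> = D" using q by (simp add: dist_on_def sum_distrib_right[symmetric])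
    finally show ?thesis .
  qed
  finally have var: "?E (\<lambda>\<xi>. (defect \<xi> - m)\<^sup>2) \<le> D" .
  have dev: "?E (\<lambda>\<xi>. \<bar>defect \<xi> - m\<bar>) \<le> sqrt D"
    by (rule order_trans[OF prod_exp_abs_le_sqrt real_sqrt_le_mono[OF var]]) (use pw in auto)
  have "?E (\<lambda>\<xi>. \<bar>bayes_err S q (mixed \<xi>) - (1 / 2 - (m + rest) / 2)\<bar>)
      \<le> ?E (\<lambda>\<xi>. \<bar>defect \<xi> - m\<bar> + (if 1 / 2 < load \<xi> then 1 else 0))"
  proof (rule prod_exp_mono[OF pw], assumption, simp)
    fix \<xi>
    show "\<bar>bayes_err S q (mixed \<xi>) - (1 / 2 - (m + rest) / 2)\<bar> \<le> \<bar>defect \<xi> - m\<bar> + (if 1 / 2 < load \<xi> then 1 else 0)"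
    proof -
      define v where "v = (defect \<xi> + rest) / 2"
      define w where "w = (m - defect \<xi>) / 2"
      have m: "(m + rest) / 2 = v + w" by (simp add: v_def w_def field_simps)
      have d: "\<bar>defect \<xi> - m\<bar> = 2 * \<bar>w\<bar>" by (simp add: w_def abs_minus_commute)
      have v: "0 \<le> v" "v \<le> 1 / 2" using defect_rest_range[of \<xi>] by (simp_all add: v_def)
      show ?thesis
      proof (cases "load \<xi> \<le> 3 / 4")
        case True
        have "bayes_err S q (mixed \<xi>) = 1 / 2 - v" unfolding v_def by (rule bayes_mixed[OF True])
        then show ?thesis unfolding m d by simp
      next
        case False
        then have "(if 1 / 2 < load \<xi> then 1 else 0) = (1 :: real)" by simp
        moreover have "0 \<le> bayes_err S q (mixed \<xi>)" "bayes_err S q (mixed \<xi>) \<le> 1 / 2"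
          using dist_on_emp_bayes_range[OF q mixed_dist] by auto
        ultimately show ?thesis unfolding m d using v by (simp only:)
      qed
    qed
  qed
  also have "\<dots> \<le> sqrt D + exp (- (\<Lambda> / 4))" unfolding prod_exp_add using dev load_tail[OF p] by linarith
  finally show ?thesis unfolding m_def .
qed

text \<open>A positive part is half of an absolute value plus a linear term, and the linear term has
  the same mean under both priors because first moments are matched.\<close>

lemma defect_gap:
  "prod_exp J a1 S defect - prod_exp J a0 S defect
   = (\<Sum>i\<in>I. (\<Sum>j\<in>J. a1 i j * \<bar>mass i j - q i\<bar>) - (\<Sum>j\<in>J. a0 i j * \<bar>mass i j - q i\<bar>)) / 2"
proof -
  have E: "prod_exp J p S defect = (\<Sum>i\<in>I. \<Sum>j\<in>J. p i j * max 0 (q i - mass i j))"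
    if w: "\<And>i. i < S \<Longrightarrow> is_weight J (p i)" for p
  proof -
    have "prod_exp J p S defect = (\<Sum>i\<in>I. prod_exp J p S (\<lambda>\<xi>. max 0 (q i - mass i (\<xi> i))))"
      unfolding prod_exp_sum[symmetric] by (intro arg_cong[where f="prod_exp J p S"] ext) (simp add: defect_def)
    also have "\<dots> = (\<Sum>i\<in>I. \<Sum>j\<in>J. p i j * max 0 (q i - mass i j))"
    proof (rule sum.cong[OF refl])
      fix i assume "i \<in> I"
      then have i: "i < S" using I by auto
      show "prod_exp J p S (\<lambda>\<xi>. max 0 (q i - mass i (\<xi> i))) = (\<Sum>j\<in>J. p i j * max 0 (q i - mass i j))"
        using prod_exp_prod_subset[of J S p "{i}" "\<lambda>i x. max 0 (q i - mass i x)"] w i by simp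
    qed
    finally show ?thesis .
  qed
  have mx: "max 0 (q i - mass i j) = \<bar>mass i j - q i\<bar> / 2 + (q i - c i) / 2 + W i / 2 * y i j" for i j
    by (simp add: mass_def max_def field_simps abs_if)
  have half: "(\<Sum>j\<in>J. p i j * max 0 (q i - mass i j))
      = (\<Sum>j\<in>J. p i j * \<bar>mass i j - q i\<bar>) / 2 + (q i - c i) / 2 + W i / 2 * (\<Sum>j\<in>J. p i j * y i j)" if "is_weight J (p i)" for p i
  proof -
    have "(\<Sum>j\<in>J. p i j * max 0 (q i - mass i j)) = (\<Sum>j\<in>J. p i j * \<bar>mass i j - q i\<bar> / 2 + p i j * ((q i - c i) / 2) + W i / 2 * (p i j * y i j))"
      unfolding mx by (intro sum.cong refl) (simp add: algebra_simps)
    then show ?thesis unfolding sum.distrib weighted_mean_const[OF that] by (simp add: sum_distrib_left sum_divide_distrib)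
  qed
  have "(\<Sum>j\<in>J. a1 i j * max 0 (q i - mass i j)) - (\<Sum>j\<in>J. a0 i j * max 0 (q i - mass i j))
      = ((\<Sum>j\<in>J. a1 i j * \<bar>mass i j - q i\<bar>) - (\<Sum>j\<in>J. a0 i j * \<bar>mass i j - q i\<bar>)) / 2" if i: "i \<in> I" for i
  proof -
    have iS: "i < S" using i I by auto
    have "1 \<le> 2 * M"
    proof (rule ccontr)
      assume "\<not> 1 \<le> 2 * M"
      then have "M = 0" by simp
      then show False using is_weightD(3)[OF weight(1)[OF iS]] by simp
    qed
    then have "(\<Sum>j\<in>J. a0 i j * y i j) = (\<Sum>j\<in>J. a1 i j * y i j)" using moments[OF i, of 1] by simp
    then show ?thesis using half[of a0 i, OF weight(1)[OF iS]] half[of a1 i, OF weight(2)[OF iS]] by (simp add: field_simps)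
  qed
  then have "(\<Sum>i\<in>I. (\<Sum>j\<in>J. a1 i j * max 0 (q i - mass i j)) - (\<Sum>j\<in>J. a0 i j * max 0 (q i - mass i j)))
      = (\<Sum>i\<in>I. ((\<Sum>j\<in>J. a1 i j * \<bar>mass i j - q i\<bar>) - (\<Sum>j\<in>J. a0 i j * \<bar>mass i j - q i\<bar>)) / 2)"
    by (intro sum.cong refl)
  moreover have "prod_exp J a0 S defect = (\<Sum>i\<in>I. \<Sum>j\<in>J. a0 i j * max 0 (q i - mass i j))"
    by (rule E) (rule weight(1))
  moreover have "prod_exp J a1 S defect = (\<Sum>i\<in>I. \<Sum>j\<in>J. a1 i j * max 0 (q i - mass i j))"
    by (rule E) (rule weight(2))
  ultimately show ?thesis by (simp only: sum_subtractf sum_divide_distrib diff_divide_distrib)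
qed

text \<open>Each of the \<open>S\<close> exchanges costs the mixture bound plus the load probability
  under the current hybrid; dummy coordinates cost nothing. The Bayes error is separated by half of
  the defect gap, that is by \<open>\<Gamma> / 4\<close>.\<close>

lemma R_EST_ge_fuzzy:
  defines "\<Gamma> \<equiv> (\<Sum>i\<in>I. (\<Sum>j\<in>J. a1 i j * \<bar>mass i j - q i\<bar>) - (\<Sum>j\<in>J. a0 i j * \<bar>mass i j - q i\<bar>))"
  assumes \<Gamma>: "0 \<le> \<Gamma>"
  shows "((1 - real S * (exp (- (real M / 2)) + exp (- (\<Lambda> / 4)))) * (\<Gamma> / 4) - 2 * (sqrt D + exp (- (\<Lambda> / 4)))) / 2 \<le> R_EST S q n"
proof -
  let ?X = "PiE {..<S} (\<lambda>_. J)"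
  define w where "w = (\<lambda>(a :: nat \<Rightarrow> nat \<Rightarrow> real) \<xi>. \<Prod>i<S. a i (\<xi> i))"
  have E: "(\<Sum>\<xi>\<in>?X. w a \<xi> * f \<xi>) = prod_exp J a S f" for a f by (simp add: prod_exp_def w_def)
  define u where "u = (\<lambda>a. 1 / 2 - (prod_exp J a S defect + rest) / 2)"
  define t where "t = exp (- (real M / 2)) + exp (- (\<Lambda> / 4))"
  have TV: "(\<Sum>xs\<in>samples S n. \<bar>(\<Sum>\<xi>\<in>?X. w a0 \<xi> * prod_list (map (mixed \<xi>) xs)) - (\<Sum>\<xi>\<in>?X. w a1 \<xi> * prod_list (map (mixed \<xi>) xs))\<bar>)
     \<le> real S * (2 * t)"
  proof -
    have "(\<Sum>xs\<in>samples S n. \<bar>prod_exp J a0 S (\<lambda>\<xi>. prod_list (map (mixed \<xi>) xs)) - prod_exp J a1 S (\<lambda>\<xi>. prod_list (map (mixed \<xi>) xs))\<bar>)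
      \<le> (\<Sum>k<S. prod_exp J (\<lambda>i. if i < k then a1 i else a0 i) S
          (\<lambda>\<xi>. \<Sum>xs\<in>samples S n. \<bar>\<Sum>x\<in>J. (a0 k x - a1 k x) * prod_list (map (mixed (\<xi>(k := x))) xs)\<bar>))"
      by (rule hybrid_bound[where F="\<lambda>xs \<xi>. prod_list (map (mixed \<xi>) xs)"]) (use weight in auto)
    also have "\<dots> \<le> (\<Sum>k<S. 2 * t)"
    proof (rule sum_mono)
      fix k
      let ?p = "\<lambda>i. if i < k then a1 i else a0 i"
      have pw: "\<And>i. i < S \<Longrightarrow> is_weight J (?p i)" using weight by auto
      have t0: "0 \<le> t" by (simp add: t_def)
      have "prod_exp J ?p S (\<lambda>\<xi>. \<Sum>xs\<in>samples S n. \<bar>\<Sum>x\<in>J. (a0 k x - a1 k x) * prod_list (map (mixed (\<xi>(k := x))) xs)\<bar>)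
          \<le> prod_exp J ?p S (\<lambda>\<xi>. 2 * exp (- (real M / 2)) + 2 * (if 1 / 2 < load \<xi> then 1 else 0))"
      proof (rule prod_exp_mono[OF pw], assumption, simp)
        fix \<xi>
        show "(\<Sum>xs\<in>samples S n. \<bar>\<Sum>x\<in>J. (a0 k x - a1 k x) * prod_list (map (mixed (\<xi>(k := x))) xs)\<bar>)
            \<le> 2 * exp (- (real M / 2)) + 2 * (if 1 / 2 < load \<xi> then 1 else 0)"
        proof (cases "k \<in> I")
          case True then show ?thesis by (rule one_coordinate)
        next
          case False then show ?thesis by (simp add: off)
        qed
      qed
      also have "\<dots> = 2 * exp (- (real M / 2)) + 2 * prod_exp J ?p S (\<lambda>\<xi>. if 1 / 2 < load \<xi> then 1 else 0)"
        unfolding prod_exp_add prod_exp_cmult using prod_exp_const[of S J ?p "exp (- (real M / 2))"] pw by simp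
      also have "\<dots> \<le> 2 * t" using load_tail[OF admissible_weights(3)[of k]] by (simp add: t_def)
      finally show "prod_exp J ?p S (\<lambda>\<xi>. \<Sum>xs\<in>samples S n. \<bar>\<Sum>x\<in>J. (a0 k x - a1 k x) * prod_list (map (mixed (\<xi>(k := x))) xs)\<bar>) \<le> 2 * t" .
    qed
    finally show ?thesis unfolding E by simp
  qed
  have le_cam: "((1 - real S * (2 * t) / 2) * \<bar>u a0 - u a1\<bar> - (sqrt D + exp (- (\<Lambda> / 4))) - (sqrt D + exp (- (\<Lambda> / 4)))) / 2 \<le> R_EST S q n"
  proof (rule R_EST_ge_two_mixtures[OF q _ _ mixed_dist TV])
    show "is_weight ?X (w a0)" unfolding w_def by (rule is_weight_prod) (use weight in auto)
    show "is_weight ?X (w a1)" unfolding w_def by (rule is_weight_prod) (use weight in auto)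
    show "(\<Sum>\<xi>\<in>?X. w a0 \<xi> * \<bar>bayes_err S q (mixed \<xi>) - u a0\<bar>) \<le> sqrt D + exp (- (\<Lambda> / 4))"
      unfolding E u_def by (rule bayes_concentration[OF admissible_weights(1)])
    show "(\<Sum>\<xi>\<in>?X. w a1 \<xi> * \<bar>bayes_err S q (mixed \<xi>) - u a1\<bar>) \<le> sqrt D + exp (- (\<Lambda> / 4))"
      unfolding E u_def by (rule bayes_concentration[OF admissible_weights(2)])
  qed
  have u_diff: "\<bar>u a0 - u a1\<bar> = \<Gamma> / 4"
  proof -
    have "u a0 - u a1 = (prod_exp J a1 S defect - prod_exp J a0 S defect) / 2" by (simp add: u_def field_simps)
    then show ?thesis unfolding defect_gap \<Gamma>_def[symmetric] using \<Gamma> by simp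
  qed
  have "real S * (2 * t) / 2 = real S * t" "z - x - x = z - 2 * x" for z x :: real by simp_all
  then show ?thesis using le_cam unfolding u_diff t_def by (simp only:)
qed

end

text \<open>A crude bound for small \<open>n\<close>. The alternative moves half of all mass to one
  symbol of mass at most 1/2, so \<open>Q\<close> has density at most 2 with respect to it and
  sample likelihoods differ by at most \<open>2 ^ n\<close>, while the Bayes errors differ by at
  least 1/8.\<close>

lemma R_EST_ge_two_point:
  assumes q: "dist_on S q" and S: "2 \<le> S"
  shows "1 / (16 * 2 ^ n) \<le> R_EST S q n"
proof -
  have q0: "\<And>i. i < S \<Longrightarrow> 0 \<le> q i" and q1: "(\<Sum>i<S. q i) = 1" using q by (auto simp: dist_on_def)
  obtain k where k: "k < S" "q k \<le> 1 / 2"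
  proof -
    have "q 0 + q 1 = (\<Sum>i\<in>{0,1}. q i)" by simp
    also have "\<dots> \<le> (\<Sum>i<S. q i)" using S q0 by (intro sum_mono2) auto
    finally have "q 0 \<le> 1 / 2 \<or> q 1 \<le> 1 / 2" using q1 by linarith
    then show ?thesis using that[of 0] that[of 1] S by auto
  qed
  define r where "r = (\<lambda>i. q i / 2 + (if i = k then 1 / 2 else 0))"
  have r: "dist_on S r" using q0 q1 k(1) by (auto simp: dist_on_def r_def sum.distrib sum_divide_distrib[symmetric])
  have "bayes_err S q r \<le> 1 / 2 - 1 / 4 * (1 / 2)"
  proof -
    have "\<bar>r k - q k\<bar> + (\<Sum>i\<in>{..<S} - {k}. \<bar>r i - q i\<bar>) = (1 - q k) / 2 + (\<Sum>i\<in>{..<S} - {k}. q i) / 2"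
    proof -
      have "\<bar>r k - q k\<bar> = (1 - q k) / 2" using k by (simp add: r_def abs_if field_simps)
      moreover have "(\<Sum>i\<in>{..<S} - {k}. \<bar>r i - q i\<bar>) = (\<Sum>i\<in>{..<S} - {k}. q i / 2)"
        using q0 by (intro sum.cong refl) (auto simp: r_def)
      ultimately show ?thesis by (simp add: sum_divide_distrib)
    qed
    moreover have "(\<Sum>i<S. \<bar>r i - q i\<bar>) = \<bar>r k - q k\<bar> + (\<Sum>i\<in>{..<S} - {k}. \<bar>r i - q i\<bar>)"
      using k(1) by (intro sum.remove) auto
    moreover have "(\<Sum>i\<in>{..<S} - {k}. q i) = 1 - q k"
      using k(1) q1 sum.remove[of "{..<S}" k q] by simp
    ultimately have "(\<Sum>i<S. \<bar>r i - q i\<bar>) = (1 - q k) / 2 + (1 - q k) / 2" by (simp only:)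
    then have "(\<Sum>i<S. \<bar>r i - q i\<bar>) = 1 - q k" by (simp only: field_sum_of_halves)
    then show ?thesis using k(2) by (simp add: bayes_err_def)
  qed
  moreover have "bayes_err S q q = 1 / 2" by (simp add: bayes_err_def)
  ultimately have gap: "1 / 8 \<le> \<bar>bayes_err S q q - bayes_err S q r\<bar>" by linarith
  show ?thesis
  proof (rule R_EST_ge[OF q])
    fix Uh :: "nat list \<Rightarrow> real" and \<rho> :: real
    assume risk: "\<And>r. dist_on S r \<Longrightarrow> expect S n r (\<lambda>xs. \<bar>Uh xs - bayes_err S q r\<bar>) \<le> \<rho>"
    have "expect S n q (\<lambda>xs. \<bar>Uh xs - bayes_err S q r\<bar>) \<le> 2 ^ n * expect S n r (\<lambda>xs. \<bar>Uh xs - bayes_err S q r\<bar>)"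
      unfolding expect_def sum_distrib_left
    proof (rule sum_mono)
      fix xs assume xs: "xs \<in> samples S n"
      have "set xs \<subseteq> {..<S} \<Longrightarrow> 0 \<le> prod_list (map r xs) \<and> 0 \<le> prod_list (map q xs) \<and> prod_list (map q xs) \<le> 2 ^ length xs * prod_list (map r xs)" for xs
      proof (induction xs)
        case (Cons x xs)
        then have x: "x < S" and IH: "0 \<le> prod_list (map r xs)" "0 \<le> prod_list (map q xs)" "prod_list (map q xs) \<le> 2 ^ length xs * prod_list (map r xs)" by auto
        have rx: "0 \<le> q x" "q x \<le> 2 * r x" "0 \<le> r x" using q0[OF x] by (auto simp: r_def)
        have "q x * prod_list (map q xs) \<le> (2 * r x) * (2 ^ length xs * prod_list (map r xs))"
          using rx IH by (intro mult_mono) auto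
        then show ?case using rx IH by (simp add: mult_ac)
      qed simp
      then have "prod_list (map q xs) \<le> 2 ^ n * prod_list (map r xs)" using xs by (auto simp: samples_def)
      then have "prod_list (map q xs) * \<bar>Uh xs - bayes_err S q r\<bar> \<le> (2 ^ n * prod_list (map r xs)) * \<bar>Uh xs - bayes_err S q r\<bar>"
        by (intro mult_right_mono) auto
      then show "prod_list (map q xs) * \<bar>Uh xs - bayes_err S q r\<bar> \<le> 2 ^ n * (prod_list (map r xs) * \<bar>Uh xs - bayes_err S q r\<bar>)"
        by (simp only: mult.assoc)
    qed
    also have "\<dots> \<le> 2 ^ n * \<rho>" using risk[OF r] by (intro mult_left_mono) auto
    finally have 1: "expect S n q (\<lambda>xs. \<bar>Uh xs - bayes_err S q r\<bar>) \<le> 2 ^ n * \<rho>" .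
    have \<rho>0: "0 \<le> \<rho>" by (rule order_trans[OF _ risk[OF q]]) (intro expect_nonneg[OF q], simp)
    have "1 * \<rho> \<le> 2 ^ n * \<rho>" using \<rho>0 by (intro mult_right_mono) auto
    then have 2: "expect S n q (\<lambda>xs. \<bar>Uh xs - bayes_err S q q\<bar>) \<le> 2 ^ n * \<rho>" using risk[OF q] by linarith
    have "1 / 8 = expect S n q (\<lambda>_. 1 / 8)" by (simp only: expect_const[OF q])
    also have "\<dots> \<le> expect S n q (\<lambda>xs. \<bar>Uh xs - bayes_err S q r\<bar> + \<bar>Uh xs - bayes_err S q q\<bar>)"
      by (intro expect_mono[OF q]) (use gap in linarith)
    also have "\<dots> \<le> 2 ^ n * \<rho> + 2 ^ n * \<rho>" unfolding expect_plus using 1 2 by linarith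
    finally have "1 / 16 \<le> 2 ^ n * \<rho>" by linarith
    then show "1 / (16 * 2 ^ n) \<le> \<rho>" by (simp add: field_simps)
  qed
qed

section \<open>Choice of parameters for the estimation lower bound\<close>

lemma regime_card_ge:
  assumes "regime c1 c2 S q n" "c2 > 0"
  shows "real n powr (1 / c2) \<le> real S"
proof -
  have q: "dist_on S q" by (rule regimeD(2)[OF assms(1)])
  have "real n powr (1 / c2) \<le> (\<Sum>i<S. min (sqrt (q i)) (q i * sqrt (real n * ln (real n))))"
    by (rule regime_sum_ge[OF assms])
  also have "\<dots> \<le> (\<Sum>i<S. 1)"
  proof (rule sum_mono)
    fix i assume "i \<in> {..<S}"
    then have "q i \<le> 1" using dist_on_le_1(2)[OF q] by simp
    then show "min (sqrt (q i)) (q i * sqrt (real n * ln (real n))) \<le> 1" by (simp add: min.coboundedI1)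
  qed
  finally show ?thesis by simp
qed

text \<open>The premises \<open>n\<close> collect all largeness demands. The number of matched
  moments is about \<open>K * ln n\<close> with \<open>K = 2 * (c1 + 1)\<close>, so that
  \<open>S * exp (- (M / 2))\<close> is at most \<open>1 / n\<close>. Symbols heavier than
  \<open>1 / n powr \<gamma>\<close> are discarded to make the load concentrate.\<close>

lemma R_EST_ge_rate_est:
  fixes S n :: nat and c1 c2 \<gamma> K \<eta> :: real
  assumes reg: "regime c1 c2 S q n" and c2: "c2 > 0" and \<gamma>: "0 < \<gamma>" "4 * \<gamma> \<le> 1 / c2"
    and K: "K = 2 * (c1 + 1)" "1 \<le> K" and \<eta>: "\<eta> = 1 / (672 * sqrt (12 * K) * 8320)"
    and n: "21 \<le> K * ln (real n)" "4 \<le> real n" "64 \<le> real n powr \<gamma>"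
      "K * ln (real n) * real n powr \<gamma> \<le> 3 * real n"
      "real n powr c1 * exp (- (real n powr \<gamma> / 8)) \<le> 1 / 4"
      "2 * (1 + real n powr \<gamma>) \<le> real n powr (4 * \<gamma>)"
      "sqrt (K / 3) * ln (real n) \<le> \<eta> * real n powr (4 * \<gamma>)"
      "exp (- (real n powr \<gamma> / 8)) \<le> \<eta> * (1 / real n)"
  shows "\<eta> * rate_est S q n \<le> R_EST S q n"
proof -
  define l where "l = ln (real n)"
  define P where "P = real n powr \<gamma>"
  note q = regimeD(2)[OF reg]
  have n0: "0 < real n" and P0: "0 < P" using n by (auto simp: P_def)
  have l0: "0 < l" using n(2) by (simp add: l_def)
  have \<eta>0: "0 < \<eta>" using K(2) by (simp add: \<eta>)
  have nn: "real n powr (4 * \<gamma>) \<le> real n powr (1 / c2)" using n(2) \<gamma>(2) by (intro powr_mono) auto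
  define M where "M = nat \<lceil>K * l\<rceil>"
  have M: "K * l \<le> real M" "real M \<le> 2 * K * l" "21 \<le> M"
  proof -
    have Kl: "21 \<le> K * l" using n(1) by (simp add: l_def)
    then have "real M = of_int \<lceil>K * l\<rceil>" by (simp add: M_def)
    then show A: "K * l \<le> real M" "real M \<le> 2 * K * l" using Kl by linarith+
    have "21 \<le> real M" using A(1) Kl by linarith
    then show "21 \<le> M" by simp
  qed
  have M0: "0 < real M" using M(3) by simp
  \<comment> \<open>The largest value allowed by \<open>6 * n * D \<le> M\<close>, the balance
    between prior width and matched moments.\<close>
  define D where "D = real M / (6 * real n)"
  have D0: "0 < D" using M0 n0 by (simp add: D_def)
  have Dn: "6 * real n * D \<le> real M" using n0 by (simp add: D_def)
  have DK: "D \<le> K * l / (3 * real n)" using M(2) n0 by (simp add: D_def field_simps)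
  have DP: "P * D \<le> 1"
  proof -
    have "P * D \<le> P * (K * l / (3 * real n))" using DK P0 by (intro mult_left_mono) auto
    also have "\<dots> = (K * l * P) / (3 * real n)" by simp
    also have "\<dots> \<le> 1" using n(4) n0 by (simp add: l_def P_def)
    finally show ?thesis .
  qed
  have S4: "4 \<le> real S"
  proof -
    have "4 \<le> 2 * (1 + real n powr \<gamma>)" using n(3) by simp
    also note n(6)
    also note nn
    also note regime_card_ge[OF reg c2]
    finally show ?thesis .
  qed
  \<comment> \<open>The compensating symbol: among at least four symbols one has mass at most
    1/4.\<close>
  obtain k0 where k0: "k0 < S" "q k0 \<le> 1 / 4"
  proof (rule ccontr)
    assume "\<not> thesis"
    then have "\<And>k. k < S \<Longrightarrow> 1 / 4 < q k" using that by (meson not_le)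
    then have "(\<Sum>k<S. 1 / 4) < (\<Sum>k<S. q k)" using S4 by (intro sum_strict_mono) (auto simp: lessThan_empty_iff)
    then show False using S4 q by (simp add: dist_on_def)
  qed
  define I0 where "I0 = {i \<in> {..<S}. i \<noteq> k0 \<and> 0 < q i \<and> P * q i \<le> 1}"
  define t where "t = (\<lambda>i. min (q i) (sqrt (q i / (real n * l))))"
  define g where "g = (\<lambda>i. min (sqrt (q i * D) / (32 * real M)) (q i / 672))"
  have g0: "0 \<le> g i" if "i \<in> I0" for i using that D0 M0 by (auto simp: g_def I0_def)
  \<comment> \<open>The loss from replacing \<open>M\<close> by \<open>2 * K * ln n\<close> in
    \<open>g\<close>. The factor \<open>8320 = 65 * 2 * 64\<close> to \<eta> covers the choice of
    one group, the discarded half of the rate, and a reserve of 64 for the final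
    subtraction.\<close>
  define \<kappa> where "\<kappa> = 1 / (672 * sqrt (12 * K))"
  have \<kappa>: "\<kappa> = 8320 * \<eta>" by (simp add: \<kappa>_def \<eta>)
  have s12: "1 \<le> sqrt (12 * K)" using K(2) by simp
  have gt: "\<kappa> * t i \<le> g i" if i: "i \<in> I0" for i
  proof -
    have qi: "0 < q i" using i by (simp add: I0_def)
    have k1: "\<kappa> \<le> 1 / 672" "0 < \<kappa>" using s12 K(2) by (auto simp: \<kappa>_def divide_le_eq)
    have "\<kappa> * t i \<le> 1 / 672 * q i" using k1 qi by (intro mult_mono) (auto simp: t_def l0 less_imp_le)
    moreover have "\<kappa> * t i \<le> sqrt (q i * D) / (32 * real M)"
    proof -
      have "\<kappa> * t i \<le> (1 / (32 * sqrt (12 * K))) * sqrt (q i / (real n * l))"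
      proof (intro mult_mono)
        show "\<kappa> \<le> 1 / (32 * sqrt (12 * K))" unfolding \<kappa>_def using s12 by (intro frac_le) auto
        show "0 \<le> 1 / (32 * sqrt (12 * K))" using K(2) by simp
        show "0 \<le> t i" using qi n0 l0 by (simp add: t_def)
      qed (simp add: t_def)
      also have "\<dots> = sqrt (q i / (real n * (12 * K * l))) / 32"
        by (simp add: real_sqrt_divide real_sqrt_mult)
      also have "\<dots> \<le> sqrt (q i / (real n * (6 * real M))) / 32"
        using M(2) M0 n0 qi K(2) l0 by (intro divide_right_mono real_sqrt_le_mono divide_left_mono mult_left_mono mult_pos_pos) auto
      also have "\<dots> = sqrt (q i * D) / (32 * real M)"
      proof -
        have "q i / (real n * (6 * real M)) = q i * D / (real M)\<^sup>2" using M0 by (simp add: D_def power2_eq_square)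
        then show ?thesis using M0 by (simp add: real_sqrt_divide)
      qed
      finally show ?thesis .
    qed
    ultimately show ?thesis by (simp add: g_def)
  qed
  have main_sum: "rate_est S q n / 2 \<le> (\<Sum>i\<in>I0. t i)"
  proof -
    define B where "B = 1 / sqrt (real n * l)"
    have B0: "0 < B" using n0 l0 by (simp add: B_def)
    have tB: "t i \<le> B" if "i < S" for i
    proof -
      have "t i \<le> sqrt (q i / (real n * l))" by (simp add: t_def)
      also have "\<dots> \<le> sqrt (1 / (real n * l))"
        using dist_on_le_1(2)[OF q that] n0 l0 by (intro real_sqrt_le_mono divide_right_mono) auto
      finally show ?thesis by (simp add: B_def real_sqrt_divide)
    qed
    \<comment> \<open>A discarded heavy symbol has \<open>1 < P * q i\<close>, so its term, at most
      \<open>B\<close>, is charged to \<open>B * P * q i\<close>; the total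
      \<open>B * (1 + P)\<close> is at most half of the rate.\<close>
    have "(\<Sum>i\<in>{..<S} - I0. t i) \<le> (\<Sum>i\<in>{..<S} - I0. (if i = k0 then B else 0) + B * P * q i)"
    proof (rule sum_mono)
      fix i assume i: "i \<in> {..<S} - I0"
      then have qi: "0 \<le> q i" using dist_on_le_1(1)[OF q] by simp
      have nonneg: "0 \<le> B * P * q i" "0 \<le> (if i = k0 then B else 0)" using B0 P0 qi by auto
      have ti: "t i \<le> B" using tB i by simp
      consider "i = k0" | "q i = 0" | "1 < P * q i" using i qi by (force simp: I0_def)
      then show "t i \<le> (if i = k0 then B else 0) + B * P * q i"
      proof cases
        case 1
        then have "(if i = k0 then B else 0) = B" by simp
        then show ?thesis using ti nonneg by linarith
      next
        case 2
        then have "t i = 0" by (simp add: t_def)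
        then show ?thesis using nonneg by linarith
      next
        case 3
        then have "B * 1 \<le> B * (P * q i)" using B0 by (intro mult_left_mono) auto
        then have "B \<le> B * P * q i" by (simp only: mult.assoc mult_1_right)
        then show ?thesis using ti nonneg by linarith
      qed
    qed
    also have "\<dots> \<le> (\<Sum>i<S. (if i = k0 then B else 0) + B * P * q i)"
      using B0 P0 dist_on_le_1(1)[OF q] by (intro sum_mono2) auto
    also have "\<dots> = B + B * P * (\<Sum>i<S. q i)" using k0(1) by (simp add: sum.distrib sum_distrib_left)
    also have "\<dots> = B * (1 + P)" using q by (simp add: dist_on_def distrib_left)
    also have "\<dots> \<le> B * (real n powr (1 / c2) / 2)" using n(6) nn B0 by (intro mult_left_mono) (auto simp: P_def)
    also have "\<dots> = (real n powr (1 / c2) / sqrt (real n * ln (real n))) / 2" by (simp add: B_def l_def)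
    also have "\<dots> \<le> rate_est S q n / 2" using rate_est_ge[OF reg c2] by (intro divide_right_mono) auto
    finally have "(\<Sum>i\<in>{..<S} - I0. t i) \<le> rate_est S q n / 2" .
    moreover have "rate_est S q n = (\<Sum>i\<in>{..<S} - I0. t i) + (\<Sum>i\<in>I0. t i)"
    proof -
      have "rate_est S q n = (\<Sum>i<S. t i)" by (simp add: rate_est_def t_def l_def)
      also have "\<dots> = (\<Sum>i\<in>{..<S} - I0. t i) + (\<Sum>i\<in>I0. t i)" by (rule sum.subset_diff) (auto simp: I0_def)
      finally show ?thesis .
    qed
    ultimately show ?thesis by linarith
  qed
  have "\<exists>I\<subseteq>I0. (\<Sum>i\<in>I. q i) \<le> 1 / 32 \<and> (\<Sum>i\<in>I0. g i) / 65 \<le> (\<Sum>i\<in>I. g i)"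
  proof (rule heavy_light_subset)
    show "q i \<le> 1 / 64" if "i \<in> I0" for i
    proof -
      have "64 * q i \<le> P * q i" using that n(3) by (intro mult_right_mono) (auto simp: I0_def P_def)
      moreover have "P * q i \<le> 1" using that by (simp add: I0_def)
      ultimately show ?thesis by linarith
    qed
    have "(\<Sum>i\<in>I0. q i) \<le> (\<Sum>i<S. q i)" using dist_on_le_1(1)[OF q] by (intro sum_mono2) (auto simp: I0_def)
    then show "(\<Sum>i\<in>I0. q i) \<le> 1" using q by (simp add: dist_on_def)
  qed (use g0 in \<open>auto simp: I0_def\<close>)
  then obtain I where Is: "I \<subseteq> I0" "(\<Sum>i\<in>I. q i) \<le> 1 / 32" "(\<Sum>i\<in>I0. g i) / 65 \<le> (\<Sum>i\<in>I. g i)" by blast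
  have "\<forall>i\<in>I. \<exists>c W y \<mu>0 \<mu>1. local_pair (q i) D M c W y \<mu>0 \<mu>1"
    using Is(1) local_prior[OF M(3) _ D0] by (auto simp: I0_def)
  then obtain c W y \<mu>0 \<mu>1 where "\<forall>i\<in>I. local_pair (q i) D M (c i) (W i) (y i) (\<mu>0 i) (\<mu>1 i)" by metis
  then have lp: "\<And>i. i \<in> I \<Longrightarrow> local_pair (q i) D M (c i) (W i) (y i) (\<mu>0 i) (\<mu>1 i)" by blast
  \<comment> \<open>Symbols outside \<open>I\<close> also need an index law, since the product runs
    over all symbols; a point mass serves for both priors.\<close>
  define pt :: "nat \<Rightarrow> real" where "pt = (\<lambda>j. if j = 0 then 1 else 0)"
  define a0 where "a0 = (\<lambda>i. if i \<in> I then \<mu>0 i else pt)"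
  define a1 where "a1 = (\<lambda>i. if i \<in> I then \<mu>1 i else pt)"
  have pt: "is_weight {..<8 * M} pt" using M(3) by (simp add: is_weight_def pt_def)
  have cP: "P * c i \<le> 1" if "i \<in> I" for i
  proof -
    have "c i \<le> max (q i) D" using lp[OF that] by (simp add: local_pair_def)
    then have "P * c i \<le> P * max (q i) D" using P0 by (intro mult_left_mono) auto
    also have "\<dots> \<le> 1" using DP that Is(1) by (auto simp: max_def I0_def)
    finally show ?thesis .
  qed
  interpret fuzzy_masses S n M k0 q c W y a0 a1 D "P / 2" I
  proof
    show "I \<subseteq> {..<S}" "k0 \<notin> I" using Is(1) by (auto simp: I0_def)
    show "8 \<le> P / 2" using n(3) by (simp add: P_def)
    show "P / 2 * (2 * c i) \<le> 1" if "i \<in> I" for i using cP[OF that] by simp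
    show "is_weight {..<8 * M} (a0 i)" "is_weight {..<8 * M} (a1 i)" for i
      using lp[of i] pt by (auto simp: a0_def a1_def local_pair_def)
    show "a0 i = a1 i" if "i \<notin> I" for i using that by (simp add: a0_def a1_def)
    show "(\<Sum>j<8 * M. a0 i j * y i j ^ k) = (\<Sum>j<8 * M. a1 i j * y i j ^ k)" if "i \<in> I" "k \<le> 2 * M" for i k
      using lp[OF that(1)] that by (simp add: a0_def a1_def local_pair_def)
    show "(\<Sum>j<8 * M. a0 i j * (c i - W i * y i j)) \<le> 4 * q i" "(\<Sum>j<8 * M. a1 i j * (c i - W i * y i j)) \<le> 4 * q i" if "i \<in> I" for i
      using lp[OF that] that by (simp_all only: a0_def a1_def local_pair_def if_True)
    show "0 < W i" "W i \<le> c i" "(W i)\<^sup>2 \<le> D * c i" "\<bar>y i j\<bar> \<le> 1" "(max 0 (q i - (c i - W i * y i j)))\<^sup>2 \<le> q i * D" if "i \<in> I" for i j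
      using lp[OF that] by (simp_all only: local_pair_def)
  qed (fact q k0 D0 Dn Is(2))+
  define \<Gamma> where "\<Gamma> = (\<Sum>i\<in>I. (\<Sum>j\<in>J. a1 i j * \<bar>mass i j - q i\<bar>) - (\<Sum>j\<in>J. a0 i j * \<bar>mass i j - q i\<bar>))"
  have "(\<Sum>i\<in>I. g i) \<le> \<Gamma>"
    unfolding \<Gamma>_def
  proof (rule sum_mono)
    fix i assume i: "i \<in> I"
    show "g i \<le> (\<Sum>j\<in>J. a1 i j * \<bar>mass i j - q i\<bar>) - (\<Sum>j\<in>J. a0 i j * \<bar>mass i j - q i\<bar>)"
      using lp[OF i] i unfolding local_pair_def g_def a0_def a1_def mass_def by (simp only: if_True)
  qed
  moreover have "\<kappa> * (rate_est S q n / 2) \<le> (\<Sum>i\<in>I0. g i)"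
  proof -
    have "\<kappa> * (rate_est S q n / 2) \<le> \<kappa> * (\<Sum>i\<in>I0. t i)" using main_sum \<eta>0 \<kappa> by (intro mult_left_mono) auto
    also have "\<dots> \<le> (\<Sum>i\<in>I0. g i)" unfolding sum_distrib_left by (intro sum_mono gt)
    finally show ?thesis .
  qed
  ultimately have G: "64 * (\<eta> * rate_est S q n) \<le> \<Gamma>" using Is(3) unfolding \<kappa> by linarith
  have er: "0 < \<eta> * rate_est S q n" using \<eta>0 rate_est_pos[OF reg c2] by simp
  have G0: "0 \<le> \<Gamma>" using G er by linarith
  have SE: "real S * (exp (- (real M / 2)) + exp (- (P / 2 / 4))) \<le> 1 / 2"
  proof -
    have Sn: "real S \<le> real n powr c1" by (rule regime_card(2)[OF reg])
    have "2 * ((c1 + 1) * l) \<le> real M" using M(1) K(1) by (simp add: algebra_simps)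
    then have "(c1 + 1) * l \<le> real M / 2" by linarith
    then have "exp (- (real M / 2)) \<le> exp (- ((c1 + 1) * l))" by simp
    then have "real S * exp (- (real M / 2)) \<le> real n powr c1 * exp (- ((c1 + 1) * l))"
      using Sn by (intro mult_mono) auto
    also have "\<dots> = exp (c1 * l + - ((c1 + 1) * l))" using n0 by (simp only: powr_def l_def exp_add) simp
    also have "c1 * l + - ((c1 + 1) * l) = - l" by (simp add: algebra_simps)
    also have "exp (- l) = 1 / real n" using n0 by (simp add: l_def exp_minus inverse_eq_divide)
    also have "\<dots> \<le> 1 / 4" using n(2) by (intro frac_le) auto
    finally have 1: "real S * exp (- (real M / 2)) \<le> 1 / 4" .
    have "real S * exp (- (P / 8)) \<le> real n powr c1 * exp (- (P / 8))" using Sn by (intro mult_right_mono) auto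
    then have "real S * exp (- (P / 8)) \<le> 1 / 4" using n(5) unfolding P_def by linarith
    then show ?thesis using 1 by (simp add: distrib_left)
  qed
  have sD: "sqrt D \<le> \<eta> * rate_est S q n"
  proof -
    have "sqrt D \<le> sqrt (K * l / (3 * real n))" by (intro real_sqrt_le_mono DK)
    also have "\<dots> = sqrt (K / 3) * l / sqrt (real n * l)"
    proof -
      have "K * l / (3 * real n) = (K / 3) * l\<^sup>2 / (real n * l)" using l0 by (simp add: power2_eq_square)
      then show ?thesis using l0 by (simp add: real_sqrt_mult real_sqrt_divide)
    qed
    also have "\<dots> \<le> \<eta> * real n powr (1 / c2) / sqrt (real n * l)"
    proof (intro divide_right_mono)
      have "\<eta> * real n powr (4 * \<gamma>) \<le> \<eta> * real n powr (1 / c2)" using nn \<eta>0 by (intro mult_left_mono) auto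
      then show "sqrt (K / 3) * l \<le> \<eta> * real n powr (1 / c2)" using n(7) by (simp add: l_def)
    qed (use n0 l0 in auto)
    also have "\<dots> = \<eta> * (real n powr (1 / c2) / sqrt (real n * ln (real n)))" by (simp add: l_def)
    also have "\<dots> \<le> \<eta> * rate_est S q n" using rate_est_ge[OF reg c2] \<eta>0 by (intro mult_left_mono) auto
    finally show ?thesis .
  qed
  have eP: "exp (- (P / 2 / 4)) \<le> \<eta> * rate_est S q n"
  proof -
    have "exp (- (P / 2 / 4)) \<le> \<eta> * (1 / real n)" using n(8) by (simp add: P_def)
    also have "\<dots> \<le> \<eta> * rate_est S q n" using inverse_n_le_rate_est[OF reg c2] \<eta>0 by (intro mult_left_mono) auto
    finally show ?thesis .
  qed
  have half: "(1 / 2) * (\<Gamma> / 4) \<le> (1 - real S * (exp (- (real M / 2)) + exp (- (P / 2 / 4)))) * (\<Gamma> / 4)"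
    using SE G0 by (intro mult_right_mono) auto
  \<comment> \<open>The overlap leaves at least \<open>G / 8 \<ge> 8 * e\<close>; the deviations
    remove at most \<open>4 * e\<close>, and half of the remainder is still at least
    \<open>e\<close>.\<close>
  have conclude: "e \<le> R" if "(1 / 2) * (G / 4) \<le> x" "(x - 2 * (a + b)) / 2 \<le> R" "64 * e \<le> G" "a \<le> e" "b \<le> e" "0 < e"
    for e R G x a b :: real
  proof -
    have "x - 2 * (a + b) \<le> R * 2" using that(2) by (simp only: divide_le_eq_numeral1)
    then have "x - 2 * a - 2 * b \<le> 2 * R" by (simp add: algebra_simps)
    moreover have "G \<le> 8 * x" using that(1) by simp
    ultimately show ?thesis using that(3-6) by linarith
  qed
  show ?thesis by (rule conclude[OF half R_EST_ge_fuzzy[folded \<Gamma>_def, OF G0] G sD eP er])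
qed

lemma R_EST_lower:
  assumes c: "c1 > 0" "c2 > 0"
  shows "\<exists>C>0. \<forall>S q n. regime c1 c2 S q n \<longrightarrow> rate_est S q n \<le> C * R_EST S q n"
proof -
  \<comment> \<open>The bound \<open>1 / (4 * c2)\<close> keeps \<open>n powr (4 * \<gamma>)\<close>
    below the regime sum, leaving room over the cost \<open>n powr \<gamma>\<close> of discarding
    heavy symbols. The bound 1/2 keeps \<open>D * n powr \<gamma>\<close> small.\<close>
  define \<gamma> where "\<gamma> = min (1 / (4 * c2)) (1 / 2)"
  have \<gamma>: "0 < \<gamma>" "\<gamma> \<le> 1 / 2" "4 * \<gamma> \<le> 1 / c2"
  proof -
    show "0 < \<gamma>" "\<gamma> \<le> 1 / 2" using c by (auto simp: \<gamma>_def)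
    have "\<gamma> \<le> 1 / (4 * c2)" by (simp add: \<gamma>_def)
    then show "4 * \<gamma> \<le> 1 / c2" using c by (simp add: field_simps)
  qed
  define K where "K = 2 * (c1 + 1)"
  have K: "1 \<le> K" "0 < K" using c by (auto simp: K_def)
  define \<eta> where "\<eta> = 1 / (672 * sqrt (12 * K) * 8320)"
  have \<eta>: "0 < \<eta>" using K by (simp add: \<eta>_def)
  have g1: "\<gamma> < 1" using \<gamma> by simp
  have "eventually (\<lambda>n::nat. 21 \<le> K * ln (real n)) at_top" using K by real_asymp
  moreover have "eventually (\<lambda>n::nat. 4 \<le> real n) at_top" by real_asymp
  moreover have "eventually (\<lambda>n::nat. 64 \<le> real n powr \<gamma>) at_top" using \<gamma> by real_asymp
  moreover have "eventually (\<lambda>n::nat. K * ln (real n) * real n powr \<gamma> \<le> 3 * real n) at_top" using K \<gamma> g1 by real_asymp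
  moreover have "eventually (\<lambda>n::nat. real n powr c1 * exp (- (real n powr \<gamma> / 8)) \<le> 1 / 4) at_top" using c \<gamma> by real_asymp
  moreover have "eventually (\<lambda>n::nat. 2 * (1 + real n powr \<gamma>) \<le> real n powr (4 * \<gamma>)) at_top" using \<gamma> by real_asymp
  moreover have "eventually (\<lambda>n::nat. sqrt (K / 3) * ln (real n) \<le> \<eta> * real n powr (4 * \<gamma>)) at_top" using K \<gamma> \<eta> by real_asymp
  moreover have "eventually (\<lambda>n::nat. exp (- (real n powr \<gamma> / 8)) \<le> \<eta> * (1 / real n)) at_top" using \<gamma> \<eta> by real_asymp
  ultimately have "eventually (\<lambda>n::nat. \<forall>S q. regime c1 c2 S q n \<longrightarrow> \<eta> * rate_est S q n \<le> R_EST S q n) at_top"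
  proof eventually_elim
    case (elim n)
    show ?case
    proof (intro allI impI)
      fix S q assume "regime c1 c2 S q n"
      then show "\<eta> * rate_est S q n \<le> R_EST S q n"
        by (rule R_EST_ge_rate_est[OF _ c(2) \<gamma>(1,3) K_def K(1) \<eta>_def elim])
    qed
  qed
  then obtain n0 where n0: "\<And>n S q. n \<ge> n0 \<Longrightarrow> regime c1 c2 S q n \<Longrightarrow> \<eta> * rate_est S q n \<le> R_EST S q n"
    by (auto simp: eventually_at_top_linorder)
  \<comment> \<open>The second summand serves the bounded range \<open>n < n0\<close>, where the
    rate is at most 1 and \<open>R_EST_ge_two_point\<close> bounds the risk from below.\<close>
  define C where "C = 1 / \<eta> + 16 * 2 ^ n0"
  have "rate_est S q n \<le> C * R_EST S q n" if reg: "regime c1 c2 S q n" for S q n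
  proof (cases "n \<ge> n0")
    case True
    have "rate_est S q n \<le> 1 / \<eta> * R_EST S q n" using n0[OF True reg] \<eta> by (simp add: field_simps)
    moreover have "0 \<le> R_EST S q n"
      by (rule order_trans[OF _ n0[OF True reg]]) (use \<eta> rate_est_pos[OF reg c(2)] in simp)
    moreover have "C * R_EST S q n = 1 / \<eta> * R_EST S q n + 16 * 2 ^ n0 * R_EST S q n" by (simp add: C_def distrib_right)
    moreover have "0 \<le> 16 * 2 ^ n0 * R_EST S q n" if "0 \<le> R_EST S q n" using that by simp
    ultimately show ?thesis by linarith
  next
    case False
    have "1 < real n powr (1 / c2)" using regimeD(1)[OF reg] c by (intro gr_one_powr) auto
    then have "2 \<le> S" using regime_card_ge[OF reg c(2)] by linarith
    then have R: "1 / (16 * 2 ^ n) \<le> R_EST S q n" by (rule R_EST_ge_two_point[OF regimeD(2)[OF reg]])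
    then have R0: "0 \<le> R_EST S q n" by (rule order_trans[rotated]) simp
    have "rate_est S q n \<le> 1" by (rule rate_est_le_1[OF regimeD(2)[OF reg]])
    also have "1 \<le> 16 * 2 ^ n * R_EST S q n" using R by (simp add: field_simps)
    also have "\<dots> \<le> C * R_EST S q n"
    proof (rule mult_right_mono[OF _ R0])
      have "(2::real) ^ n \<le> 2 ^ n0" using False by (intro power_increasing) auto
      moreover have "0 \<le> 1 / \<eta>" using \<eta> by simp
      ultimately show "16 * 2 ^ n \<le> C" unfolding C_def by linarith
    qed
    finally show ?thesis .
  qed
  moreover have "0 < C" using \<eta> by (simp add: C_def add_pos_pos)
  ultimately show ?thesis by blast
qed

theorem theorem2:
  shows "(\<forall>c1>0. \<forall>c2>0. \<exists>C>0. \<forall>S q n. regime c1 c2 S q n \<longrightarrow>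
            asymp_eq C (R_EST S q n) (rate_est S q n) \<and>
            asymp_eq C (R_ACH S q n) (rate_ach S q n) \<and>
            asymp_eq C (R_PLU S q n) (rate_ach S q n) \<and>
            worst_regret S q n (t_Q q n) \<le> C * rate_ach S q n)
       \<and> (\<exists>c1>0. \<exists>c2>0. \<forall>C. \<exists>S q n. regime c1 c2 S q n \<and>
            worst_regret S q n (t_MLE q) > C * rate_ach S q n)"
proof (rule conjI)
  show "\<forall>c1>0. \<forall>c2>0. \<exists>C>0. \<forall>S q n. regime c1 c2 S q n \<longrightarrow>
            asymp_eq C (R_EST S q n) (rate_est S q n) \<and>
            asymp_eq C (R_ACH S q n) (rate_ach S q n) \<and>
            asymp_eq C (R_PLU S q n) (rate_ach S q n) \<and>
            worst_regret S q n (t_Q q n) \<le> C * rate_ach S q n"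
  proof (intro allI impI)
    fix c1 c2 :: real
    assume c: "0 < c1" "0 < c2"
    obtain Ca where Ca: "Ca > 0" "\<And>S q n. regime c1 c2 S q n \<Longrightarrow> rate_ach S q n \<le> Ca * R_ACH S q n \<and> rate_ach S q n \<le> Ca * R_PLU S q n"
      using R_ACH_R_PLU_lower[OF c] by blast
    obtain Cu where Cu: "Cu > 0" "\<And>S q n. regime c1 c2 S q n \<Longrightarrow> R_EST S q n \<le> Cu * rate_est S q n"
      using R_EST_upper_regime[OF c] by blast
    obtain Cl where Cl: "Cl > 0" "\<And>S q n. regime c1 c2 S q n \<Longrightarrow> rate_est S q n \<le> Cl * R_EST S q n"
      using R_EST_lower[OF c] by blast
    define C where "C = 1 + Ca + Cu + Cl"
    have C: "0 < C" "1 \<le> C" "Ca \<le> C" "Cu \<le> C" "Cl \<le> C" using Ca(1) Cu(1) Cl(1) by (auto simp: C_def)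
    have up: "a \<le> C * b" if "a \<le> D * b" "D \<le> C" "0 \<le> b" for a b D :: real
      using that(1) mult_right_mono[OF that(2,3)] by linarith
    \<comment> \<open>Enlarging the constants to the common \<open>C\<close> requires the risks to
      be nonnegative; this follows from the lower bounds, since the rates are nonnegative.\<close>
    have nonneg: "0 \<le> b" if "a \<le> D * b" "0 < D" "0 \<le> a" for a b D :: real
      using order_trans[OF that(3,1)] that(2) by (simp add: zero_le_mult_iff)
    show "\<exists>C>0. \<forall>S q n. regime c1 c2 S q n \<longrightarrow>
            asymp_eq C (R_EST S q n) (rate_est S q n) \<and>
            asymp_eq C (R_ACH S q n) (rate_ach S q n) \<and>
            asymp_eq C (R_PLU S q n) (rate_ach S q n) \<and>
            worst_regret S q n (t_Q q n) \<le> C * rate_ach S q n"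
    proof (intro exI[of _ C] conjI allI impI C(1))
      fix S n :: nat and q :: "nat \<Rightarrow> real"
      assume reg: "regime c1 c2 S q n"
      have q: "dist_on S q" and n: "0 < n" using regimeD(1,2)[OF reg] by auto
      have e0: "0 \<le> rate_est S q n" using rate_est_pos[OF reg c(2)] by simp
      have a0: "0 \<le> rate_ach S q n"
        unfolding rate_ach_def using dist_on_le_1(1)[OF q] by (intro sum_nonneg) auto
      note A = Ca(2)[OF reg, THEN conjunct1] and P = Ca(2)[OF reg, THEN conjunct2]
      show "asymp_eq C (R_EST S q n) (rate_est S q n)"
        unfolding asymp_eq_def
        using up[OF Cu(2)[OF reg] C(4) e0] up[OF Cl(2)[OF reg] C(5) nonneg[OF Cl(2)[OF reg] Cl(1) e0]] by blast
      show "asymp_eq C (R_ACH S q n) (rate_ach S q n)"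
        unfolding asymp_eq_def
        using up[of _ 1, OF _ C(2) a0] R_ACH_le[OF q n] up[OF A C(3) nonneg[OF A Ca(1) a0]] by simp
      show "asymp_eq C (R_PLU S q n) (rate_ach S q n)"
        unfolding asymp_eq_def
        using up[of _ 1, OF _ C(2) a0] R_PLU_le[OF q n] up[OF P C(3) nonneg[OF P Ca(1) a0]] by simp
      show "worst_regret S q n (t_Q q n) \<le> C * rate_ach S q n"
        using up[of _ 1, OF _ C(2) a0] worst_regret_t_Q[OF q n] by simp
    qed
  qed
  have "\<forall>C. \<exists>S q n. regime 2 4 S q n \<and> worst_regret S q n (t_MLE q) > C * rate_ach S q n"
    using t_MLE_not_optimal by blast
  then show "\<exists>c1>0. \<exists>c2>0. \<forall>C. \<exists>S q n. regime c1 c2 S q n \<and> worst_regret S q n (t_MLE q) > C * rate_ach S q n"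
    by (intro exI[of _ 2] exI[of _ 4] conjI) auto
qed

end
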